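(* Let $s,\sigma>0$. There exists a finite linearly dependent Gabor system with a nonzero window in $\mathcal S_s^\sigma(\mathbb R)$ if and only if $s\ge1$ and $\sigma\ge1$. Moreover, among all nonzero windows in $L^2(\mathbb R)$, four is the minimum cardinality of a linearly dependent finite Gabor system; that is, there exist a nonzero $g\in L^2(\mathbb R)$ and four distinct points of $\mathbb R^2$ whose Gabor system with window $g$ is linearly dependent, and for every nonzero $g\in L^2(\mathbb R)$ every Gabor system with window $g$ indexed by at most three distinct points is linearly independent.
   Context: For $z=(x,\omega)\in\mathbb R^2$, the Weyl shift on $L^2(\mathbb R)$ is $(\rho(x,\omega)f)(t)=e^{2\pi i\omega(t-x/2)}f(t-x)$. A finite Gabor system with window $g$ is a finite family $\{\rho(z)g: z\in\Lambda\}$ indexed by a finite set $\Lambda\subset\mathbb R^2$ of distinct points; its cardinality is $\#\Lambda$, and linear (in)dependence is over $\mathbb C$, as a family indexed by $\Lambda$. For $s,\sigma>0$, the Roumieu Gelfand--Shilov class $\mathcal S_s^\sigma(\mathbb R)$ consists of the functions $f\in C^\infty(\mathbb R)$ (complex-valued) for which there are constants $C,h>0$ with $\sup_{t\in\mathbb R}|t^m f^{(n)}(t)|\le C h^{m+n}(m!)^s(n!)^\sigma$ for all integers $m,n\ge0$. *)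

theory Defs
  imports "HOL-Analysis.Analysis"
begin

text \<open>
  Elements of \<open>L\<^sup>2(\<real>)\<close> are represented by Lebesgue measurable, square integrable functions;
  equality of classes is almost-everywhere equality, so it is spelled out as an \<open>AE\<close> statement
  wherever an identity in \<open>L\<^sup>2(\<real>)\<close> is meant.
\<close>

definition L2 :: "(real \<Rightarrow> complex) set" where
  "L2 = {f. f \<in> borel_measurable lebesgue \<and> integrable lebesgue (\<lambda>t. (cmod (f t))\<^sup>2)}"

definition L2_zero :: "(real \<Rightarrow> complex) \<Rightarrow> bool" where
  "L2_zero f \<longleftrightarrow> (AE t in lebesgue. f t = 0)"

text \<open>
  Dependence of an indexed family, not of its range: a repeated vector makes the family dependent.
\<close>

definition L2_lin_dependent :: "('i \<Rightarrow> real \<Rightarrow> complex) \<Rightarrow> 'i set \<Rightarrow> bool" where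
  "L2_lin_dependent u I \<longleftrightarrow>
     (\<exists>c :: 'i \<Rightarrow> complex. (\<exists>i\<in>I. c i \<noteq> 0) \<and> L2_zero (\<lambda>t. \<Sum>i\<in>I. c i * u i t))"

definition weyl_shift :: "real \<times> real \<Rightarrow> (real \<Rightarrow> complex) \<Rightarrow> real \<Rightarrow> complex" where
  "weyl_shift = (\<lambda>(x, \<omega>) f t. exp (2 * pi * \<i> * \<omega> * (t - x / 2)) * f (t - x))"

definition gabor_system :: "(real \<Rightarrow> complex) \<Rightarrow> real \<times> real \<Rightarrow> real \<Rightarrow> complex" where
  "gabor_system g = (\<lambda>z. weyl_shift z g)"

definition nth_derivative :: "nat \<Rightarrow> (real \<Rightarrow> complex) \<Rightarrow> real \<Rightarrow> complex" where
  "nth_derivative n = (\<lambda>f t. vector_derivative f (at t)) ^^ n"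

text \<open>
  \<open>vector_derivative\<close> is total, hence the differentiability requirement at every order.
\<close>

definition smooth :: "(real \<Rightarrow> complex) \<Rightarrow> bool" where
  "smooth f \<longleftrightarrow> (\<forall>n t. nth_derivative n f differentiable at t)"

definition gelfand_shilov :: "real \<Rightarrow> real \<Rightarrow> (real \<Rightarrow> complex) set" where
  "gelfand_shilov s \<sigma> = {f. smooth f \<and>
     (\<exists>C>0. \<exists>h>0. \<forall>m n t.
        cmod (t ^ m * nth_derivative n f t) \<le> C * h ^ (m + n) * fact m powr s * fact n powr \<sigma>)}"

end

theory Submission
  imports Defs "HOL-Complex_Analysis.Complex_Analysis" "HOL-Probability.Probability" "HOL-Real_Asymp.Real_Asymp"
begin

text \<open>
  Regularity forces \<open>s, sigma >= 1\<close>: solving a relation for an extreme translate expresses \<open>g(t)\<close> by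
  neighbouring values divided by a trigonometric polynomial. The sublevel sets of such polynomials are
  small uniformly in the position, so that iterating along a good orbit bounds \<open>g\<close> from below by
  a quantity incompatible with the decay \<open>exp(- c |t|^(1/s))\<close>, \<open>s < 1\<close>; the Fourier transform exchanges
  \<open>s\<close> and \<open>sigma\<close>.

  At most three points: chirps and the Fourier transform move the points onto two vertical lines, one
  of which carries a single point. Then \<open>|g(t - x)|\<close> is \<open>|g(t)|\<close> times the modulus of a trigonometric polynomial, and
  the mass of \<open>g\<close> on the cosets of \<open>x \<int>\<close> together with Bessel's inequality rules this out.

  Four points: on Zak transforms the sum of two translates by \<open>sg t - 1/4\<close> and \<open>sg t + 1/4\<close>, divided by
  \<open>1 - (9/10) e(x)\<close>, acts at \<open>t = 0\<close> by matrices whose square has a holomorphic eigenvector with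
  a spectral gap. The eigenvector persists for small \<open>t\<close> by a graph transform. The shifts are
  multiples of \<open>\<surd>2\<close> and \<open>\<surd>3\<close>, whose small divisors \<open>a + b \<surd>2 + c \<surd>3\<close> are bounded below through the norm;
  hence a cohomological equation is solvable and turns the eigenvalue, a function, into a constant.
  Integrating the resulting holomorphic quasi-periodic section over \<open>k\<close> gives a window that extends
  to a strip and decays exponentially.
\<close>

section \<open>Sublevel sets of trigonometric polynomials\<close>

text \<open>The obstacle in the four-point part is that an eigenvalue must be one number. At
  \<open>t = 0\<close> the squared operator acts fibre by fibre, and rescaling an eigenvector does
  not alter an eigenvalue that varies with the fibre. For \<open>t > 0\<close> the fibres move by
  irrational amounts; rescaling by a function then changes the multiplier by the quotient of that
  function and its translate, so that constancy becomes an equation with a solution. The square is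
  taken because two quarter steps lead from \<open>x\<close> to \<open>x\<close>,
  \<open>x - 1/2\<close> or a period away. A continuous Zak transform always has a zero, but the
  pair of its values at \<open>x\<close> and \<open>x - 1/2\<close> need not vanish, so this 2 x 2
  system has room for a nowhere vanishing eigenvector. Write \<open>q\<close> for
  \<open>9/10\<close>. The condition \<open>q < 1\<close> excludes real zeros of the denominator.
  The matrix splits according to a square root of
  \<open>8 q^2 + i (e(k) - e(-k)) (e(-2x) - q^4 e(2x))\<close>, whose real part is positive for real
  \<open>x\<close>, \<open>k\<close> once \<open>8 q^2 > 2 (1 + q^4)\<close>, for instance if
  \<open>0.52 < q < 1\<close>. Holomorphy in \<open>k\<close> yields the decay and holomorphy in
  \<open>x\<close> the regularity; each stops at exponent 1.\<close>

definition trig_poly :: "(real \<Rightarrow> complex) \<Rightarrow> real set \<Rightarrow> real \<Rightarrow> complex" where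
 "trig_poly c B t = (\<Sum>b\<in>B. c b * cis (b * t))"

lemma trig_poly_has_vector_derivative:
 "(trig_poly c B has_vector_derivative trig_poly (\<lambda>b. \<i> * b * c b) B t) (at t within S)"
proof -
 have "((\<lambda>t. cis (b * t)) has_vector_derivative \<i> * b * cis (b * t)) (at t within S)" for b
  unfolding cis_conv_exp
  by (auto intro!: derivative_eq_intros has_vector_derivative_real_field simp: algebra_simps)
 then show ?thesis
  unfolding trig_poly_def[abs_def]
  by (rule has_vector_derivative_eq_rhs[OF has_vector_derivative_sum[OF has_vector_derivative_mult_right]])
   (auto intro!: sum.cong)
qed

lemma norm_trig_poly_le: "cmod (trig_poly c B t) \<le> (\<Sum>b\<in>B. cmod (c b))"
 unfolding trig_poly_def by (rule order.trans[OF norm_sum]) (simp add: norm_mult)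

lemma continuous_on_trig_poly [continuous_intros]:
 "continuous_on S f ==> continuous_on S (\<lambda>t. trig_poly c B (f t))"
 unfolding trig_poly_def by (intro continuous_intros)

lemma borel_measurable_trig_poly [measurable]: "trig_poly c B \<in> borel_measurable borel"
 by (intro borel_measurable_continuous_onI continuous_intros)

lemma trig_poly_lipschitz:
 "cmod (trig_poly c B s - trig_poly c B t) \<le> (\<Sum>b\<in>B. \<bar>b\<bar> * cmod (c b)) * \<bar>s - t\<bar>"
proof -
 have "cmod (trig_poly c B s - trig_poly c B t) \<le> (\<Sum>b\<in>B. \<bar>b\<bar> * cmod (c b)) * norm (s - t)"
 proof (rule differentiable_bound)
  show "(trig_poly c B has_derivative (\<lambda>h. h *\<^sub>R trig_poly (\<lambda>b. \<i> * b * c b) B x)) (at x within UNIV)" for x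
   using trig_poly_has_vector_derivative has_vector_derivative_def by blast
  show "onorm (\<lambda>h. h *\<^sub>R trig_poly (\<lambda>b. \<i> * b * c b) B x) \<le> (\<Sum>b\<in>B. \<bar>b\<bar> * cmod (c b))" for x
  proof (rule onorm_bound)
   show "norm (h *\<^sub>R trig_poly (\<lambda>b. \<i> * b * c b) B x) \<le> (\<Sum>b\<in>B. \<bar>b\<bar> * cmod (c b)) * norm h" for h
    using mult_right_mono[OF norm_trig_poly_le[of "\<lambda>b. \<i> * b * c b" B x], of "\<bar>h\<bar>"]
    by (simp add: norm_mult mult.commute[of "\<bar>h\<bar>"])
  qed (simp add: sum_nonneg)
 qed auto
 then show ?thesis by simp
qed

text \<open>After rotation by the phase of \<open>Q u\<close>, the real part of \<open>F\<close> has
  derivative at least \<open>L * eta\<close> on the whole cell, because \<open>Q\<close> loses at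
  most \<open>L * eta\<close> of \<open>2 * L * eta\<close> there. A real function with that slope
  can stay within \<open>eps\<close> of 0 only on a short interval.\<close>

lemma trig_poly_sublevel_step:
 fixes F Q :: "real \<Rightarrow> complex"
 assumes der: "\<And>t. (F has_vector_derivative Q t) (at t)"
  and lip: "\<And>s t. cmod (Q s - Q t) \<le> L * \<bar>s - t\<bar>" and L: "L > 0"
  and eta: "eta > 0" and eps: "eps > 0" and big: "cmod (Q u) \<ge> 2 * L * eta"
 shows "\<exists>s. {t\<in>{u..u+eta}. cmod (F t) < eps} \<subseteq> {s - 2 * eps / (L * eta) .. s + 2 * eps / (L * eta)}"
proof -
 define w where "w = sgn (Q u)"
 have Q0: "Q u \<noteq> 0" using big mult_pos_pos[OF L eta] by auto
 have w1: "cmod w = 1" using Q0 by (simp add: w_def norm_sgn)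
 have wQ: "cnj w * Q u = cmod (Q u)"
  using Q0 complex_norm_square[of "Q u"]
  by (simp add: w_def sgn_eq mult.commute[of "cnj (Q u)"] power2_eq_square divide_eq_eq)
 define f where "f t = Re (cnj w * F t)" for t
 have df: "(f has_real_derivative Re (cnj w * Q t)) (at t)" for t
 proof -
  have "((\<lambda>t. cnj w * F t) has_vector_derivative cnj w * Q t) (at t)"
   using der by (rule has_vector_derivative_mult_right)
  from bounded_linear.has_vector_derivative[OF bounded_linear_Re this] show ?thesis
   unfolding f_def has_real_derivative_iff_has_vector_derivative by (simp add: o_def)
 qed
 have pos: "Re (cnj w * Q t) \<ge> L * eta" if "t \<in> {u..u+eta}" for t
 proof -
  have "Re (cnj w * Q t) = cmod (Q u) + Re (cnj w * (Q t - Q u))"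
   using arg_cong[OF wQ, of Re] by (simp add: right_diff_distrib)
  moreover have "\<bar>Re (cnj w * (Q t - Q u))\<bar> \<le> cmod (cnj w * (Q t - Q u))" by (rule abs_Re_le_cmod)
  moreover have "cmod (cnj w * (Q t - Q u)) \<le> L * \<bar>t - u\<bar>" using lip[of t u] w1 by (simp add: norm_mult)
  moreover have "L * \<bar>t - u\<bar> \<le> L * eta" using that L by (intro mult_left_mono) auto
  ultimately show ?thesis using big by linarith
 qed
 have sep: "t - s \<le> 2 * eps / (L * eta)"
  if st: "s \<in> {u..u+eta}" "t \<in> {u..u+eta}" "cmod (F s) < eps" "cmod (F t) < eps" for s t
 proof (cases "s < t")
  case True
  have "\<exists>z>s. z < t \<and> f t - f s = (t - s) * Re (cnj w * Q z)"
   by (rule MVT2[OF True]) (rule df)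
  then obtain z where z: "z > s" "z < t" "f t - f s = (t - s) * Re (cnj w * Q z)" by blast
  have "z \<in> {u..u+eta}" using z st by auto
  then have "(t - s) * (L * eta) \<le> f t - f s" using z pos[of z] True by (simp add: mult_left_mono)
  also have "... \<le> cmod (F t) + cmod (F s)"
   using abs_Re_le_cmod[of "cnj w * F t"] abs_Re_le_cmod[of "cnj w * F s"] w1
   by (simp add: f_def norm_mult)
  also have "... \<le> 2 * eps" using st by simp
  finally show ?thesis using L eta by (simp add: field_simps)
 next
  case False
  moreover have "0 \<le> 2 * eps / (L * eta)" using L eta eps by simp
  ultimately show ?thesis by linarith
 qed
 show ?thesis
 proof (cases "\<exists>s\<in>{u..u+eta}. cmod (F s) < eps")
  case True
  then obtain s where s: "s \<in> {u..u+eta}" "cmod (F s) < eps" by blast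
  show ?thesis
  proof (intro exI[of _ s] subsetI)
   fix t assume "t \<in> {t\<in>{u..u+eta}. cmod (F t) < eps}"
   then have t: "t \<in> {u..u+eta}" "cmod (F t) < eps" by auto
   show "t \<in> {s - 2 * eps / (L * eta) .. s + 2 * eps / (L * eta)}"
    using sep[OF s(1) t(1) s(2) t(2)] sep[OF t(1) s(1) t(2) s(2)] by auto
  qed
 qed auto
qed

lemma interval_fmeasurable [simp]: "{a..b::real} \<in> fmeasurable lborel"
 using fmeasurable_cbox[of a b] by (auto simp: fmeasurable_def)

text \<open>Induction on the number of frequencies. Where the derivative \<open>Q\<close> is small,
  the induction hypothesis bounds the measure; on every other cell of length \<open>eta\<close> the
  sublevel set lies in a short interval. Each step divides the exponent \<open>alp\<close> by 3.
  Uniformity in the position survives because the Lipschitz constant is global.\<close>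

lemma trig_poly_sublevel:
 assumes "finite B" "B \<noteq> {}" "\<forall>b\<in>B. c b \<noteq> 0"
 shows "\<exists>C alp. C \<ge> 1 \<and> alp > 0 \<and> alp \<le> 1 \<and> (\<forall>a v eps. eps > 0 \<longrightarrow>
      measure lborel {t\<in>{a..a+1}. cmod (trig_poly c B (t + v)) < eps} \<le> C * eps powr alp)"
 using assms
proof (induction B arbitrary: c rule: finite_ne_induct)
 case (singleton b)
 have cb: "cmod (c b) > 0" using singleton by auto
 have "measure lborel {t\<in>{a..a+1}. cmod (trig_poly c {b} (t + v)) < eps} \<le> (1 + 1 / cmod (c b)) * eps powr 1"
  if "eps > 0" for a v eps :: real
 proof (cases "eps \<le> cmod (c b)")
  case True
  then have "{t\<in>{a..a+1}. cmod (trig_poly c {b} (t + v)) < eps} = {}"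
   by (auto simp: trig_poly_def norm_mult)
  then have "measure lborel {t\<in>{a..a+1}. cmod (trig_poly c {b} (t + v)) < eps} = 0"
   by (simp only: measure_empty)
  then show ?thesis using that by simp
 next
  case False
  have "measure lborel {t\<in>{a..a+1}. cmod (trig_poly c {b} (t + v)) < eps} \<le> measure lborel {a..a+1}"
   by (intro measure_mono_fmeasurable) (auto intro!: sets.sets_Collect)
  also have "... = 1" by simp
  also have "... \<le> eps / cmod (c b)" using False cb by (simp add: field_simps)
  also have "... \<le> (1 + 1 / cmod (c b)) * eps" using that by (simp add: field_simps)
  finally show ?thesis using that by simp
 qed
 then show ?case using cb by (intro exI[of _ "1 + 1 / cmod (c b)"] exI[of _ 1]) auto
next
 case (insert b0 B)
 define c' where "c' = (\<lambda>d. \<i> * d * c (d + b0))"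
 define B' where "B' = (\<lambda>b. b - b0) ` B"
 define F where "F = trig_poly (\<lambda>d. c (d + b0)) (insert 0 B')"
 define Q where "Q = trig_poly c' B'"
 have inj: "inj_on (\<lambda>b. b - b0) B" by (auto simp: inj_on_def)
 have B': "finite B'" "B' \<noteq> {}" "0 \<notin> B'" using insert by (auto simp: B'_def)
 \<comment> \<open>Dividing by one of the exponentials turns its term into a constant, so that the derivative
  has one term less.\<close>
 have FP: "cmod (F t) = cmod (trig_poly c (insert b0 B) t)" for t
 proof -
  have im: "insert 0 B' = (\<lambda>b. b - b0) ` insert b0 B" by (auto simp: B'_def)
  have "F t = (\<Sum>b\<in>insert b0 B. c b * cis ((b - b0) * t))"
   unfolding F_def trig_poly_def im by (subst sum.reindex) (auto simp: inj_on_def)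
  also have "... = cis (- b0 * t) * trig_poly c (insert b0 B) t"
   unfolding trig_poly_def sum_distrib_left
   by (intro sum.cong refl) (auto simp: cis_mult algebra_simps)
  finally show ?thesis by (simp add: norm_mult)
 qed
 have der: "(F has_vector_derivative Q t) (at t)" for t
 proof -
  have "trig_poly (\<lambda>d. \<i> * d * c (d + b0)) (insert 0 B') t = Q t"
   unfolding trig_poly_def Q_def c'_def using B' by simp
  then show ?thesis using trig_poly_has_vector_derivative unfolding F_def by metis
 qed
 have IH: "\<exists>C alp. C \<ge> 1 \<and> alp > 0 \<and> alp \<le> 1 \<and> (\<forall>a v eps. eps > 0 \<longrightarrow>
      measure lborel {t\<in>{a..a+1}. cmod (trig_poly (\<lambda>b. \<i> * (b - b0) * c b) B (t + v)) < eps} \<le> C * eps powr alp)"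
  using insert.prems insert.hyps by (intro insert.IH) auto
 have Qeq: "cmod (Q t) = cmod (trig_poly (\<lambda>b. \<i> * (b - b0) * c b) B t)" for t
 proof -
  have "Q t = (\<Sum>b\<in>B. \<i> * (b - b0) * c b * cis ((b - b0) * t))"
   unfolding Q_def trig_poly_def B'_def c'_def by (subst sum.reindex[OF inj]) (auto simp: o_def)
  also have "... = cis (- b0 * t) * trig_poly (\<lambda>b. \<i> * (b - b0) * c b) B t"
   unfolding trig_poly_def sum_distrib_left
   by (intro sum.cong refl) (auto simp: cis_mult algebra_simps)
  finally show ?thesis by (simp add: norm_mult)
 qed
 from IH obtain C alp where C: "C \<ge> 1" "alp > 0" "alp \<le> 1"
  and meas: "\<And>a v eps. eps > 0 ==> measure lborel {t\<in>{a..a+1}. cmod (Q (t + v)) < eps} \<le> C * eps powr alp"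
  unfolding Qeq by blast
 define L where "L = 1 + (\<Sum>b\<in>B'. \<bar>b\<bar> * cmod (c' b))"
 have L: "L > 0" unfolding L_def by (smt (verit) sum_nonneg mult_nonneg_nonneg norm_ge_zero abs_ge_zero)
 have lip: "cmod (Q s - Q t) \<le> L * \<bar>s - t\<bar>" for s t
  using trig_poly_lipschitz[of c' B' s t] unfolding Q_def L_def by (smt (verit) mult_right_mono abs_ge_zero)
 define C' where "C' = 1 + C * (3 * L) powr alp + 8 / L"
 have C': "C' \<ge> 1" unfolding C'_def using C L by simp
 have "measure lborel {t\<in>{a..a+1}. cmod (F (t + v)) < eps} \<le> C' * eps powr (alp / 3)"
  if eps: "eps > 0" for a v eps :: real
 proof (cases "eps \<le> 1")
  case False
  have "measure lborel {t\<in>{a..a+1}. cmod (F (t + v)) < eps} \<le> measure lborel {a..a+1}"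
   unfolding F_def by (intro measure_mono_fmeasurable) (auto intro!: sets.sets_Collect)
  also have "... = 1" by simp
  also have "... \<le> eps powr (alp / 3)" using False C by (simp add: ge_one_powr_ge_zero)
  also have "... \<le> C' * eps powr (alp / 3)" using C' by (simp add: mult_le_cancel_right1)
  finally show ?thesis .
 next
  case True
  \<comment> \<open>The exponent 1/3 balances two contributions: \<open>eta powr alp\<close> from
    the set of small derivative, and \<open>eps / eta\<^sup>2\<close> from about
    \<open>1 / eta\<close> intervals of length comparable to \<open>eps / eta\<close>.\<close>
  define eta where "eta = eps powr (1/3)"
  have eta: "eta > 0" "eta \<le> 1" using eps True by (auto simp: eta_def powr_le1)
  define n where "n = nat \<lfloor>1 / eta\<rfloor> + 1"
  define u where "u j = a + v + real j * eta" for j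
  define d where "d = 2 * eps / (L * eta)"
  have d: "d > 0" using eps L eta by (simp add: d_def)
  have "\<exists>s. cmod (Q (u j)) \<ge> 2 * L * eta \<longrightarrow> {t\<in>{u j..u j+eta}. cmod (F t) < eps} \<subseteq> {s - d .. s + d}" for j
   using trig_poly_sublevel_step[OF der lip L eta(1) eps] unfolding d_def by blast
  then obtain s where s: "\<And>j. cmod (Q (u j)) \<ge> 2 * L * eta ==> {t\<in>{u j..u j+eta}. cmod (F t) < eps} \<subseteq> {s j - d .. s j + d}"
   by metis
  \<comment> \<open>If \<open>cmod (Q (u j)) < 2 * L * eta\<close> at the left end of a cell, the
    Lipschitz bound adds at most \<open>L * eta\<close> inside it, hence the factor 3.\<close>
  define Y where "Y = {t\<in>{a..a+1}. cmod (Q (t + v)) < 3 * L * eta}"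
  define Z where "Z = (\<Union>j<n. {s j - d - v .. s j + d - v})"
  have sub: "{t\<in>{a..a+1}. cmod (F (t + v)) < eps} \<subseteq> Y \<union> Z"
  proof
   fix t assume "t \<in> {t\<in>{a..a+1}. cmod (F (t + v)) < eps}"
   then have t: "a \<le> t" "t \<le> a + 1" "cmod (F (t + v)) < eps" by auto
   define j where "j = nat \<lfloor>(t - a) / eta\<rfloor>"
   have "(t - a) / eta \<le> 1 / eta" using t eta by (intro divide_right_mono) auto
   then have "j < n" unfolding j_def n_def by (smt (verit, best) floor_mono nat_mono less_Suc_eq_le Suc_eq_plus1)
   have j: "real j \<le> (t - a) / eta" "(t - a) / eta < real j + 1"
   proof -
    have "(t - a) / eta \<ge> 0" using t eta by simp
    then have "real j = of_int \<lfloor>(t - a) / eta\<rfloor>" unfolding j_def by simp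
    then show "real j \<le> (t - a) / eta" "(t - a) / eta < real j + 1" by linarith+
   qed
   have tj: "t + v \<in> {u j..u j + eta}" using j eta by (auto simp: u_def field_simps)
   show "t \<in> Y \<union> Z"
   proof (cases "cmod (Q (u j)) \<ge> 2 * L * eta")
    case True
    with s[OF this] tj t have "t + v \<in> {s j - d .. s j + d}" by auto
    then have "t \<in> {s j - d - v .. s j + d - v}" by auto
    then show ?thesis using \<open>j < n\<close> unfolding Z_def by blast
   next
    case False
    have "cmod (Q (t + v)) \<le> cmod (Q (u j)) + cmod (Q (t + v) - Q (u j))"
     by (metis add.commute diff_add_cancel norm_triangle_ineq)
    also have "cmod (Q (t + v) - Q (u j)) \<le> L * \<bar>t + v - u j\<bar>" by (rule lip)
    also have "L * \<bar>t + v - u j\<bar> \<le> L * eta" using tj L by (intro mult_left_mono) auto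
    also have "cmod (Q (u j)) + L * eta < 3 * L * eta" using False by linarith
    finally show ?thesis using t unfolding Y_def by auto
   qed
  qed
  have Z: "measure lborel Z \<le> (\<Sum>j<n. 2 * d)" "Z \<in> fmeasurable lborel"
  proof -
   have "measure lborel Z \<le> (\<Sum>j<n. measure lborel {s j - d - v .. s j + d - v})"
    unfolding Z_def by (intro measure_UNION_le) auto
   also have "... = (\<Sum>j<n. 2 * d)" using d by (intro sum.cong) auto
   finally show "measure lborel Z \<le> (\<Sum>j<n. 2 * d)" .
   show "Z \<in> fmeasurable lborel" unfolding Z_def by (intro fmeasurable.finite_UN) auto
  qed
  have Ym: "Y \<in> fmeasurable lborel"
  proof (rule fmeasurableI2[of "{a..a+1}"])
   show "Y \<in> sets lborel" unfolding Y_def Q_def by measurable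
  qed (auto simp: Y_def)
  have "measure lborel {t\<in>{a..a+1}. cmod (F (t + v)) < eps} \<le> measure lborel (Y \<union> Z)"
   using sub Ym Z(2) unfolding F_def by (intro measure_mono_fmeasurable) (auto intro!: sets.sets_Collect)
  also have "... \<le> measure lborel Y + measure lborel Z"
   using Ym Z by (intro measure_Un_le) auto
  also have "measure lborel Y \<le> C * (3 * L * eta) powr alp"
   unfolding Y_def using L eta by (intro meas) auto
  also have "(3 * L * eta) powr alp = (3 * L) powr alp * eps powr (alp / 3)"
   using L eta unfolding eta_def by (simp add: powr_mult powr_powr)
  also have "measure lborel Z \<le> 8 / L * eps powr (alp / 3)"
  proof -
   have "real n \<le> 1 / eta + 1" unfolding n_def using eta by simp
   also have "... \<le> 2 / eta" using eta by (simp add: field_simps)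
   finally have "real n * (2 * d) \<le> 2 / eta * (2 * d)" using d by (intro mult_right_mono) auto
   also have "... = 8 / L * (eps / eta\<^sup>2)" unfolding d_def by (simp add: power2_eq_square field_simps)
   also have "eps / eta\<^sup>2 = eps powr (1/3)"
   proof -
    have "eta\<^sup>2 = eps powr (2/3)" unfolding eta_def by (simp add: power2_eq_square flip: powr_add)
    then show ?thesis using eps powr_diff[of eps 1 "2/3"] by simp
   qed
   also have "8 / L * eps powr (1/3) \<le> 8 / L * eps powr (alp / 3)"
    using C True eps L by (intro mult_left_mono powr_mono') auto
   finally show ?thesis using Z(1) by simp
  qed
  finally have "measure lborel {t\<in>{a..a+1}. cmod (F (t + v)) < eps} \<le> (C * (3 * L) powr alp + 8 / L) * eps powr (alp / 3)"
   by (simp add: algebra_simps)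
  also have "... \<le> C' * eps powr (alp / 3)" unfolding C'_def by (intro mult_right_mono) auto
  finally show ?thesis .
 qed
 then show ?case using C C' unfolding FP by (intro exI[of _ C'] exI[of _ "alp / 3"]) auto
qed

text \<open>A Borel--Cantelli argument with an explicit budget: at most
  \<open>(n + 1) ^ card D\<close> multi-indices have level \<open>n\<close>, so a lower bound that
  decays like a fixed power of \<open>n\<close> can hold at all orbit points simultaneously.
  \<open>K\<close> depends on the polynomial and on \<open>card D\<close>, not on the
  interval.\<close>

lemma good_translate_exists:
 fixes D :: "real set"
 assumes B: "finite B" "B \<noteq> {}" "\<forall>b\<in>B. c b \<noteq> 0" and D: "finite D"
 shows "\<exists>K::nat. \<forall>u v x. u < v \<longrightarrow> (\<exists>t\<in>{u..v}. \<exists>gam>0. \<forall>n. \<forall>f\<in>D \<rightarrow>\<^sub>E (UNIV::nat set). (\<Sum>d\<in>D. f d) = n \<longrightarrow>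
      cmod (trig_poly c B (t + x + (\<Sum>d\<in>D. real (f d) * d))) \<ge> gam / real (n + 1) ^ K)"
proof -
 obtain C alp where C: "C \<ge> 1" "alp > 0" and meas: "\<And>a v eps. eps > 0 ==>
   measure lborel {t\<in>{a..a+1}. cmod (trig_poly c B (t + v)) < eps} \<le> C * eps powr alp"
  using trig_poly_sublevel[OF B] by metis
 define p where "p = card D"
 \<comment> \<open>Gives \<open>p - K * alp \<le> - 2\<close>, which makes the measures of the bad
   sets summable over the levels.\<close>
 define K where "K = nat \<lceil>(real p + 2) / alp\<rceil>"
 have K: "real K * alp \<ge> real p + 2"
  using C by (simp add: K_def) (metis le_of_int_ceiling pos_divide_le_eq C(2) ceiling_def real_nat_ceiling_ge)
 define S where "S = (\<Sum>n. 1 / (real (n+1))\<^sup>2)"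
 have summ: "summable (\<lambda>n. 1 / (real (n+1))\<^sup>2)"
  using inverse_squares_sums by (simp add: sums_iff)
 have S: "S \<ge> 0" unfolding S_def by (intro suminf_nonneg summ) auto
 show ?thesis
 proof (rule exI[of _ K], intro allI impI)
  fix u v x :: real assume uv: "u < v"
  define l where "l = min 1 (v - u)"
  have l: "l > 0" "l \<le> 1" "u + l \<le> v" using uv by (auto simp: l_def)
  \<comment> \<open>Keeps the total bad measure, at most \<open>C * gam powr alp * S\<close>, within
    half of the available length \<open>l\<close>.\<close>
  define gam where "gam = (l / (2 * C * (S + 1))) powr (1/alp)"
  have gam: "gam > 0" using l C S unfolding gam_def by simp
  have gamalp: "C * gam powr alp * S < l"
  proof -
   have "gam powr alp = l / (2 * C * (S + 1))" unfolding gam_def using l C S by (simp add: powr_powr)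
   then have "C * gam powr alp = l / 2 / (S + 1)" using C by simp
   then have "C * gam powr alp * S = l / 2 * (S / (S + 1))" by simp
   also have "... \<le> l / 2 * 1" using l S by (intro mult_left_mono) auto
   also have "... < l" using l by simp
   finally show ?thesis .
  qed
  define Fs where "Fs n = {f \<in> D \<rightarrow>\<^sub>E (UNIV::nat set). (\<Sum>d\<in>D. f d) = n}" for n
  have Fs: "finite (Fs n)" "card (Fs n) \<le> (n + 1) ^ p" for n
  proof -
   have sub: "Fs n \<subseteq> D \<rightarrow>\<^sub>E {..n}"
   proof
    fix f assume f: "f \<in> Fs n"
    have "f d \<le> n" if "d \<in> D" for d
     using member_le_sum[of d D f] that f D unfolding Fs_def by auto
    then show "f \<in> D \<rightarrow>\<^sub>E {..n}" using f unfolding Fs_def by (auto simp: PiE_iff)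
   qed
   have fin: "finite (D \<rightarrow>\<^sub>E {..n})" using D by (intro finite_PiE) auto
   show "finite (Fs n)" using finite_subset[OF sub fin] .
   show "card (Fs n) \<le> (n + 1) ^ p"
    using card_mono[OF fin sub] D by (simp add: card_PiE p_def)
  qed
  define bad where "bad n f = {t\<in>{u..u+1}. cmod (trig_poly c B (t + (x + (\<Sum>d\<in>D. real (f d) * d)))) < gam / real (n + 1) ^ K}" for n f
  define A where "A n = (\<Union>f\<in>Fs n. bad n f)" for n
  have badm: "bad n f \<in> sets lborel" for n f unfolding bad_def by measurable
  have bad: "emeasure lborel (bad n f) \<le> ennreal (C * (gam / real (n + 1) ^ K) powr alp)" for n f
  proof -
   have "emeasure lborel (bad n f) \<le> emeasure lborel {u..u+1}"
    using badm by (intro emeasure_mono) (auto simp: bad_def)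
   then have "emeasure lborel (bad n f) \<noteq> \<infinity>" by (auto simp: top_unique)
   then have "emeasure lborel (bad n f) = ennreal (measure lborel (bad n f))"
    by (simp add: emeasure_eq_ennreal_measure)
   also have "... \<le> ennreal (C * (gam / real (n + 1) ^ K) powr alp)"
    unfolding bad_def using gam by (intro ennreal_leI meas) auto
   finally show ?thesis .
  qed
  have A: "emeasure lborel (A n) \<le> ennreal (C * gam powr alp * (1 / (real (n+1))\<^sup>2))" for n
  proof -
   have "emeasure lborel (A n) \<le> (\<Sum>f\<in>Fs n. emeasure lborel (bad n f))"
    unfolding A_def using Fs badm by (intro emeasure_subadditive_finite) auto
   also have "... \<le> (\<Sum>f\<in>Fs n. ennreal (C * (gam / real (n + 1) ^ K) powr alp))"
    by (intro sum_mono bad)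
   also have "... = ennreal (real (card (Fs n)) * (C * (gam / real (n + 1) ^ K) powr alp))"
    using C by (simp add: ennreal_mult ennreal_of_nat_eq_real_of_nat)
   also have "... \<le> ennreal (C * gam powr alp * (1 / (real (n+1))\<^sup>2))"
   proof (rule ennreal_leI)
    have pw: "(gam / real (n + 1) ^ K) powr alp = gam powr alp * real (n + 1) powr (- (real K * alp))"
     using gam by (simp add: powr_divide powr_minus_divide powr_powr flip: powr_realpow)
    have "real (card (Fs n)) \<le> real (n + 1) powr (real p)"
     using Fs(2)[of n] by (simp add: powr_realpow flip: of_nat_power) (metis Fs(2) Suc_eq_plus1 of_nat_le_iff of_nat_power of_nat_Suc add.commute)
    then have "real (card (Fs n)) * real (n + 1) powr (- (real K * alp)) \<le> real (n + 1) powr (real p) * real (n + 1) powr (- (real K * alp))"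
     by (intro mult_right_mono) auto
    also have "... = real (n + 1) powr (real p - real K * alp)" by (simp flip: powr_add)
    also have "... \<le> real (n + 1) powr (- 2)" using K by (intro powr_mono) auto
    also have "... = 1 / (real (n+1))\<^sup>2" by (simp add: powr_minus_divide)
    finally have "C * gam powr alp * (real (card (Fs n)) * real (n + 1) powr (- (real K * alp))) \<le> C * gam powr alp * (1 / (real (n+1))\<^sup>2)"
     using C by (intro mult_left_mono) auto
    then show "real (card (Fs n)) * (C * (gam / real (n + 1) ^ K) powr alp) \<le> C * gam powr alp * (1 / (real (n+1))\<^sup>2)"
     unfolding pw by (simp only: mult_ac)
   qed
   finally show ?thesis .
  qed
  have Am: "A n \<in> sets lborel" for n unfolding A_def using Fs badm by auto
  have "emeasure lborel (\<Union>n. A n) \<le> (\<Sum>n. emeasure lborel (A n))"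
   using Am by (intro emeasure_subadditive_countably) auto
  also have "... \<le> (\<Sum>n. ennreal (C * gam powr alp * (1 / (real (n+1))\<^sup>2)))"
   using A by (intro suminf_le) auto
  also have "... = ennreal (C * gam powr alp * S)"
  proof -
   have sm: "summable (\<lambda>n. C * gam powr alp * (1 / (real (n+1))\<^sup>2))" by (rule summable_mult[OF summ])
   have eq: "(\<Sum>n. C * gam powr alp * (1 / (real (n+1))\<^sup>2)) = C * gam powr alp * S"
    unfolding S_def by (rule suminf_mult[OF summ])
   show ?thesis unfolding eq[symmetric] using C by (intro suminf_ennreal2 sm) simp
  qed
  also have "... < ennreal l" using gamalp l by (intro ennreal_lessI) auto
  also have "ennreal l = emeasure lborel {u..u+l}" using l by simp
  finally have "\<not> {u..u+l} \<subseteq> (\<Union>n. A n)"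
   using Am emeasure_mono[of "{u..u+l}" "\<Union>n. A n" lborel] by (auto simp: not_le[symmetric])
  then obtain t where t: "t \<in> {u..u+l}" "t \<notin> (\<Union>n. A n)" by blast
  show "\<exists>t\<in>{u..v}. \<exists>gam>0. \<forall>n. \<forall>f\<in>D \<rightarrow>\<^sub>E (UNIV::nat set). (\<Sum>d\<in>D. f d) = n \<longrightarrow>
      cmod (trig_poly c B (t + x + (\<Sum>d\<in>D. real (f d) * d))) \<ge> gam / real (n + 1) ^ K"
  proof (rule bexI[of _ t], rule exI[of _ gam], intro conjI gam allI ballI impI)
   fix n f assume "f \<in> D \<rightarrow>\<^sub>E (UNIV::nat set)" "(\<Sum>d\<in>D. f d) = n"
   then have "f \<in> Fs n" by (simp add: Fs_def)
   then have "t \<notin> bad n f" using t(2) by (auto simp: A_def)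
   moreover have "t \<in> {u..u+1}" using t l by auto
   ultimately show "cmod (trig_poly c B (t + x + (\<Sum>d\<in>D. real (f d) * d))) \<ge> gam / real (n + 1) ^ K"
    by (auto simp: bad_def add.assoc)
  qed (use t l in auto)
 qed
qed

text \<open>Solving for the translate by the largest shift \<open>xN\<close> expresses
  \<open>g t\<close> through values further to the right; \<open>n\<close> rounds move the argument
  by at least \<open>n * dlt\<close> and cost a factor \<open>A ^ n * fact n ^ K\<close>. The moment
  bound of order \<open>L * n\<close> gains about \<open>n powr (- (1 - s) * L * n)\<close>. Since
  \<open>s < 1\<close>, a large \<open>L\<close> lets the gain win.\<close>

lemma fast_decay_independent:
 fixes g :: "real \<Rightarrow> complex" and X :: "real set"
 assumes X: "finite X" "X \<noteq> {}" and B: "\<And>x. x \<in> X ==> finite (B x) \<and> B x \<noteq> {} \<and> (\<forall>b\<in>B x. c x b \<noteq> 0)"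
  and rel: "\<And>t. (\<Sum>x\<in>X. trig_poly (c x) (B x) t * g (t - x)) = 0"
  and cont: "continuous_on UNIV g"
  and dec: "\<And>m t. \<bar>t\<bar> ^ m * cmod (g t) \<le> C * h ^ m * fact m powr s"
  and s: "0 < s" "s < 1" and h: "h > 0"
 shows "g t = 0"
proof -
 define xN where "xN = Max X"
 define D where "D = (\<lambda>x. xN - x) ` (X - {xN})"
 have xN: "xN \<in> X" "\<And>x. x \<in> X ==> x \<le> xN" using X by (auto simp: xN_def)
 have D: "finite D" "\<And>d. d \<in> D ==> d > 0" using X xN by (auto simp: D_def less_le)
 define M where "M = 1 + (\<Sum>x\<in>X. \<Sum>b\<in>B x. cmod (c x b))"
 have M: "M > 0" unfolding M_def by (intro add_pos_nonneg sum_nonneg) auto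
 define P where "P = trig_poly (c xN) (B xN)"
 obtain K where K: "\<And>u v x. u < v ==> (\<exists>t\<in>{u..v}. \<exists>gam>0. \<forall>n. \<forall>f\<in>D \<rightarrow>\<^sub>E (UNIV::nat set). (\<Sum>d\<in>D. f d) = n \<longrightarrow>
      cmod (P (t + x + (\<Sum>d\<in>D. real (f d) * d))) \<ge> gam / real (n + 1) ^ K)"
  using good_translate_exists[of "B xN" "c xN" D] B[OF xN(1)] D(1) unfolding P_def by blast
 have C0: "C \<ge> 0"
 proof -
  have "0 \<le> \<bar>0\<bar> ^ 0 * cmod (g 0)" by simp
  also have "... \<le> C * h ^ 0 * fact 0 powr s" by (rule dec)
  finally show ?thesis by simp
 qed
 have step: "cmod (P (t + xN)) * cmod (g t) \<le> M * (\<Sum>d\<in>D. cmod (g (t + d)))" for t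
 proof -
  have "P (t + xN) * g t = - (\<Sum>x\<in>X - {xN}. trig_poly (c x) (B x) (t + xN) * g (t + xN - x))"
   using rel[of "t + xN"] X xN by (simp add: sum.remove[of X xN] P_def add_eq_0_iff)
  then have "cmod (P (t + xN)) * cmod (g t) = cmod (\<Sum>x\<in>X - {xN}. trig_poly (c x) (B x) (t + xN) * g (t + xN - x))"
   by (metis norm_minus_cancel norm_mult)
  also have "... \<le> (\<Sum>x\<in>X - {xN}. M * cmod (g (t + (xN - x))))"
  proof (intro order.trans[OF norm_sum] sum_mono)
   fix x assume x: "x \<in> X - {xN}"
   have "cmod (trig_poly (c x) (B x) (t + xN)) \<le> (\<Sum>b\<in>B x. cmod (c x b))" by (rule norm_trig_poly_le)
   also have "... \<le> (\<Sum>x\<in>X. \<Sum>b\<in>B x. cmod (c x b))"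
    using x X by (intro member_le_sum) (auto intro: sum_nonneg)
   also have "... \<le> M" by (simp add: M_def)
   finally show "cmod (trig_poly (c x) (B x) (t + xN) * g (t + xN - x)) \<le> M * cmod (g (t + (xN - x)))"
    by (simp add: norm_mult mult_right_mono add_diff_eq)
  qed
  also have "... = M * (\<Sum>d\<in>D. cmod (g (t + d)))"
   unfolding D_def sum_distrib_left by (subst sum.reindex) (auto simp: inj_on_def)
  finally show ?thesis .
 qed
 \<comment> \<open>If \<open>X\<close> is a single point, \<open>D\<close> is empty and the value 1
   is arbitrary: no multi-index has positive level, so the iterated bound holds vacuously.\<close>
 define dlt where "dlt = (if D = {} then 1 else Min D)"
 have dlt: "dlt > 0" "\<And>d. d \<in> D ==> dlt \<le> d" using D by (auto simp: dlt_def)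
 have zero: "g t = 0" if gam: "gam > 0" and good: "\<And>f. f \<in> D \<rightarrow>\<^sub>E (UNIV::nat set) ==>
   cmod (P (t + xN + (\<Sum>d\<in>D. real (f d) * d))) \<ge> gam / real ((\<Sum>d\<in>D. f d) + 1) ^ K" for t gam
 proof -
  define A where "A = M * (real (card D)) / gam + 1"
  have A: "A > 0" unfolding A_def using M gam by (simp add: add_nonneg_pos)
  have iter: "cmod (g t) \<le> A ^ n * fact n ^ K * b"
   if "b \<ge> 0" "\<And>f. f \<in> D \<rightarrow>\<^sub>E (UNIV::nat set) ==> (\<Sum>d\<in>D. f d) = n ==> cmod (g (t + (\<Sum>d\<in>D. real (f d) * d))) \<le> b" for n b
   using that
  proof (induction n arbitrary: b)
   case 0
   define f where "f = (\<lambda>d\<in>D. 0::nat)"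
   have "f \<in> D \<rightarrow>\<^sub>E UNIV" "(\<Sum>d\<in>D. f d) = 0" "(\<Sum>d\<in>D. real (f d) * d) = 0" by (auto simp: f_def)
   then show ?case using "0.prems"(2)[of f] by simp
  next
   case (Suc n)
   have lvl: "cmod (g (t + (\<Sum>d\<in>D. real (f d) * d))) \<le> A * real (n + 1) ^ K * b"
    if f: "f \<in> D \<rightarrow>\<^sub>E (UNIV::nat set)" "(\<Sum>d\<in>D. f d) = n" for f
   proof -
    define y where "y = (\<Sum>d\<in>D. real (f d) * d)"
    have nb: "cmod (g (t + y + d)) \<le> b" if d: "d \<in> D" for d
    proof -
     have "(\<Sum>e\<in>D. (f(d := Suc (f d))) e) = Suc n"
      using d D f by (subst sum.remove[of _ d]) (auto simp: sum.remove[of D d f])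
     moreover have "(\<Sum>e\<in>D. real ((f(d := Suc (f d))) e) * e) = y + d"
     proof -
      have yeq: "y = real (f d) * d + (\<Sum>e\<in>D - {d}. real (f e) * e)"
       unfolding y_def by (rule sum.remove[OF D(1) d])
      have "(\<Sum>e\<in>D - {d}. real ((f(d := Suc (f d))) e) * e) = (\<Sum>e\<in>D - {d}. real (f e) * e)"
       by (intro sum.cong) auto
      then show ?thesis unfolding yeq sum.remove[OF D(1) d, of "\<lambda>e. real ((f(d := Suc (f d))) e) * e"]
       by (simp add: algebra_simps)
     qed
     ultimately show ?thesis
      using Suc.prems(2)[of "f(d := Suc (f d))"] f d by (auto simp: add.assoc PiE_iff extensional_def)
    qed
    have "cmod (P (t + y + xN)) * cmod (g (t + y)) \<le> M * (\<Sum>d\<in>D. cmod (g (t + y + d)))"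
     by (rule step)
    also have "... \<le> M * (\<Sum>d\<in>D. b)" using M nb by (intro mult_left_mono sum_mono) auto
    also have "... = M * real (card D) * b" by simp
    finally have le: "cmod (P (t + y + xN)) * cmod (g (t + y)) \<le> M * real (card D) * b" .
    have "gam / real (n + 1) ^ K * cmod (g (t + y)) \<le> cmod (P (t + y + xN)) * cmod (g (t + y))"
     using good[OF f(1)] f(2) by (intro mult_right_mono) (auto simp: y_def add_ac)
    with le have le2: "gam / real (n + 1) ^ K * cmod (g (t + y)) \<le> M * real (card D) * b" by linarith
    have "real (n + 1) ^ K > 0" by simp
    with le2 have "cmod (g (t + y)) \<le> M * real (card D) * b / gam * real (n + 1) ^ K"
     using gam by (simp add: field_simps del: of_nat_add of_nat_Suc)
    also have "... = (A - 1) * real (n + 1) ^ K * b" by (simp add: A_def)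
    also have "... \<le> A * real (n + 1) ^ K * b"
     using Suc.prems(1) by (intro mult_right_mono) auto
    finally show ?thesis by (simp add: y_def)
   qed
   have "cmod (g t) \<le> A ^ n * fact n ^ K * (A * real (n + 1) ^ K * b)"
    using A Suc.prems(1) by (intro Suc.IH[OF _ lvl]) auto
   also have "... = A ^ Suc n * fact (Suc n) ^ K * b"
    unfolding Suc_eq_plus1[symmetric] by (simp add: power_mult_distrib del: of_nat_Suc)
   finally show ?case .
  qed
  \<comment> \<open>Once \<open>n * dlt \<ge> 2 * \<bar>t\<bar>\<close>, the points of level
    \<open>n\<close> have modulus at least \<open>n * dlt / 2\<close>; this turns \<open>h\<close>
    into \<open>H / n\<close>.\<close>
  define H where "H = 2 * h / dlt"
  have H: "H > 0" using h dlt by (simp add: H_def)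
  have bound: "cmod (g t) \<le> A ^ n * fact n ^ K * (C * (H / n) ^ m * fact m powr s)"
   if n: "n > 0" "real n * dlt \<ge> 2 * \<bar>t\<bar>" for n m
  proof (rule iter)
   show "0 \<le> C * (H / n) ^ m * fact m powr s" using C0 H by simp
   fix f assume f: "f \<in> D \<rightarrow>\<^sub>E (UNIV::nat set)" "(\<Sum>d\<in>D. f d) = n"
   define y where "y = (\<Sum>d\<in>D. real (f d) * d)"
   have "real n * dlt = (\<Sum>d\<in>D. real (f d) * dlt)" unfolding f(2)[symmetric] by (simp add: sum_distrib_right)
   also have "... \<le> y" unfolding y_def using dlt by (intro sum_mono mult_left_mono) auto
   finally have y: "n * dlt / 2 \<le> \<bar>t + y\<bar>" using n by linarith
   have pos: "n * dlt / 2 > 0" using n dlt by simp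
   have "(n * dlt / 2) ^ m * cmod (g (t + y)) \<le> \<bar>t + y\<bar> ^ m * cmod (g (t + y))"
    using y pos by (intro mult_right_mono power_mono) auto
   also have "... \<le> C * h ^ m * fact m powr s" by (rule dec)
   finally have "cmod (g (t + y)) \<le> C * h ^ m * fact m powr s / (n * dlt / 2) ^ m"
    using pos by (simp add: pos_le_divide_eq mult.commute)
   also have "... = C * (H / n) ^ m * fact m powr s"
    unfolding H_def using pos by (simp add: power_divide power_mult_distrib field_simps)
   finally show "cmod (g (t + (\<Sum>d\<in>D. real (f d) * d))) \<le> C * (H / n) ^ m * fact m powr s"
    by (simp add: y_def)
  qed
  \<comment> \<open>With \<open>m = L * n\<close> moments the exponent of \<open>n\<close> per round
    becomes \<open>K - L * (1 - s) \<le> - 1\<close>, which leaves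
    \<open>(E / n) ^ n\<close>.\<close>
  define L where "L = nat \<lceil>(real K + 1) / (1 - s)\<rceil> + 1"
  have "(real K + 1) / (1 - s) \<le> real L" unfolding L_def by linarith
  then have L: "real L * (1 - s) \<ge> real K + 1" "L > 0" using s by (simp_all add: pos_divide_le_eq L_def)
  define E where "E = A * (H * real L powr s) ^ L"
  have E: "E > 0" unfolding E_def using A H L by simp
  have base: "A ^ n * fact n ^ K * (C * (H / n) ^ (L * n) * fact (L * n) powr s) \<le> C * (E / n) ^ n"
   if n: "n > 0" for n
  proof -
   have f1: "fact n ^ K \<le> (real n ^ K) ^ n"
   proof -
    have "fact n \<le> real n ^ n" using fact_le_power[of n, where 'a=real] by simp
    then have "fact n ^ K \<le> (real n ^ n) ^ K" by (intro power_mono) auto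
    then show ?thesis by (simp add: mult.commute flip: power_mult)
   qed
   have f2: "fact (L * n) powr s \<le> ((real L * real n) powr s) ^ (L * n)"
   proof -
    have "fact (L * n) \<le> real (L * n) ^ (L * n)"
     using fact_le_power[of "L * n", where 'a=real] by simp
    then have "fact (L * n) powr s \<le> (real (L * n) ^ (L * n)) powr s" using s by (intro powr_mono2) auto
    also have "... = (real (L * n) powr s) ^ (L * n)" using n L
     by (simp add: powr_powr mult.commute flip: powr_realpow)
    finally show ?thesis by simp
   qed
   have "A ^ n * fact n ^ K * (C * (H / n) ^ (L * n) * fact (L * n) powr s)
     \<le> A ^ n * (real n ^ K) ^ n * (C * (H / n) ^ (L * n) * ((real L * real n) powr s) ^ (L * n))"
    using f1 f2 A H C0 by (intro mult_mono) auto
   also have "... = C * (A * real n ^ K * ((H / n) * (real L * real n) powr s) ^ L) ^ n"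
    by (simp only: power_mult_distrib power_mult mult_ac)
   also have "A * real n ^ K * ((H / n) * (real L * real n) powr s) ^ L
     = E * (real n ^ K * (real n powr s / n) ^ L)"
    unfolding E_def by (simp add: powr_mult power_mult_distrib power_divide)
   also have "real n powr s / n = real n powr (s - 1)" using n by (simp add: powr_diff)
   also have "real n ^ K * (real n powr (s - 1)) ^ L = real n powr (real K - real L * (1 - s))"
    using n by (simp add: powr_powr powr_power algebra_simps flip: powr_realpow powr_add)
   finally have "A ^ n * fact n ^ K * (C * (H / n) ^ (L * n) * fact (L * n) powr s)
     \<le> C * (E * real n powr (real K - real L * (1 - s))) ^ n" .
   also have "... \<le> C * (E * real n powr (-1)) ^ n"
    using n L E C0 by (intro mult_left_mono power_mono powr_mono) auto
   also have "E * real n powr (-1) = E / n" using n by (simp add: powr_minus_divide)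
   finally show ?thesis .
  qed
  have ev: "\<forall>\<^sub>F n in sequentially. cmod (g t) \<le> C * (1/2) ^ n"
   using eventually_gt_at_top[of "nat \<lceil>2 * \<bar>t\<bar> / dlt\<rceil> + nat \<lceil>2 * E\<rceil>"]
  proof eventually_elim
   case (elim n)
   then have n: "n > 0" "real n \<ge> 2 * \<bar>t\<bar> / dlt" "real n \<ge> 2 * E" by linarith+
   have "cmod (g t) \<le> C * (E / n) ^ n"
    using bound[of n "L * n"] base[of n] n dlt by (simp add: pos_divide_le_eq)
   also have "... \<le> C * (1/2) ^ n"
    using n E C0 by (intro mult_left_mono power_mono) (auto simp: field_simps)
   finally show ?case .
  qed
  have "(\<lambda>n. C * (1/2) ^ n) \<longlonglongrightarrow> C * 0"
   by (intro tendsto_mult tendsto_const LIMSEQ_realpow_zero) auto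
  then have "cmod (g t) \<le> C * 0" using ev by (rule tendsto_lowerbound) simp
  then show ?thesis by simp
 qed
 show ?thesis
 proof (rule ccontr)
  assume "g t \<noteq> 0"
  moreover have "isCont g t" using cont by (simp add: continuous_on_eq_continuous_at)
  ultimately obtain e where e: "e > 0" "\<And>u. dist t u < e ==> g u \<noteq> 0"
   using continuous_at_avoid[of t g 0] by auto
  \<comment> \<open>The point \<open>t\<close> itself need not be good, but continuity keeps
    \<open>g\<close> away from 0 on an interval to its right, and every interval contains a good
    point.\<close>
  obtain u gam where u: "u \<in> {t..t + e/2}" "gam > 0" and good: "\<forall>n. \<forall>f\<in>D \<rightarrow>\<^sub>E (UNIV::nat set). (\<Sum>d\<in>D. f d) = n \<longrightarrow>
      cmod (P (u + xN + (\<Sum>d\<in>D. real (f d) * d))) \<ge> gam / real (n + 1) ^ K"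
   using K[of t "t + e/2" xN] e by auto
  have "g u = 0" by (rule zero[OF u(2)]) (rule good[rule_format, OF _ refl])
  then show False using e u by (auto simp: dist_real_def)
 qed
qed

section \<open>The Fourier transform\<close>

definition fourier :: "(real \<Rightarrow> complex) \<Rightarrow> real \<Rightarrow> complex" where
 "fourier f xi = (LINT t|lborel. f t * cis (- 2 * pi * xi * t))"

lemma integrable_mult_cis:
 fixes f :: "real \<Rightarrow> complex"
 assumes "integrable lborel f"
 shows "integrable lborel (\<lambda>t. f t * cis (a * t + b))"
proof (rule Bochner_Integration.integrable_bound[OF assms])
 have [measurable]: "f \<in> borel_measurable lborel" using assms by auto
 have "(\<lambda>t. cis (a * t + b)) \<in> borel_measurable borel"
  by (intro borel_measurable_continuous_onI continuous_intros)
 then show "(\<lambda>t. f t * cis (a * t + b)) \<in> borel_measurable lborel" by measurable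
qed (simp add: norm_mult)

lemma integrable_mult_cis':
 fixes f :: "real \<Rightarrow> complex"
 assumes "integrable lborel f"
 shows "integrable lborel (\<lambda>t. f t * cis (a * t))"
 using integrable_mult_cis[OF assms, of a 0] by simp

text \<open>Frequency 0 shows that the positive and the negative part have the same mass
  \<open>c\<close>. Divided by \<open>c\<close>, they are densities of probability measures with
  equal characteristic functions, and Levy's uniqueness theorem applies.\<close>

lemma char_vanish_real:
 fixes u :: "real \<Rightarrow> real"
 assumes u: "integrable lborel u" and zero: "\<And>w. (LINT t|lborel. u t * cis (w * t)) = 0"
 shows "AE t in lborel. u t = 0"
proof -
 have [measurable]: "u \<in> borel_measurable borel" using u by auto
 define p where "p t = max (u t) 0" for t
 define n where "n t = max (- u t) 0" for t
 have "integrable lborel p" "integrable lborel n"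
  unfolding p_def n_def using u by (auto intro!: Bochner_Integration.integrable_max)
 then have pn: "integrable lborel p" "integrable lborel n" "\<And>t. u t = p t - n t" "\<And>t. p t \<ge> 0" "\<And>t. n t \<ge> 0"
  by (auto simp: p_def n_def max_def)
 have [measurable]: "p \<in> borel_measurable borel" "n \<in> borel_measurable borel" using pn by auto
 have i: "integrable lborel (\<lambda>t. f t * cis (w * t))" if "integrable lborel f" for f :: "real \<Rightarrow> real" and w
  using integrable_mult_cis'[of "\<lambda>t. complex_of_real (f t)" w] that by simp
 have eq: "(LINT t|lborel. p t * cis (w * t)) = (LINT t|lborel. n t * cis (w * t))" for w
  using zero[of w] i[OF pn(1), of w] i[OF pn(2), of w] by (simp add: pn(3) left_diff_distrib)
 define c where "c = (LINT t|lborel. p t)"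
 have c: "(LINT t|lborel. n t) = c" using eq[of 0] unfolding c_def by simp
 show ?thesis
 proof (cases "c = 0")
  case True
  have "AE t in lborel. p t = 0" "AE t in lborel. n t = 0"
   using True c pn integral_nonneg_eq_0_iff_AE[OF pn(1)] integral_nonneg_eq_0_iff_AE[OF pn(2)]
   by (auto simp: c_def)
  then show ?thesis by eventually_elim (simp add: pn)
 next
  case False
  have "c \<ge> 0" unfolding c_def using pn by (intro integral_nonneg_AE) auto
  with False have c0: "c > 0" by simp
  define M where "M f = density lborel (\<lambda>t. ennreal (f t / c))" for f :: "real \<Rightarrow> real"
  have rd: "real_distribution (M f)" if f: "integrable lborel f" "\<And>t. f t \<ge> 0" "(LINT t|lborel. f t) = c" for f
  proof -
   have [measurable]: "f \<in> borel_measurable borel" using f by auto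
   have "emeasure (M f) (space (M f)) = (\<integral>\<^sup>+t. ennreal (f t / c) \<partial>lborel)"
    unfolding M_def by (simp add: emeasure_density)
   also have "... = ennreal (LINT t|lborel. f t / c)" using f c0 by (intro nn_integral_eq_integral) auto
   also have "... = 1" using f c0 by simp
   finally have "prob_space (M f)" by (rule prob_spaceI)
   then show ?thesis by (simp add: real_distribution_def real_distribution_axioms_def M_def)
  qed
  have ch: "char (M f) w = (LINT t|lborel. f t * cis (w * t)) / c" if f: "integrable lborel f" "\<And>t. f t \<ge> 0" for f w
  proof -
   have [measurable]: "f \<in> borel_measurable borel" using f by auto
   have "char (M f) w = (LINT t|lborel. (f t / c) *\<^sub>R iexp (w * t))"
    unfolding char_def M_def using f c0 by (intro integral_density) auto
   also have "... = (LINT t|lborel. f t * cis (w * t) / c)"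
    by (intro Bochner_Integration.integral_cong refl) (simp add: scaleR_conv_of_real cis_conv_exp)
   finally show ?thesis by simp
  qed
  have "M p = M n"
  proof (rule Levy_uniqueness)
   show "real_distribution (M p)" using pn by (intro rd) (simp_all add: c_def)
   show "real_distribution (M n)" using pn c by (intro rd) simp_all
   show "char (M p) = char (M n)"
    by (rule ext) (simp only: ch[OF pn(1,4)] ch[OF pn(2,5)] eq)
  qed
  then have "AE t in lborel. ennreal (p t / c) = ennreal (n t / c)"
   unfolding M_def by (subst (asm) sigma_finite_measure.density_unique_iff[OF lborel.sigma_finite_measure_axioms]) auto
  then show ?thesis by eventually_elim (use c0 pn in \<open>simp add: ennreal_inj\<close>)
 qed
qed

lemma fourier_vanish:
 assumes f: "integrable lborel f" and zero: "\<And>xi. fourier f xi = 0"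
 shows "AE t in lborel. f t = 0"
proof -
 have z: "(LINT t|lborel. f t * cis (w * t)) = 0" for w
  using zero[of "- w / (2 * pi)"] by (simp add: fourier_def)
 define u where "u t = Re (f t)" for t
 define v where "v t = Im (f t)" for t
 have uv: "integrable lborel u" "integrable lborel v" unfolding u_def v_def using f by (simp_all only: integrable_Re integrable_Im)
 have i: "integrable lborel (\<lambda>t. f t * cis (w * t))" if "integrable lborel f" for f :: "real \<Rightarrow> real" and w
  using integrable_mult_cis'[of "\<lambda>t. complex_of_real (f t)" w] that by simp
 define U where "U w = (LINT t|lborel. u t * cis (w * t))" for w
 define V where "V w = (LINT t|lborel. v t * cis (w * t))" for w
 have UV: "U w + \<i> * V w = 0" for w
 proof -
  have "f t * cis (w * t) = u t * cis (w * t) + \<i> * (v t * cis (w * t))" for t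
   unfolding u_def v_def by (subst (1) complex_eq[of "f t"]) (simp add: algebra_simps)
  then show ?thesis using z[of w] i[OF uv(1), of w] i[OF uv(2), of w] by (simp add: U_def V_def)
 qed
 \<comment> \<open>For a real integrand conjugation reflects the frequency. The identity at
   \<open>w\<close> and its conjugate at \<open>- w\<close> then separate the real from the
   imaginary part.\<close>
 have conj: "cnj (U (- w)) = U w" "cnj (V (- w)) = V w" for w
 proof -
  have "cnj (LINT t|lborel. complex_of_real (q t) * cis (- w * t)) = (LINT t|lborel. complex_of_real (q t) * cis (w * t))" for q
  proof -
   have "(LINT t|lborel. complex_of_real (q t) * cis (w * t)) = (LINT t|lborel. cnj (complex_of_real (q t) * cis (- w * t)))"
    by (intro Bochner_Integration.integral_cong refl) (simp add: cis_cnj)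
   then show ?thesis by (simp only: Bochner_Integration.integral_cnj)
  qed
  then show "cnj (U (- w)) = U w" "cnj (V (- w)) = V w" unfolding U_def V_def by blast+
 qed
 have "U w = 0 \<and> V w = 0" for w
 proof -
  have "cnj (U (-w) + \<i> * V (-w)) = 0" using UV by simp
  then have "U w - \<i> * V w = 0" using conj by simp
  then have "U w = \<i> * V w" by simp
  with UV[of w] show ?thesis by simp
 qed
 then have "AE t in lborel. u t = 0" "AE t in lborel. v t = 0"
  using char_vanish_real[OF uv(1)] char_vanish_real[OF uv(2)] unfolding U_def V_def by auto
 then show ?thesis by eventually_elim (simp add: u_def v_def complex_eq_iff)
qed

lemma continuous_on_fourier:
 assumes "integrable lborel f"
 shows "continuous_on UNIV (fourier f)"
proof -
 have [measurable]: "f \<in> borel_measurable borel" using assms by auto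
 have m: "(\<lambda>t. cis (a * t)) \<in> borel_measurable borel" for a
  by (intro borel_measurable_continuous_onI continuous_intros)
 have "isCont (fourier f) xi" for xi
  unfolding continuous_at_sequentially
 proof (intro allI impI)
  fix x :: "nat \<Rightarrow> real" assume x: "x \<longlonglongrightarrow> xi"
  show "(fourier f \<circ> x) \<longlonglongrightarrow> fourier f xi"
   unfolding fourier_def o_def
  proof (rule integral_dominated_convergence[where w="\<lambda>t. cmod (f t)"])
   show "AE t in lborel. (\<lambda>i. f t * cis (- 2 * pi * x i * t)) \<longlonglongrightarrow> f t * cis (- 2 * pi * xi * t)"
   proof (rule AE_I2)
    fix t show "(\<lambda>i. f t * cis (- 2 * pi * x i * t)) \<longlonglongrightarrow> f t * cis (- 2 * pi * xi * t)"
     by (intro tendsto_intros continuous_on_tendsto_compose[OF continuous_on_cis[OF continuous_on_id]] x UNIV_I always_eventually allI)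
   qed
   show "(\<lambda>t. f t * cis (- 2 * pi * xi * t)) \<in> borel_measurable lborel"
    using m[of "- 2 * pi * xi"] by simp
   show "(\<lambda>t. f t * cis (- 2 * pi * x i * t)) \<in> borel_measurable lborel" for i
    using m[of "- 2 * pi * x i"] by simp
  qed (use assms in \<open>auto simp: norm_mult\<close>)
 qed
 then show ?thesis by (simp add: continuous_on_eq_continuous_at)
qed

lemma fourier_shift:
 "fourier (\<lambda>t. cis (2 * pi * w * t) * f (t - x)) xi = cis (2 * pi * (w - xi) * x) * fourier f (xi - w)"
proof -
 have "fourier (\<lambda>t. cis (2 * pi * w * t) * f (t - x)) xi
   = (LINT t|lborel. (\<lambda>s. cis (2 * pi * w * s) * f (s - x) * cis (- 2 * pi * xi * s)) (x + 1 * t))"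
  unfolding fourier_def using lborel_integral_real_affine[of 1 "\<lambda>s. cis (2 * pi * w * s) * f (s - x) * cis (- 2 * pi * xi * s)" x]
  by simp
 also have "... = (LINT t|lborel. cis (2 * pi * (w - xi) * x) * (f t * cis (- 2 * pi * (xi - w) * t)))"
 proof (intro Bochner_Integration.integral_cong refl)
  fix t
  have "cis (2 * pi * w * (x + t)) * cis (- 2 * pi * xi * (x + t)) = cis (2 * pi * (w - xi) * x) * cis (- 2 * pi * (xi - w) * t)"
   by (simp add: cis_mult algebra_simps)
  then have "(cis (2 * pi * w * (x + t)) * cis (- 2 * pi * xi * (x + t))) * f t
    = (cis (2 * pi * (w - xi) * x) * cis (- 2 * pi * (xi - w) * t)) * f t"
   by (simp only:)
  then show "(\<lambda>s. cis (2 * pi * w * s) * f (s - x) * cis (- 2 * pi * xi * s)) (x + 1 * t) = cis (2 * pi * (w - xi) * x) * (f t * cis (- 2 * pi * (xi - w) * t))"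
   by (simp only: mult_ac add_diff_cancel_left' mult_1)
 qed
 finally show ?thesis by (simp add: fourier_def)
qed

section \<open>Decay of Fourier transforms of Gelfand--Shilov functions\<close>

lemma integrable_inverse_1_plus_square: "integrable lborel (\<lambda>t::real. inverse (1 + t\<^sup>2))"
 using integrable_inverse_1_plus_square by (simp add: set_integrable_def)

lemma nth_derivative_has_vector_derivative:
 assumes "smooth f"
 shows "(nth_derivative n f has_vector_derivative nth_derivative (Suc n) f t) (at t)"
proof -
 have "nth_derivative n f differentiable at t" using assms unfolding smooth_def by blast
 then show ?thesis by (simp add: vector_derivative_works nth_derivative_def)
qed

lemma isCont_nth_derivative: "smooth f ==> isCont (nth_derivative n f) t"
 using nth_derivative_has_vector_derivative has_vector_derivative_continuous by blast

text \<open>The estimates for \<open>m = 0\<close> and \<open>m = 2\<close> are added; the result is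
  an integrable majorant whose dependence on \<open>n\<close> is still
  \<open>h ^ n * fact n powr \<sigma>\<close>.\<close>

lemma gelfand_shilov_bound:
 assumes "f \<in> gelfand_shilov s \<sigma>"
 obtains C h where "C > 0" "h > 0" "\<And>n t. cmod (nth_derivative n f t) \<le> C * h ^ n * fact n powr \<sigma> * inverse (1 + t\<^sup>2)"
proof -
 obtain C h where C: "C > 0" "h > 0" and b': "\<forall>m n t. cmod (t ^ m * nth_derivative n f t) \<le> C * h ^ (m + n) * fact m powr s * fact n powr \<sigma>"
  using assms unfolding gelfand_shilov_def by blast
 have b: "\<bar>t\<bar> ^ m * cmod (nth_derivative n f t) \<le> C * h ^ (m + n) * fact m powr s * fact n powr \<sigma>" for m n t
  using b'[rule_format, of t m n] by (simp add: norm_mult norm_power)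
 define C' where "C' = C * (1 + h\<^sup>2 * 2 powr s)"
 have "cmod (nth_derivative n f t) \<le> C' * h ^ n * fact n powr \<sigma> * inverse (1 + t\<^sup>2)" for n t
 proof -
  have "(1 + t\<^sup>2) * cmod (nth_derivative n f t) = \<bar>t\<bar> ^ 0 * cmod (nth_derivative n f t) + \<bar>t\<bar> ^ 2 * cmod (nth_derivative n f t)"
   by (simp add: algebra_simps)
  also have "... \<le> C * h ^ (0 + n) * fact 0 powr s * fact n powr \<sigma> + C * h ^ (2 + n) * fact 2 powr s * fact n powr \<sigma>"
   by (intro add_mono b)
  also have "... = C' * h ^ n * fact n powr \<sigma>" by (simp add: C'_def algebra_simps power_add power2_eq_square)
  finally show ?thesis by (simp add: field_simps add_pos_nonneg)
 qed
 moreover have "C' > 0" unfolding C'_def using C by (intro mult_pos_pos add_pos_nonneg) auto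
 ultimately show ?thesis using that C by blast
qed

text \<open>Integration by parts on the whole line: the derivative of
  \<open>f t * cis (k * t)\<close> has integral 0 because the boundary values vanish.\<close>

lemma fourier_deriv:
 assumes der: "\<And>t. (f has_vector_derivative f' t) (at t)" and cont: "\<And>t. isCont f' t"
  and int: "integrable lborel f" "integrable lborel f'"
  and lim: "(f \<longlongrightarrow> 0) at_top" "(f \<longlongrightarrow> 0) at_bot"
 shows "fourier f' xi = 2 * pi * \<i> * xi * fourier f xi"
proof -
 define k where "k = - 2 * pi * xi"
 define F where "F t = f t * cis (k * t)" for t
 define F' where "F' t = f' t * cis (k * t) + f t * (\<i> * k * cis (k * t))" for t
 have dc: "((\<lambda>t. cis (k * t)) has_vector_derivative \<i> * k * cis (k * t)) (at t)" for t
  unfolding cis_conv_exp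
  by (auto intro!: derivative_eq_intros has_vector_derivative_real_field simp: algebra_simps)
 have dF: "(F has_vector_derivative F' t) (at t)" for t
  unfolding F_def F'_def using has_vector_derivative_mult[OF der dc] by (simp add: add.commute)
 have cf: "isCont f t" for t using der has_vector_derivative_continuous by blast
 have F'_eq: "F' = (\<lambda>t. f' t * cis (k * t) + \<i> * k * (f t * cis (k * t)))"
  unfolding F'_def by (simp only: mult.left_commute mult.assoc)
 have ints: "integrable lborel (\<lambda>t. f' t * cis (k * t))" "integrable lborel (\<lambda>t. \<i> * k * (f t * cis (k * t)))"
  by (rule integrable_mult_cis'[OF int(2)], rule integrable_mult_right, rule integrable_mult_cis'[OF int(1)])
 have intF: "integrable lborel F'"
  unfolding F'_eq by (rule Bochner_Integration.integrable_add[OF ints])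
 have lim': "(F \<longlongrightarrow> 0) at_top" "(F \<longlongrightarrow> 0) at_bot"
 proof -
  have "(\<lambda>t. norm (F t)) = (\<lambda>t. norm (f t))" by (simp add: F_def norm_mult)
  then show "(F \<longlongrightarrow> 0) at_top" "(F \<longlongrightarrow> 0) at_bot"
   using lim by (metis tendsto_norm_zero_iff)+
 qed
 have "(LBINT t=-\<infinity>..\<infinity>. F' t) = 0 - 0"
 proof (rule interval_integral_FTC_integrable)
  show "((F \<circ> real_of_ereal) \<longlongrightarrow> 0) (at_right (-\<infinity>))"
   using lim'(2) by (simp add: ereal_tendsto_simps)
  show "((F \<circ> real_of_ereal) \<longlongrightarrow> 0) (at_left \<infinity>)"
   using lim'(1) by (simp add: ereal_tendsto_simps)
  show "isCont F' t" for t
   unfolding F'_def using has_vector_derivative_continuous[OF dc] cf cont by (intro continuous_intros)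
  show "set_integrable lborel (einterval (- \<infinity>) \<infinity>) F'" using intF by (simp add: set_integrable_def)
 qed (use dF in auto)
 then have "(LINT t|lborel. F' t) = 0" by (simp add: interval_lebesgue_integral_def set_lebesgue_integral_def)
 moreover have "(LINT t|lborel. F' t) = fourier f' xi + \<i> * k * fourier f xi"
  unfolding F'_eq Bochner_Integration.integral_add[OF ints] by (simp add: fourier_def k_def)
 ultimately show ?thesis by (simp add: k_def)
qed

lemma tendsto_zero_inverse_1_plus_square:
 fixes f :: "real \<Rightarrow> complex"
 assumes "\<And>t. cmod (f t) \<le> K * inverse (1 + t\<^sup>2)"
 shows "(f \<longlongrightarrow> 0) at_top" "(f \<longlongrightarrow> 0) at_bot"
proof -
 have *: "((\<lambda>t::real. inverse (1 + t\<^sup>2)) \<longlongrightarrow> 0) at_top" "((\<lambda>t::real. inverse (1 + t\<^sup>2)) \<longlongrightarrow> 0) at_bot"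
  by real_asymp+
 show "(f \<longlongrightarrow> 0) at_top"
  by (rule Lim_null_comparison[OF always_eventually tendsto_mult_right_zero[OF *(1), of K]]) (intro allI assms)
 show "(f \<longlongrightarrow> 0) at_bot"
  by (rule Lim_null_comparison[OF always_eventually tendsto_mult_right_zero[OF *(2), of K]]) (intro allI assms)
qed

lemma gelfand_shilov_integrable:
 assumes "f \<in> gelfand_shilov s \<sigma>"
 shows "integrable lborel (nth_derivative n f)"
proof -
 have sm: "smooth f" using assms by (simp add: gelfand_shilov_def)
 obtain C h where b: "\<And>n t. cmod (nth_derivative n f t) \<le> C * h ^ n * fact n powr \<sigma> * inverse (1 + t\<^sup>2)"
  using gelfand_shilov_bound[OF assms] by metis
 show ?thesis
 proof (rule Bochner_Integration.integrable_bound[OF integrable_mult_right[OF integrable_inverse_1_plus_square]])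
  have "continuous_on UNIV (nth_derivative n f)"
   using isCont_nth_derivative[OF sm] by (simp add: continuous_on_eq_continuous_at)
  then show "nth_derivative n f \<in> borel_measurable lborel"
   by (simp add: borel_measurable_continuous_onI)
  show "AE t in lborel. norm (nth_derivative n f t) \<le> norm (C * h ^ n * fact n powr \<sigma> * inverse (1 + t\<^sup>2))"
   using b order.trans[OF b abs_ge_self] by auto
 qed
qed

text \<open>Under the transform a derivative of order \<open>m\<close> becomes a factor of modulus
  \<open>(2 * pi * \<bar>xi\<bar>) ^ m\<close>, so the exponent that measured regularity now
  measures decay.\<close>

lemma gelfand_shilov_fourier_decay:
 assumes f: "f \<in> gelfand_shilov s \<sigma>"
 obtains C h where "h > 0" "\<And>m xi. \<bar>xi\<bar> ^ m * cmod (fourier f xi) \<le> C * h ^ m * fact m powr \<sigma>"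
proof -
 have sm: "smooth f" using f by (simp add: gelfand_shilov_def)
 obtain C h where C: "C > 0" "h > 0" and b: "\<And>n t. cmod (nth_derivative n f t) \<le> C * h ^ n * fact n powr \<sigma> * inverse (1 + t\<^sup>2)"
  using gelfand_shilov_bound[OF f] by metis
 have F: "fourier (nth_derivative n f) xi = (2 * pi * \<i> * xi) ^ n * fourier f xi" for n xi
 proof (induction n)
  case 0
  show ?case by (simp add: nth_derivative_def)
 next
  case (Suc n)
  have "fourier (nth_derivative (Suc n) f) xi = 2 * pi * \<i> * xi * fourier (nth_derivative n f) xi"
   by (rule fourier_deriv nth_derivative_has_vector_derivative isCont_nth_derivative sm
     gelfand_shilov_integrable[OF f] tendsto_zero_inverse_1_plus_square b)+
  with Suc show ?case by simp
 qed
 define I where "I = (LINT t|lborel. inverse (1 + (t::real)\<^sup>2))"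
 have "\<bar>xi\<bar> ^ m * cmod (fourier f xi) \<le> (C * I) * (h / (2 * pi)) ^ m * fact m powr \<sigma>" for m xi
 proof -
  have "(2 * pi * \<bar>xi\<bar>) ^ m * cmod (fourier f xi) = cmod (fourier (nth_derivative m f) xi)"
   unfolding F by (simp add: norm_mult norm_power)
  also have "... \<le> (LINT t|lborel. cmod (nth_derivative m f t * cis (- 2 * pi * xi * t)))"
   unfolding fourier_def by (rule integral_norm_bound)
  also have "... = (LINT t|lborel. cmod (nth_derivative m f t))" by (simp add: norm_mult)
  also have "... \<le> (LINT t|lborel. C * h ^ m * fact m powr \<sigma> * inverse (1 + t\<^sup>2))"
   by (intro integral_mono integrable_norm gelfand_shilov_integrable[OF f]
     integrable_mult_right integrable_inverse_1_plus_square b)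
  also have "... = C * I * h ^ m * fact m powr \<sigma>" by (simp add: I_def)
  finally show ?thesis by (simp add: power_mult_distrib power_divide field_simps)
 qed
 then show ?thesis using that[of "h / (2 * pi)" "C * I"] C by auto
qed

text \<open>Points with the same first coordinate are collected into one trigonometric polynomial
  with frequencies \<open>2 * pi * w\<close>. Vanishing coefficients are discarded beforehand, so
  that every polynomial that occurs is nonzero.\<close>

lemma gabor_fast_decay:
 fixes f :: "real \<Rightarrow> complex" and \<Lambda> :: "(real \<times> real) set"
 assumes \<Lambda>: "finite \<Lambda>" "z0 \<in> \<Lambda>" "d z0 \<noteq> 0"
  and rel: "\<And>t. (\<Sum>z\<in>\<Lambda>. d z * (cis (2 * pi * snd z * t) * f (t - fst z))) = 0"
  and cont: "continuous_on UNIV f"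
  and dec: "\<And>m t. \<bar>t\<bar> ^ m * cmod (f t) \<le> C * h ^ m * fact m powr s"
  and s: "0 < s" "s < 1" and h: "h > 0"
 shows "f t = 0"
proof -
 define L where "L = {z\<in>\<Lambda>. d z \<noteq> 0}"
 have L: "finite L" using \<Lambda> by (simp add: L_def)
 define W where "W x = {w. (x, w) \<in> L}" for x
 define B where "B x = (\<lambda>w. 2 * pi * w) ` W x" for x
 define c where "c x b = d (x, b / (2 * pi))" for x b
 have W: "finite (W x)" for x
 proof -
  have "W x \<subseteq> snd ` L" by (force simp: W_def)
  then show ?thesis using L finite_subset by blast
 qed
 have tp: "trig_poly (c x) (B x) t = (\<Sum>w\<in>W x. d (x, w) * cis (2 * pi * w * t))" for x t
  unfolding trig_poly_def B_def c_def by (subst sum.reindex) (auto simp: inj_on_def)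
 have LS: "L = Sigma (fst ` L) W" by (force simp: W_def)
 show ?thesis
 proof (rule fast_decay_independent[where X = "fst ` L" and B = B and c = c])
  show "finite (fst ` L)" using L by simp
  have "fst z0 \<in> fst ` L" using \<Lambda> by (simp add: L_def)
  then show "fst ` L \<noteq> {}" by blast
  show "finite (B x) \<and> B x \<noteq> {} \<and> (\<forall>b\<in>B x. c x b \<noteq> 0)" if "x \<in> fst ` L" for x
   using W[of x] that by (force simp: B_def W_def c_def L_def)
  fix t
  have "0 = (\<Sum>z\<in>L. d z * (cis (2 * pi * snd z * t) * f (t - fst z)))"
   using sum.mono_neutral_right[of \<Lambda> L "\<lambda>z. d z * (cis (2 * pi * snd z * t) * f (t - fst z))"] \<Lambda> rel[of t]
   by (auto simp: L_def)
  also have "... = (\<Sum>x\<in>fst ` L. \<Sum>w\<in>W x. d (x, w) * (cis (2 * pi * w * t) * f (t - x)))"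
   by (subst LS, subst sum.Sigma) (use L W in \<open>auto simp: case_prod_beta\<close>)
  also have "... = (\<Sum>x\<in>fst ` L. trig_poly (c x) (B x) t * f (t - x))"
   unfolding tp sum_distrib_right by (simp add: mult_ac)
  finally show "(\<Sum>x\<in>fst ` L. trig_poly (c x) (B x) t * f (t - x)) = 0" by simp
 qed (rule cont dec s h)+
qed

section \<open>Gabor systems below the critical exponents\<close>

lemma weyl_shift_cis:
 "weyl_shift z f t = cis (- pi * fst z * snd z) * (cis (2 * pi * snd z * t) * f (t - fst z))"
proof -
 have "exp (2 * pi * \<i> * snd z * (t - fst z / 2)) = cis (- pi * fst z * snd z + 2 * pi * snd z * t)"
  by (simp add: cis_conv_exp algebra_simps)
 also have "... = cis (- pi * fst z * snd z) * cis (2 * pi * snd z * t)" by (rule cis_mult[symmetric])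
 finally show ?thesis
  by (cases z) (simp add: weyl_shift_def mult.assoc)
qed

lemma AE_lebesgue_continuous_eq_0:
 fixes f :: "real \<Rightarrow> complex"
 assumes "AE t in lebesgue. f t = 0" "continuous_on UNIV f"
 shows "f t = 0"
proof (rule ccontr)
 assume "f t \<noteq> 0"
 moreover have "isCont f t" using assms by (simp add: continuous_on_eq_continuous_at)
 ultimately obtain e where e: "e > 0" "\<And>u. dist t u < e ==> f u \<noteq> 0"
  using continuous_at_avoid[of t f 0] by auto
 have "AE u in lebesgue. u \<notin> {t..t + e/2}"
  using assms(1) by eventually_elim (use e in \<open>force simp: dist_real_def\<close>)
 then have "{t..t + e/2} \<in> null_sets lebesgue"
  by (subst AE_iff_null_sets) auto
 then have "emeasure lebesgue {t..t + e/2} = 0" by auto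
 then show False using e by simp
qed

text \<open>Both cases use the same decay criterion: for \<open>s < 1\<close> it is applied to
  \<open>g\<close>, otherwise to the Fourier transform of \<open>g\<close>, whose vanishing forces
  \<open>g = 0\<close>.\<close>

theorem gelfand_shilov_independent:
 assumes g: "g \<in> gelfand_shilov s \<sigma>" and s: "s > 0" "\<sigma> > 0" and lt: "s < 1 \<or> \<sigma> < 1"
  and \<Lambda>: "finite \<Lambda>" and dep: "L2_lin_dependent (gabor_system g) \<Lambda>"
 shows "g = (\<lambda>t. 0)"
proof -
 have sm: "smooth g" using g by (simp add: gelfand_shilov_def)
 have cont: "continuous_on UNIV g"
  using isCont_nth_derivative[OF sm] by (metis continuous_at_imp_continuous_on funpow_0 nth_derivative_def)
 have int: "integrable lborel g"
  using gelfand_shilov_integrable[OF g, of 0] by (simp add: nth_derivative_def)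
 obtain c z0 where c: "z0 \<in> \<Lambda>" "c z0 \<noteq> 0" "AE t in lebesgue. (\<Sum>z\<in>\<Lambda>. c z * weyl_shift z g t) = 0"
  using dep unfolding L2_lin_dependent_def L2_zero_def gabor_system_def by blast
 define d where "d z = c z * cis (- pi * fst z * snd z)" for z
 have eq: "(\<Sum>z\<in>\<Lambda>. c z * weyl_shift z g t) = (\<Sum>z\<in>\<Lambda>. d z * (cis (2 * pi * snd z * t) * g (t - fst z)))" for t
  unfolding weyl_shift_cis d_def by (simp add: mult_ac)
 have rel: "(\<Sum>z\<in>\<Lambda>. d z * (cis (2 * pi * snd z * t) * g (t - fst z))) = 0" for t
 proof (rule AE_lebesgue_continuous_eq_0)
  show "AE t in lebesgue. (\<Sum>z\<in>\<Lambda>. d z * (cis (2 * pi * snd z * t) * g (t - fst z))) = 0"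
   using c(3) unfolding eq .
  show "continuous_on UNIV (\<lambda>t. \<Sum>z\<in>\<Lambda>. d z * (cis (2 * pi * snd z * t) * g (t - fst z)))"
   by (intro continuous_intros continuous_on_compose2[OF cont]) auto
 qed
 have d0: "d z0 \<noteq> 0" using c by (simp add: d_def)
 show ?thesis
 proof (cases "s < 1")
  case True
  obtain C h where C: "h > 0" and b: "\<forall>m n t. cmod (t ^ m * nth_derivative n g t) \<le> C * h ^ (m + n) * fact m powr s * fact n powr \<sigma>"
   using g unfolding gelfand_shilov_def by blast
  have dec: "\<bar>t\<bar> ^ m * cmod (g t) \<le> C * h ^ m * fact m powr s" for m t
   using b[rule_format, of t m 0] by (simp add: norm_mult norm_power nth_derivative_def)
  show ?thesis
   using gabor_fast_decay[OF \<Lambda> c(1) d0 rel cont dec s(1) True C] by blast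
 next
  case False
  with lt have \<sigma>: "\<sigma> < 1" by simp
  obtain C h where C: "h > 0" and dec: "\<And>m xi. \<bar>xi\<bar> ^ m * cmod (fourier g xi) \<le> C * h ^ m * fact m powr \<sigma>"
   using gelfand_shilov_fourier_decay[OF g] by metis
  \<comment> \<open>In phase space the Fourier transform is the rotation of
    \<open>(x, \<omega>)\<close> to \<open>(\<omega>, - x)\<close>. \<open>M\<close> is the rotated
    set, and \<open>e\<close> carries the old coefficients with the phases that the rotation
    creates.\<close>
  define e where "e z = d (- snd z, fst z) * cis (2 * pi * (- snd z) * fst z)" for z
  define M where "M = (\<lambda>z. (snd z, - fst z)) ` \<Lambda>"
  have intt: "integrable lborel (\<lambda>t. cis (2 * pi * w * t) * g (t - x))" for w x
  proof -
   have "integrable lborel (\<lambda>t. g (- x + 1 * t))"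
    using lborel_integrable_real_affine[OF int, of 1 "- x"] by simp
   from integrable_mult_cis'[OF this, of "2 * pi * w"] show ?thesis by (simp add: mult.commute)
  qed
  have Frel: "(\<Sum>z\<in>M. e z * (cis (2 * pi * snd z * xi) * fourier g (xi - fst z))) = 0" for xi
  proof -
   have "0 = fourier (\<lambda>t. \<Sum>z\<in>\<Lambda>. d z * (cis (2 * pi * snd z * t) * g (t - fst z))) xi"
    by (simp add: rel fourier_def)
   also have "... = (\<Sum>z\<in>\<Lambda>. d z * fourier (\<lambda>t. cis (2 * pi * snd z * t) * g (t - fst z)) xi)"
   proof -
    have "integrable lborel (\<lambda>t. d z * (cis (2 * pi * snd z * t) * g (t - fst z)) * cis (- 2 * pi * xi * t))" for z
     by (intro integrable_mult_cis' integrable_mult_right intt)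
    then show ?thesis
     unfolding fourier_def sum_distrib_right by (subst Bochner_Integration.integral_sum) (simp_all add: mult.assoc)
   qed
   also have "... = (\<Sum>z\<in>\<Lambda>. d z * (cis (2 * pi * (snd z - xi) * fst z) * fourier g (xi - snd z)))"
    by (simp only: fourier_shift)
   also have "... = (\<Sum>z\<in>M. e z * (cis (2 * pi * snd z * xi) * fourier g (xi - fst z)))"
    unfolding M_def
   proof (subst sum.reindex)
    show "inj_on (\<lambda>z. (snd z, - fst z)) \<Lambda>" by (auto simp: inj_on_def prod_eq_iff)
    have "cis (2 * pi * (snd z - xi) * fst z) = cis (2 * pi * fst z * snd z) * cis (2 * pi * (- fst z) * xi)" for z
     by (simp add: cis_mult algebra_simps)
    then show "(\<Sum>z\<in>\<Lambda>. d z * (cis (2 * pi * (snd z - xi) * fst z) * fourier g (xi - snd z))) =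
     sum ((\<lambda>z. e z * (cis (2 * pi * snd z * xi) * fourier g (xi - fst z))) \<circ> (\<lambda>z. (snd z, - fst z))) \<Lambda>"
     by (intro sum.cong refl) (simp add: e_def)
   qed
   finally show ?thesis by simp
  qed
  have F0: "fourier g xi = 0" for xi
  proof (rule gabor_fast_decay[OF _ _ _ Frel continuous_on_fourier[OF int] dec s(2) \<sigma> C])
   show "finite M" using \<Lambda> by (simp add: M_def)
   show "(snd z0, - fst z0) \<in> M" using c by (auto simp: M_def)
   show "e (snd z0, - fst z0) \<noteq> 0" using d0 by (simp add: e_def)
  qed
  have "AE t in lborel. g t = 0" by (rule fourier_vanish[OF int F0])
  then have "AE t in lebesgue. g t = 0" by (rule AE_completion)
  then show ?thesis using AE_lebesgue_continuous_eq_0[OF _ cont] by blast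
 qed
qed

section \<open>Relations supported on two lines\<close>

lemma borel_measurable_nn_integral_int:
 assumes "\<And>k::int. (\<lambda>t. f t k) \<in> borel_measurable M"
 shows "(\<lambda>t. \<integral>\<^sup>+k. f t k \<partial>count_space UNIV) \<in> borel_measurable M"
proof -
 have "(\<integral>\<^sup>+k. f t k \<partial>count_space UNIV) = (\<Sum>n. f t (from_nat_into UNIV n))" for t
  using nn_integral_bij_count_space[OF bij_betw_from_nat_into[OF countableI_type infinite_UNIV_int], of "f t"]
  by (simp add: nn_integral_count_space_nat)
 then show ?thesis using assms by simp
qed

lemma nn_integral_unfold_period:
 fixes u :: "real \<Rightarrow> ennreal" and a :: real
 assumes [measurable]: "u \<in> borel_measurable borel" and a: "a > 0"
 shows "(\<integral>\<^sup>+t. u t \<partial>lborel) = (\<integral>\<^sup>+t. (\<integral>\<^sup>+m. u (t + of_int m * a) \<partial>count_space (UNIV::int set)) * indicator {0..<a} t \<partial>lborel)"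
proof -
 define I where "I m = {of_int m * a ..< (of_int m + 1) * a}" for m :: int
 have part: "(\<integral>\<^sup>+m. indicator (I m) t \<partial>count_space UNIV) = (1::ennreal)" for t :: real
 proof -
  have "indicator (I m) t = (indicator {\<lfloor>t / a\<rfloor>} m :: ennreal)" for m
  proof -
   have "t \<in> I m \<longleftrightarrow> \<lfloor>t / a\<rfloor> = m"
    unfolding I_def using a by (simp add: floor_eq_iff field_simps)
   then show ?thesis by (auto simp: indicator_def)
  qed
  then show ?thesis by (simp add: one_ennreal_def[symmetric])
 qed
 have [measurable]: "I m \<in> sets borel" for m by (simp add: I_def)
 have "(\<integral>\<^sup>+t. u t \<partial>lborel) = (\<integral>\<^sup>+t. (\<integral>\<^sup>+m. u t * indicator (I m) t \<partial>count_space UNIV) \<partial>lborel)"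
  by (simp add: nn_integral_cmult part)
 also have "... = (\<integral>\<^sup>+m. (\<integral>\<^sup>+t. u t * indicator (I m) t \<partial>lborel) \<partial>count_space UNIV)"
  by (rule nn_integral_count_space_nn_integral) auto
 also have "... = (\<integral>\<^sup>+m. (\<integral>\<^sup>+t. u (t + of_int m * a) * indicator {0..<a} t \<partial>lborel) \<partial>count_space UNIV)"
 proof (rule nn_integral_cong)
  fix m :: int
  have "(\<integral>\<^sup>+t. u t * indicator (I m) t \<partial>lborel) = (\<integral>\<^sup>+t. u (of_int m * a + 1 * t) * indicator (I m) (of_int m * a + 1 * t) \<partial>lborel)"
   by (subst nn_integral_real_affine[of _ 1 "of_int m * a"]) auto
  also have "... = (\<integral>\<^sup>+t. u (t + of_int m * a) * indicator {0..<a} t \<partial>lborel)"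
   by (intro nn_integral_cong) (auto simp: I_def indicator_def algebra_simps)
  finally show "(\<integral>\<^sup>+t. u t * indicator (I m) t \<partial>lborel) = (\<integral>\<^sup>+t. u (t + of_int m * a) * indicator {0..<a} t \<partial>lborel)" .
 qed
 also have "... = (\<integral>\<^sup>+t. (\<integral>\<^sup>+m. u (t + of_int m * a) * indicator {0..<a} t \<partial>count_space UNIV) \<partial>lborel)"
  by (rule nn_integral_count_space_nn_integral[symmetric]) auto
 finally show ?thesis by (simp add: nn_integral_multc)
qed

lemma AE_lborel_shift:
 fixes P :: "real \<Rightarrow> bool"
 assumes "AE t in lborel. P t"
 shows "AE t in lborel. P (t + x)"
proof -
 obtain N where N: "{t. \<not> P t} \<subseteq> N" "emeasure lborel N = 0" "N \<in> sets lborel"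
  using assms by (auto elim: AE_E)
 have "emeasure lborel ((\<lambda>t. t - x) ` N) = 0"
 proof -
  have eq: "(\<lambda>t. t - x) ` N = (\<lambda>t. x + t) -` N" by (force simp: image_iff)
  have "emeasure lborel ((\<lambda>t. x + t) -` N) = emeasure (distr lborel borel ((+) x)) N"
   using N by (subst emeasure_distr) auto
  also have "... = 0" using N by (simp add: lborel_distr_plus)
  finally show ?thesis unfolding eq .
 qed
 moreover have "(\<lambda>t. t - x) ` N \<in> sets lborel"
 proof -
  have eq: "(\<lambda>t. t - x) ` N = (\<lambda>t. x + t) -` N \<inter> space lborel" by (force simp: image_iff)
  show ?thesis unfolding eq by (rule measurable_sets[of _ lborel borel]) (use N in auto)
 qed
 ultimately have "(\<lambda>t. t - x) ` N \<in> null_sets lborel" by auto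
 then show ?thesis
  by (rule AE_I') (use N(1) in \<open>force simp: image_iff\<close>)
qed

text \<open>The zero set lies in every sublevel set, so letting \<open>eps\<close> tend to 0 in the
  sublevel estimate makes it null on each unit interval.\<close>

lemma trig_poly_AE_nonzero:
 assumes "finite B" "B \<noteq> {}" "\<forall>b\<in>B. c b \<noteq> 0"
 shows "AE t in lborel. trig_poly c B t \<noteq> 0"
proof -
 obtain C alp where C: "C \<ge> 1" "alp > 0" and meas: "\<And>a v eps. eps > 0 ==>
   measure lborel {t\<in>{a..a+1}. cmod (trig_poly c B (t + v)) < eps} \<le> C * eps powr alp"
  using trig_poly_sublevel[OF assms] by metis
 define N where "N k = {t\<in>{of_int k..of_int k + 1}. trig_poly c B t = 0}" for k :: int
 have Nm: "N k \<in> sets lborel" for k unfolding N_def by measurable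
 have "N k \<in> null_sets lborel" for k
 proof -
  have fin: "N k \<in> fmeasurable lborel"
   by (rule fmeasurableI2[of "{of_int k..of_int k+1}"]) (use Nm in \<open>auto simp: N_def\<close>)
  have le: "measure lborel (N k) \<le> C * eps powr alp" if "eps > 0" for eps
  proof -
   have "measure lborel (N k) \<le> measure lborel {t\<in>{of_int k..of_int k+1}. cmod (trig_poly c B (t + 0)) < eps}"
   proof (rule measure_mono_fmeasurable)
    show "{t\<in>{of_int k..of_int k+1}. cmod (trig_poly c B (t + 0)) < eps} \<in> fmeasurable lborel"
     by (rule fmeasurableI2[of "{of_int k..of_int k+1}"]) auto
   qed (use Nm that in \<open>auto simp: N_def\<close>)
   then show ?thesis using meas[OF that, of "of_int k" 0] by linarith
  qed
  have "((\<lambda>eps. C * eps powr alp) \<longlongrightarrow> C * 0) (at_right 0)"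
  proof (intro tendsto_intros)
   show "((\<lambda>eps::real. eps powr alp) \<longlongrightarrow> 0) (at_right 0)"
    using C by real_asymp
  qed
  then have "measure lborel (N k) \<le> C * 0"
   by (rule tendsto_lowerbound) (auto simp: eventually_at_right_less eventually_mono[OF eventually_at_right_less[of 0] le])
  then have "measure lborel (N k) = 0" by (simp add: measure_le_0_iff)
  then show ?thesis using fin Nm by (auto simp: fmeasurable_def emeasure_eq_ennreal_measure null_sets_def)
 qed
 then have "(\<Union>k. N k) \<in> null_sets lborel" by (intro null_sets_UN) auto
 then show ?thesis
 proof (rule AE_I')
  show "{t \<in> space lborel. \<not> trig_poly c B t \<noteq> 0} \<subseteq> (\<Union>k. N k)"
  proof
   fix t assume "t \<in> {t \<in> space lborel. \<not> trig_poly c B t \<noteq> 0}"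
   then have "t \<in> N \<lfloor>t\<rfloor>" by (auto simp: N_def)
   then show "t \<in> (\<Union>k. N k)" by blast
  qed
 qed
qed

text \<open>The shares \<open>r(t + kb)\<close>, \<open>k \<in> \<int>\<close>, of the mass of \<open>g\<close> on a coset of \<open>b\<int>\<close> add up to at most one,
 whereas the functional equation makes \<open>r\<close> periodic with period \<open>a\<close>: infinitely many shifts of \<open>r\<close>
 have the same integral over a period.\<close>

lemma two_lines_zero:
 fixes g :: "real \<Rightarrow> complex"
 assumes gm [measurable]: "g \<in> borel_measurable borel"
  and fin: "(\<integral>\<^sup>+t. (cmod (g t))\<^sup>2 \<partial>lborel) < \<infinity>"
  and pm [measurable]: "p \<in> borel_measurable borel"
  and p: "AE t in lborel. 0 < p t" and per: "\<And>t k. p (t + of_int k * b) = (p t :: real)"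
  and ab: "a > 0" "b > 0"
  and rel: "AE t in lborel. (cmod (g (t + a)))\<^sup>2 = p t * (cmod (g t))\<^sup>2"
 shows "AE t in lborel. g t = 0"
proof -
 define v where "v t = ennreal ((cmod (g t))\<^sup>2)" for t
 define h where "h t = (\<integral>\<^sup>+k. v (t + of_int k * b) \<partial>count_space (UNIV::int set))" for t
 have [measurable]: "v \<in> borel_measurable borel" unfolding v_def by measurable
 have [measurable]: "h \<in> borel_measurable borel" unfolding h_def
  by (rule borel_measurable_nn_integral_int) simp
 \<comment> \<open>Where \<open>h t\<close> is 0, so is \<open>v t\<close>, and
   \<open>0 / 0 = 0\<close> in \<open>ennreal\<close>; where \<open>h t\<close> is infinite the
   quotient is 0 as well. Thus the shares add up to at most 1 at every point, with no exceptional
   set.\<close>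
 define r where "r t = v t / h t" for t
 have [measurable]: "r \<in> borel_measurable borel" unfolding r_def by measurable
 have hper: "h (t + of_int m * b) = h t" for t m
 proof -
  have "h (t + of_int m * b) = (\<integral>\<^sup>+k. v (t + of_int (m + k) * b) \<partial>count_space (UNIV::int set))"
   unfolding h_def by (simp add: algebra_simps)
  also have "... = h t" unfolding h_def
   by (rule nn_integral_bij_count_space) (rule bij_betwI[of _ _ _ "\<lambda>k. k - m"], auto)
  finally show ?thesis .
 qed
 have hfin: "AE t in lborel. h t < \<infinity>"
 proof -
  have "(\<integral>\<^sup>+t. h t * indicator {0..<b} t \<partial>lborel) < \<infinity>"
   using fin nn_integral_unfold_period[of v b] ab unfolding v_def[symmetric] h_def[symmetric] by simp
  then have "AE t in lborel. h t * indicator {0..<b} t \<noteq> \<infinity>"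
   by (intro nn_integral_PInf_AE) auto
  then have "AE t in lborel. \<forall>m::int. h (t + of_int m * b) * indicator {0..<b} (t + of_int m * b) \<noteq> \<infinity>"
   by (subst AE_all_countable) (intro allI AE_lborel_shift)
  then show ?thesis
  proof eventually_elim
   case (elim t)
   define m where "m = - \<lfloor>t / b\<rfloor>"
   have "t + of_int m * b \<in> {0..<b}"
    using floor_divide_lower[OF ab(2), of t] floor_divide_upper[OF ab(2), of t] by (simp add: m_def algebra_simps)
   then show ?case using elim[rule_format, of m] by (simp add: hper top.not_eq_extremum)
  qed
 qed
 have relv: "AE t in lborel. v (t + a) = ennreal (p t) * v t"
  using rel p by eventually_elim (simp add: v_def ennreal_mult)
 have "AE t in lborel. \<forall>k::int. v (t + of_int k * b + a) = ennreal (p (t + of_int k * b)) * v (t + of_int k * b)"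
  by (subst AE_all_countable) (intro allI AE_lborel_shift[OF relv, of "of_int _ * b"])
 then have hrel: "AE t in lborel. h (t + a) = ennreal (p t) * h t"
 proof eventually_elim
  case (elim t)
  have "h (t + a) = (\<integral>\<^sup>+k. v (t + of_int k * b + a) \<partial>count_space (UNIV::int set))"
   unfolding h_def by (simp add: add_ac)
  also have "... = (\<integral>\<^sup>+k. ennreal (p t) * v (t + of_int k * b) \<partial>count_space (UNIV::int set))"
   using elim by (simp add: per)
  finally show ?case by (simp add: nn_integral_cmult h_def)
 qed
 have rper: "AE t in lborel. r (t + a) = r t"
  using relv hrel p
 proof eventually_elim
  case (elim t)
  have "ennreal (p t) \<noteq> 0" "ennreal (p t) \<noteq> \<infinity>" using elim by auto
  then show ?case unfolding r_def elim(1,2) by (simp add: mult.commute[of "ennreal (p t)"] divide_mult_eq)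
 qed
 have rsum: "(\<integral>\<^sup>+k. r (t + of_int k * b) \<partial>count_space (UNIV::int set)) \<le> 1" for t
 proof -
  have "(\<integral>\<^sup>+k. r (t + of_int k * b) \<partial>count_space (UNIV::int set)) = (\<integral>\<^sup>+k. v (t + of_int k * b) / h t \<partial>count_space (UNIV::int set))"
   unfolding r_def hper by simp
  also have "... = h t / h t" unfolding h_def[of t] by (simp add: nn_integral_divide)
  also have "... \<le> 1" by (cases "h t = 0 \<or> h t = \<infinity>") (auto simp: ennreal_divide_self top.not_eq_extremum)
  finally show ?thesis .
 qed
 \<comment> \<open>the integral of \<open>r\<close> over an interval of length \<open>a\<close> does not depend on the interval\<close>
 have rperm: "AE t in lborel. \<forall>m::int. r (t + of_int m * a) = r t"
 proof -
  have s: "AE t in lborel. \<forall>m::int. r (t + of_int m * a + a) = r (t + of_int m * a)"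
   by (subst AE_all_countable) (intro allI AE_lborel_shift[OF rper, of "of_int _ * a"])
  then show ?thesis
  proof eventually_elim
   case (elim t)
   have "r (t + of_int (m + 1) * a) = r (t + of_int m * a)" for m :: int
    using elim[rule_format, of m] by (simp add: algebra_simps)
   note step = this
   have "r (t + of_int m * a) = r (t + of_int 0 * a)" for m :: int
   proof (induction m rule: int_induct[of _ 0])
    case base
    show ?case by simp
   next
    case (step1 i)
    then show ?case using step[of i] by simp
   next
    case (step2 i)
    then show ?case using step[of "i - 1"] by simp
   qed
   then show ?case by simp
  qed
 qed
 define R where "R = (\<integral>\<^sup>+t. r t * indicator {0..<a} t \<partial>lborel)"
 have Rshift: "(\<integral>\<^sup>+t. r (t + x) * indicator {0..<a} t \<partial>lborel) = R" for x
 proof -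
  have "(\<integral>\<^sup>+t. r (t + x) * indicator {0..<a} t \<partial>lborel) = (\<integral>\<^sup>+t. r t * indicator {x..<x+a} t \<partial>lborel)"
   by (subst nn_integral_real_affine[of "\<lambda>t. r t * indicator {x..<x+a} t" 1 x])
    (auto intro!: nn_integral_cong simp: indicator_def add_ac)
  also have "... = (\<integral>\<^sup>+t. (\<integral>\<^sup>+m. r (t + of_int m * a) * indicator {x..<x+a} (t + of_int m * a) \<partial>count_space (UNIV::int set)) * indicator {0..<a} t \<partial>lborel)"
   by (rule nn_integral_unfold_period) (use ab in auto)
  also have "... = (\<integral>\<^sup>+t. r t * indicator {0..<a} t \<partial>lborel)"
  proof (intro nn_integral_cong_AE)
   show "AE t in lborel. (\<integral>\<^sup>+m. r (t + of_int m * a) * indicator {x..<x+a} (t + of_int m * a) \<partial>count_space (UNIV::int set)) * indicator {0..<a} t = r t * indicator {0..<a} t"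
    using rperm
   proof eventually_elim
    case (elim t)
    \<comment> \<open>Exactly one translate of \<open>t\<close> by a multiple of \<open>a\<close>
      falls into a half-open interval of length \<open>a\<close>; this is its index.\<close>
    define m0 where "m0 = \<lceil>(x - t) / a\<rceil>"
    have ind: "indicator {x..<x+a} (t + of_int m * a) = (indicator {m0} m :: ennreal)" for m :: int
    proof -
     have "t + of_int m * a \<in> {x..<x+a} \<longleftrightarrow> \<lceil>(x - t) / a\<rceil> = m"
      using ab by (simp add: ceiling_eq_iff field_simps) linarith
     then show ?thesis by (auto simp: indicator_def m0_def)
    qed
    show ?case using elim unfolding ind by (simp add: nn_integral_cmult)
   qed
  qed
  finally show ?thesis by (simp add: R_def)
 qed
 have "R = 0"
 proof (rule ccontr)
  assume "R \<noteq> 0"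
  have "(\<integral>\<^sup>+k. R \<partial>count_space (UNIV::int set)) = (\<integral>\<^sup>+k. (\<integral>\<^sup>+t. r (t + of_int k * b) * indicator {0..<a} t \<partial>lborel) \<partial>count_space (UNIV::int set))"
   by (simp only: Rshift)
  also have "... = (\<integral>\<^sup>+t. (\<integral>\<^sup>+k. r (t + of_int k * b) * indicator {0..<a} t \<partial>count_space (UNIV::int set)) \<partial>lborel)"
   by (rule nn_integral_count_space_nn_integral[symmetric]) auto
  also have "... \<le> (\<integral>\<^sup>+t. indicator {0..<a} t \<partial>lborel)"
   using rsum by (intro nn_integral_mono) (auto simp: nn_integral_multc indicator_def)
  also have "... = ennreal a" using ab by simp
  finally have "R * emeasure (count_space (UNIV::int set)) UNIV \<le> ennreal a" by simp
  then show False using \<open>R \<noteq> 0\<close> by (simp add: infinite_UNIV_int ennreal_mult_top top_unique)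
 qed
 then have "AE t in lborel. r t * indicator {0..<a} t = 0"
  unfolding R_def by (subst (asm) nn_integral_0_iff_AE) auto
 then have "AE t in lborel. \<forall>m::int. r (t + of_int m * a) * indicator {0..<a} (t + of_int m * a) = 0"
  by (subst AE_all_countable) (intro allI AE_lborel_shift)
 with rperm hfin show ?thesis
 proof eventually_elim
  case (elim t)
  define m where "m = - \<lfloor>t / a\<rfloor>"
  have "t + of_int m * a \<in> {0..<a}"
   using floor_divide_lower[OF ab(1), of t] floor_divide_upper[OF ab(1), of t] by (simp add: m_def algebra_simps)
  then have "r t = 0" using elim(1)[rule_format, of m] elim(3)[rule_format, of m] by simp
  \<comment> \<open>Finiteness of \<open>h\<close> enters here: a zero share of an infinite total
    would say nothing about \<open>v t\<close>.\<close>
  then have "v t = 0" using elim(2) unfolding r_def by auto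
  then show ?case by (simp add: v_def ennreal_eq_0_iff)
 qed
qed

section \<open>The Fourier transform of square integrable functions\<close>

definition L12 :: "(real \<Rightarrow> complex) \<Rightarrow> bool" where
 "L12 u \<longleftrightarrow> integrable lborel u \<and> integrable lborel (\<lambda>t. (cmod (u t))\<^sup>2)"

text \<open>The squared norm of the Hilbert space, with values in \<open>ennreal\<close> so that
  inequalities can be stated before finiteness is known.\<close>

definition sqn :: "(real \<Rightarrow> complex) \<Rightarrow> ennreal" where
 "sqn f = (\<integral>\<^sup>+t. (cmod (f t))\<^sup>2 \<partial>lborel)"

lemma sqn_add_le:
 assumes [measurable]: "f \<in> borel_measurable borel" "g \<in> borel_measurable borel"
 shows "sqn (\<lambda>t. f t + g t) \<le> 2 * (sqn f + sqn g)"
proof -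
 have "(cmod (f t + g t))\<^sup>2 \<le> 2 * ((cmod (f t))\<^sup>2 + (cmod (g t))\<^sup>2)" for t
 proof -
  have "(cmod (f t + g t))\<^sup>2 \<le> (cmod (f t) + cmod (g t))\<^sup>2" by (intro power_mono norm_triangle_ineq) auto
  also have "... \<le> 2 * ((cmod (f t))\<^sup>2 + (cmod (g t))\<^sup>2)"
   using sum_squares_bound[of "cmod (f t)" "cmod (g t)"] by (simp add: power2_sum)
  finally show ?thesis .
 qed
 then have "ennreal ((cmod (f t + g t))\<^sup>2) \<le> 2 * (ennreal ((cmod (f t))\<^sup>2) + ennreal ((cmod (g t))\<^sup>2))" for t
  by (rule order.trans[OF ennreal_leI]) (simp add: ennreal_mult ennreal_plus)
 then have "sqn (\<lambda>t. f t + g t) \<le> (\<integral>\<^sup>+t. 2 * (ennreal ((cmod (f t))\<^sup>2) + ennreal ((cmod (g t))\<^sup>2)) \<partial>lborel)"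
  unfolding sqn_def by (rule nn_integral_mono)
 also have "... = 2 * (sqn f + sqn g)"
  unfolding sqn_def by (simp add: nn_integral_cmult nn_integral_add)
 finally show ?thesis .
qed

lemma sqn_mult:
 assumes [measurable]: "f \<in> borel_measurable borel"
 shows "sqn (\<lambda>t. c * f t) = ennreal ((cmod c)\<^sup>2) * sqn f"
 unfolding sqn_def by (simp add: norm_mult power_mult_distrib ennreal_mult nn_integral_cmult)

lemma sqn_shift:
 assumes [measurable]: "f \<in> borel_measurable borel"
 shows "sqn (\<lambda>t. cis (a * t + b) * f (t - x)) = sqn f"
 unfolding sqn_def by (subst nn_integral_real_affine[of _ 1 "x"]) (simp_all add: norm_mult)

lemma sqn_eq_0_iff:
 assumes [measurable]: "f \<in> borel_measurable borel"
 shows "sqn f = 0 \<longleftrightarrow> (AE t in lborel. f t = 0)"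
 unfolding sqn_def by (subst nn_integral_0_iff_AE) (auto simp: ennreal_eq_0_iff)

lemma borel_measurable_fourier [measurable]:
 "integrable lborel f ==> fourier f \<in> borel_measurable borel"
 by (intro borel_measurable_continuous_onI continuous_on_fourier)

lemma borel_measurable_cnj [measurable]:
 assumes "f \<in> borel_measurable M"
 shows "(\<lambda>x. cnj (f x)) \<in> borel_measurable M"
 by (rule measurable_compose[OF assms borel_measurable_continuous_onI]) (intro continuous_intros)

text \<open>Both claims come from the normal distribution: \<open>s\<close> is the standard
  deviation whose density is proportional to \<open>exp (- a * t\<^sup>2)\<close>, and rescaling by
  it yields the known characteristic function.\<close>

lemma gaussian_fourier:
 assumes "a > 0"
 shows "integrable lborel (\<lambda>t::real. exp (- a * t\<^sup>2))"
  "(LINT t|lborel. complex_of_real (exp (- a * t\<^sup>2)) * cis (w * t)) = complex_of_real (sqrt (pi / a) * exp (- w\<^sup>2 / (4 * a)))"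
proof -
 define s where "s = 1 / sqrt (2 * a)"
 have s: "s > 0" "s\<^sup>2 = 1 / (2 * a)" using assms by (simp_all add: s_def power_divide)
 have dens: "normal_density 0 s t = sqrt (a / pi) * exp (- a * t\<^sup>2)" for t
 proof -
  have "1 / sqrt (2 * pi * s\<^sup>2) = sqrt (a / pi)"
   unfolding s(2) using assms by (simp add: real_sqrt_divide)
  moreover have "- (t - 0)\<^sup>2 / (2 * s\<^sup>2) = - a * t\<^sup>2" unfolding s(2) using assms by simp
  ultimately show ?thesis unfolding normal_density_def by simp
 qed
 have i: "integrable lborel (\<lambda>t. sqrt (a / pi) * exp (- a * t\<^sup>2))"
  using integrable_normal_density[OF s(1), of 0] unfolding dens .
 show "integrable lborel (\<lambda>t::real. exp (- a * t\<^sup>2))"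
  using i assms by simp
 define X where "X = (LINT t|lborel. complex_of_real (exp (- a * t\<^sup>2)) * cis (w * t))"
 have "char std_normal_distribution (s * w) = (LINT t|lborel. std_normal_density t *\<^sub>R iexp (s * w * t))"
  unfolding char_def by (subst integral_density) auto
 also have "... = \<bar>1 / s\<bar> *\<^sub>R (LINT t|lborel. std_normal_density (0 + (1 / s) * t) *\<^sub>R iexp (s * w * (0 + (1 / s) * t)))"
  by (rule lborel_integral_real_affine) (use s in simp)
 also have "... = (LINT t|lborel. \<bar>1 / s\<bar> *\<^sub>R (std_normal_density (0 + (1 / s) * t) *\<^sub>R iexp (s * w * (0 + (1 / s) * t))))"
  by (rule integral_scaleR_right[symmetric])
 also have "... = (LINT t|lborel. complex_of_real (sqrt (a / pi)) * (complex_of_real (exp (- a * t\<^sup>2)) * cis (w * t)))"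
 proof (intro Bochner_Integration.integral_cong refl)
  fix t
  have "\<bar>1 / s\<bar> * std_normal_density ((1 / s) * t) = normal_density 0 s t"
  proof -
   have "sqrt (2 * pi * s\<^sup>2) = sqrt (2 * pi) * s" using s(1) by (simp add: real_sqrt_mult)
   then show ?thesis unfolding normal_density_def using s(1)
    by (simp add: power_divide power_mult_distrib mult.commute)
  qed
  then have "\<bar>1 / s\<bar> * std_normal_density (0 + (1 / s) * t) = sqrt (a / pi) * exp (- a * t\<^sup>2)" by (simp add: dens)
  moreover have "iexp (s * w * (0 + (1 / s) * t)) = cis (w * t)" using s(1) by (simp add: cis_conv_exp)
  ultimately show "\<bar>1 / s\<bar> *\<^sub>R (std_normal_density (0 + (1 / s) * t) *\<^sub>R iexp (s * w * (0 + (1 / s) * t)))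
    = complex_of_real (sqrt (a / pi)) * (complex_of_real (exp (- a * t\<^sup>2)) * cis (w * t))"
   by (simp only: scaleR_scaleR) (simp only: scaleR_conv_of_real of_real_mult mult.assoc)
 qed
 also have "... = complex_of_real (sqrt (a / pi)) * X" unfolding X_def by (rule integral_mult_right_zero)
 finally have "complex_of_real (sqrt (a / pi)) * X = complex_of_real (exp (- ((s * w)\<^sup>2) / 2))"
  unfolding char_std_normal_distribution by simp
 also have "(s * w)\<^sup>2 / 2 = w\<^sup>2 / (4 * a)" using s(2) by (simp add: power_mult_distrib)
 then have "- ((s * w)\<^sup>2) / 2 = - w\<^sup>2 / (4 * a)" by simp
 finally have eq: "complex_of_real (sqrt (a / pi)) * X = complex_of_real (exp (- w\<^sup>2 / (4 * a)))" .
 have "sqrt (pi / a) * sqrt (a / pi) = 1" using assms by (simp flip: real_sqrt_mult)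
 then have one: "complex_of_real (sqrt (pi / a)) * complex_of_real (sqrt (a / pi)) = 1"
  by (simp only: flip: of_real_mult) simp
 have "X = complex_of_real (sqrt (pi / a)) * (complex_of_real (sqrt (a / pi)) * X)"
  by (simp only: mult.assoc[symmetric] one mult_1)
 then have "X = complex_of_real (sqrt (pi / a)) * complex_of_real (exp (- w\<^sup>2 / (4 * a)))" unfolding eq .
 then show "(LINT t|lborel. complex_of_real (exp (- a * t\<^sup>2)) * cis (w * t)) = complex_of_real (sqrt (pi / a) * exp (- w\<^sup>2 / (4 * a)))"
  unfolding X_def of_real_mult .
qed

lemma norm_integral_le_nn_integral:
 fixes f :: "'a \<Rightarrow> complex"
 shows "ennreal (cmod (integral\<^sup>L M f)) \<le> (\<integral>\<^sup>+x. cmod (f x) \<partial>M)"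
 by (cases "integrable M f") (auto simp: integral_norm_bound_ennreal not_integrable_integral_eq)

text \<open>Fubini's theorem for the kernel \<open>f t * cis (- 2 * pi * xi * t) * u xi\<close>,
  which is integrable on the plane because \<open>cis\<close> has modulus 1.\<close>

lemma fourier_multiplication:
 assumes f: "integrable lborel f" and u: "integrable lborel u"
 shows "(LINT xi|lborel. fourier f xi * u xi) = (LINT t|lborel. f t * fourier u t)"
proof -
 have [measurable]: "f \<in> borel_measurable borel" "u \<in> borel_measurable borel" using f u by auto
 have "(\<lambda>p::real \<times> real. cis (- 2 * pi * fst p * snd p)) \<in> borel_measurable borel"
  by (intro borel_measurable_continuous_onI continuous_intros)
 then have [measurable]: "(\<lambda>p::real \<times> real. cis (- 2 * pi * fst p * snd p)) \<in> borel_measurable (borel \<Otimes>\<^sub>M borel)"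
  by (simp only: borel_prod)
 define H where "H t xi = f t * cis (- 2 * pi * xi * t) * u xi" for t xi
 have m: "(\<lambda>(t, xi). H t xi) \<in> borel_measurable (lborel \<Otimes>\<^sub>M lborel)"
 proof -
  have "(\<lambda>(t, xi). H t xi) = (\<lambda>p. f (fst p) * (\<lambda>p::real \<times> real. cis (- 2 * pi * fst p * snd p)) p * u (snd p))"
   unfolding H_def by (auto simp: fun_eq_iff mult_ac)
  also have "... \<in> borel_measurable (borel \<Otimes>\<^sub>M borel)" by measurable
  finally show ?thesis by simp
 qed
 have int: "integrable (lborel \<Otimes>\<^sub>M lborel) (\<lambda>(t, xi). H t xi)"
 proof (rule lborel_pair.Fubini_integrable[OF m])
  have "(\<lambda>t. LINT xi|lborel. norm ((\<lambda>(t, xi). H t xi) (t, xi))) = (\<lambda>t. cmod (f t) * (LINT xi|lborel. cmod (u xi)))"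
   by (simp add: H_def norm_mult)
  then show "integrable lborel (\<lambda>t. LINT xi|lborel. norm ((\<lambda>(t, xi). H t xi) (t, xi)))"
   using f by simp
  show "AE t in lborel. integrable lborel (\<lambda>xi. (\<lambda>(t, xi). H t xi) (t, xi))"
  proof (rule AE_I2)
   fix t
   have "(\<lambda>xi. (\<lambda>(t, xi). H t xi) (t, xi)) = (\<lambda>xi. f t * (u xi * cis (- 2 * pi * t * xi)))"
    by (simp add: H_def mult_ac)
   then show "integrable lborel (\<lambda>xi. (\<lambda>(t, xi). H t xi) (t, xi))"
    using integrable_mult_cis'[OF u, of "- 2 * pi * t"] by simp
  qed
 qed
 have "(LINT xi|lborel. fourier f xi * u xi) = (LINT xi|lborel. LINT t|lborel. H t xi)"
  unfolding fourier_def H_def by simp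
 also have "... = (LINT t|lborel. LINT xi|lborel. H t xi)"
  by (rule lborel_pair.Fubini_integral[OF int])
 also have "... = (LINT t|lborel. f t * fourier u t)"
 proof (intro Bochner_Integration.integral_cong refl)
  fix t
  have "(\<lambda>xi. H t xi) = (\<lambda>xi. f t * (u xi * cis (- 2 * pi * t * xi)))" by (auto simp: H_def fun_eq_iff mult_ac)
  then show "(LINT xi|lborel. H t xi) = f t * fourier u t" by (simp add: fourier_def)
 qed
 finally show ?thesis .
qed

text \<open>Schur's test: the product of the two moduli is at most half the sum of their squares,
  and in each half one variable integrates the kernel to 1.\<close>

lemma young_positive_kernel:
 fixes f :: "real \<Rightarrow> complex" and G :: "real \<Rightarrow> real"
 assumes [measurable]: "f \<in> borel_measurable borel" "G \<in> borel_measurable borel"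
  and G: "\<And>u. G u \<ge> 0" "(\<integral>\<^sup>+u. G u \<partial>lborel) = 1" "\<And>u. G (- u) = G u"
 shows "(\<integral>\<^sup>+x. (\<integral>\<^sup>+y. ennreal (cmod (f x) * (cmod (f y) * G (x - y))) \<partial>lborel) \<partial>lborel) \<le> sqn f"
proof -
 define v where "v t = ennreal ((cmod (f t))\<^sup>2 / 2)" for t
 have [measurable]: "v \<in> borel_measurable borel" unfolding v_def by measurable
 have Gx: "(\<integral>\<^sup>+y. ennreal (G (x - y)) \<partial>lborel) = 1" for x
 proof -
  have "(\<integral>\<^sup>+y. ennreal (G (x - y)) \<partial>lborel) = (\<integral>\<^sup>+y. ennreal (G (y - x)) \<partial>lborel)"
   by (intro nn_integral_cong) (metis G(3) minus_diff_eq)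
  also have "... = (\<integral>\<^sup>+y. ennreal (G y) \<partial>lborel)"
   by (subst nn_integral_real_affine[of "\<lambda>y. ennreal (G (y - x))" 1 x]) simp_all
  finally show ?thesis using G by simp
 qed
 have vh: "(\<integral>\<^sup>+t. v t \<partial>lborel) + (\<integral>\<^sup>+t. v t \<partial>lborel) = sqn f"
  unfolding sqn_def v_def by (subst nn_integral_add[symmetric]) (auto intro!: nn_integral_cong simp flip: ennreal_plus)
 have le: "ennreal (cmod (f x) * (cmod (f y) * G (x - y))) \<le> v x * G (x - y) + v y * G (x - y)" for x y
 proof -
  have "cmod (f x) * cmod (f y) \<le> (cmod (f x))\<^sup>2 / 2 + (cmod (f y))\<^sup>2 / 2"
   using sum_squares_bound[of "cmod (f x)" "cmod (f y)"] by simp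
  from mult_right_mono[OF this G(1)[of "x - y"]]
  have "cmod (f x) * (cmod (f y) * G (x - y)) \<le> (cmod (f x))\<^sup>2 / 2 * G (x - y) + (cmod (f y))\<^sup>2 / 2 * G (x - y)"
   by (simp add: algebra_simps)
  then show ?thesis unfolding v_def using G(1)
   by (simp add: ennreal_leI flip: ennreal_mult' ennreal_plus)
 qed
 have "(\<integral>\<^sup>+x. (\<integral>\<^sup>+y. ennreal (cmod (f x) * (cmod (f y) * G (x - y))) \<partial>lborel) \<partial>lborel)
   \<le> (\<integral>\<^sup>+x. (\<integral>\<^sup>+y. v x * G (x - y) + v y * G (x - y) \<partial>lborel) \<partial>lborel)"
  by (intro nn_integral_mono le)
 also have "... = (\<integral>\<^sup>+x. v x + (\<integral>\<^sup>+y. v y * G (x - y) \<partial>lborel) \<partial>lborel)"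
  by (simp add: nn_integral_add nn_integral_cmult Gx)
 also have "... = (\<integral>\<^sup>+x. v x \<partial>lborel) + (\<integral>\<^sup>+x. (\<integral>\<^sup>+y. v y * G (x - y) \<partial>lborel) \<partial>lborel)"
  by (subst nn_integral_add) auto
 also have "(\<integral>\<^sup>+x. (\<integral>\<^sup>+y. v y * G (x - y) \<partial>lborel) \<partial>lborel) = (\<integral>\<^sup>+y. (\<integral>\<^sup>+x. v y * G (x - y) \<partial>lborel) \<partial>lborel)"
  by (rule lborel_pair.Fubini') simp
 also have "... = (\<integral>\<^sup>+y. v y \<partial>lborel)"
 proof (intro nn_integral_cong)
  fix y
  have "(\<integral>\<^sup>+x. ennreal (G (x - y)) \<partial>lborel) = 1"
   using Gx[of y] by (metis (no_types, lifting) G(3) minus_diff_eq nn_integral_cong)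
  then show "(\<integral>\<^sup>+x. v y * G (x - y) \<partial>lborel) = v y" by (simp add: nn_integral_cmult)
 qed
 finally show ?thesis by (simp add: vh)
qed

text \<open>Bessel's inequality: after inserting a Gaussian factor, Fubini turns the left-hand side into a
 quadratic form with a positive convolution kernel of mass one.\<close>

lemma fourier_bessel:
 assumes f: "integrable lborel f"
 shows "sqn (fourier f) \<le> sqn f"
proof -
 have [measurable]: "f \<in> borel_measurable borel" using f by auto
 note [measurable] = borel_measurable_fourier[OF f]
 have bound: "(\<integral>\<^sup>+xi. ennreal (exp (- eps * xi\<^sup>2) * (cmod (fourier f xi))\<^sup>2) \<partial>lborel) \<le> sqn f" if eps: "eps > 0" for eps
 proof -
  \<comment> \<open>\<open>G\<close> is the Fourier transform of the Gaussian factor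
    \<open>exp (- eps * xi\<^sup>2)\<close> and is normalised to mass one.\<close>
  define G where "G u = sqrt (pi / eps) * exp (- (2 * pi * u)\<^sup>2 / (4 * eps))" for u
  have Gpos: "G u \<ge> 0" for u unfolding G_def using eps by simp
  have [measurable]: "G \<in> borel_measurable borel" unfolding G_def by measurable
  have Gint: "(\<integral>\<^sup>+u. G u \<partial>lborel) = 1"
  proof -
   have e: "G = (\<lambda>u. sqrt (pi / eps) * exp (- (pi\<^sup>2 / eps) * u\<^sup>2))"
    unfolding G_def by (auto simp: fun_eq_iff power_mult_distrib)
   have p: "pi\<^sup>2 / eps > 0" using eps by simp
   have i: "integrable lborel G" unfolding e by (intro integrable_mult_right gaussian_fourier(1)[OF p])
   have "complex_of_real (LINT u|lborel. exp (- (pi\<^sup>2 / eps) * u\<^sup>2)) = complex_of_real (sqrt (pi / (pi\<^sup>2 / eps)))"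
    using gaussian_fourier(2)[OF p, of 0] by (simp del: of_real_exp exp_of_real flip: integral_complex_of_real)
   then have "(LINT u|lborel. exp (- (pi\<^sup>2 / eps) * u\<^sup>2)) = sqrt (pi / (pi\<^sup>2 / eps))"
    by (simp only: of_real_eq_iff)
   then have "(LINT u|lborel. G u) = sqrt (pi / eps) * sqrt (pi / (pi\<^sup>2 / eps))"
    unfolding e by simp
   also have "... = 1"
    using eps by (simp add: power2_eq_square flip: real_sqrt_mult)
   finally show ?thesis using nn_integral_eq_integral[OF i] Gpos by simp
  qed
  \<comment> \<open>The transform of \<open>f'\<close> is the conjugate of the transform of
    \<open>f\<close>. This makes the squared modulus a product of two transforms, to which the
    multiplication formula applies twice.\<close>
  define f' where "f' t = cnj (f (- t))" for t
  have f': "integrable lborel f'"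
   unfolding f'_def using lborel_integrable_real_affine[OF f, of "-1" 0] by simp
  have Ff': "fourier f' xi = cnj (fourier f xi)" for xi
  proof -
   have "fourier f xi = (LINT t|lborel. f (- t) * cis (2 * pi * xi * t))"
    unfolding fourier_def by (subst lborel_integral_real_affine[of "-1" _ 0]) simp_all
   then have "cnj (fourier f xi) = (LINT t|lborel. cnj (f (- t) * cis (2 * pi * xi * t)))"
    by (simp only: Bochner_Integration.integral_cnj)
   also have "... = fourier f' xi"
    unfolding fourier_def f'_def by (intro Bochner_Integration.integral_cong refl) (simp add: cis_cnj)
   finally show ?thesis by simp
  qed
  define e where "e xi = complex_of_real (exp (- eps * xi\<^sup>2))" for xi
  have e: "integrable lborel e" unfolding e_def using gaussian_fourier(1)[OF eps] by simp
  have [measurable]: "e \<in> borel_measurable borel" using e by auto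
  define M where "M = (LINT t|lborel. cmod (f t))"
  have FM: "cmod (fourier f xi) \<le> M" for xi
   unfolding fourier_def M_def by (rule order.trans[OF integral_norm_bound]) (simp add: norm_mult)
  define u where "u xi = e xi * cnj (fourier f xi)" for xi
  have u: "integrable lborel u"
  proof (rule Bochner_Integration.integrable_bound[OF integrable_mult_left[OF e, of M]])
   show "u \<in> borel_measurable lborel" unfolding u_def by measurable
   show "AE xi in lborel. norm (u xi) \<le> norm (e xi * M)"
    using FM order.trans[OF FM abs_ge_self] by (auto simp: u_def norm_mult intro!: mult_left_mono)
  qed
  have Fu: "fourier u x = (LINT y|lborel. cnj (f y) * G (x - y))" for x
  proof -
   have ec: "integrable lborel (\<lambda>xi. e xi * cis (- 2 * pi * x * xi))" by (rule integrable_mult_cis'[OF e])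
   have "fourier u x = (LINT xi|lborel. fourier f' xi * (e xi * cis (- 2 * pi * x * xi)))"
    unfolding fourier_def[of u] u_def Ff' by (simp add: mult_ac)
   also have "... = (LINT t|lborel. f' t * fourier (\<lambda>xi. e xi * cis (- 2 * pi * x * xi)) t)"
    by (rule fourier_multiplication[OF f' ec])
   also have "... = (LINT t|lborel. f' t * G (x + t))"
   proof (intro Bochner_Integration.integral_cong refl)
    fix t
    have eqe: "e xi * cis (- 2 * pi * x * xi) * cis (- 2 * pi * t * xi) = complex_of_real (exp (- eps * xi\<^sup>2)) * cis ((- 2 * pi * (x + t)) * xi)" for xi
     by (simp add: e_def mult.assoc cis_mult algebra_simps)
    have "(- 2 * pi * (x + t))\<^sup>2 = (2 * pi * (x + t))\<^sup>2" by (simp add: power_mult_distrib)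
    then have "fourier (\<lambda>xi. e xi * cis (- 2 * pi * x * xi)) t = G (x + t)"
     unfolding fourier_def eqe gaussian_fourier(2)[OF eps] G_def by simp
    then show "f' t * fourier (\<lambda>xi. e xi * cis (- 2 * pi * x * xi)) t = f' t * G (x + t)" by simp
   qed
   also have "... = (LINT y|lborel. cnj (f y) * G (x - y))"
    unfolding f'_def by (subst lborel_integral_real_affine[of "-1" _ 0]) simp_all
   finally show ?thesis .
  qed
  have "complex_of_real (LINT xi|lborel. exp (- eps * xi\<^sup>2) * (cmod (fourier f xi))\<^sup>2) = (LINT xi|lborel. complex_of_real (exp (- eps * xi\<^sup>2) * (cmod (fourier f xi))\<^sup>2))"
   by (rule integral_complex_of_real[symmetric])
  also have "... = (LINT xi|lborel. fourier f xi * u xi)"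
   unfolding u_def e_def by (intro Bochner_Integration.integral_cong refl) (simp only: of_real_mult complex_norm_square mult_ac)
  also have "... = (LINT x|lborel. f x * fourier u x)" by (rule fourier_multiplication[OF f u])
  finally have eq: "complex_of_real (LINT xi|lborel. exp (- eps * xi\<^sup>2) * (cmod (fourier f xi))\<^sup>2) = (LINT x|lborel. f x * fourier u x)" .
  have int: "integrable lborel (\<lambda>xi. exp (- eps * xi\<^sup>2) * (cmod (fourier f xi))\<^sup>2)"
  proof (rule Bochner_Integration.integrable_bound[OF integrable_mult_left[OF gaussian_fourier(1)[OF eps], of "M\<^sup>2"]])
   show "(\<lambda>xi. exp (- eps * xi\<^sup>2) * (cmod (fourier f xi))\<^sup>2) \<in> borel_measurable lborel" by measurable
   have "(cmod (fourier f xi))\<^sup>2 \<le> M\<^sup>2" for xi using FM by (intro power_mono) auto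
   then show "AE xi in lborel. norm (exp (- eps * xi\<^sup>2) * (cmod (fourier f xi))\<^sup>2) \<le> norm (exp (- eps * xi\<^sup>2) * M\<^sup>2)"
    by (auto simp: abs_mult mult_left_mono)
  qed
  have "(\<integral>\<^sup>+xi. ennreal (exp (- eps * xi\<^sup>2) * (cmod (fourier f xi))\<^sup>2) \<partial>lborel) = ennreal (LINT xi|lborel. exp (- eps * xi\<^sup>2) * (cmod (fourier f xi))\<^sup>2)"
   by (rule nn_integral_eq_integral[OF int]) auto
  also have "... \<le> ennreal (cmod (LINT x|lborel. f x * fourier u x))"
   unfolding eq[symmetric] by (intro ennreal_leI) simp
  also have "... \<le> (\<integral>\<^sup>+x. ennreal (cmod (f x * fourier u x)) \<partial>lborel)"
   by (rule norm_integral_le_nn_integral) 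
  also have "... \<le> (\<integral>\<^sup>+x. (\<integral>\<^sup>+y. ennreal (cmod (f x) * (cmod (f y) * G (x - y))) \<partial>lborel) \<partial>lborel)"
  proof (intro nn_integral_mono)
   fix x
   have "ennreal (cmod (fourier u x)) \<le> (\<integral>\<^sup>+y. ennreal (cmod (f y) * G (x - y)) \<partial>lborel)"
    unfolding Fu using norm_integral_le_nn_integral[of lborel "\<lambda>y. cnj (f y) * G (x - y)"] Gpos by (simp add: norm_mult)
   then have "ennreal (cmod (f x)) * ennreal (cmod (fourier u x)) \<le> ennreal (cmod (f x)) * (\<integral>\<^sup>+y. ennreal (cmod (f y) * G (x - y)) \<partial>lborel)"
    by (rule mult_left_mono) simp
   also have "... = (\<integral>\<^sup>+y. ennreal (cmod (f x) * (cmod (f y) * G (x - y))) \<partial>lborel)"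
    by (subst nn_integral_cmult[symmetric]) (simp_all add: ennreal_mult')
   finally show "ennreal (cmod (f x * fourier u x)) \<le> (\<integral>\<^sup>+y. ennreal (cmod (f x) * (cmod (f y) * G (x - y))) \<partial>lborel)"
    by (simp add: norm_mult ennreal_mult')
  qed
  also have "... \<le> sqn f"
   by (rule young_positive_kernel) (use Gpos Gint in \<open>auto simp: G_def\<close>)
  finally show ?thesis .
 qed
 \<comment> \<open>The Gaussian factor is removed by Fatou's lemma along
   \<open>eps = 1 / (n + 1)\<close>.\<close>
 define w where "w n xi = ennreal (exp (- (1 / real (Suc n)) * xi\<^sup>2) * (cmod (fourier f xi))\<^sup>2)" for n xi
 have [measurable]: "w n \<in> borel_measurable borel" for n unfolding w_def by measurable
 have lim: "liminf (\<lambda>n. w n xi) = ennreal ((cmod (fourier f xi))\<^sup>2)" for xi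
 proof (rule lim_imp_Liminf)
  have "(\<lambda>n. exp (- (1 / real (Suc n)) * xi\<^sup>2) * (cmod (fourier f xi))\<^sup>2) \<longlonglongrightarrow> exp (- 0 * xi\<^sup>2) * (cmod (fourier f xi))\<^sup>2"
   by (intro tendsto_intros LIMSEQ_Suc[OF lim_1_over_n])
  then show "(\<lambda>n. w n xi) \<longlonglongrightarrow> ennreal ((cmod (fourier f xi))\<^sup>2)"
   unfolding w_def by (intro tendsto_ennrealI) simp
 qed simp
 have "sqn (fourier f) = (\<integral>\<^sup>+xi. liminf (\<lambda>n. w n xi) \<partial>lborel)" unfolding sqn_def lim ..
 also have "... \<le> liminf (\<lambda>n. \<integral>\<^sup>+xi. w n xi \<partial>lborel)" by (rule nn_integral_liminf) simp
 also have "... \<le> liminf (\<lambda>n. sqn f)"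
  unfolding w_def by (intro Liminf_mono always_eventually allI bound) simp
 also have "... = sqn f" by (simp add: Liminf_const)
 finally show ?thesis .
qed

text \<open>\<open>fourier_rel f F\<close>: the function \<open>F\<close> is the Fourier transform of the square integrable function \<open>f\<close>.\<close>

definition fourier_rel :: "(real \<Rightarrow> complex) \<Rightarrow> (real \<Rightarrow> complex) \<Rightarrow> bool" where
 "fourier_rel f F \<longleftrightarrow> f \<in> borel_measurable borel \<and> F \<in> borel_measurable borel \<and>
   (\<forall>e>0. \<exists>u. integrable lborel u \<and> sqn (\<lambda>t. f t - u t) \<le> ennreal e \<and> sqn (\<lambda>t. F t - fourier u t) \<le> ennreal e)"

lemma fourier_relD:
 assumes "fourier_rel f F" "e > 0"
 obtains u where "integrable lborel u" "sqn (\<lambda>t. f t - u t) \<le> ennreal e" "sqn (\<lambda>t. F t - fourier u t) \<le> ennreal e"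
 using assms unfolding fourier_rel_def by blast

lemma sqn_add_le_ennreal:
 assumes "f \<in> borel_measurable borel" "g \<in> borel_measurable borel"
  and "sqn f \<le> ennreal a" "sqn g \<le> ennreal b" "a \<ge> 0" "b \<ge> 0"
 shows "sqn (\<lambda>t. f t + g t) \<le> ennreal (2 * (a + b))"
proof -
 have "sqn (\<lambda>t. f t + g t) \<le> 2 * (sqn f + sqn g)" by (rule sqn_add_le[OF assms(1,2)])
 also have "... \<le> 2 * (ennreal a + ennreal b)" using assms by (intro mult_left_mono add_mono) auto
 also have "... = ennreal 2 * ennreal (a + b)" using assms by simp
 also have "... = ennreal (2 * (a + b))" using assms by (intro ennreal_mult[symmetric]) auto
 finally show ?thesis .
qed

lemma fourier_add: "integrable lborel u ==> integrable lborel v ==> fourier (\<lambda>t. u t + v t) xi = fourier u xi + fourier v xi"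
 unfolding fourier_def distrib_right by (intro Bochner_Integration.integral_add integrable_mult_cis')

lemma fourier_diff: "integrable lborel u ==> integrable lborel v ==> fourier (\<lambda>t. u t - v t) xi = fourier u xi - fourier v xi"
 unfolding fourier_def left_diff_distrib by (intro Bochner_Integration.integral_diff integrable_mult_cis')

lemma fourier_cmult: "fourier (\<lambda>t. c * u t) xi = c * fourier u xi"
 unfolding fourier_def by (simp add: mult.assoc)

lemma fourier_rel_add:
 assumes f: "fourier_rel f F" and g: "fourier_rel g G"
 shows "fourier_rel (\<lambda>t. f t + g t) (\<lambda>t. F t + G t)"
proof -
 have m [measurable]: "f \<in> borel_measurable borel" "F \<in> borel_measurable borel" "g \<in> borel_measurable borel" "G \<in> borel_measurable borel"
  using f g by (auto simp: fourier_rel_def)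
 show ?thesis unfolding fourier_rel_def
 proof (intro conjI allI impI)
  fix e :: real assume e: "e > 0"
  obtain u where u: "integrable lborel u" "sqn (\<lambda>t. f t - u t) \<le> ennreal (e/4)" "sqn (\<lambda>t. F t - fourier u t) \<le> ennreal (e/4)"
   using fourier_relD[OF f, of "e/4"] e by auto
  obtain v where v: "integrable lborel v" "sqn (\<lambda>t. g t - v t) \<le> ennreal (e/4)" "sqn (\<lambda>t. G t - fourier v t) \<le> ennreal (e/4)"
   using fourier_relD[OF g, of "e/4"] e by auto
  have [measurable]: "u \<in> borel_measurable borel" "v \<in> borel_measurable borel" "fourier u \<in> borel_measurable borel" "fourier v \<in> borel_measurable borel"
   using u v by (auto intro: borel_measurable_fourier)
  have "sqn (\<lambda>t. (f t - u t) + (g t - v t)) \<le> ennreal (2 * (e/4 + e/4))"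
   by (rule sqn_add_le_ennreal) (use u v e in auto)
  moreover have "sqn (\<lambda>t. (F t - fourier u t) + (G t - fourier v t)) \<le> ennreal (2 * (e/4 + e/4))"
   by (rule sqn_add_le_ennreal) (use u v e in auto)
  ultimately show "\<exists>w. integrable lborel w \<and> sqn (\<lambda>t. f t + g t - w t) \<le> ennreal e \<and> sqn (\<lambda>t. F t + G t - fourier w t) \<le> ennreal e"
   by (intro exI[of _ "\<lambda>t. u t + v t"]) (simp add: u v fourier_add add_diff_add)
 qed measurable
qed

lemma fourier_rel_0: "fourier_rel (\<lambda>t. 0) (\<lambda>t. 0)"
 unfolding fourier_rel_def
proof (intro conjI allI impI)
 fix e :: real assume "e > 0"
 then show "\<exists>u. integrable lborel u \<and> sqn (\<lambda>t. 0 - u t) \<le> ennreal e \<and> sqn (\<lambda>t. 0 - fourier u t) \<le> ennreal e"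
  by (intro exI[of _ "\<lambda>t. 0"]) (simp add: sqn_def fourier_def)
qed auto

lemma fourier_rel_cmult:
 assumes f: "fourier_rel f F"
 shows "fourier_rel (\<lambda>t. c * f t) (\<lambda>t. c * F t)"
proof -
 have m [measurable]: "f \<in> borel_measurable borel" "F \<in> borel_measurable borel"
  using f by (auto simp: fourier_rel_def)
 show ?thesis unfolding fourier_rel_def
 proof (intro conjI allI impI)
  fix e :: real assume e: "e > 0"
  define K where "K = (cmod c)\<^sup>2 + 1"
  have K: "K > 0" "(cmod c)\<^sup>2 \<le> K" by (auto simp: K_def add_nonneg_pos)
  obtain u where u: "integrable lborel u" "sqn (\<lambda>t. f t - u t) \<le> ennreal (e/K)" "sqn (\<lambda>t. F t - fourier u t) \<le> ennreal (e/K)"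
   using fourier_relD[OF f, of "e/K"] e K by auto
  have [measurable]: "u \<in> borel_measurable borel" "fourier u \<in> borel_measurable borel"
   using u by (auto intro: borel_measurable_fourier)
  have le: "ennreal ((cmod c)\<^sup>2) * x \<le> ennreal e" if "x \<le> ennreal (e/K)" for x
  proof -
   have "ennreal ((cmod c)\<^sup>2) * x \<le> ennreal K * ennreal (e/K)"
    using that K by (intro mult_mono ennreal_leI) auto
   also have "... = ennreal e" using K e by (simp flip: ennreal_mult)
   finally show ?thesis .
  qed
  have "sqn (\<lambda>t. c * (f t - u t)) \<le> ennreal e" "sqn (\<lambda>t. c * (F t - fourier u t)) \<le> ennreal e"
   using u(2,3) by (auto simp: sqn_mult intro: le)
  then show "\<exists>w. integrable lborel w \<and> sqn (\<lambda>t. c * f t - w t) \<le> ennreal e \<and> sqn (\<lambda>t. c * F t - fourier w t) \<le> ennreal e"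
   using u(1) by (intro exI[of _ "\<lambda>t. c * u t"]) (simp add: fourier_cmult right_diff_distrib)
 qed measurable
qed

lemma borel_measurable_cis_affine [measurable]: "(\<lambda>t. cis (a * t + b)) \<in> borel_measurable borel"
 by (intro borel_measurable_continuous_onI continuous_intros)

lemma borel_measurable_cis_linear [measurable]: "(\<lambda>t. cis (a * t)) \<in> borel_measurable borel"
 by (intro borel_measurable_continuous_onI continuous_intros)

lemma fourier_rel_shift:
 assumes f: "fourier_rel f F"
 shows "fourier_rel (\<lambda>t. cis (2 * pi * w * t) * f (t - x)) (\<lambda>xi. cis (2 * pi * (w - xi) * x) * F (xi - w))"
proof -
 have m [measurable]: "f \<in> borel_measurable borel" "F \<in> borel_measurable borel"
  using f by (auto simp: fourier_rel_def)
 have c: "cis (2 * pi * (w - xi) * x) = cis ((- 2 * pi * x) * xi + 2 * pi * w * x)" for xi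
  by (simp add: algebra_simps)
 show ?thesis unfolding fourier_rel_def
 proof (intro conjI allI impI)
  fix e :: real assume e: "e > 0"
  obtain u where u: "integrable lborel u" "sqn (\<lambda>t. f t - u t) \<le> ennreal e" "sqn (\<lambda>t. F t - fourier u t) \<le> ennreal e"
   using fourier_relD[OF f e] by auto
  have [measurable]: "u \<in> borel_measurable borel" "fourier u \<in> borel_measurable borel"
   using u by (auto intro: borel_measurable_fourier)
  define v where "v t = cis (2 * pi * w * t) * u (t - x)" for t
  have "integrable lborel (\<lambda>t. u (- x + 1 * t))"
   using lborel_integrable_real_affine[OF u(1), of 1 "- x"] by simp
  then have "integrable lborel v"
   using integrable_mult_cis'[of "\<lambda>t. u (t - x)" "2 * pi * w"] by (simp add: v_def[abs_def] mult.commute)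
  moreover have "sqn (\<lambda>t. cis (2 * pi * w * t) * f (t - x) - v t) = sqn (\<lambda>t. f t - u t)"
   using sqn_shift[of "\<lambda>t. f t - u t" "2 * pi * w" 0 x] by (simp add: v_def right_diff_distrib)
  moreover have "sqn (\<lambda>xi. cis (2 * pi * (w - xi) * x) * F (xi - w) - fourier v xi) = sqn (\<lambda>t. F t - fourier u t)"
   using sqn_shift[of "\<lambda>t. F t - fourier u t" "- 2 * pi * x" "2 * pi * w * x" w]
   unfolding v_def[abs_def] fourier_shift c by (simp add: right_diff_distrib)
  ultimately show "\<exists>v. integrable lborel v \<and> sqn (\<lambda>t. cis (2 * pi * w * t) * f (t - x) - v t) \<le> ennreal e \<and>
    sqn (\<lambda>xi. cis (2 * pi * (w - xi) * x) * F (xi - w) - fourier v xi) \<le> ennreal e"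
   using u by auto
 qed (unfold c, measurable)
qed

lemma fourier_rel_sum:
 "finite I ==> (\<And>i. i \<in> I ==> fourier_rel (f i) (F i)) ==> fourier_rel (\<lambda>t. \<Sum>i\<in>I. f i t) (\<lambda>t. \<Sum>i\<in>I. F i t)"
 by (induction I rule: finite_induct) (auto intro: fourier_rel_0 fourier_rel_add)

lemma sqn_diff_commute: "sqn (\<lambda>t. f t - g t) = sqn (\<lambda>t. g t - f t)"
 by (simp add: sqn_def norm_minus_commute)

lemma sqn_le_all_imp_zero:
 assumes "f \<in> borel_measurable borel" "\<And>e. e > 0 ==> sqn f \<le> ennreal (c * e)" "c > 0"
 shows "AE t in lborel. f t = 0"
proof -
 have "sqn f \<le> 0 + ennreal e" if "e > 0" for e
  using assms(2)[of "e / c"] assms(3) that by simp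
 then have "sqn f \<le> 0" by (rule ennreal_le_epsilon) auto
 then show ?thesis using sqn_eq_0_iff[OF assms(1)] by simp
qed

text \<open>The integrable approximants of a null function have small norm; by Bessel's inequality
  so have their transforms, which approximate \<open>F\<close>.\<close>

lemma fourier_rel_zero_left:
 assumes f: "fourier_rel f F" and z: "AE t in lborel. f t = 0"
 shows "AE t in lborel. F t = 0"
proof -
 have m [measurable]: "f \<in> borel_measurable borel" "F \<in> borel_measurable borel"
  using f by (auto simp: fourier_rel_def)
 show ?thesis
 proof (rule sqn_le_all_imp_zero[of _ 4])
  fix e :: real assume e: "e > 0"
  obtain u where u: "integrable lborel u" "sqn (\<lambda>t. f t - u t) \<le> ennreal e" "sqn (\<lambda>t. F t - fourier u t) \<le> ennreal e"
   using fourier_relD[OF f e] by auto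
  have [measurable]: "u \<in> borel_measurable borel" "fourier u \<in> borel_measurable borel"
   using u by (auto intro: borel_measurable_fourier)
  have "sqn u = sqn (\<lambda>t. f t - u t)"
   unfolding sqn_def by (intro nn_integral_cong_AE) (use z in \<open>eventually_elim, simp\<close>)
  then have "sqn (fourier u) \<le> ennreal e" using fourier_bessel[OF u(1)] u(2) by simp
  then have "sqn (\<lambda>t. (F t - fourier u t) + fourier u t) \<le> ennreal (2 * (e + e))"
   by (intro sqn_add_le_ennreal) (use u e in auto)
  then show "sqn F \<le> ennreal (4 * e)" by simp
 qed auto
qed

lemma nn_integral_mult_le_sqn:
 assumes [measurable]: "f \<in> borel_measurable borel" "g \<in> borel_measurable borel"
  and "sqn f \<le> ennreal a" "sqn g \<le> ennreal b" "a \<ge> 0" "b \<ge> 0"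
 shows "(\<integral>\<^sup>+t. cmod (f t * g t) \<partial>lborel) \<le> ennreal (sqrt (a * b))"
proof -
 have "(\<integral>\<^sup>+t. ennreal (cmod (f t)) * ennreal (cmod (g t)) \<partial>lborel)\<^sup>2 \<le> (\<integral>\<^sup>+t. (ennreal (cmod (f t)))\<^sup>2 \<partial>lborel) * (\<integral>\<^sup>+t. (ennreal (cmod (g t)))\<^sup>2 \<partial>lborel)"
  by (rule Cauchy_Schwarz_nn_integral) auto
 also have "... = sqn f * sqn g" unfolding sqn_def by (simp add: ennreal_power)
 also have "... \<le> ennreal a * ennreal b" by (intro mult_mono assms) auto
 also have "... = (ennreal (sqrt (a * b)))\<^sup>2" using assms by (simp add: ennreal_power flip: ennreal_mult)
 finally have le: "(\<integral>\<^sup>+t. ennreal (cmod (f t)) * ennreal (cmod (g t)) \<partial>lborel)\<^sup>2 \<le> (ennreal (sqrt (a * b)))\<^sup>2" .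
 have "x \<le> ennreal r" if "x\<^sup>2 \<le> (ennreal r)\<^sup>2" "0 \<le> r" for x r
 proof (cases x)
  case (real y)
  then show ?thesis using that by (auto simp: ennreal_power power2_le_iff_abs_le intro: ennreal_leI)
 next
  case top
  then show ?thesis using that by (simp add: ennreal_power top_unique)
 qed
 from this[OF le] have "(\<integral>\<^sup>+t. ennreal (cmod (f t)) * ennreal (cmod (g t)) \<partial>lborel) \<le> ennreal (sqrt (a * b))"
  using assms by simp
 then show ?thesis by (simp add: norm_mult ennreal_mult)
qed

text \<open>Injectivity by duality. The product of \<open>f\<close> with a Gaussian is integrable,
  and each of its Fourier coefficients is a pairing of \<open>f\<close> with the transform of a
  shifted Gaussian. For approximants the multiplication formula moves this pairing to the side of
  \<open>F\<close>, where it is small; so the product vanishes almost everywhere.\<close>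

lemma fourier_rel_zero_right:
 assumes f: "fourier_rel f F" and fin: "sqn f < \<infinity>" and z: "AE t in lborel. F t = 0"
 shows "AE t in lborel. f t = 0"
proof -
 have m [measurable]: "f \<in> borel_measurable borel" "F \<in> borel_measurable borel"
  using f by (auto simp: fourier_rel_def)
 define G where "G t = complex_of_real (exp (- 1 * t\<^sup>2))" for t :: real
 have [measurable]: "G \<in> borel_measurable borel" unfolding G_def by measurable
 have sg: "sqn (\<lambda>t. complex_of_real (exp (- a * (t - x)\<^sup>2)) * cis (b * t)) \<le> ennreal (sqrt (pi / (2 * a)))" if "a > 0" for a b x :: real
 proof -
  have "sqn (\<lambda>t. complex_of_real (exp (- a * (t - x)\<^sup>2)) * cis (b * t)) = (\<integral>\<^sup>+t. ennreal (exp (- (2 * a) * (t - x)\<^sup>2)) \<partial>lborel)"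
   unfolding sqn_def by (intro nn_integral_cong) (simp add: norm_mult flip: exp_double)
  also have "... = (\<integral>\<^sup>+t. ennreal (exp (- (2 * a) * t\<^sup>2)) \<partial>lborel)"
   by (subst nn_integral_real_affine[of _ 1 x]) simp_all
  also have "... = ennreal (LINT t|lborel. exp (- (2 * a) * t\<^sup>2))"
   using that by (intro nn_integral_eq_integral gaussian_fourier) auto
  also have "(LINT t|lborel. exp (- (2 * a) * t\<^sup>2)) = sqrt (pi / (2 * a))"
  proof -
   have "complex_of_real (LINT t|lborel. exp (- (2 * a) * t\<^sup>2)) = complex_of_real (sqrt (pi / (2 * a)))"
    using gaussian_fourier(2)[of "2 * a" 0] that by (simp del: of_real_exp exp_of_real flip: integral_complex_of_real)
   then show ?thesis by (simp only: of_real_eq_iff)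
  qed
  finally show ?thesis by simp
 qed
 obtain s where s: "s \<ge> 0" "sqn f = ennreal s" using fin by (cases "sqn f") auto
 have G1: "sqn G \<le> ennreal (sqrt (pi / 2))" using sg[of 1 0 0] by (simp add: G_def[abs_def])
 have fG: "integrable lborel (\<lambda>t. f t * G t)"
 proof (rule integrableI_bounded)
  have "(\<integral>\<^sup>+t. cmod (f t * G t) \<partial>lborel) \<le> ennreal (sqrt (s * sqrt (pi / 2)))"
   by (rule nn_integral_mult_le_sqn) (use s G1 in auto)
  also have "... < \<infinity>" by simp
  finally show "(\<integral>\<^sup>+t. ennreal (cmod (f t * G t)) \<partial>lborel) < \<infinity>" .
 qed auto
 have "fourier (\<lambda>t. f t * G t) xi = 0" for xi
 proof -
  \<comment> \<open>The shifted Gaussian whose transform is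
    \<open>G t * cis (- 2 * pi * xi * t)\<close>.\<close>
  define phi where "phi eta = complex_of_real (sqrt pi * exp (- (pi\<^sup>2) * (eta - xi)\<^sup>2))" for eta
  have phii: "integrable lborel phi"
  proof -
   have "integrable lborel (\<lambda>eta. exp (- (pi\<^sup>2) * (- xi + 1 * eta)\<^sup>2))"
    using lborel_integrable_real_affine[OF gaussian_fourier(1)[of "pi\<^sup>2"], of 1 "- xi"] by simp
   then show ?thesis unfolding phi_def by simp
  qed
  have [measurable]: "phi \<in> borel_measurable borel" using phii by auto
  have Fphi: "fourier phi t = G t * cis (- 2 * pi * xi * t)" for t
  proof -
   define k where "k eta = complex_of_real (sqrt pi * exp (- (pi\<^sup>2) * eta\<^sup>2))" for eta
   have "fourier phi t = fourier (\<lambda>eta. cis (2 * pi * 0 * eta) * k (eta - xi)) t"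
    unfolding phi_def k_def by simp
   also have "... = cis (- 2 * pi * xi * t) * fourier k t"
    unfolding fourier_shift by (simp add: mult_ac)
   also have "fourier k t = complex_of_real (sqrt pi) * (LINT eta|lborel. complex_of_real (exp (- (pi\<^sup>2) * eta\<^sup>2)) * cis ((- 2 * pi * t) * eta))"
    unfolding fourier_def k_def by (simp only: of_real_mult mult.assoc integral_mult_right_zero)
   also have "... = complex_of_real (sqrt pi * (sqrt (pi / pi\<^sup>2) * exp (- (- 2 * pi * t)\<^sup>2 / (4 * pi\<^sup>2))))"
    by (subst gaussian_fourier(2)) (simp_all only: of_real_mult zero_less_power pi_gt_zero)
   also have "sqrt pi * (sqrt (pi / pi\<^sup>2) * exp (- (- 2 * pi * t)\<^sup>2 / (4 * pi\<^sup>2))) = exp (- 1 * t\<^sup>2)"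
   proof -
    have "sqrt pi * sqrt (pi / pi\<^sup>2) = 1" by (simp add: power2_eq_square flip: real_sqrt_mult)
    moreover have "- (- 2 * pi * t)\<^sup>2 / (4 * pi\<^sup>2) = - 1 * t\<^sup>2" by (simp add: power_mult_distrib)
    ultimately show ?thesis by (simp only: mult.assoc[symmetric])
   qed
   also have "complex_of_real (exp (- 1 * t\<^sup>2)) = G t" by (simp only: G_def)
   finally show ?thesis by simp
  qed
  define b where "b = sqrt (pi / (2 * pi\<^sup>2)) * pi"
  have b: "b \<ge> 0" by (simp add: b_def)
  have sphi: "sqn phi \<le> ennreal b"
  proof -
   have "phi = (\<lambda>eta. complex_of_real (sqrt pi) * (complex_of_real (exp (- (pi\<^sup>2) * (eta - xi)\<^sup>2)) * cis (0 * eta)))"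
    by (simp add: phi_def fun_eq_iff)
   then have "sqn phi = sqn (\<lambda>eta. complex_of_real (sqrt pi) * (complex_of_real (exp (- (pi\<^sup>2) * (eta - xi)\<^sup>2)) * cis (0 * eta)))"
    by (rule arg_cong)
   also have "... = ennreal ((cmod (complex_of_real (sqrt pi)))\<^sup>2) * sqn (\<lambda>eta. complex_of_real (exp (- (pi\<^sup>2) * (eta - xi)\<^sup>2)) * cis (0 * eta))"
    by (rule sqn_mult) (intro borel_measurable_continuous_onI continuous_intros)
   also have "... = ennreal pi * sqn (\<lambda>eta. complex_of_real (exp (- (pi\<^sup>2) * (eta - xi)\<^sup>2)) * cis (0 * eta))" by simp
   also have "... \<le> ennreal pi * ennreal (sqrt (pi / (2 * pi\<^sup>2)))"
    by (intro mult_left_mono sg) auto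
   also have "... = ennreal b" by (simp add: b_def mult.commute flip: ennreal_mult)
   finally show ?thesis .
  qed
  have sG: "sqn (\<lambda>t. G t * cis (- 2 * pi * xi * t)) \<le> ennreal (sqrt (pi / 2))"
   using sg[of 1 0 "- 2 * pi * xi"] by (simp add: G_def)
  have "cmod (fourier (\<lambda>t. f t * G t) xi) \<le> sqrt (e * sqrt (pi / 2)) + sqrt (e * b)" if e: "e > 0" for e
  proof -
   obtain u where u: "integrable lborel u" "sqn (\<lambda>t. f t - u t) \<le> ennreal e" "sqn (\<lambda>t. F t - fourier u t) \<le> ennreal e"
    using fourier_relD[OF f e] by auto
   have [measurable]: "u \<in> borel_measurable borel" "fourier u \<in> borel_measurable borel"
    using u by (auto intro: borel_measurable_fourier)
   have su: "sqn (fourier u) \<le> ennreal e"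
   proof -
    have "sqn (fourier u) = sqn (\<lambda>t. F t - fourier u t)"
     unfolding sqn_def by (intro nn_integral_cong_AE) (use z in \<open>eventually_elim, simp\<close>)
    then show ?thesis using u by simp
   qed
   have i1: "integrable lborel (\<lambda>t. f t * (G t * cis (- 2 * pi * xi * t)))"
    using integrable_mult_cis'[OF fG, of "- 2 * pi * xi"] by (simp add: mult.assoc)
   have i2: "integrable lborel (\<lambda>t. u t * (G t * cis (- 2 * pi * xi * t)))"
   proof (rule Bochner_Integration.integrable_bound[OF u(1)])
    show "AE t in lborel. cmod (u t * (G t * cis (- 2 * pi * xi * t))) \<le> cmod (u t)"
     by (auto simp: norm_mult G_def intro!: mult_left_le)
   qed measurable
   have "(LINT t|lborel. u t * (G t * cis (- 2 * pi * xi * t))) = (LINT eta|lborel. fourier u eta * phi eta)"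
    unfolding fourier_multiplication[OF u(1) phii] Fphi ..
   moreover have "ennreal (cmod (LINT eta|lborel. fourier u eta * phi eta)) \<le> ennreal (sqrt (e * b))"
    by (rule order.trans[OF norm_integral_le_nn_integral]) (rule nn_integral_mult_le_sqn, use su sphi e b in auto)
   ultimately have 1: "cmod (LINT t|lborel. u t * (G t * cis (- 2 * pi * xi * t))) \<le> sqrt (e * b)"
    using e b by (simp add: ennreal_le_iff)
   have "ennreal (cmod (LINT t|lborel. (f t - u t) * (G t * cis (- 2 * pi * xi * t)))) \<le> ennreal (sqrt (e * sqrt (pi / 2)))"
   proof (rule order.trans[OF norm_integral_le_nn_integral nn_integral_mult_le_sqn[OF _ _ u(2) sG]])
    show "(\<lambda>t. G t * cis (- 2 * pi * xi * t)) \<in> borel_measurable borel" "(\<lambda>t. f t - u t) \<in> borel_measurable borel"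
     by measurable
   qed (use e in auto)
   then have 2: "cmod (LINT t|lborel. (f t - u t) * (G t * cis (- 2 * pi * xi * t))) \<le> sqrt (e * sqrt (pi / 2))"
    using e by (simp add: ennreal_le_iff)
   have "fourier (\<lambda>t. f t * G t) xi = (LINT t|lborel. f t * (G t * cis (- 2 * pi * xi * t)))"
    unfolding fourier_def by (simp add: mult.assoc)
   also have "... = (LINT t|lborel. (f t - u t) * (G t * cis (- 2 * pi * xi * t))) + (LINT t|lborel. u t * (G t * cis (- 2 * pi * xi * t)))"
    using i1 i2 by (simp add: left_diff_distrib)
   finally show ?thesis using 1 2 norm_triangle_ineq by (smt (verit))
  qed
  moreover have "((\<lambda>e. sqrt (e * sqrt (pi / 2)) + sqrt (e * b)) \<longlongrightarrow> sqrt (0 * sqrt (pi / 2)) + sqrt (0 * b)) (at_right 0)"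
   by (intro tendsto_intros)
  ultimately have "cmod (fourier (\<lambda>t. f t * G t) xi) \<le> sqrt (0 * sqrt (pi / 2)) + sqrt (0 * b)"
   by (intro tendsto_lowerbound[of _ _ "at_right (0::real)"]) (auto simp: eventually_at_right_less eventually_mono[OF eventually_at_right_less[of 0]])
  then show ?thesis by simp
 qed
 from fourier_vanish[OF fG this] show ?thesis
  by eventually_elim (simp add: G_def)
qed

text \<open>The scheme of the Riesz--Fischer theorem: truncations of \<open>f\<close> are integrable
  and converge to it in norm, Bessel's inequality makes their transforms a Cauchy sequence, and a
  rapidly converging subsequence converges almost everywhere.\<close>

lemma fourier_rel_exists:
 assumes [measurable]: "f \<in> borel_measurable borel" and fin: "sqn f < \<infinity>"
 obtains F where "fourier_rel f F"
proof -
 define fn where "fn n t = (if \<bar>t\<bar> \<le> real n then f t else 0)" for n t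
 have [measurable]: "fn n \<in> borel_measurable borel" for n unfolding fn_def by measurable
 have fni: "integrable lborel (fn n)" for n
 proof (rule integrableI_bounded)
  have "(\<integral>\<^sup>+t. cmod (fn n t) \<partial>lborel) \<le> (\<integral>\<^sup>+t. ennreal ((cmod (f t))\<^sup>2) + indicator {- real n..real n} t \<partial>lborel)"
  proof (intro nn_integral_mono)
   fix t
   have "cmod (f t) \<le> (cmod (f t))\<^sup>2 + 1"
    using sum_squares_bound[of "cmod (f t)" 1] by (simp add: power2_eq_square) (smt (verit) norm_ge_zero zero_le_square)
   then have "ennreal (cmod (f t)) \<le> ennreal ((cmod (f t))\<^sup>2) + 1"
    by (metis ennreal_1 ennreal_leI ennreal_plus zero_le_one zero_le_power2)
   then show "ennreal (cmod (fn n t)) \<le> ennreal ((cmod (f t))\<^sup>2) + indicator {- real n..real n} t"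
    by (auto simp: fn_def indicator_def)
  qed
  also have "... = sqn f + ennreal (2 * real n)"
   unfolding sqn_def by (subst nn_integral_add) auto
  also have "... < \<infinity>" using fin by simp
  finally show "(\<integral>\<^sup>+t. ennreal (cmod (fn n t)) \<partial>lborel) < \<infinity>" .
 qed simp
 have lim: "(\<lambda>n. sqn (\<lambda>t. f t - fn n t)) \<longlonglongrightarrow> 0"
 proof -
  have "(\<lambda>n. \<integral>\<^sup>+t. ennreal ((cmod (f t - fn n t))\<^sup>2) \<partial>lborel) \<longlonglongrightarrow> (\<integral>\<^sup>+(t::real). 0 \<partial>lborel)"
  proof (rule nn_integral_dominated_convergence[where w="\<lambda>t. ennreal ((cmod (f t))\<^sup>2)"])
   show "(\<integral>\<^sup>+t. ennreal ((cmod (f t))\<^sup>2) \<partial>lborel) < \<infinity>" using fin by (simp add: sqn_def)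
   show "AE t in lborel. ennreal ((cmod (f t - fn n t))\<^sup>2) \<le> ennreal ((cmod (f t))\<^sup>2)" for n
    by (auto simp: fn_def)
   show "AE t in lborel. (\<lambda>n. ennreal ((cmod (f t - fn n t))\<^sup>2)) \<longlonglongrightarrow> 0"
   proof (rule AE_I2)
    fix t :: real
    have "\<forall>\<^sub>F n in sequentially. ennreal ((cmod (f t - fn n t))\<^sup>2) = 0"
     using eventually_ge_at_top[of "nat \<lceil>\<bar>t\<bar>\<rceil>"]
    proof eventually_elim
     case (elim n)
     then have "\<bar>t\<bar> \<le> real n" by linarith
     then show ?case by (simp add: fn_def)
    qed
    then show "(\<lambda>n. ennreal ((cmod (f t - fn n t))\<^sup>2)) \<longlonglongrightarrow> 0" by (rule tendsto_eventually)
   qed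
  qed auto
  then show ?thesis by (simp add: sqn_def)
 qed
 \<comment> \<open>The rate \<open>(1/8) ^ k\<close> is chosen against the weight
   \<open>4 ^ k\<close> of the series below: its finiteness almost everywhere forces
   \<open>cmod (d k t) \<le> (1/2) ^ k\<close> from some \<open>k\<close> on.\<close>
 have "\<exists>n. sqn (\<lambda>t. f t - fn n t) \<le> ennreal ((1/8) ^ k)" for k :: nat
 proof -
  have "\<forall>\<^sub>F n in sequentially. sqn (\<lambda>t. f t - fn n t) < ennreal ((1/8) ^ k)"
   using lim by (rule order_tendstoD) simp
  then show ?thesis by (metis (mono_tags) eventually_happens less_imp_le sequentially_bot)
 qed
 then obtain s where s: "\<And>k. sqn (\<lambda>t. f t - fn (s k) t) \<le> ennreal ((1/8) ^ k)" by metis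
 define u where "u k = fn (s k)" for k
 have [measurable]: "u k \<in> borel_measurable borel" for k by (simp add: u_def)
 have ui: "integrable lborel (u k)" for k by (simp add: u_def fni)
 have [measurable]: "fourier (u k) \<in> borel_measurable borel" for k by (rule borel_measurable_fourier[OF ui])
 have cauchy: "sqn (\<lambda>t. fourier (u j) t - fourier (u k) t) \<le> ennreal (4 * (1/8) ^ k)" if "k \<le> j" for j k
 proof -
  have "sqn (\<lambda>t. fourier (u j) t - fourier (u k) t) = sqn (fourier (\<lambda>t. u j t - u k t))"
   by (simp only: fourier_diff[OF ui ui, symmetric])
  also have "... \<le> sqn (\<lambda>t. u j t - u k t)" by (intro fourier_bessel Bochner_Integration.integrable_diff ui)
  also have "... = sqn (\<lambda>t. (u j t - f t) + (f t - u k t))" by simp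
  also have "... \<le> ennreal (2 * ((1/8) ^ k + (1/8) ^ k))"
  proof (rule sqn_add_le_ennreal)
   have "sqn (\<lambda>t. u j t - f t) \<le> ennreal ((1/8) ^ j)" using s[of j] by (simp add: u_def sqn_diff_commute[of _ f])
   also have "... \<le> ennreal ((1/8) ^ k)" using that by (intro ennreal_leI power_decreasing) auto
   finally show "sqn (\<lambda>t. u j t - f t) \<le> ennreal ((1/8) ^ k)" .
   show "sqn (\<lambda>t. f t - u k t) \<le> ennreal ((1/8) ^ k)" using s[of k] by (simp add: u_def)
  qed auto
  finally show ?thesis by simp
 qed
 define d where "d k t = fourier (u (Suc k)) t - fourier (u k) t" for k t
 have [measurable]: "d k \<in> borel_measurable borel" for k unfolding d_def by measurable
 have "(\<integral>\<^sup>+t. (\<Sum>k. ennreal (4 ^ k * (cmod (d k t))\<^sup>2)) \<partial>lborel) = (\<Sum>k. \<integral>\<^sup>+t. ennreal (4 ^ k * (cmod (d k t))\<^sup>2) \<partial>lborel)"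
  by (rule nn_integral_suminf) simp
 also have "... \<le> (\<Sum>k. ennreal (4 * (1/2) ^ k))"
 proof (intro suminf_le allI)
  fix k
  have "(\<integral>\<^sup>+t. ennreal (4 ^ k * (cmod (d k t))\<^sup>2) \<partial>lborel) = ennreal (4 ^ k) * sqn (d k)"
   unfolding sqn_def by (subst nn_integral_cmult[symmetric]) (simp_all add: ennreal_mult)
  also have "... \<le> ennreal (4 ^ k) * ennreal (4 * (1/8) ^ k)"
   unfolding d_def by (intro mult_left_mono cauchy) auto
  also have "... = ennreal (4 * (1/2) ^ k)"
   by (simp add: power_divide flip: ennreal_mult power_mult_distrib) (simp add: field_simps flip: power_mult_distrib)
  finally show "(\<integral>\<^sup>+t. ennreal (4 ^ k * (cmod (d k t))\<^sup>2) \<partial>lborel) \<le> ennreal (4 * (1/2) ^ k)" .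
 qed auto
 also have "... = ennreal (\<Sum>k. 4 * (1/2) ^ k)"
  by (rule suminf_ennreal2) (auto intro!: summable_mult summable_geometric)
 also have "... < \<infinity>" by simp
 finally have "AE t in lborel. (\<Sum>k. ennreal (4 ^ k * (cmod (d k t))\<^sup>2)) \<noteq> \<infinity>"
  by (intro nn_integral_PInf_AE) auto
 then have conv: "AE t in lborel. convergent (\<lambda>k. fourier (u k) t)"
 proof eventually_elim
  case (elim t)
  have "summable (\<lambda>k. 4 ^ k * (cmod (d k t))\<^sup>2)"
   using elim by (intro summable_suminf_not_top) auto
  then have "(\<lambda>k. 4 ^ k * (cmod (d k t))\<^sup>2) \<longlonglongrightarrow> 0" by (rule summable_LIMSEQ_zero)
  then have "\<forall>\<^sub>F k in sequentially. 4 ^ k * (cmod (d k t))\<^sup>2 < 1" by (rule order_tendstoD) simp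
  then have "\<forall>\<^sub>F k in sequentially. norm (d k t) \<le> (1/2) ^ k"
  proof eventually_elim
   case (elim k)
   have "(cmod (d k t))\<^sup>2 \<le> ((1/2) ^ k)\<^sup>2"
    using elim by (simp add: field_simps power2_eq_square flip: power_mult_distrib)
   then show ?case by (rule power2_le_imp_le) simp
  qed
  then have "summable (\<lambda>k. d k t)"
   by (rule summable_comparison_test_ev) (simp add: summable_geometric)
  then have "convergent (\<lambda>n. \<Sum>k<n. d k t)" by (simp add: summable_iff_convergent)
  moreover have "(\<Sum>k<n. d k t) = fourier (u n) t - fourier (u 0) t" for n
   unfolding d_def by (rule sum_lessThan_telescope)
  ultimately have "convergent (\<lambda>n. fourier (u n) t - fourier (u 0) t)" by simp
  then show ?case by (simp add: convergent_diff_const_right_iff)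
 qed
 define F where "F t = lim (\<lambda>k. fourier (u k) t)" for t
 have [measurable]: "F \<in> borel_measurable borel" unfolding F_def by measurable
 have close: "sqn (\<lambda>t. F t - fourier (u k) t) \<le> ennreal (4 * (1/8) ^ k)" for k
 proof -
  have "sqn (\<lambda>t. F t - fourier (u k) t) = (\<integral>\<^sup>+t. liminf (\<lambda>j. ennreal ((cmod (fourier (u j) t - fourier (u k) t))\<^sup>2)) \<partial>lborel)"
   unfolding sqn_def
  proof (intro nn_integral_cong_AE)
   show "AE t in lborel. ennreal ((cmod (F t - fourier (u k) t))\<^sup>2) = liminf (\<lambda>j. ennreal ((cmod (fourier (u j) t - fourier (u k) t))\<^sup>2))"
    using conv
   proof eventually_elim
    case (elim t)
    then have "(\<lambda>j. fourier (u j) t) \<longlonglongrightarrow> F t" unfolding F_def by (simp add: convergent_LIMSEQ_iff)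
    then have "(\<lambda>j. ennreal ((cmod (fourier (u j) t - fourier (u k) t))\<^sup>2)) \<longlonglongrightarrow> ennreal ((cmod (F t - fourier (u k) t))\<^sup>2)"
     by (intro tendsto_intros)
    then show ?case by (rule lim_imp_Liminf[OF sequentially_bot, symmetric])
   qed
  qed
  also have "... \<le> liminf (\<lambda>j. sqn (\<lambda>t. fourier (u j) t - fourier (u k) t))"
   unfolding sqn_def by (rule nn_integral_liminf) simp
  also have "... \<le> liminf (\<lambda>j. ennreal (4 * (1/8) ^ k))"
   by (intro Liminf_mono eventually_mono[OF eventually_ge_at_top[of k]] cauchy)
  finally show ?thesis by (simp add: Liminf_const)
 qed
 have "fourier_rel f F"
  unfolding fourier_rel_def
 proof (intro conjI allI impI)
  fix e :: real assume e: "e > 0"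
  have "(\<lambda>k. 4 * (1/8) ^ k) \<longlonglongrightarrow> (4 * 0 :: real)"
   by (intro tendsto_intros LIMSEQ_realpow_zero) auto
  then have "\<forall>\<^sub>F k in sequentially. 4 * (1/8) ^ k < e" by (rule order_tendstoD) (use e in simp)
  then obtain k where k: "4 * (1/8) ^ k < e" by (metis (mono_tags) eventually_happens sequentially_bot)
  have "(0::real) \<le> (1/8) ^ k" by simp
  then have "(1/8) ^ k \<le> e" using k by linarith
  then have "sqn (\<lambda>t. f t - u k t) \<le> ennreal e"
   by (intro order.trans[OF s[of k, folded u_def]] ennreal_leI)
  moreover have "sqn (\<lambda>t. F t - fourier (u k) t) \<le> ennreal e"
   by (rule order.trans[OF close]) (use k in \<open>auto intro!: ennreal_leI\<close>)
  ultimately show "\<exists>u. integrable lborel u \<and> sqn (\<lambda>t. f t - u t) \<le> ennreal e \<and> sqn (\<lambda>t. F t - fourier u t) \<le> ennreal e"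
   using ui by blast
 qed auto
 then show ?thesis by (rule that)
qed

section \<open>Relations between at most three points\<close>

lemma AE_lborel_uminus:
 fixes P :: "real \<Rightarrow> bool"
 assumes "AE t in lborel. P t"
 shows "AE t in lborel. P (- t)"
proof (rule AE_distrD[of uminus lborel borel])
 show "AE t in distr lborel borel uminus. P t" unfolding lborel_distr_uminus by (rule assms)
qed simp

lemma cis_period_quotient:
 fixes u v :: real
 assumes "u \<noteq> v"
 shows "cis ((v - u) * (2 * pi * (of_int k * (1 / \<bar>v - u\<bar>)))) = 1"
proof -
 have "(v - u) * (2 * pi * (of_int k * (1 / \<bar>v - u\<bar>))) = 2 * pi * of_int (if v > u then k else - k)"
  using assms by (simp add: field_simps)
 then show ?thesis by (simp only: cis_multiple_2pi Ints_of_int)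
qed

text \<open>One of the two lines carries a single point, so that \<open>|g(t - x2)|\<^sup>2\<close> is a
 periodic multiple of \<open>|g(t - x1)|\<^sup>2\<close>.\<close>

lemma two_lines_core:
 fixes g :: "real \<Rightarrow> complex" and U :: "real set"
 assumes [measurable]: "g \<in> borel_measurable borel" and fin: "sqn g < \<infinity>"
  and U: "finite U" "U \<noteq> {}" "card U \<le> 2" "\<forall>u\<in>U. c u \<noteq> 0" and d: "d \<noteq> 0" and x: "x1 \<noteq> x2"
  and rel: "AE t in lborel. (\<Sum>u\<in>U. c u * cis (2 * pi * u * t)) * g (t - x1) + d * cis (2 * pi * w * t) * g (t - x2) = 0"
 shows "AE t in lborel. g t = 0"
proof -
 define P where "P t = (\<Sum>u\<in>U. c u * cis (2 * pi * u * t))" for t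
 define p where "p t = (cmod (P t))\<^sup>2 / (cmod d)\<^sup>2" for t
 have [measurable]: "P \<in> borel_measurable borel" unfolding P_def
  by (intro borel_measurable_continuous_onI continuous_intros)
 have [measurable]: "p \<in> borel_measurable borel" unfolding p_def by measurable
 obtain b where b: "b > 0" "\<And>t k. p (t + of_int k * b) = p t"
 proof (cases "\<exists>u. U = {u}")
  case True
  then obtain u where "U = {u}" by blast
  \<comment> \<open>A single exponential has constant modulus, so any period serves.\<close>
  then have "p (t + of_int k * 1) = p t" for t k by (simp add: p_def P_def norm_mult)
  then show ?thesis using that[of 1] by auto
 next
  case False
  then have "card U = 2" using U card_1_singleton_iff[of U] by (cases "card U") (auto simp: card_eq_0_iff le_Suc_eq numeral_2_eq_2)
  then obtain u v where uv: "U = {u, v}" "u \<noteq> v" unfolding card_2_iff by blast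
  define b where "b = 1 / \<bar>v - u\<bar>"
  \<comment> \<open>Taking out one exponential leaves a function of \<open>(v - u) * t\<close>
    alone, of period \<open>1 / \<bar>v - u\<bar>\<close>.\<close>
  have eq: "cmod (P t) = cmod (c u + c v * cis (2 * pi * (v - u) * t))" for t
  proof -
   have e: "cis (2 * pi * v * t) = cis (2 * pi * u * t) * cis (2 * pi * (v - u) * t)"
    by (simp add: cis_mult algebra_simps)
   have "P t = c u * cis (2 * pi * u * t) + c v * cis (2 * pi * v * t)"
    using uv by (simp add: P_def)
   also have "... = cis (2 * pi * u * t) * (c u + c v * cis (2 * pi * (v - u) * t))"
    unfolding e by (simp add: algebra_simps)
   finally have "P t = cis (2 * pi * u * t) * (c u + c v * cis (2 * pi * (v - u) * t))" .
   then show ?thesis by (simp add: norm_mult)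
  qed
  have "cis (2 * pi * (v - u) * (t + of_int k * b)) = cis (2 * pi * (v - u) * t)" for t k
  proof -
   have "2 * pi * (v - u) * (t + of_int k * b) = 2 * pi * (v - u) * t + (v - u) * (2 * pi * (of_int k * b))"
    by (simp add: algebra_simps)
   then show ?thesis using cis_period_quotient[OF uv(2), of k, folded b_def] by (simp only: cis_mult[symmetric] mult_1_right)
  qed
  then show ?thesis using that[of b] uv(2) by (simp add: p_def eq b_def)
 qed
 have pos: "AE t in lborel. 0 < p t"
 proof -
  have inj: "inj_on (\<lambda>u. 2 * pi * u) U" by (auto simp: inj_on_def)
  have P: "P t = trig_poly (\<lambda>u. c (u / (2 * pi))) ((\<lambda>u. 2 * pi * u) ` U) t" for t
   unfolding P_def trig_poly_def by (subst sum.reindex[OF inj]) (simp add: o_def)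
  have "AE t in lborel. P t \<noteq> 0"
   unfolding P by (rule trig_poly_AE_nonzero) (use U in auto)
  then show ?thesis by eventually_elim (use d in \<open>simp add: p_def\<close>)
 qed
 have rel': "AE t in lborel. (cmod (g (t + (x1 - x2))))\<^sup>2 = p (t + x1) * (cmod (g t))\<^sup>2"
  using AE_lborel_shift[OF rel, of x1]
 proof eventually_elim
  case (elim t)
  then have "d * cis (2 * pi * w * (t + x1)) * g (t + (x1 - x2)) = - (P (t + x1) * g t)"
   by (simp add: P_def eq_neg_iff_add_eq_0 add.commute add_diff_eq)
  then have "cmod (d * cis (2 * pi * w * (t + x1)) * g (t + (x1 - x2))) = cmod (P (t + x1) * g t)" by simp
  then have "cmod d * cmod (g (t + (x1 - x2))) = cmod (P (t + x1)) * cmod (g t)" by (simp add: norm_mult)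
  then have "(cmod d)\<^sup>2 * (cmod (g (t + (x1 - x2))))\<^sup>2 = (cmod (P (t + x1)))\<^sup>2 * (cmod (g t))\<^sup>2"
   by (simp flip: power_mult_distrib)
  then show ?case using d by (simp add: p_def field_simps)
 qed
 show ?thesis
 proof (cases "x1 > x2")
  case True
  show ?thesis
  proof (rule two_lines_zero[where a = "x1 - x2" and b = b and p = "\<lambda>t. p (t + x1)"])
   show "p (t + of_int k * b + x1) = p (t + x1)" for t k using b(2)[of "t + x1" k] by (simp add: algebra_simps)
   show "AE t in lborel. 0 < p (t + x1)" by (rule AE_lborel_shift[OF pos])
  qed (use True b rel' fin in \<open>simp_all add: sqn_def\<close>)
 next
  case False
  \<comment> \<open>Reflection makes the step between the two lines positive.\<close>
  have "AE t in lborel. g (- t) = 0"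
  proof (rule two_lines_zero[where a = "x2 - x1" and b = b and p = "\<lambda>t. p (x1 - t)"])
   show "p (x1 - (t + of_int k * b)) = p (x1 - t)" for t k using b(2)[of "x1 - t" "- k"] by (simp add: algebra_simps)
   show "AE t in lborel. 0 < p (x1 - t)" using AE_lborel_uminus[OF AE_lborel_shift[OF pos, of x1]] by simp
   show "AE t in lborel. (cmod (g (- (t + (x2 - x1)))))\<^sup>2 = p (x1 - t) * (cmod (g (- t)))\<^sup>2"
    using AE_lborel_uminus[OF rel'] by (simp add: algebra_simps)
   have "sqn (\<lambda>t. g (- t)) = sqn g"
    unfolding sqn_def by (subst (2) nn_integral_real_affine[of _ "-1" 0]) simp_all
   then show "(\<integral>\<^sup>+t. (cmod (g (- t)))\<^sup>2 \<partial>lborel) < \<infinity>" using fin by (simp add: sqn_def)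
  qed (use False b x in simp_all)
  then show ?thesis using AE_lborel_uminus[of "\<lambda>t. g (- t) = 0"] by simp
 qed
qed

text \<open>By counting, three points on two lines leave a single point on one of them. If all
  points lie on one line, the relation is a trigonometric polynomial times a translate of
  \<open>g\<close>, and the polynomial is nonzero almost everywhere.\<close>

lemma two_lines_independent:
 fixes g :: "real \<Rightarrow> complex" and L :: "(real \<times> real) set"
 assumes g: "g \<in> borel_measurable borel" "sqn g < \<infinity>"
  and L: "finite L" "L \<noteq> {}" "card L \<le> 3" "card (fst ` L) \<le> 2" and d: "\<And>z. z \<in> L ==> d z \<noteq> 0"
  and rel: "AE t in lborel. (\<Sum>z\<in>L. d z * (cis (2 * pi * snd z * t) * g (t - fst z))) = 0"
 shows "AE t in lborel. g t = 0"
proof -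
 define V where "V x = {w. (x, w) \<in> L}" for x
 have V: "finite (V x)" for x
  by (rule finite_subset[of _ "snd ` L"]) (use L in \<open>force simp: V_def\<close>)+
 have fib: "{z \<in> L. fst z = x} = Pair x ` V x" for x by (auto simp: V_def)
 have part: "(\<Sum>z\<in>L. d z * (cis (2 * pi * snd z * t) * g (t - fst z)))
   = (\<Sum>x\<in>fst ` L. (\<Sum>w\<in>V x. d (x, w) * cis (2 * pi * w * t)) * g (t - x))" for t
 proof -
  have "(\<Sum>z\<in>L. d z * (cis (2 * pi * snd z * t) * g (t - fst z)))
    = (\<Sum>x\<in>fst ` L. \<Sum>z\<in>{z \<in> L. fst z = x}. d z * (cis (2 * pi * snd z * t) * g (t - fst z)))"
   by (rule sum.image_gen[OF L(1)])
  also have "... = (\<Sum>x\<in>fst ` L. (\<Sum>w\<in>V x. d (x, w) * cis (2 * pi * w * t)) * g (t - x))"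
  proof (rule sum.cong[OF refl])
   fix x
   have "inj_on (Pair x) (V x)" by (auto simp: inj_on_def)
   then show "(\<Sum>z\<in>{z \<in> L. fst z = x}. d z * (cis (2 * pi * snd z * t) * g (t - fst z)))
     = (\<Sum>w\<in>V x. d (x, w) * cis (2 * pi * w * t)) * g (t - x)"
    unfolding fib by (subst sum.reindex) (simp_all add: sum_distrib_right sum_distrib_left mult_ac)
  qed
  finally show ?thesis .
 qed
 have ne: "V x \<noteq> {}" if "x \<in> fst ` L" for x using that by (auto simp: V_def)
 have dn: "\<forall>w\<in>V x. d (x, w) \<noteq> 0" for x using d by (auto simp: V_def)
 have cardL: "card L = (\<Sum>x\<in>fst ` L. card (V x))"
 proof -
  have "card L = (\<Sum>x\<in>fst ` L. card {z \<in> L. fst z = x})"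
   using sum.image_gen[OF L(1), of "\<lambda>_. 1::nat" fst] by simp
  then show ?thesis unfolding fib by (simp add: card_image inj_on_def)
 qed
 have "card (fst ` L) = 1 \<or> card (fst ` L) = 2"
  using L by (cases "card (fst ` L)") (auto simp: card_eq_0_iff)
 then show ?thesis
 proof
  assume "card (fst ` L) = 1"
  then obtain x where x: "fst ` L = {x}" using card_1_singletonE by blast
  define P where "P t = (\<Sum>w\<in>V x. d (x, w) * cis (2 * pi * w * t))" for t
  have "AE t in lborel. P t \<noteq> 0"
  proof -
   have inj: "inj_on (\<lambda>u. 2 * pi * u) (V x)" by (auto simp: inj_on_def)
   have P: "P t = trig_poly (\<lambda>u. d (x, u / (2 * pi))) ((\<lambda>u. 2 * pi * u) ` V x) t" for t
    unfolding P_def trig_poly_def by (subst sum.reindex[OF inj]) (simp add: o_def)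
   show ?thesis unfolding P by (rule trig_poly_AE_nonzero) (use V ne x dn in auto)
  qed
  with rel have "AE t in lborel. g (t - x) = 0"
   by eventually_elim (simp add: part x P_def)
  then show ?thesis using AE_lborel_shift[of "\<lambda>t. g (t - x) = 0" x] by simp
 next
  assume "card (fst ` L) = 2"
  then obtain x1 x2 where x: "fst ` L = {x1, x2}" "x1 \<noteq> x2" unfolding card_2_iff by blast
  have core: ?thesis if y: "y1 \<noteq> y2" "fst ` L = {y1, y2}" and c: "card (V y2) = 1" for y1 y2
  proof -
   obtain w where w: "V y2 = {w}" using c card_1_singletonE by blast
   have "card (V y1) \<le> 2" using cardL y c L(3) by simp
   moreover have R: "AE t in lborel. (\<Sum>u\<in>V y1. d (y1, u) * cis (2 * pi * u * t)) * g (t - y1)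
     + d (y2, w) * cis (2 * pi * w * t) * g (t - y2) = 0"
    using rel unfolding part y(2) using y(1) w by simp
   moreover have "d (y2, w) \<noteq> 0" using dn[of y2] w by simp
   ultimately show ?thesis
    using two_lines_core[where g = g and U = "V y1" and c = "\<lambda>u. d (y1, u)" and d = "d (y2, w)" and w = w,
      OF g V _ _ _ _ y(1) R] ne[of y1] dn[of y1] y by simp
  qed
  have "card (V x1) + card (V x2) \<le> 3" using cardL x L(3) by simp
  moreover have "card (V x1) > 0" "card (V x2) > 0" using V ne x by (auto simp: card_gt_0_iff)
  ultimately have "card (V x1) = 1 \<or> card (V x2) = 1" by linarith
  then show ?thesis using core[of x1 x2] core[of x2 x1] x by auto
 qed
qed

text \<open>Completing the square. In phase space, multiplication by the chirp is the shear that
  sends \<open>(x, w)\<close> to \<open>(x, w + q * x)\<close>.\<close>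

lemma cis_chirp:
 "cis (pi * q * t\<^sup>2) * (cis (2 * pi * w * t) * a) = cis (2 * pi * (w + q * x) * t) * (cis (- (pi * q * x\<^sup>2)) * (cis (pi * q * (t - x)\<^sup>2) * a))"
proof -
 have "pi * q * t\<^sup>2 + 2 * pi * w * t = 2 * pi * (w + q * x) * t + (- (pi * q * x\<^sup>2)) + pi * q * (t - x)\<^sup>2"
  by (simp add: power2_diff algebra_simps)
 then have "cis (pi * q * t\<^sup>2) * cis (2 * pi * w * t) = cis (2 * pi * (w + q * x) * t) * cis (- (pi * q * x\<^sup>2)) * cis (pi * q * (t - x)\<^sup>2)"
  by (simp only: cis_mult)
 then show ?thesis by (simp only: mult.assoc[symmetric])
qed

text \<open>A chirp makes two of the three frequencies equal, and the Fourier transform then turns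
 this into a relation on two lines.\<close>

lemma three_points_independent:
 fixes g :: "real \<Rightarrow> complex" and L :: "(real \<times> real) set"
 assumes g [measurable]: "g \<in> borel_measurable borel" and fin: "sqn g < \<infinity>"
  and L: "finite L" "L \<noteq> {}" "card L \<le> 3" and d: "\<And>z. z \<in> L ==> d z \<noteq> 0"
  and rel: "AE t in lborel. (\<Sum>z\<in>L. d z * (cis (2 * pi * snd z * t) * g (t - fst z))) = 0"
 shows "AE t in lborel. g t = 0"
proof (cases "card (fst ` L) \<le> 2")
 case True
 then show ?thesis using two_lines_independent[OF g fin L _ d rel] by simp
next
 case False
 then have c3: "card L = 3" "card (fst ` L) = 3" using card_image_le[OF L(1), of fst] L(3) by auto
 then have inj: "inj_on fst L" using L(1) by (simp add: eq_card_imp_inj_on)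
 obtain z1 z2 where z: "z1 \<in> L" "z2 \<in> L" "z1 \<noteq> z2"
  using c3(1) by (auto simp: card_3_iff)
 then have xne: "fst z1 \<noteq> fst z2" using inj by (auto simp: inj_on_def)
 \<comment> \<open>Minus the slope of the line through \<open>z1\<close> and \<open>z2\<close>, so
   that the shear makes this line horizontal.\<close>
 define q where "q = - (snd z1 - snd z2) / (fst z1 - fst z2)"
 define W where "W z = snd z + q * fst z" for z
 have Weq: "W z1 = W z2" using xne by (simp add: W_def q_def field_simps)
 define h where "h t = cis (pi * q * t\<^sup>2) * g t" for t
 have [measurable]: "(\<lambda>t. cis (pi * q * t\<^sup>2)) \<in> borel_measurable borel"
  by (intro borel_measurable_continuous_onI continuous_intros)
 have hm [measurable]: "h \<in> borel_measurable borel" unfolding h_def by measurable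
 have hfin: "sqn h < \<infinity>" using fin by (simp add: sqn_def h_def norm_mult)
 define D where "D z = d z * cis (- (pi * q * (fst z)\<^sup>2))" for z
 have relh: "AE t in lborel. (\<Sum>z\<in>L. D z * (cis (2 * pi * W z * t) * h (t - fst z))) = 0"
  using rel
 proof eventually_elim
  case (elim t)
  have "(\<Sum>z\<in>L. D z * (cis (2 * pi * W z * t) * h (t - fst z)))
    = (\<Sum>z\<in>L. cis (pi * q * t\<^sup>2) * (d z * (cis (2 * pi * snd z * t) * g (t - fst z))))"
  proof (rule sum.cong[OF refl])
   fix z
   show "D z * (cis (2 * pi * W z * t) * h (t - fst z)) = cis (pi * q * t\<^sup>2) * (d z * (cis (2 * pi * snd z * t) * g (t - fst z)))"
    using cis_chirp[of q t "snd z" "g (t - fst z)" "fst z"] unfolding D_def h_def W_def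
    by (simp only: mult.assoc mult.left_commute[of _ "d z"]) (simp only: mult.left_commute)
  qed
  also have "... = 0" using elim by (simp flip: sum_distrib_left)
  finally show ?case .
 qed
 obtain F where F: "fourier_rel h F" using fourier_rel_exists[OF hm hfin] .
 have Fm [measurable]: "F \<in> borel_measurable borel" using F by (simp add: fourier_rel_def)
 have Ffin: "sqn F < \<infinity>"
 proof -
  obtain u where u: "integrable lborel u" "sqn (\<lambda>t. h t - u t) \<le> ennreal 1" "sqn (\<lambda>t. F t - fourier u t) \<le> ennreal 1"
   using fourier_relD[OF F zero_less_one] .
  note [measurable] = borel_measurable_fourier[OF u(1)]
  have [measurable]: "u \<in> borel_measurable borel" using u(1) by auto
  have "sqn u \<le> 2 * (sqn h + sqn (\<lambda>t. - (h t - u t)))"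
   using sqn_add_le[of h "\<lambda>t. - (h t - u t)"] by simp
  also have "sqn (\<lambda>t. - (h t - u t)) = sqn (\<lambda>t. h t - u t)" by (simp add: sqn_def norm_minus_commute)
  also have "2 * (sqn h + sqn (\<lambda>t. h t - u t)) \<le> 2 * (sqn h + ennreal 1)"
   using u(2) by (intro mult_left_mono add_left_mono) auto
  also have "... < \<infinity>" using hfin by (simp add: ennreal_mult_less_top)
  finally have "sqn (fourier u) < \<infinity>" using fourier_bessel[OF u(1)] by (rule order.strict_trans1[rotated])
  have "sqn F \<le> 2 * (sqn (\<lambda>t. F t - fourier u t) + sqn (fourier u))"
   using sqn_add_le[of "\<lambda>t. F t - fourier u t" "fourier u"] by simp
  also have "... \<le> 2 * (ennreal 1 + sqn (fourier u))"
   using u(3) by (intro mult_left_mono add_right_mono) auto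
  also have "... < \<infinity>" using \<open>sqn (fourier u) < \<infinity>\<close> by (simp add: ennreal_mult_less_top)
  finally show ?thesis .
 qed
 have "fourier_rel (\<lambda>t. \<Sum>z\<in>L. D z * (cis (2 * pi * W z * t) * h (t - fst z)))
   (\<lambda>xi. \<Sum>z\<in>L. D z * (cis (2 * pi * (W z - xi) * fst z) * F (xi - W z)))"
  by (intro fourier_rel_sum fourier_rel_cmult fourier_rel_shift F L)
 from fourier_rel_zero_left[OF this relh]
 have relF: "AE xi in lborel. (\<Sum>z\<in>L. D z * (cis (2 * pi * (W z - xi) * fst z) * F (xi - W z))) = 0" .
 \<comment> \<open>The rotation by the Fourier transform; after it the equality
   \<open>W z1 = W z2\<close> leaves at most two first coordinates.\<close>
 define m where "m z = (W z, - fst z)" for z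
 have injm: "inj_on m L" using inj by (auto simp: inj_on_def m_def)
 define E where "E y = D (- snd y, fst y + q * snd y) * cis (- (2 * pi * fst y * snd y))" for y
 have Em: "E (m z) = D z * cis (2 * pi * W z * fst z)" for z
  by (simp add: E_def m_def W_def)
 have "AE xi in lborel. F xi = 0"
 proof (rule two_lines_independent[OF Fm Ffin, of "m ` L" E])
  show "finite (m ` L)" "m ` L \<noteq> {}" using L by auto
  show "card (m ` L) \<le> 3" using card_image_le[OF L(1), of m] L(3) by linarith
  have "W ` L = insert (W z1) (W ` (L - {z1}))" using z by (metis image_insert insert_Diff)
  moreover have "W z1 \<in> W ` (L - {z1})" using z Weq by auto
  ultimately have "fst ` m ` L = W ` (L - {z1})" by (simp add: m_def image_image insert_absorb)
  also have "card ... \<le> card (L - {z1})" by (rule card_image_le) (use L in simp)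
  also have "... = 2" using c3 z L by simp
  finally show "card (fst ` m ` L) \<le> 2" .
  show "E y \<noteq> 0" if "y \<in> m ` L" for y using that d by (auto simp: Em D_def)
  show "AE t in lborel. (\<Sum>y\<in>m ` L. E y * (cis (2 * pi * snd y * t) * F (t - fst y))) = 0"
   using relF
  proof eventually_elim
   case (elim t)
   have "(\<Sum>y\<in>m ` L. E y * (cis (2 * pi * snd y * t) * F (t - fst y)))
     = (\<Sum>z\<in>L. E (m z) * (cis (2 * pi * snd (m z) * t) * F (t - fst (m z))))"
    by (subst sum.reindex[OF injm]) (simp add: o_def)
   also have "... = (\<Sum>z\<in>L. D z * (cis (2 * pi * (W z - t) * fst z) * F (t - W z)))"
   proof (rule sum.cong[OF refl])
    fix z
    have "2 * pi * (W z - t) * fst z = 2 * pi * W z * fst z + 2 * pi * snd (m z) * t"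
     by (simp add: m_def algebra_simps)
    then have "cis (2 * pi * (W z - t) * fst z) = cis (2 * pi * W z * fst z) * cis (2 * pi * snd (m z) * t)"
     by (simp only: cis_mult)
    then show "E (m z) * (cis (2 * pi * snd (m z) * t) * F (t - fst (m z))) = D z * (cis (2 * pi * (W z - t) * fst z) * F (t - W z))"
     unfolding Em by (simp add: m_def)
   qed
   finally show ?case using elim by simp
  qed
 qed
 then have "AE t in lborel. h t = 0" by (rule fourier_rel_zero_right[OF F hfin])
 then show ?thesis by eventually_elim (simp add: h_def)
qed

theorem gabor_three_points:
 assumes g: "g \<in> L2" and \<Lambda>: "finite \<Lambda>" "card \<Lambda> \<le> 3" and dep: "L2_lin_dependent (gabor_system g) \<Lambda>"
 shows "L2_zero g"
proof -
 obtain c where c: "\<exists>z\<in>\<Lambda>. c z \<noteq> 0" "AE t in lebesgue. (\<Sum>z\<in>\<Lambda>. c z * weyl_shift z g t) = 0"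
  using dep unfolding L2_lin_dependent_def L2_zero_def gabor_system_def by blast
 have gm: "g \<in> borel_measurable (completion lborel)" and gi: "integrable lebesgue (\<lambda>t. (cmod (g t))\<^sup>2)"
  using g by (auto simp: L2_def)
 have "(\<lambda>t. Re (g t)) \<in> borel_measurable (completion lborel)" using gm by measurable
 from completion_ex_borel_measurable_real[OF this]
 obtain u where u [measurable]: "u \<in> borel_measurable lborel" and u': "AE t in lborel. Re (g t) = u t" by blast
 have "(\<lambda>t. Im (g t)) \<in> borel_measurable (completion lborel)" using gm by measurable
 from completion_ex_borel_measurable_real[OF this]
 obtain v where v [measurable]: "v \<in> borel_measurable lborel" and v': "AE t in lborel. Im (g t) = v t" by blast
 \<comment> \<open>A Borel measurable representative of \<open>g\<close>, assembled from those of
   the real and the imaginary part.\<close>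
 define f where "f t = Complex (u t) (v t)" for t
 have fu: "f = (\<lambda>t. complex_of_real (u t) + \<i> * complex_of_real (v t))" by (auto simp: f_def complex_eq_iff)
 have fm [measurable]: "f \<in> borel_measurable borel" unfolding fu using u v by measurable
 have gf: "AE t in lborel. g t = f t"
  using u' v' by eventually_elim (simp add: f_def complex_eq_iff)
 have "sqn f = (\<integral>\<^sup>+t. ennreal ((cmod (f t))\<^sup>2) \<partial>lebesgue)"
  unfolding sqn_def by (rule nn_integral_completion[symmetric])
 also have "... = (\<integral>\<^sup>+t. ennreal ((cmod (g t))\<^sup>2) \<partial>lebesgue)"
  by (rule nn_integral_cong_AE) (use AE_completion[OF gf] in eventually_elim, simp)
 also have "... < \<infinity>" using gi by (simp add: integrable_iff_bounded)
 finally have fin: "sqn f < \<infinity>" .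
 define L where "L = {z\<in>\<Lambda>. c z \<noteq> 0}"
 define d where "d z = c z * cis (- pi * fst z * snd z)" for z
 have "AE t in lborel. \<forall>z\<in>L. g (t - fst z) = f (t - fst z)"
 proof (rule AE_finite_allI)
  show "finite L" using \<Lambda> by (simp add: L_def)
  fix z
  show "AE t in lborel. g (t - fst z) = f (t - fst z)" using AE_lborel_shift[OF gf, of "- fst z"] by simp
 qed
 moreover have "AE t in lborel. (\<Sum>z\<in>\<Lambda>. c z * weyl_shift z g t) = 0"
  using c(2) by (simp only: AE_completion_iff)
 ultimately have "AE t in lborel. (\<Sum>z\<in>L. d z * (cis (2 * pi * snd z * t) * f (t - fst z))) = 0"
 proof eventually_elim
  case (elim t)
  have "(\<Sum>z\<in>L. d z * (cis (2 * pi * snd z * t) * f (t - fst z))) = (\<Sum>z\<in>L. c z * weyl_shift z g t)"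
   using elim(1) by (intro sum.cong refl) (simp add: d_def weyl_shift_cis mult.assoc)
  also have "... = (\<Sum>z\<in>\<Lambda>. c z * weyl_shift z g t)"
   by (rule sum.mono_neutral_left) (use \<Lambda> in \<open>auto simp: L_def\<close>)
  finally show ?case using elim(2) by simp
 qed
 then have "AE t in lborel. f t = 0"
 proof (rule three_points_independent[OF fm fin, rotated -1])
  show "finite L" "L \<noteq> {}" using \<Lambda> c(1) by (auto simp: L_def)
  have "card L \<le> card \<Lambda>" by (rule card_mono) (use \<Lambda> in \<open>auto simp: L_def\<close>)
  then show "card L \<le> 3" using \<Lambda> by simp
  show "d z \<noteq> 0" if "z \<in> L" for z using that by (simp add: d_def L_def)
 qed
 with gf have "AE t in lborel. g t = 0" by eventually_elim simp
 then show ?thesis unfolding L2_zero_def by (rule AE_completion)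
qed

section \<open>Periodic holomorphic functions of two variables\<close>

definition ee :: "complex \<Rightarrow> complex" where "ee z = exp (2 * pi * \<i> * z)"

lemma ee_add: "ee (z + w) = ee z * ee w" by (simp add: ee_def exp_add[symmetric] algebra_simps)
lemma ee_diff: "ee (z - w) = ee z / ee w" by (simp add: ee_def exp_diff[symmetric] algebra_simps)
lemma ee_minus: "ee (- z) = inverse (ee z)" by (simp add: ee_def exp_minus)
lemma ee_0 [simp]: "ee 0 = 1" by (simp add: ee_def)
lemma ee_nonzero [simp]: "ee z \<noteq> 0" by (simp add: ee_def)
lemma ee_of_int [simp]: "ee (of_int n) = 1"
proof -
 have "ee (of_int n) = exp (2 * of_int n * pi * \<i>)" by (simp add: ee_def mult_ac)
 also have "... = 1" by (rule exp_integer_2pi) simp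
 finally show ?thesis .
qed
lemma ee_1 [simp]: "ee 1 = 1" using ee_of_int[of 1] by simp
lemma norm_ee: "cmod (ee z) = exp (- 2 * pi * Im z)" by (simp add: ee_def)
lemma ee_of_real: "ee (of_real x) = cis (2 * pi * x)" by (simp add: ee_def cis_conv_exp mult_ac)
lemma holomorphic_on_ee [holomorphic_intros]: "f holomorphic_on A ==> (\<lambda>z. ee (f z)) holomorphic_on A"
 unfolding ee_def by (intro holomorphic_intros)
lemma continuous_on_ee [continuous_intros]: "continuous_on A f ==> continuous_on A (\<lambda>z. ee (f z))"
 unfolding ee_def by (intro continuous_intros)
definition strip :: "real \<Rightarrow> complex set" where "strip dlt = {z. \<bar>Im z\<bar> < dlt}"

lemma open_strip: "open (strip dlt)"
proof -
 have "strip dlt = Im -` {-dlt<..<dlt}" by (auto simp: strip_def)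
 then show ?thesis by (simp add: open_vimage continuous_on_Im continuous_on_id)
qed

lemma convex_strip: "convex (strip dlt)"
proof -
 have "strip dlt = Im -` {-dlt<..<dlt}" by (auto simp: strip_def)
 then show ?thesis using convex_linear_vimage[of Im "{-dlt<..<dlt}"] by (simp add: bounded_linear.linear bounded_linear_Im)
qed

lemma strip_add_real [simp]: "z + of_real x \<in> strip dlt \<longleftrightarrow> z \<in> strip dlt" "z - of_real x \<in> strip dlt \<longleftrightarrow> z \<in> strip dlt"
 by (auto simp: strip_def)

lemma of_real_strip [simp]: "dlt > 0 ==> of_real x \<in> strip dlt" by (simp add: strip_def)

text \<open>By Osgood's lemma this is holomorphy in two variables. In this form the theorems on one
  variable apply slice by slice, while joint continuity supplies uniform continuity on compact
  sets.\<close>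

definition hol2 :: "real \<Rightarrow> (complex \<Rightarrow> complex \<Rightarrow> complex) \<Rightarrow> bool" where
 "hol2 dlt f \<longleftrightarrow> continuous_on (strip dlt \<times> strip dlt) (\<lambda>p. f (fst p) (snd p)) \<and>
   (\<forall>k\<in>strip dlt. (\<lambda>x. f x k) holomorphic_on strip dlt) \<and> (\<forall>x\<in>strip dlt. f x holomorphic_on strip dlt)"

lemma hol2_const: "hol2 dlt (\<lambda>x k. c)" by (auto simp: hol2_def intro!: continuous_intros)
lemma hol2_add: "hol2 dlt f ==> hol2 dlt g ==> hol2 dlt (\<lambda>x k. f x k + g x k)"
 by (auto simp: hol2_def intro!: continuous_intros holomorphic_intros)
lemma hol2_diff: "hol2 dlt f ==> hol2 dlt g ==> hol2 dlt (\<lambda>x k. f x k - g x k)"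
 by (auto simp: hol2_def intro!: continuous_intros holomorphic_intros)
lemma hol2_mult: "hol2 dlt f ==> hol2 dlt g ==> hol2 dlt (\<lambda>x k. f x k * g x k)"
 by (auto simp: hol2_def intro!: continuous_intros holomorphic_intros)
lemma hol2_divide:
 "hol2 dlt f ==> hol2 dlt g ==> (\<And>x k. x \<in> strip dlt ==> k \<in> strip dlt ==> g x k \<noteq> 0) ==> hol2 dlt (\<lambda>x k. f x k / g x k)"
 by (auto simp: hol2_def intro!: continuous_intros holomorphic_intros)
lemma hol2_fst: "f holomorphic_on strip dlt ==> hol2 dlt (\<lambda>x k. f x)"
 by (auto simp: hol2_def intro!: continuous_on_compose2[OF holomorphic_on_imp_continuous_on[of f]] continuous_intros)
lemma hol2_snd: "f holomorphic_on strip dlt ==> hol2 dlt (\<lambda>x k. f k)"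
 by (auto simp: hol2_def intro!: continuous_on_compose2[OF holomorphic_on_imp_continuous_on[of f]] continuous_intros)
lemma hol2_compose:
 assumes f: "hol2 dlt f" and g: "g holomorphic_on S" "\<And>x k. x \<in> strip dlt ==> k \<in> strip dlt ==> f x k \<in> S"
 shows "hol2 dlt (\<lambda>x k. g (f x k))"
 using f g unfolding hol2_def
 by (auto intro!: continuous_on_compose2[OF holomorphic_on_imp_continuous_on[OF g(1)]]
   holomorphic_on_compose_gen[OF _ g(1), unfolded o_def])
lemma hol2_shift:
 assumes f: "hol2 dlt f"
 shows "hol2 dlt (\<lambda>x k. f (x - of_real a) (k - of_real b))"
proof -
 have "continuous_on (strip dlt \<times> strip dlt) (\<lambda>p. f (fst (fst p - of_real a, snd p - of_real b)) (snd (fst p - of_real a, snd p - of_real b)))"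
  by (rule continuous_on_compose2[of "strip dlt \<times> strip dlt" "\<lambda>p. f (fst p) (snd p)"])
   (use f in \<open>auto simp: hol2_def intro!: continuous_intros\<close>)
 moreover have "(\<lambda>x. f (x - of_real a) (k - of_real b)) holomorphic_on strip dlt" if "k \<in> strip dlt" for k
  by (rule holomorphic_on_compose_gen[of "\<lambda>x. x - of_real a" _ "\<lambda>x. f x (k - of_real b)" "strip dlt", unfolded o_def])
   (use f that in \<open>auto simp: hol2_def intro!: holomorphic_intros\<close>)
 moreover have "(\<lambda>k. f (x - of_real a) (k - of_real b)) holomorphic_on strip dlt" if "x \<in> strip dlt" for x
  by (rule holomorphic_on_compose_gen[of "\<lambda>x. x - of_real b" _ "f (x - of_real a)" "strip dlt", unfolded o_def])
   (use f that in \<open>auto simp: hol2_def intro!: holomorphic_intros\<close>)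
 ultimately show ?thesis by (auto simp: hol2_def)
qed
lemma hol2_mono: "hol2 dlt f ==> dlt' \<le> dlt ==> hol2 dlt' f"
proof -
 assume f: "hol2 dlt f" and le: "dlt' \<le> dlt"
 have sub: "strip dlt' \<subseteq> strip dlt" using le by (auto simp: strip_def)
 then have "strip dlt' \<times> strip dlt' \<subseteq> strip dlt \<times> strip dlt" by auto
 then show ?thesis using f sub unfolding hol2_def by (meson continuous_on_subset holomorphic_on_subset subsetD)
qed
lemma hol2_swap: "hol2 dlt f ==> hol2 dlt (\<lambda>x k. f k x)"
proof -
 assume f: "hol2 dlt f"
 have "continuous_on (strip dlt \<times> strip dlt) (\<lambda>p. f (fst (snd p, fst p)) (snd (snd p, fst p)))"
  by (rule continuous_on_compose2[of "strip dlt \<times> strip dlt" "\<lambda>p. f (fst p) (snd p)"])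
   (use f in \<open>auto simp: hol2_def intro!: continuous_intros\<close>)
 then show ?thesis using f by (auto simp: hol2_def)
qed

lemma hol2_cong:
 assumes "hol2 dlt f" "\<And>x k. x \<in> strip dlt ==> k \<in> strip dlt ==> g x k = f x k"
 shows "hol2 dlt g"
proof -
 have "continuous_on (strip dlt \<times> strip dlt) (\<lambda>p. g (fst p) (snd p))"
  using assms by (subst continuous_on_cong[OF refl, of _ _ "\<lambda>p. f (fst p) (snd p)"]) (auto simp: hol2_def)
 moreover have "(\<lambda>x. g x k) holomorphic_on strip dlt" if "k \<in> strip dlt" for k
  using assms that by (subst holomorphic_cong[OF refl, of _ _ "\<lambda>x. f x k"]) (auto simp: hol2_def)
 moreover have "g x holomorphic_on strip dlt" if "x \<in> strip dlt" for x
  using assms that by (subst holomorphic_cong[OF refl, of _ _ "f x"]) (auto simp: hol2_def)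
 ultimately show ?thesis by (auto simp: hol2_def)
qed

text \<open>Quasi-periodic functions are unbounded on the strip, so convergence is required to be
  uniform on bounded parts only; small balls and discs suffice for continuity and
  holomorphy.\<close>

lemma hol2_uniform_limit:
 assumes f: "\<And>n. hol2 dlt (f n)"
  and lim: "\<And>M. uniform_limit {p \<in> strip dlt \<times> strip dlt. norm p \<le> M} (\<lambda>n p. f n (fst p) (snd p)) (\<lambda>p. g (fst p) (snd p)) sequentially"
 shows "hol2 dlt g"
proof -
 let ?S = "strip dlt \<times> strip dlt"
 have cont: "continuous_on ?S (\<lambda>p. g (fst p) (snd p))"
 proof -
  have "\<exists>e>0. continuous_on (ball p e \<inter> ?S) (\<lambda>p. g (fst p) (snd p))" if "p \<in> ?S" for p
  proof (intro exI[of _ 1] conjI)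
   have sub: "ball p 1 \<inter> ?S \<subseteq> {q \<in> ?S. norm q \<le> norm p + 1}"
   proof
    fix q assume "q \<in> ball p 1 \<inter> ?S"
    then have "norm (p - q) < 1" "q \<in> ?S" by (auto simp: dist_norm)
    then show "q \<in> {q \<in> ?S. norm q \<le> norm p + 1}"
     using norm_triangle_ineq2[of q p] by (simp add: norm_minus_commute)
   qed
   show "continuous_on (ball p 1 \<inter> ?S) (\<lambda>p. g (fst p) (snd p))"
   proof (rule uniform_limit_theorem[OF always_eventually uniform_limit_on_subset[OF lim sub]])
    show "\<forall>n. continuous_on (ball p 1 \<inter> ?S) (\<lambda>p. f n (fst p) (snd p))"
     using f unfolding hol2_def by (blast intro: continuous_on_subset)
   qed simp
  qed simp
  moreover have "open ?S" by (intro open_Times open_strip)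
  ultimately have "isCont (\<lambda>p. g (fst p) (snd p)) p" if "p \<in> ?S" for p
  proof -
   obtain e where e: "e > 0" "continuous_on (ball p e \<inter> ?S) (\<lambda>p. g (fst p) (snd p))"
    using \<open>\<And>p. p \<in> ?S ==> \<exists>e>0. continuous_on (ball p e \<inter> ?S) (\<lambda>p. g (fst p) (snd p))\<close> \<open>p \<in> ?S\<close> by blast
   have "p \<in> ball p e \<inter> ?S" using e(1) \<open>p \<in> ?S\<close> by simp
   then show ?thesis
    using continuous_on_eq_continuous_at[THEN iffD1, OF open_Int[OF open_ball \<open>open ?S\<close>] e(2)] by blast
  qed
  then show ?thesis by (simp add: continuous_at_imp_continuous_on)
 qed
 have hx: "(\<lambda>x. g x k) holomorphic_on strip dlt" if k: "k \<in> strip dlt" for k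
 proof (rule holomorphic_uniform_sequence[OF open_strip, where f = "\<lambda>n x. f n x k"])
  show "(\<lambda>x. f n x k) holomorphic_on strip dlt" for n using f k by (auto simp: hol2_def)
  fix x assume "x \<in> strip dlt"
  then obtain d where d: "d > 0" "cball x d \<subseteq> strip dlt" using open_strip open_contains_cball by blast
  have "uniform_limit ((\<lambda>y. (y, k)) ` cball x d) (\<lambda>n p. f n (fst p) (snd p)) (\<lambda>p. g (fst p) (snd p)) sequentially"
  proof (rule uniform_limit_on_subset[OF lim[of "norm x + d + norm k"]])
   show "(\<lambda>y. (y, k)) ` cball x d \<subseteq> {p \<in> ?S. norm p \<le> norm x + d + norm k}"
   proof
    fix p assume "p \<in> (\<lambda>y. (y, k)) ` cball x d"
    then obtain y where p: "p = (y, k)" and y: "y \<in> cball x d" by blast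
    have S: "p \<in> ?S" using y d k p by auto
    have "norm y \<le> norm x + d" using y norm_triangle_ineq2[of y x] by (simp add: dist_norm norm_minus_commute)
    then have "norm p \<le> norm x + d + norm k" unfolding p using norm_Pair_le[of y k] by linarith
    with S show "p \<in> {p \<in> ?S. norm p \<le> norm x + d + norm k}" by blast
   qed
  qed
  then have "uniform_limit (cball x d) (\<lambda>n y. f n y k) (\<lambda>y. g y k) sequentially"
   unfolding uniform_limit_iff by auto
  then show "\<exists>d>0. cball x d \<subseteq> strip dlt \<and> uniform_limit (cball x d) (\<lambda>n y. f n y k) (\<lambda>y. g y k) sequentially"
   using d by blast
 qed
 have hk: "g x holomorphic_on strip dlt" if x: "x \<in> strip dlt" for x
 proof (rule holomorphic_uniform_sequence[OF open_strip, where f = "\<lambda>n. f n x"])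
  show "f n x holomorphic_on strip dlt" for n using f x by (auto simp: hol2_def)
  fix k assume "k \<in> strip dlt"
  then obtain d where d: "d > 0" "cball k d \<subseteq> strip dlt" using open_strip open_contains_cball by blast
  have "uniform_limit (Pair x ` cball k d) (\<lambda>n p. f n (fst p) (snd p)) (\<lambda>p. g (fst p) (snd p)) sequentially"
  proof (rule uniform_limit_on_subset[OF lim[of "norm x + (norm k + d)"]])
   show "Pair x ` cball k d \<subseteq> {p \<in> ?S. norm p \<le> norm x + (norm k + d)}"
   proof
    fix p assume "p \<in> Pair x ` cball k d"
    then obtain y where p: "p = (x, y)" and y: "y \<in> cball k d" by blast
    have S: "p \<in> ?S" using y d x p by auto
    have "norm y \<le> norm k + d" using y norm_triangle_ineq2[of y k] by (simp add: dist_norm norm_minus_commute)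
    then have "norm p \<le> norm x + (norm k + d)" unfolding p using norm_Pair_le[of x y] by linarith
    with S show "p \<in> {p \<in> ?S. norm p \<le> norm x + (norm k + d)}" by blast
   qed
  qed
  then have "uniform_limit (cball k d) (\<lambda>n. f n x) (g x) sequentially"
   unfolding uniform_limit_iff by auto
  then show "\<exists>d>0. cball k d \<subseteq> strip dlt \<and> uniform_limit (cball k d) (\<lambda>n. f n x) (g x) sequentially"
   using d by blast
 qed
 show ?thesis using cont hx hk by (auto simp: hol2_def)
qed

text \<open>The Riemann sums are finite sums of slices, hence holomorphic in \<open>x\<close>;
  uniform continuity on a compact product makes them converge locally uniformly.\<close>

lemma uniform_limit_riemann:
 assumes f: "hol2 dlt f" and dlt: "dlt > 0"
  and per: "\<And>x k. x \<in> strip dlt ==> k \<in> strip dlt ==> f x (k + 1) = f x k"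
 shows "(\<lambda>x. integral {0..1} (\<lambda>t. f x (of_real t))) holomorphic_on strip dlt"
proof (rule holomorphic_uniform_sequence[OF open_strip, where f = "\<lambda>n x. (\<Sum>j<Suc n. f x (of_real (real j / real (Suc n)))) / of_nat (Suc n)"])
 show "(\<lambda>x. (\<Sum>j<Suc n. f x (of_real (real j / real (Suc n)))) / of_nat (Suc n)) holomorphic_on strip dlt" for n
 proof (intro holomorphic_intros)
  fix j
  have "complex_of_real (real j / real (Suc n)) \<in> strip dlt" using dlt by (rule of_real_strip)
  then show "(\<lambda>x. f x (of_real (real j / real (Suc n)))) holomorphic_on strip dlt" using f unfolding hol2_def by blast
 qed (simp del: of_nat_Suc)
 fix x assume "x \<in> strip dlt"
 then obtain d where d: "d > 0" "cball x d \<subseteq> strip dlt" using open_strip open_contains_cball by blast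
 let ?K = "cball x d \<times> (complex_of_real ` {0..1})"
 have "compact ?K" by (intro compact_Times compact_continuous_image continuous_intros) auto
 moreover have "?K \<subseteq> strip dlt \<times> strip dlt" using d dlt by auto
 ultimately have uc: "uniformly_continuous_on ?K (\<lambda>p. f (fst p) (snd p))"
  using f by (intro compact_uniformly_continuous) (auto simp: hol2_def intro: continuous_on_subset)
 have "uniform_limit (cball x d) (\<lambda>n x. (\<Sum>j<Suc n. f x (of_real (real j / real (Suc n)))) / of_nat (Suc n))
    (\<lambda>x. integral {0..1} (\<lambda>t. f x (of_real t))) sequentially"
  unfolding uniform_limit_iff
 proof (intro allI impI)
  fix e :: real assume e: "e > 0"
  obtain r where r: "r > 0" "\<And>p q. p \<in> ?K ==> q \<in> ?K ==> dist p q < r ==> dist (f (fst p) (snd p)) (f (fst q) (snd q)) < e / 2"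
   using uc e unfolding uniformly_continuous_on_def by (metis half_gt_zero_iff dist_commute)
  show "\<forall>\<^sub>F n in sequentially. \<forall>y\<in>cball x d. dist ((\<Sum>j<Suc n. f y (of_real (real j / real (Suc n)))) / of_nat (Suc n)) (integral {0..1} (\<lambda>t. f y (of_real t))) < e"
   using eventually_gt_at_top[of "nat \<lceil>1 / r\<rceil>"]
  proof eventually_elim
   case (elim n)
   have "1 / r < real (Suc n)" using elim by linarith
   then have nr: "1 / real (Suc n) < r" using r by (simp add: field_simps)
   show ?case
   proof
    fix y assume y: "y \<in> cball x d"
    define N where "N = Suc n"
    have N: "N > 0" "1 / real N < r" using nr by (auto simp: N_def)
    have cont: "continuous_on {a..b} (\<lambda>t. f y (of_real t))" if "{a..b} \<subseteq> {0..1}" for a b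
    proof -
     have "f y holomorphic_on strip dlt" using f y d by (auto simp: hol2_def)
     then have "continuous_on (strip dlt) (f y)" by (rule holomorphic_on_imp_continuous_on)
     then show ?thesis by (rule continuous_on_compose2) (use dlt in \<open>auto intro!: continuous_intros\<close>)
    qed
    define a where "a j = real j / real N" for j
    have int: "integral {0..a m} (\<lambda>t. f y (of_real t)) = (\<Sum>j<m. integral {a j..a (Suc j)} (\<lambda>t. f y (of_real t)))" if "m \<le> N" for m
     using that
    proof (induction m)
     case 0
     then show ?case by (simp add: a_def)
    next
     case (Suc m)
     have "{0..a (Suc m)} \<subseteq> {0..1}" using Suc.prems N by (auto simp: a_def field_simps)
     then have "integral {0..a m} (\<lambda>t. f y (of_real t)) + integral {a m..a (Suc m)} (\<lambda>t. f y (of_real t)) = integral {0..a (Suc m)} (\<lambda>t. f y (of_real t))"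
      by (intro Henstock_Kurzweil_Integration.integral_combine integrable_continuous_interval cont) (auto simp: a_def divide_right_mono)
     then show ?case using Suc by simp
    qed
    have diff: "norm (integral {a j..a (Suc j)} (\<lambda>t. f y (of_real t)) - f y (of_real (a j)) / of_nat N) \<le> e / 2 * (1 / real N)" if "j < N" for j
    proof -
     have sub: "{a j..a (Suc j)} \<subseteq> {0..1}"
     proof -
      have "real (Suc j) \<le> real N" using that by linarith
      then have "a (Suc j) \<le> 1" "0 \<le> a j" unfolding a_def using N by (simp_all add: divide_le_eq_1)
      then show ?thesis by auto
     qed
     have len: "a (Suc j) - a j = 1 / real N" by (simp add: a_def diff_divide_distrib[symmetric])
     have le: "a j \<le> a (Suc j)" by (simp add: a_def divide_right_mono)
     have "norm (integral {a j..a (Suc j)} (\<lambda>t. f y (of_real t) - f y (of_real (a j)))) \<le> e / 2 * (a (Suc j) - a j)"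
     proof (rule integral_bound[OF le])
      show "continuous_on {a j..a (Suc j)} (\<lambda>t. f y (of_real t) - f y (of_real (a j)))"
       by (intro continuous_intros cont sub)
      fix t assume t: "t \<in> {a j..a (Suc j)}"
      have "dist (f (fst (y, complex_of_real t)) (snd (y, complex_of_real t))) (f (fst (y, complex_of_real (a j))) (snd (y, complex_of_real (a j)))) < e / 2"
      proof (rule r(2))
       show "(y, complex_of_real t) \<in> ?K" "(y, complex_of_real (a j)) \<in> ?K" using y t sub le by auto
       have "\<bar>t - a j\<bar> \<le> 1 / real N" using t len by auto
       then show "dist (y, complex_of_real t) (y, complex_of_real (a j)) < r"
        using N by (simp add: dist_Pair_Pair dist_norm flip: of_real_diff)
      qed
      then show "cmod (f y (of_real t) - f y (of_real (a j))) \<le> e / 2" by (simp add: dist_norm)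
     qed
     moreover have "integral {a j..a (Suc j)} (\<lambda>t. f y (of_real t) - f y (of_real (a j))) = integral {a j..a (Suc j)} (\<lambda>t. f y (of_real t)) - f y (of_real (a j)) / of_nat N"
      using len le by (subst Henstock_Kurzweil_Integration.integral_diff)
       (auto intro!: integrable_continuous_interval cont sub simp: scaleR_conv_of_real)
     ultimately show ?thesis using len le by simp
    qed
    have "integral {0..1} (\<lambda>t. f y (of_real t)) = (\<Sum>j<N. integral {a j..a (Suc j)} (\<lambda>t. f y (of_real t)))"
     using int[of N] N by (simp add: a_def)
    then have "norm (integral {0..1} (\<lambda>t. f y (of_real t)) - (\<Sum>j<N. f y (of_real (a j))) / of_nat N)
      = norm (\<Sum>j<N. integral {a j..a (Suc j)} (\<lambda>t. f y (of_real t)) - f y (of_real (a j)) / of_nat N)"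
     by (simp add: sum_subtractf sum_divide_distrib)
    also have "... \<le> (\<Sum>j<N. e / 2 * (1 / real N))"
     by (intro order.trans[OF norm_sum] sum_mono diff) auto
    also have "... = e / 2" using N by simp
    also have "... < e" using e by simp
    finally show "dist ((\<Sum>j<Suc n. f y (of_real (real j / real (Suc n)))) / of_nat (Suc n)) (integral {0..1} (\<lambda>t. f y (of_real t))) < e"
     by (simp add: dist_norm norm_minus_commute a_def N_def)
   qed
  qed
 qed
 then show "\<exists>d>0. cball x d \<subseteq> strip dlt \<and> uniform_limit (cball x d) (\<lambda>n x. (\<Sum>j<Suc n. f x (of_real (real j / real (Suc n)))) / of_nat (Suc n))
    (\<lambda>x. integral {0..1} (\<lambda>t. f x (of_real t))) sequentially"
  using d by blast
qed

section \<open>Fourier series of periodic functions on a strip\<close>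

definition fcoef :: "(complex \<Rightarrow> complex) \<Rightarrow> int \<Rightarrow> complex" where
 "fcoef f n = integral {0..1} (\<lambda>t. f (of_real t) * ee (- of_int n * of_real t))"

text \<open>A contour shift by means of a primitive \<open>P\<close>: the derivative of
  \<open>P (z + 1) - P z\<close> vanishes by periodicity, so the integral over a period is the same
  on every horizontal line.\<close>

lemma integral_period_shift:
 assumes g: "g holomorphic_on strip dlt" and per: "\<And>z. z \<in> strip dlt ==> g (z + 1) = g z"
 obtains c where "\<And>z. z \<in> strip dlt ==> ((\<lambda>t. g (z + of_real t)) has_integral c) {0..1}"
proof -
 obtain P where P: "\<And>z. z \<in> strip dlt ==> (P has_field_derivative g z) (at z)"
  using holomorphic_convex_primitive'[OF convex_strip open_strip g] by (metis at_within_open open_strip)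
 have one: "z + 1 \<in> strip dlt" if "z \<in> strip dlt" for z using that by (simp add: strip_def)
 have "\<exists>c. \<forall>z\<in>strip dlt. P (z + 1) - P z = c"
 proof (rule has_field_derivative_zero_constant[OF convex_strip])
  fix z assume z: "z \<in> strip dlt"
  have "((\<lambda>z. P (z + 1)) has_field_derivative g (z + 1)) (at z)"
   using DERIV_shift[of P "g (z + 1)" z 1] P[OF one[OF z]] by simp
  then have "((\<lambda>z. P (z + 1) - P z) has_field_derivative g (z + 1) - g z) (at z)"
   using P[OF z] by (rule DERIV_diff)
  then show "((\<lambda>z. P (z + 1) - P z) has_field_derivative 0) (at z within strip dlt)"
   using per[OF z] by (auto intro: has_field_derivative_at_within)
 qed
 then obtain c where c: "\<And>z. z \<in> strip dlt ==> P (z + 1) - P z = c" by blast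
 have "((\<lambda>t. g (z + of_real t)) has_integral c) {0..1}" if z: "z \<in> strip dlt" for z
 proof -
  have "((\<lambda>t. g (z + of_real t)) has_integral (P (z + of_real 1) - P (z + of_real 0))) {0..1}"
  proof (rule fundamental_theorem_of_calculus)
   fix t :: real
   have s: "z + of_real t \<in> strip dlt" using z by simp
   have d: "((\<lambda>t. z + of_real t) has_vector_derivative 1) (at t within {0..1})"
    by (auto intro!: derivative_eq_intros)
   show "((\<lambda>t. P (z + of_real t)) has_vector_derivative g (z + of_real t)) (at t within {0..1})"
    using field_vector_diff_chain_within[OF d has_field_derivative_at_within[OF P[OF s]]] by (simp add: o_def)
  qed simp
  then show ?thesis using c[OF z] by simp
 qed
 then show ?thesis using that by blast
qed

lemma fcoef_shift:
 assumes f: "f holomorphic_on strip dlt" and per: "\<And>z. z \<in> strip dlt ==> f (z + 1) = f z" and z: "z \<in> strip dlt"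
 shows "((\<lambda>t. f (z + of_real t) * ee (- of_int n * (z + of_real t))) has_integral fcoef f n) {0..1}"
proof -
 define g where "g z = f z * ee (- of_int n * z)" for z
 have "g holomorphic_on strip dlt" unfolding g_def by (intro holomorphic_intros f)
 moreover have "g (z + 1) = g z" if "z \<in> strip dlt" for z
 proof -
  have "ee (- of_int n * (z + 1)) = ee (- of_int n * z) * ee (of_int (- n))"
   by (simp only: ee_add[symmetric] distrib_left mult_1_right of_int_minus)
  then show ?thesis using per[OF that] by (simp only: g_def ee_of_int mult_1_right)
 qed
 ultimately obtain c where c: "\<And>z. z \<in> strip dlt ==> ((\<lambda>t. g (z + of_real t)) has_integral c) {0..1}"
  using integral_period_shift by blast
 have "((\<lambda>t. g (0 + of_real t)) has_integral c) {0..1}" using z by (intro c) (auto simp: strip_def)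
 then have "fcoef f n = c" unfolding fcoef_def g_def by (simp add: integral_unique)
 then show ?thesis using c[OF z] by (simp add: g_def)
qed

lemma fcoef_bound:
 assumes f: "f holomorphic_on strip dlt" and per: "\<And>z. z \<in> strip dlt ==> f (z + 1) = f z"
  and M: "\<And>z. z \<in> strip dlt ==> cmod (f z) \<le> M" and eta: "0 \<le> eta" "eta < dlt"
 shows "cmod (fcoef f n) \<le> M * exp (- 2 * pi * eta * \<bar>of_int n\<bar>)"
proof -
 \<comment> \<open>For positive \<open>n\<close> the line of integration is lowered, for negative
   \<open>n\<close> it is raised; in both cases the exponential contributes
   \<open>exp (- 2 * pi * eta * \<bar>of_int n\<bar>)\<close>.\<close>
 define y where "y = - sgn (of_int n) * eta"
 have y: "\<bar>y\<bar> < dlt" using eta by (simp add: y_def abs_mult sgn_if)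
 define z where "z = Complex 0 y"
 have z: "z \<in> strip dlt" using y by (simp add: strip_def z_def)
 have "0 \<in> strip dlt" using eta by (simp add: strip_def)
 then have M0: "M \<ge> 0" using M norm_ge_zero order.trans by blast
 have "cmod (fcoef f n) \<le> (M * exp (- 2 * pi * eta * \<bar>of_int n\<bar>)) * measure lborel (cbox 0 (1::real))"
 proof (rule has_integral_bound)
  show "((\<lambda>t. f (z + of_real t) * ee (- of_int n * (z + of_real t))) has_integral fcoef f n) (cbox 0 1)"
   using fcoef_shift[OF f per z] by simp
  fix t :: real
  have "cmod (ee (- of_int n * (z + of_real t))) = exp (- 2 * pi * eta * \<bar>of_int n\<bar>)"
   by (simp add: norm_ee y_def z_def abs_sgn mult_ac)
  then show "cmod (f (z + of_real t) * ee (- of_int n * (z + of_real t))) \<le> M * exp (- 2 * pi * eta * \<bar>of_int n\<bar>)"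
   using M[of "z + of_real t"] z by (simp add: norm_mult mult_right_mono)
 qed (use M0 in simp)
 then show ?thesis by simp
qed

lemma ee_eq_1_iff: "ee z = 1 \<longleftrightarrow> z \<in> \<int>"
proof
 assume "ee z = 1"
 then obtain n :: int where "2 * pi * \<i> * z = of_int (2 * n) * pi * \<i>"
  unfolding ee_def exp_eq_1 by (auto simp: complex_eq_iff)
 then have "z = of_int n" by simp
 then show "z \<in> \<int>" by simp
next
 assume "z \<in> \<int>"
 then show "ee z = 1" by (auto elim: Ints_cases)
qed

text \<open>At an integer the numerator vanishes and \<open>1 - ee (- z)\<close> has a simple zero.
  Locally both are replaced by their difference quotients, which are holomorphic, the second one
  being nonzero there.\<close>

lemma removable_period_quotient:
 assumes f: "f holomorphic_on strip dlt" and zero: "\<And>n::int. f (of_int n) = 0" and dlt: "dlt > 0"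
 obtains phi where "phi holomorphic_on strip dlt" "\<And>z. z \<in> strip dlt ==> z \<notin> \<int> ==> phi z = f z / (1 - ee (- z))"
  "\<And>z. z \<in> strip dlt ==> z \<in> \<int> ==> phi z = deriv f z / (2 * pi * \<i>)"
proof -
 define phi where "phi z = (if z \<in> \<int> then deriv f z / (2 * pi * \<i>) else f z / (1 - ee (- z)))" for z
 define D where "D z = 1 - ee (- z)" for z
 have D: "D holomorphic_on S" for S unfolding D_def by (intro holomorphic_intros)
 have D0: "D z = 0 \<longleftrightarrow> z \<in> \<int>" for z unfolding D_def using ee_eq_1_iff[of "- z"] by (auto simp: Ints_minus)
 have "phi field_differentiable at z" if z: "z \<in> strip dlt" for z
 proof (cases "z \<in> \<int>")
  case False
  have op: "open (strip dlt - \<int>)" by (intro open_Diff open_strip closed_Ints)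
  have "(\<lambda>z. f z / D z) holomorphic_on (strip dlt - \<int>)"
   using D0 by (intro holomorphic_intros D holomorphic_on_subset[OF f]) auto
  then have "phi holomorphic_on (strip dlt - \<int>)"
   by (rule holomorphic_transform) (auto simp: phi_def D_def)
  then show ?thesis using op z False by (auto simp: holomorphic_on_open field_differentiable_def)
 next
  case True
  then obtain n :: int where n: "z = of_int n" by (auto elim: Ints_cases)
  define S where "S = strip dlt \<inter> ball z 1"
  have S: "open S" "z \<in> S" using z by (auto simp: S_def open_strip)
  have only: "w = z" if w: "w \<in> S" "w \<in> \<int>" for w
  proof -
   obtain m :: int where m: "w = of_int m" using w(2) Ints_cases by blast
   have "dist w z < 1" using w(1) unfolding S_def by (simp add: dist_commute)
   moreover have "dist w z = \<bar>real_of_int (m - n)\<bar>"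
    unfolding m n dist_norm of_int_diff[symmetric] norm_of_int ..
   ultimately have "\<bar>m - n\<bar> < 1" by linarith
   then show ?thesis using m n by simp
  qed
  define F where "F w = (if w = z then deriv f z else (f w - f z) / (w - z))" for w
  define E where "E w = (if w = z then deriv D z else (D w - D z) / (w - z))" for w
  have F: "F holomorphic_on S" unfolding F_def
   by (rule pole_lemma_open) (use S f in \<open>auto simp: S_def intro: holomorphic_on_subset\<close>)
  have E: "E holomorphic_on S" unfolding E_def by (rule pole_lemma_open) (use S D in auto)
  have "(D has_field_derivative 2 * pi * \<i> * ee (- z)) (at z)"
  proof -
   have "((\<lambda>z. exp (2 * pi * \<i> * (- z))) has_field_derivative (exp (2 * pi * \<i> * (- z)) * (2 * pi * \<i> * (- 1)))) (at z)"
    by (intro DERIV_chain2[of exp] DERIV_exp DERIV_cmult DERIV_minus DERIV_ident)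
   from DERIV_diff[OF DERIV_const this, of 1] show ?thesis
    unfolding D_def[abs_def] ee_def by (simp add: mult_ac)
  qed
  moreover have "ee (- z) = 1" using ee_of_int[of "- n"] n by simp
  ultimately have "(D has_field_derivative 2 * pi * \<i>) (at z)" by simp
  then have dD: "deriv D z = 2 * pi * \<i>" by (rule DERIV_imp_deriv)
  have Dz: "D z = 0" and fz: "f z = 0" using D0[of z] True zero[of n] n by simp_all
  have E0: "E w \<noteq> 0" and quot: "phi w = F w / E w" if w: "w \<in> S" for w
  proof -
   have "E w \<noteq> 0 \<and> phi w = F w / E w"
   proof (cases "w = z")
    case True
    then show ?thesis using \<open>z \<in> \<int>\<close> dD by (simp add: E_def F_def phi_def)
   next
    case False
    then have "w \<notin> \<int>" using only[OF w] by blast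
    moreover from this have "D w \<noteq> 0" using D0[of w] by blast
    ultimately show ?thesis using False by (simp add: E_def F_def phi_def Dz fz flip: D_def)
   qed
   then show "E w \<noteq> 0" "phi w = F w / E w" by blast+
  qed
  have "phi holomorphic_on S"
   using holomorphic_transform[OF holomorphic_on_divide[OF F E E0], of phi] quot by simp
  then show ?thesis using S by (auto simp: holomorphic_on_open field_differentiable_def)
 qed
 then have "phi holomorphic_on strip dlt" by (auto simp: holomorphic_on_def field_differentiable_at_within)
 then show ?thesis using that[of phi] by (auto simp: phi_def)
qed

text \<open>The two halves of the Fourier series are geometric series on two horizontal lines; they add up to
 the difference of the integrals of the holomorphic function \<open>f z / (1 - e(-z))\<close> over these lines.\<close>

lemma fourier_series_at_0:
 assumes f: "f holomorphic_on strip dlt" and per: "\<And>z. z \<in> strip dlt ==> f (z + 1) = f z" and dlt: "dlt > 0"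
  and f0: "f 0 = 0"
 shows "(\<lambda>n. fcoef f (int n) + fcoef f (- int n - 1)) sums 0"
proof -
 have per': "f (of_int n) = 0" for n :: int
 proof -
  have "f (of_int n) = f (of_int 0)"
  proof (induction n rule: int_induct[of _ 0])
   case (step1 i) then show ?case using per[of "of_int i"] dlt by (simp add: strip_def)
  next
   case (step2 i) then show ?case using per[of "of_int (i - 1)"] dlt by (simp add: strip_def)
  qed simp
  then show ?thesis using f0 by simp
 qed
 obtain phi where phi: "phi holomorphic_on strip dlt" "\<And>z. z \<in> strip dlt ==> z \<notin> \<int> ==> phi z = f z / (1 - ee (- z))"
  and phii: "\<And>z. z \<in> strip dlt ==> z \<in> \<int> ==> phi z = deriv f z / (2 * pi * \<i>)"
  using removable_period_quotient[OF f per' dlt] by blast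
 have one: "z + 1 \<in> strip dlt" if "z \<in> strip dlt" for z using that by (simp add: strip_def)
 have df: "deriv f (z + 1) = deriv f z" if z: "z \<in> strip dlt" for z
 proof -
  have "deriv f z = deriv (\<lambda>w. f (w + 1)) z"
   by (rule deriv_cong_ev) (use per z open_strip in \<open>auto simp: eventually_nhds intro!: exI[of _ "strip dlt"]\<close>)
  also have "... = deriv f (z + 1)"
  proof (rule DERIV_imp_deriv)
   have "(f has_field_derivative deriv f (z + 1)) (at (z + 1))"
    using f one[OF z] open_strip by (intro holomorphic_derivI)
   then show "((\<lambda>w. f (w + 1)) has_field_derivative deriv f (z + 1)) (at z)"
    using DERIV_shift[of f "deriv f (z + 1)" z 1] by simp
  qed
  finally show ?thesis by simp
 qed
 have phiper: "phi (z + 1) = phi z" if z: "z \<in> strip dlt" for z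
 proof (cases "z \<in> \<int>")
  case True
  then have "z + 1 \<in> \<int>" by simp
  then show ?thesis using phii[OF z True] phii[OF one[OF z]] df[OF z] by simp
 next
  case False
  then have n: "z + 1 \<notin> \<int>" by (metis Ints_1 Ints_diff add_diff_cancel_right')
  have "ee (- (z + 1)) = ee (- z)" using ee_of_int[of "-1"] by (simp add: ee_diff)
  then show ?thesis using phi(2)[OF z False] phi(2)[OF one[OF z] n] per[OF z] by simp
 qed
 define eta where "eta = dlt / 2"
 have eta: "0 < eta" "eta < dlt" using dlt by (auto simp: eta_def)
 define q where "q = exp (- 2 * pi * eta)"
 have q: "0 < q" "q < 1" using eta by (auto simp: q_def)
 \<comment> \<open>partial sums, with the remainder of the geometric series\<close>
 have part: "(\<Sum>n<N. fcoef f (int n) + fcoef f (- int n - 1)) = - fcoef phi (int N) + fcoef phi (- int N)" for N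
 proof -
  \<comment> \<open>\<open>f z = phi z * (1 - ee (- z))\<close>, and a factor
    \<open>ee (- z)\<close> raises the index of a coefficient by one; the coefficients of
    \<open>f\<close> are differences, and the partial sums telescope from both ends.\<close>
  have tele: "fcoef f n = fcoef phi n - fcoef phi (n + 1)" for n :: int
  proof -
   \<comment> \<open>Off the real axis no point of the line is an integer, so the quotient formula
     for \<open>phi\<close> applies along all of it.\<close>
   define z0 where "z0 = Complex 0 eta"
   have y: "z0 \<in> strip dlt" using eta by (simp add: z0_def strip_def)
   have "((\<lambda>t. phi ((z0 + of_real t)) * ee (- of_int n * (z0 + of_real t)) - phi ((z0 + of_real t)) * ee (- of_int (n + 1) * (z0 + of_real t))) has_integral (fcoef phi n - fcoef phi (n + 1))) {0..1}"
    by (intro has_integral_diff fcoef_shift[OF phi(1) phiper y])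
   moreover have "phi ((z0 + of_real t)) * ee (- of_int n * (z0 + of_real t)) - phi ((z0 + of_real t)) * ee (- of_int (n + 1) * (z0 + of_real t)) = f ((z0 + of_real t)) * ee (- of_int n * (z0 + of_real t))" for t
   proof -
    let ?z = "(z0 + of_real t)"
    have z: "?z \<in> strip dlt" "?z \<notin> \<int>" using eta by (auto simp: strip_def z0_def complex_eq_iff elim!: Ints_cases)
    then have "1 - ee (- ?z) \<noteq> 0" using ee_eq_1_iff[of "- ?z"] by (metis Ints_minus eq_iff_diff_eq_0 minus_minus)
    then have 1: "f ?z = phi ?z * (1 - ee (- ?z))" using phi(2)[OF z] by simp
    have 2: "ee (- of_int (n + 1) * ?z) = ee (- of_int n * ?z) * ee (- ?z)"
     by (simp add: algebra_simps flip: ee_add)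
    have "p * A - p * (A * E) = (p * (1 - E)) * A" for p A E :: complex by (simp add: algebra_simps)
    then show ?thesis unfolding 1 2 .
   qed
   ultimately have "((\<lambda>t. f ((z0 + of_real t)) * ee (- of_int n * (z0 + of_real t))) has_integral (fcoef phi n - fcoef phi (n + 1))) {0..1}"
    by simp
   then show ?thesis using fcoef_shift[OF f per y] has_integral_unique by blast
  qed
  show ?thesis
  proof (induction N)
   case (Suc N)
   have "fcoef f (int N) = fcoef phi (int N) - fcoef phi (int (Suc N))" using tele[of "int N"] by (simp add: add.commute)
   moreover have "fcoef f (- int N - 1) = fcoef phi (- int (Suc N)) - fcoef phi (- int N)"
   proof -
    have e: "- int (Suc N) + 1 = - int N" "- int N - 1 = - int (Suc N)" by simp_all
    show ?thesis using tele[of "- int (Suc N)"] unfolding e .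
   qed
   ultimately show ?case unfolding sum.lessThan_Suc Suc by simp
  qed simp
 qed
 have lim: "(\<lambda>N. fcoef phi (s N)) \<longlonglongrightarrow> 0" if s: "\<And>N. \<bar>s N\<bar> = int N" for s :: "nat \<Rightarrow> int"
 proof -
  \<comment> \<open>No bound on \<open>f\<close> is assumed here, so \<open>phi\<close> is bounded
    by compactness on one period of a closed narrower strip.\<close>
  have comp: "compact ((\<lambda>p. Complex (fst p) (snd p)) ` ({0..1} \<times> {-eta..eta}))" (is "compact ?K")
   by (intro compact_continuous_image compact_Times continuous_intros) auto
  have "?K \<subseteq> strip dlt" using eta by (auto simp: strip_def)
  from compact_continuous_image[OF continuous_on_subset[OF holomorphic_on_imp_continuous_on[OF phi(1)] this] comp]
  have "bounded (phi ` ?K)" by (rule compact_imp_bounded)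
  then obtain M where M0': "M > 0" and M': "\<forall>w\<in>phi ` ?K. cmod w \<le> M" unfolding bounded_pos by blast
  have M: "\<And>z. z \<in> ?K ==> cmod (phi z) \<le> M" using M' by blast
  have M0: "M \<ge> 0" using M0' by simp
  have "cmod (fcoef phi (s N)) \<le> M * q ^ N" for N
  proof -
   define y where "y = - sgn (of_int (s N)) * eta"
   have y: "\<bar>y\<bar> < dlt" "\<bar>y\<bar> \<le> eta" using eta by (auto simp: y_def abs_mult sgn_if)
   define z where "z = Complex 0 y"
   have z: "z \<in> strip dlt" using y by (simp add: z_def strip_def)
   have "cmod (fcoef phi (s N)) \<le> (M * q ^ N) * measure lborel (cbox 0 (1::real))"
   proof (rule has_integral_bound)
    show "((\<lambda>t. phi (z + of_real t) * ee (- of_int (s N) * (z + of_real t))) has_integral fcoef phi (s N)) (cbox 0 1)"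
     using fcoef_shift[OF phi(1) phiper z] by simp
    fix t :: real assume t: "t \<in> cbox 0 1"
    have "\<bar>of_int (s N)\<bar> = real N" using s[of N] by (metis of_int_abs of_int_of_nat_eq)
    then have "of_int (s N) * y = - real N * eta" unfolding y_def using abs_sgn[of "real_of_int (s N)"] by (simp add: mult.assoc)
    then have "cmod (ee (- of_int (s N) * (z + of_real t))) = exp (real N * (- 2 * pi * eta))"
     by (simp add: norm_ee z_def)
    also have "... = q ^ N" unfolding q_def by (rule exp_of_nat_mult)
    finally have "cmod (ee (- of_int (s N) * (z + of_real t))) = q ^ N" .
    moreover have "z + of_real t \<in> ?K"
     by (rule image_eqI[of _ _ "(t, y)"]) (use t y in \<open>auto simp: z_def complex_eq_iff\<close>)
    ultimately show "cmod (phi (z + of_real t) * ee (- of_int (s N) * (z + of_real t))) \<le> M * q ^ N"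
     using M[of "z + of_real t"] q by (simp add: norm_mult mult_right_mono)
   qed (use M0 q in simp)
   then show ?thesis by simp
  qed
  moreover have "(\<lambda>N. M * q ^ N) \<longlonglongrightarrow> 0" using tendsto_mult_right_zero[OF LIMSEQ_realpow_zero[of q], of M] q by simp
  ultimately show ?thesis using Lim_null_comparison[of "\<lambda>N. fcoef phi (s N)" "\<lambda>N. M * q ^ N" sequentially] by (simp add: always_eventually)
 qed
 have "(\<lambda>N. - fcoef phi (int N) + fcoef phi (- int N)) \<longlonglongrightarrow> - 0 + 0"
  by (rule tendsto_add[OF tendsto_minus[OF lim[of int]] lim[of "\<lambda>N. - int N"]]) auto
 then show ?thesis unfolding sums_def part by simp
qed

lemma hol2_const_x: "hol2 dlt (\<lambda>x k. ee (of_int m * x + of_int n * k))"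
 unfolding ee_def by (auto simp: hol2_def intro!: continuous_intros holomorphic_intros)

text \<open>Enumerating the index set reduces this to the Weierstrass test for sequences.\<close>

lemma hol2_infsum:
 fixes f :: "'i::countable \<Rightarrow> complex \<Rightarrow> complex \<Rightarrow> complex"
 assumes inf: "infinite (UNIV :: 'i set)" and f: "\<And>i. hol2 dlt (f i)"
  and B: "\<And>M. \<exists>B. B summable_on UNIV \<and> (\<forall>i. \<forall>x\<in>strip dlt. \<forall>k\<in>strip dlt. cmod x \<le> M \<longrightarrow> cmod k \<le> M \<longrightarrow> cmod (f i x k) \<le> B i)"
 shows "hol2 dlt (\<lambda>x k. \<Sum>\<^sub>\<infinity>i. f i x k)"
proof -
 define b :: "nat \<Rightarrow> 'i" where "b = from_nat_into UNIV"
 have b: "bij_betw b UNIV UNIV" unfolding b_def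
  using bij_betw_from_nat_into[OF countableI_type inf] .
 have lim: "uniform_limit {p \<in> strip dlt \<times> strip dlt. norm p \<le> M} (\<lambda>n p. \<Sum>j<n. f (b j) (fst p) (snd p))
   (\<lambda>p. \<Sum>\<^sub>\<infinity>i. f i (fst p) (snd p)) sequentially" for M
 proof -
  obtain B where B: "B summable_on UNIV"
   "\<And>i x k. x \<in> strip dlt ==> k \<in> strip dlt ==> cmod x \<le> M ==> cmod k \<le> M ==> cmod (f i x k) \<le> B i"
   using B by meson
  have "(\<lambda>j. B (b j)) summable_on UNIV" using B(1) summable_on_reindex_bij_betw[OF b, of B] by simp
  then have sB: "summable (\<lambda>j. B (b j))" using has_sum_imp_sums unfolding summable_on_def summable_def by blast
  have bnd: "cmod (f (b j) (fst p) (snd p)) \<le> B (b j)" if "p \<in> {p \<in> strip dlt \<times> strip dlt. norm p \<le> M}" for p j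
   using that norm_fst_le[of "fst p" "snd p"] norm_snd_le[of "snd p" "fst p"] by (intro B(2)) auto
  have "uniform_limit {p \<in> strip dlt \<times> strip dlt. norm p \<le> M} (\<lambda>n p. \<Sum>j<n. f (b j) (fst p) (snd p))
   (\<lambda>p. \<Sum>j. f (b j) (fst p) (snd p)) sequentially"
   by (rule Weierstrass_m_test[OF bnd sB])
  moreover have "(\<Sum>j. f (b j) (fst p) (snd p)) = (\<Sum>\<^sub>\<infinity>i. f i (fst p) (snd p))"
   if "p \<in> {p \<in> strip dlt \<times> strip dlt. norm p \<le> M}" for p
  proof -
   have "summable (\<lambda>j. cmod (f (b j) (fst p) (snd p)))"
    by (rule summable_comparison_test'[OF sB, of 0]) (use bnd[OF that] in auto)
   from norm_summable_imp_has_sum[OF this summable_sums[OF summable_norm_cancel[OF this]]]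
   have "((\<lambda>j. f (b j) (fst p) (snd p)) has_sum (\<Sum>j. f (b j) (fst p) (snd p))) UNIV" .
   then have "((\<lambda>i. f i (fst p) (snd p)) has_sum (\<Sum>j. f (b j) (fst p) (snd p))) UNIV"
    by (subst (asm) has_sum_reindex_bij_betw[OF b, of "\<lambda>i. f i (fst p) (snd p)"])
   then show ?thesis by (simp add: infsumI)
  qed
  ultimately show ?thesis by (subst uniform_limit_cong'[OF refl, symmetric]) auto
 qed
 have "hol2 dlt (\<lambda>x k. \<Sum>j<n. f (b j) x k)" for n
  by (induction n) (auto intro!: hol2_const hol2_add f)
 then show ?thesis by (rule hol2_uniform_limit[OF _ lim])
qed

lemma bij_betw_int_ge: "bij_betw int UNIV {0..}"
 by (rule bij_betwI[of _ _ _ nat]) auto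

lemma bij_betw_int_neg: "bij_betw (\<lambda>n. - int n - 1) UNIV {..<0}"
 by (rule bij_betwI[of _ _ _ "\<lambda>i. nat (- i - 1)"]) auto

lemma has_sum_int_split:
 fixes f :: "int \<Rightarrow> 'a :: topological_comm_monoid_add"
 assumes "((\<lambda>n. f (int n)) has_sum a) UNIV" "((\<lambda>n. f (- int n - 1)) has_sum b) UNIV"
 shows "(f has_sum (a + b)) UNIV"
proof -
 have "(f has_sum a) {0..}" using assms(1) has_sum_reindex_bij_betw[OF bij_betw_int_ge, of f] by simp
 moreover have "(f has_sum b) {..<0}" using assms(2) has_sum_reindex_bij_betw[OF bij_betw_int_neg, of f] by simp
 ultimately have "(f has_sum (a + b)) ({0..} \<union> {..<0})" by (rule has_sum_Un_disjoint) auto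
 moreover have "{0..} \<union> {..<0} = (UNIV :: int set)" by auto
 ultimately show ?thesis by simp
qed

lemma summable_on_exp_int:
 fixes c :: real
 assumes "c > 0"
 shows "(\<lambda>n::int. exp (- c * \<bar>of_int n\<bar>)) summable_on UNIV"
proof -
 have s: "summable (\<lambda>n. exp (- c) ^ n)" using assms by (intro summable_geometric) simp
 have e: "exp (- (c * real n)) = exp (- c) ^ n" for n by (simp add: exp_of_nat_mult[symmetric] mult.commute)
 have "(\<lambda>n. exp (- c * \<bar>of_int (int n)\<bar>)) summable_on UNIV"
  by (rule summable_nonneg_imp_summable_on) (use s in \<open>simp_all add: e\<close>)
 then have 1: "(\<lambda>n::int. exp (- c * \<bar>of_int n\<bar>)) summable_on {0..}"
  using summable_on_reindex_bij_betw[OF bij_betw_int_ge, of "\<lambda>n. exp (- c * \<bar>of_int n\<bar>)"] by simp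
 have "exp (- c * \<bar>of_int (- int n - 1)\<bar>) = exp (- c) * exp (- c) ^ n" for n
 proof -
  have "- c * \<bar>of_int (- int n - 1)\<bar> = - c + (- (c * real n))" by (simp add: algebra_simps)
  then show ?thesis by (simp only: exp_add e)
 qed
 moreover have "(\<lambda>n. exp (- c) * exp (- c) ^ n) summable_on UNIV"
  by (rule summable_nonneg_imp_summable_on[OF summable_mult[OF s]]) simp
 ultimately have "(\<lambda>n. exp (- c * \<bar>of_int (- int n - 1)\<bar>)) summable_on UNIV"
  by (simp only:)
 then have 2: "(\<lambda>n::int. exp (- c * \<bar>of_int n\<bar>)) summable_on {..<0}"
  using summable_on_reindex_bij_betw[OF bij_betw_int_neg, of "\<lambda>n. exp (- c * \<bar>of_int n\<bar>)"] by simp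
 have "(\<lambda>n::int. exp (- c * \<bar>of_int n\<bar>)) summable_on ({0..} \<union> {..<0})"
  by (rule summable_on_Un_disjoint[OF 1 2]) auto
 moreover have "{0..} \<union> {..<0} = (UNIV :: int set)" by auto
 ultimately show ?thesis by simp
qed

lemma summable_on_exp_int_prod:
 fixes c :: real
 assumes "c > 0"
 shows "(\<lambda>p::int \<times> int. exp (- c * (\<bar>of_int (fst p)\<bar> + \<bar>of_int (snd p)\<bar>))) summable_on UNIV"
proof -
 obtain S where S: "((\<lambda>n::int. exp (- c * \<bar>of_int n\<bar>)) has_sum S) UNIV"
  using summable_on_exp_int[OF assms] unfolding summable_on_def by blast
 have "(\<lambda>p::int \<times> int. exp (- c * (\<bar>of_int (fst p)\<bar> + \<bar>of_int (snd p)\<bar>))) summable_on (UNIV \<times> UNIV)"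
 proof (rule summable_on_SigmaI)
  show "((\<lambda>n. exp (- c * (\<bar>of_int (fst (m, n))\<bar> + \<bar>of_int (snd (m, n))\<bar>))) has_sum (exp (- c * \<bar>of_int m\<bar>) * S)) UNIV" for m :: int
  proof -
   have "exp (- c * (\<bar>real_of_int m\<bar> + \<bar>real_of_int n\<bar>)) = exp (- c * \<bar>of_int m\<bar>) * exp (- c * \<bar>of_int n\<bar>)" for n
    by (simp only: distrib_left exp_add)
   then show ?thesis using has_sum_cmult_right[OF S, of "exp (- c * \<bar>of_int m\<bar>)"] by (simp only: fst_conv snd_conv)
  qed
  show "(\<lambda>m::int. exp (- c * \<bar>of_int m\<bar>) * S) summable_on UNIV"
   using summable_on_cmult_right[OF summable_on_exp_int[OF assms], of S] by (simp add: mult.commute)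
 qed auto
 then show ?thesis by simp
qed

text \<open>Raising the line of integration by \<open>\<i>\<close> leaves the coefficient unchanged
  and also multiplies it by \<open>ee (- of_int n * z)\<close>, which differs from 1.\<close>

lemma fcoef_const:
 assumes "n \<noteq> 0"
 shows "fcoef (\<lambda>z. c) n = 0"
proof -
 define z where "z = Complex 0 1"
 have h: "((\<lambda>t. c * ee (- of_int n * (w + of_real t))) has_integral fcoef (\<lambda>z. c) n) {0..1}" if "w \<in> strip 2" for w
  by (rule fcoef_shift[OF _ _ that]) auto
 have "((\<lambda>t. ee (- of_int n * z) * (c * ee (- of_int n * (0 + of_real t)))) has_integral (ee (- of_int n * z) * fcoef (\<lambda>z. c) n)) {0..1}"
  by (intro has_integral_mult_right h) (simp add: strip_def)
 moreover have "ee (- of_int n * z) * (c * ee (- of_int n * (0 + of_real t))) = c * ee (- of_int n * (z + of_real t))" for t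
  unfolding mult.left_commute[of _ c] ee_add[symmetric] by (simp add: algebra_simps)
 ultimately have "((\<lambda>t. c * ee (- of_int n * (z + of_real t))) has_integral (ee (- of_int n * z) * fcoef (\<lambda>z. c) n)) {0..1}"
  by (simp only:)
 then have "ee (- of_int n * z) * fcoef (\<lambda>z. c) n = fcoef (\<lambda>z. c) n"
  by (rule has_integral_unique[OF _ h]) (simp add: strip_def z_def)
 moreover have "ee (- of_int n * z) \<noteq> 1"
  using assms unfolding ee_eq_1_iff by (auto simp: z_def complex_eq_iff elim!: Ints_cases)
 ultimately show ?thesis by simp
qed

lemma fcoef_const_0: "fcoef (\<lambda>z. c) 0 = c" by (simp add: fcoef_def)

text \<open>The symmetric summation is the earlier result at 0 for the translated function minus its
  value. The exponential decay of the coefficients makes the series absolutely summable, so the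
  symmetric sum is also the unordered one.\<close>

theorem fourier_inversion:
 assumes f: "f holomorphic_on strip dlt" and per: "\<And>z. z \<in> strip dlt ==> f (z + 1) = f z"
  and M: "\<And>z. z \<in> strip dlt ==> cmod (f z) \<le> M" and x: "x \<in> strip dlt"
 shows "((\<lambda>n. fcoef f n * ee (of_int n * x)) has_sum f x) UNIV"
proof -
 define eta where "eta = dlt - \<bar>Im x\<bar>"
 have eta: "eta > 0" using x by (simp add: eta_def strip_def)
 have sub: "x + z \<in> strip dlt" if "z \<in> strip eta" for z using that by (auto simp: strip_def eta_def)
 define F where "F z = f (x + z) - f x" for z
 have F: "F holomorphic_on strip eta" unfolding F_def
  by (intro holomorphic_intros holomorphic_on_compose_gen[of "\<lambda>z. x + z" _ f "strip dlt", unfolded o_def] f) (use sub in auto)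
 have Fper: "F (z + 1) = F z" if "z \<in> strip eta" for z using per[OF sub[OF that]] by (simp add: F_def add.assoc)
 have coef: "fcoef F n = fcoef f n * ee (of_int n * x) - (if n = 0 then f x else 0)" for n
 proof -
  have "((\<lambda>t. ee (of_int n * x) * (f (x + of_real t) * ee (- of_int n * (x + of_real t)))) has_integral (ee (of_int n * x) * fcoef f n)) {0..1}"
   by (intro has_integral_mult_right fcoef_shift[OF f per x])
  moreover have "ee (of_int n * x) * (f (x + of_real t) * ee (- of_int n * (x + of_real t))) = f (x + of_real t) * ee (- of_int n * of_real t)" for t
  proof -
   have "ee (of_int n * x) * ee (- of_int n * (x + of_real t)) = ee (- of_int n * of_real t)"
    unfolding ee_add[symmetric] by (simp add: algebra_simps)
   then show ?thesis by (simp only: mult.left_commute[of _ "f (x + of_real t)"])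
  qed
  ultimately have 1: "((\<lambda>t. f (x + of_real t) * ee (- of_int n * of_real t)) has_integral (ee (of_int n * x) * fcoef f n)) {0..1}" by (simp only:)
  have "((\<lambda>t. f x * ee (- of_int n * (0 + of_real t))) has_integral fcoef (\<lambda>z. f x) n) {0..1}"
   by (rule fcoef_shift[of _ 1]) (auto simp: strip_def)
  from has_integral_diff[OF 1 this]
  have "((\<lambda>t. F (of_real t) * ee (- of_int n * of_real t)) has_integral (ee (of_int n * x) * fcoef f n - fcoef (\<lambda>z. f x) n)) {0..1}"
   by (simp add: F_def left_diff_distrib)
  then have "fcoef F n = ee (of_int n * x) * fcoef f n - fcoef (\<lambda>z. f x) n"
   unfolding fcoef_def[of F] by (rule integral_unique)
  then show ?thesis by (simp add: fcoef_const fcoef_const_0 mult.commute)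
 qed
 define t where "t n = fcoef f n * ee (of_int n * x)" for n
 have "F 0 = 0" by (simp add: F_def)
 then have "(\<lambda>n. fcoef F (int n) + fcoef F (- int n - 1)) sums 0"
  using fourier_series_at_0[OF F Fper eta] by blast
 moreover have "fcoef F (int n) + fcoef F (- int n - 1) = (t (int n) + t (- int n - 1)) - (if n = 0 then f x else 0)" for n
 proof -
  have "- int n - 1 \<noteq> 0" by linarith
  then show ?thesis unfolding coef t_def by (simp only: if_False) simp
 qed
 ultimately have "(\<lambda>n. (t (int n) + t (- int n - 1)) - (if n = 0 then f x else 0)) sums 0" by (simp only:)
 moreover have "(\<lambda>n::nat. if n = 0 then f x else 0) sums f x" using sums_single[of 0 "\<lambda>_. f x"] by simp
 ultimately have "(\<lambda>n. ((t (int n) + t (- int n - 1)) - (if n = 0 then f x else 0)) + (if n = 0 then f x else 0)) sums (0 + f x)"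
  by (rule sums_add)
 then have S: "(\<lambda>n. t (int n) + t (- int n - 1)) sums f x" by (simp only: diff_add_cancel add_0)
 have "(\<lambda>n. norm (t n)) summable_on UNIV"
 proof (rule Infinite_Sum.abs_summable_on_comparison_test)
  \<comment> \<open>The midpoint between \<open>\<bar>Im x\<bar>\<close> and \<open>dlt\<close>: the
    coefficients must decay faster than the exponentials grow at height \<open>Im x\<close>.\<close>
  define eta' where "eta' = (dlt + \<bar>Im x\<bar>) / 2"
  have eta': "\<bar>Im x\<bar> < eta'" "eta' < dlt" using eta by (auto simp: eta'_def eta_def)
  have pos: "2 * pi * (eta' - \<bar>Im x\<bar>) > 0" using eta' by simp
  show "(\<lambda>n::int. norm (M * exp (- (2 * pi * (eta' - \<bar>Im x\<bar>)) * \<bar>of_int n\<bar>))) summable_on UNIV"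
   by (rule summable_on_iff_abs_summable_on_real[THEN iffD1, OF summable_on_cmult_right[OF summable_on_exp_int[OF pos]]])
  fix n :: int
  have M0: "0 \<le> M" using M[OF x] norm_ge_zero order.trans by blast
  have "cmod (t n) \<le> M * exp (- 2 * pi * eta' * \<bar>of_int n\<bar>) * exp (2 * pi * \<bar>Im x\<bar> * \<bar>of_int n\<bar>)"
   unfolding t_def norm_mult
  proof (rule mult_mono)
   show "cmod (fcoef f n) \<le> M * exp (- 2 * pi * eta' * \<bar>of_int n\<bar>)"
    by (rule fcoef_bound[OF f per M]) (use eta' in auto)
   have "- (of_int n * Im x) \<le> \<bar>Im x\<bar> * \<bar>of_int n\<bar>" using abs_ge_minus_self[of "of_int n * Im x"] by (simp add: abs_mult mult.commute)
   then have "2 * pi * (- (of_int n * Im x)) \<le> 2 * pi * (\<bar>Im x\<bar> * \<bar>of_int n\<bar>)" by (intro mult_left_mono) auto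
   then show "cmod (ee (of_int n * x)) \<le> exp (2 * pi * \<bar>Im x\<bar> * \<bar>of_int n\<bar>)" by (simp add: norm_ee mult_ac)
  qed (use M0 in simp_all)
  also have "... = M * exp (- (2 * pi * (eta' - \<bar>Im x\<bar>)) * \<bar>of_int n\<bar>)"
   by (simp add: mult.assoc exp_add[symmetric] algebra_simps)
  finally show "norm (t n) \<le> norm (M * exp (- (2 * pi * (eta' - \<bar>Im x\<bar>)) * \<bar>of_int n\<bar>))" using M0 by simp
 qed
 then have ts: "t summable_on UNIV" by (rule Infinite_Sum.abs_summable_summable)
 then have "t summable_on {0..}" "t summable_on {..<0}" by (auto intro: summable_on_subset_banach[OF ts])
 then have "(\<lambda>n. t (int n)) summable_on UNIV" "(\<lambda>n. t (- int n - 1)) summable_on UNIV"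
  using summable_on_reindex_bij_betw[OF bij_betw_int_ge, of t] summable_on_reindex_bij_betw[OF bij_betw_int_neg, of t] by auto
 then obtain a b where ab: "((\<lambda>n. t (int n)) has_sum a) UNIV" "((\<lambda>n. t (- int n - 1)) has_sum b) UNIV"
  unfolding summable_on_def by blast
 then have "(\<lambda>n. t (int n) + t (- int n - 1)) sums (a + b)" by (intro sums_add has_sum_imp_sums)
 then have "a + b = f x" using S sums_unique2 unfolding t_def by blast
 then show ?thesis using has_sum_int_split[OF ab] unfolding t_def by simp
qed

section \<open>Small divisors\<close>

text \<open>For nonzero \<open>b\<close> the multiplicity of \<open>p\<close> would be even on the
  left and odd on the right.\<close>

lemma int_square_eq_prime_mult:
 fixes a b d :: int
 assumes eq: "a\<^sup>2 = d * b\<^sup>2" and p: "prime (p::int)" "odd (multiplicity p d)"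
 shows "b = 0"
proof (rule ccontr)
 assume b: "b \<noteq> 0"
 have d: "d \<noteq> 0" using p(2) by (intro notI) simp
 then have a: "a \<noteq> 0" using eq b by auto
 have pe: "prime_elem p" using p(1) by (rule prime_imp_prime_elem)
 have "multiplicity p (a\<^sup>2) = multiplicity p d + multiplicity p (b\<^sup>2)"
  unfolding eq using pe d b by (subst prime_elem_multiplicity_mult_distrib) auto
 then have "2 * multiplicity p a = multiplicity p d + 2 * multiplicity p b"
  using prime_elem_multiplicity_power_distrib[OF pe, of a 2] prime_elem_multiplicity_power_distrib[OF pe, of b 2] a b by simp
 then show False using p(2) by presburger
qed

lemma odd_multiplicity_prime: "prime (p::int) ==> odd (multiplicity p p)"
 using multiplicity_self[of p] not_prime_unit[of p] by fastforce

text \<open>The norm of \<open>a + b \<surd>2 + c \<surd>3\<close> is \<open>(a\<^sup>2 + 2 b\<^sup>2 - 3 c\<^sup>2)\<^sup>2 - 8 a\<^sup>2 b\<^sup>2\<close>.\<close>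

lemma sqrt2_sqrt3_norm_nonzero:
 fixes a b c :: int
 assumes "(b, c) \<noteq> (0, 0)"
 shows "(a\<^sup>2 + 2 * b\<^sup>2 - 3 * c\<^sup>2)\<^sup>2 - 8 * a\<^sup>2 * b\<^sup>2 \<noteq> 0"
proof
 assume *: "(a\<^sup>2 + 2 * b\<^sup>2 - 3 * c\<^sup>2)\<^sup>2 - 8 * a\<^sup>2 * b\<^sup>2 = 0"
 have p2: "prime (2::int)" and p3: "prime (3::int)" by simp_all
 have "(a\<^sup>2 + 2 * b\<^sup>2 - 3 * c\<^sup>2)\<^sup>2 = 2 * (2 * a * b)\<^sup>2" using * by (simp add: power_mult_distrib)
 from int_square_eq_prime_mult[OF this p2 odd_multiplicity_prime[OF p2]]
 have ab: "a * b = 0" by simp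
 with * have "a\<^sup>2 + 2 * b\<^sup>2 - 3 * c\<^sup>2 = 0" by auto
 then have e: "a\<^sup>2 + 2 * b\<^sup>2 = 3 * c\<^sup>2" by simp
 show False
 proof (cases "b = 0")
  case True
  then show False using int_square_eq_prime_mult[OF _ p3 odd_multiplicity_prime[OF p3], of a c] e assms by simp
 next
  case False
  then have "a = 0" using ab by simp
  \<comment> \<open>The relation \<open>2 * b\<^sup>2 = 3 * c\<^sup>2\<close> is multiplied by 3 to
    produce a square on one side; the prime 3 divides 6 exactly once.\<close>
  then have "(3 * c)\<^sup>2 = 6 * b\<^sup>2" using e by (simp add: power_mult_distrib)
  moreover have "odd (multiplicity 3 (6::int))"
  proof -
   have "multiplicity 3 (2 * 3 :: int) = multiplicity 3 (2::int) + multiplicity 3 (3::int)"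
    by (rule prime_elem_multiplicity_mult_distrib) auto
   moreover have "multiplicity 3 (2::int) = 0" by (rule not_dvd_imp_multiplicity_0) simp
   ultimately show ?thesis by simp
  qed
  ultimately show False using int_square_eq_prime_mult[OF _ p3, of "3 * c" 6 b] False by simp
 qed
qed

text \<open>The product of the four conjugates is a nonzero integer. If the first factor is below 1,
  then \<open>\<bar>a\<bar>\<close> is controlled by \<open>b\<close> and \<open>c\<close>, and each
  other conjugate is at most four times \<open>1 + \<bar>b\<bar> + \<bar>c\<bar>\<close>, whence the
  constant 64 and the cube.\<close>

lemma sqrt2_sqrt3_lower_bound:
 fixes a b c :: int
 assumes "(b, c) \<noteq> (0, 0)"
 shows "\<bar>a + b * sqrt 2 + c * sqrt 3\<bar> \<ge> 1 / (64 * (1 + \<bar>b\<bar> + \<bar>c\<bar>) ^ 3)"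
proof (cases "\<bar>a + b * sqrt 2 + c * sqrt 3\<bar> < 1")
 case False
 have "1 \<le> (1 + \<bar>real_of_int b\<bar> + \<bar>real_of_int c\<bar>) ^ 3" by (rule one_le_power) simp
 then have "1 \<le> 64 * (1 + \<bar>real_of_int b\<bar> + \<bar>real_of_int c\<bar>) ^ 3" by linarith
 then have "1 / (64 * (1 + \<bar>b\<bar> + \<bar>c\<bar>) ^ 3) \<le> (1::real)" by simp
 then show ?thesis using False by linarith
next
 case True
 define S where "S = 1 + \<bar>real_of_int b\<bar> + \<bar>real_of_int c\<bar>"
 have S: "S \<ge> 1" by (simp add: S_def)
 have s2: "sqrt 2 \<le> 2" and s3: "sqrt 3 \<le> 2" by (simp_all add: real_le_lsqrt)
 have b: "\<bar>b * sqrt 2\<bar> \<le> 2 * \<bar>real_of_int b\<bar>" and c: "\<bar>c * sqrt 3\<bar> \<le> 2 * \<bar>real_of_int c\<bar>"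
  using mult_left_mono[OF s2, of "\<bar>real_of_int b\<bar>"] mult_left_mono[OF s3, of "\<bar>real_of_int c\<bar>"] by (simp_all add: abs_mult mult.commute)
 have f: "\<bar>a + b * sqrt 2 - c * sqrt 3\<bar> \<le> 4 * S" "\<bar>a - b * sqrt 2 + c * sqrt 3\<bar> \<le> 4 * S" "\<bar>a - b * sqrt 2 - c * sqrt 3\<bar> \<le> 4 * S"
 proof -
  have "\<bar>u + v - w\<bar> \<le> 4 * (1 + B + C) \<and> \<bar>u - v + w\<bar> \<le> 4 * (1 + B + C) \<and> \<bar>u - v - w\<bar> \<le> 4 * (1 + B + C)"
   if "\<bar>v\<bar> \<le> 2 * B" "\<bar>w\<bar> \<le> 2 * C" "\<bar>u + v + w\<bar> < 1" "0 \<le> B" "0 \<le> C" for u v w B C :: real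
   using that by (auto simp: abs_le_iff abs_less_iff)
  from this[OF b c True]
  show "\<bar>a + b * sqrt 2 - c * sqrt 3\<bar> \<le> 4 * S" "\<bar>a - b * sqrt 2 + c * sqrt 3\<bar> \<le> 4 * S" "\<bar>a - b * sqrt 2 - c * sqrt 3\<bar> \<le> 4 * S"
   unfolding S_def by simp_all
 qed
 have id: "(a + b * sqrt 2 + c * sqrt 3) * ((a + b * sqrt 2 - c * sqrt 3) * ((a - b * sqrt 2 + c * sqrt 3) * (a - b * sqrt 2 - c * sqrt 3)))
   = real_of_int ((a\<^sup>2 + 2 * b\<^sup>2 - 3 * c\<^sup>2)\<^sup>2 - 8 * a\<^sup>2 * b\<^sup>2)"
 proof -
  have "(u + x + y) * ((u + x - y) * ((u - x + y) * (u - x - y))) = (u\<^sup>2 + x\<^sup>2 - y\<^sup>2)\<^sup>2 - 4 * u\<^sup>2 * x\<^sup>2" for u x y :: real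
   by algebra
  from this[of a "b * sqrt 2" "c * sqrt 3"] show ?thesis by (simp add: power_mult_distrib mult_ac)
 qed
 have "1 \<le> \<bar>real_of_int ((a\<^sup>2 + 2 * b\<^sup>2 - 3 * c\<^sup>2)\<^sup>2 - 8 * a\<^sup>2 * b\<^sup>2)\<bar>"
  using sqrt2_sqrt3_norm_nonzero[OF assms, of a] by linarith
 also have "... = \<bar>a + b * sqrt 2 + c * sqrt 3\<bar> * (\<bar>a + b * sqrt 2 - c * sqrt 3\<bar> * (\<bar>a - b * sqrt 2 + c * sqrt 3\<bar> * \<bar>a - b * sqrt 2 - c * sqrt 3\<bar>))"
  unfolding id[symmetric] by (simp only: abs_mult)
 also have "... \<le> \<bar>a + b * sqrt 2 + c * sqrt 3\<bar> * (4 * S * (4 * S * (4 * S)))"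
  using S by (intro mult_left_mono mult_mono f) auto
 finally have "1 \<le> \<bar>a + b * sqrt 2 + c * sqrt 3\<bar> * (64 * S ^ 3)" by (simp add: power3_eq_cube mult_ac)
 then show ?thesis using S unfolding S_def[symmetric] by (simp add: S_def[symmetric] divide_le_eq)
qed

lemma abs_sin_ge_third:
 fixes x :: real
 assumes "\<bar>x\<bar> \<le> pi / 2"
 shows "\<bar>sin x\<bar> \<ge> \<bar>x\<bar> / 3"
proof -
 have "\<bar>sin x - (\<Sum>m<3. sin_coeff m * x ^ m)\<bar> \<le> inverse (fact 3) * \<bar>x\<bar> ^ 3" by (rule Maclaurin_sin_bound)
 moreover have "(\<Sum>m<3. sin_coeff m * x ^ m) = x" by (simp add: numeral_3_eq_3 sin_coeff_def)
 ultimately have 1: "\<bar>sin x - x\<bar> \<le> \<bar>x\<bar> ^ 3 / 6" by (simp add: fact_numeral)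
 have "\<bar>x\<bar> \<le> 2" using assms pi_less_4 by linarith
 then have "\<bar>x\<bar>\<^sup>2 \<le> 2\<^sup>2" by (intro power_mono) auto
 then have "\<bar>x\<bar> * \<bar>x\<bar>\<^sup>2 \<le> \<bar>x\<bar> * 4" by (intro mult_left_mono) auto
 then have "\<bar>x\<bar> ^ 3 \<le> 4 * \<bar>x\<bar>" by (simp add: power3_eq_cube power2_eq_square)
 then show ?thesis using 1 by linarith
qed

text \<open>\<open>cmod (1 - ee (- z))\<close> for real \<open>z\<close> is twice the modulus of the
  sine of \<open>pi\<close> times the distance to the nearest integer, and so comparable to that
  distance.\<close>

lemma small_divisors_sqrt2_sqrt3:
 fixes N :: nat
 assumes N: "N > 0"
 obtains c where "c > 0" "\<And>m n::int. (m, n) \<noteq> (0, 0) ==>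
  cmod (1 - ee (- (of_int m * of_real (sqrt 2 / N) + of_int n * of_real (sqrt 3 / N)))) \<ge> c / (1 + \<bar>of_int m\<bar> + \<bar>of_int n\<bar>) ^ 3"
proof
 show "1 / (32 * real N) > 0" using N by simp
 fix m n :: int assume mn: "(m, n) \<noteq> (0, 0)"
 define tht where "tht = of_int m * (sqrt 2 / N) + of_int n * (sqrt 3 / N)"
 define d where "d = tht - of_int (round tht)"
 have "\<bar>d\<bar> \<le> 1 / 2" using of_int_round_abs_le[of tht] by (simp add: d_def abs_minus_commute)
 then have "\<bar>pi * d\<bar> \<le> pi / 2" by (simp add: abs_mult)
 then have sd: "\<bar>sin (pi * d)\<bar> \<ge> \<bar>pi * d\<bar> / 3" by (rule abs_sin_ge_third)
 have "ee (- of_real tht) = ee (of_real (- d) + of_int (- round tht))" by (simp add: d_def)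
 also have "... = cis (2 * pi * (- d))" by (simp only: ee_add ee_of_int ee_of_real mult_1_right)
 finally have "cmod (1 - ee (- of_real tht)) = cmod (1 - cis (2 * pi * (- d)))" by simp
 also have "... = 2 * \<bar>sin (pi * d)\<bar>"
 proof -
  have "(cmod (1 - cis (2 * pi * (- d))))\<^sup>2 = (2 * \<bar>sin (pi * d)\<bar>)\<^sup>2"
  proof -
   have c2: "cos (2 * pi * d) = 1 - 2 * (sin (pi * d))\<^sup>2" using cos_double_sin[of "pi * d"] by (simp add: mult.assoc)
   have "(cmod (1 - cis (2 * pi * (- d))))\<^sup>2 = (1 - cos (2 * pi * d))\<^sup>2 + (sin (2 * pi * d))\<^sup>2"
    by (simp add: cmod_power2)
   also have "... = 2 - 2 * cos (2 * pi * d)"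
    using sin_cos_squared_add[of "2 * pi * d"] by (simp add: power2_diff)
   finally show ?thesis unfolding c2 by (simp add: power_mult_distrib)
  qed
  then show ?thesis by (simp only: power2_eq_iff_nonneg norm_ge_zero abs_ge_zero mult_nonneg_nonneg zero_le_numeral)
 qed
 finally have eq: "cmod (1 - ee (- of_real tht)) = 2 * \<bar>sin (pi * d)\<bar>" .
 \<comment> \<open>Multiplication by \<open>N\<close> clears the denominators and yields a form with
   integer coefficients, to which the norm bound applies.\<close>
 have "d * N = (- round tht * int N) + m * sqrt 2 + n * sqrt 3" using N by (simp add: d_def tht_def field_simps)
 then have "\<bar>d\<bar> * N = \<bar>of_int (- round tht * int N) + m * sqrt 2 + n * sqrt 3\<bar>"
  by (metis abs_mult abs_of_nat)
 also have "... \<ge> 1 / (64 * (1 + \<bar>m\<bar> + \<bar>n\<bar>) ^ 3)" by (rule sqrt2_sqrt3_lower_bound[OF mn])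
 finally have dN: "1 / (64 * (1 + \<bar>of_int m\<bar> + \<bar>of_int n\<bar>) ^ 3) \<le> \<bar>d\<bar> * N" by simp
 define S where "S = (1 + \<bar>real_of_int m\<bar> + \<bar>real_of_int n\<bar>) ^ 3"
 have S: "S > 0" unfolding S_def by (intro zero_less_power) linarith
 have "1 / (32 * real N) / S = 2 * (1 / (64 * S)) / N" by simp
 also have "... \<le> 2 * (\<bar>d\<bar> * N) / N" using dN unfolding S_def[symmetric] by (intro divide_right_mono mult_left_mono) auto
 also have "... = 2 * \<bar>d\<bar>" using N by simp
 also have "... \<le> 2 * (\<bar>pi * d\<bar> / 3)" using pi_gt3 mult_right_mono[of 3 pi "\<bar>d\<bar>"] by (simp add: abs_mult)
 also have "... \<le> 2 * \<bar>sin (pi * d)\<bar>" using sd by simp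
 finally show "cmod (1 - ee (- (of_int m * of_real (sqrt 2 / N) + of_int n * of_real (sqrt 3 / N)))) \<ge> 1 / (32 * real N) / (1 + \<bar>of_int m\<bar> + \<bar>of_int n\<bar>) ^ 3"
  unfolding S_def eq[symmetric] by (simp add: tht_def)
qed

section \<open>The cohomological equation\<close>

lemma cube_le_exp:
 fixes eps :: real
 assumes "eps > 0"
 obtains K where "K > 0" "\<And>s. s \<ge> 0 ==> (1 + s) ^ 3 \<le> K * exp (eps * s)"
proof
 define K where "K = max 1 (3 / eps)"
 show "K ^ 3 > 0" by (simp add: K_def)
 fix s :: real assume s: "s \<ge> 0"
 have "1 + s \<le> K * (1 + eps * s / 3)"
 proof -
  have "s = 3 / eps * (eps * s / 3)" using assms by simp
  also have "... \<le> K * (eps * s / 3)" by (intro mult_right_mono) (use s assms in \<open>auto simp: K_def\<close>)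
  finally have "s \<le> K * (eps * s / 3)" .
  moreover have "1 \<le> K" by (simp add: K_def)
  ultimately show ?thesis unfolding distrib_left by linarith
 qed
 then have "(1 + s) ^ 3 \<le> (K * (1 + eps * s / 3)) ^ 3" using s by (intro power_mono) auto
 also have "... = K ^ 3 * (1 + eps * s / 3) ^ 3" by (simp add: power_mult_distrib)
 also have "... \<le> K ^ 3 * exp (eps * s)"
 proof (intro mult_left_mono)
  have "0 \<le> eps * s" using s assms by simp
  then show "(1 + eps * s / 3) ^ 3 \<le> exp (eps * s)"
   using exp_ge_one_plus_x_over_n_power_n[of 3 "eps * s"] by simp
 qed (auto simp: K_def)
 finally show "(1 + s) ^ 3 \<le> K ^ 3 * exp (eps * s)" .
qed

text \<open>On the mode \<open>(m, n)\<close> the difference operator is multiplication by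
  \<open>1 - ee (- (m * alp + n * \<beta>))\<close>. Dividing by it is harmless, since its inverse
  grows polynomially while the coefficients decay exponentially; only some width of the strip is
  lost. The mode \<open>(0, 0)\<close> cannot be divided and becomes the constant
  \<open>C\<close>.\<close>

theorem cohomological_equation:
 assumes f: "hol2 dlt f" and dlt: "dlt > 0"
  and px: "\<And>x k. x \<in> strip dlt ==> k \<in> strip dlt ==> f (x + 1) k = f x k"
  and pk: "\<And>x k. x \<in> strip dlt ==> k \<in> strip dlt ==> f x (k + 1) = f x k"
  and M: "\<And>x k. x \<in> strip dlt ==> k \<in> strip dlt ==> cmod (f x k) \<le> M"
  and c: "c > 0" and sd: "\<And>m n::int. (m, n) \<noteq> (0, 0) ==>
   cmod (1 - ee (- (of_int m * of_real alp + of_int n * of_real \<beta>))) \<ge> c / (1 + \<bar>of_int m\<bar> + \<bar>of_int n\<bar>) ^ 3"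
 obtains h C where "hol2 (dlt / 2) h"
  "\<And>x k. h (x + 1) k = h x k" "\<And>x k. h x (k + 1) = h x k"
  "\<And>x k. x \<in> strip (dlt / 2) ==> k \<in> strip (dlt / 2) ==> h x k - h (x - of_real alp) (k - of_real \<beta>) = f x k - C"
proof -
 have one: "z + 1 \<in> strip dlt'" if "z \<in> strip dlt'" for z dlt' using that by (simp add: strip_def)
 have fx: "(\<lambda>x. f x k) holomorphic_on strip dlt" if "k \<in> strip dlt" for k using f that by (auto simp: hol2_def)
 define a where "a m k = fcoef (\<lambda>x. f x k) m" for m k
 have ah: "a m holomorphic_on strip dlt" for m
 proof -
  have "hol2 dlt (\<lambda>k x. f x k * ee (- of_int m * x))"
   by (intro hol2_mult hol2_swap[OF f] hol2_snd holomorphic_intros)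
  moreover have "f (x + 1) k * ee (- of_int m * (x + 1)) = f x k * ee (- of_int m * x)" if "x \<in> strip dlt" "k \<in> strip dlt" for x k
  proof -
   have "ee (- of_int m * (x + 1)) = ee (- of_int m * x) * ee (of_int (- m))"
    by (simp only: ee_add[symmetric] distrib_left mult_1_right of_int_minus)
   then show ?thesis using px[OF that] by (simp only: ee_of_int mult_1_right)
  qed
  ultimately have "(\<lambda>k. integral {0..1} (\<lambda>t. f (of_real t) k * ee (- of_int m * of_real t))) holomorphic_on strip dlt"
   by (intro uniform_limit_riemann dlt)
  then show ?thesis unfolding a_def fcoef_def .
 qed
 have ap: "a m (k + 1) = a m k" if "k \<in> strip dlt" for m k
  unfolding a_def fcoef_def using pk[OF of_real_strip[OF dlt] that] by simp
 have aM: "cmod (a m k) \<le> M * exp (- 2 * pi * eta * \<bar>of_int m\<bar>)" if "k \<in> strip dlt" "0 \<le> eta" "eta < dlt" for m k eta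
  unfolding a_def by (rule fcoef_bound[OF fx]) (use that px M in auto)
 define b where "b m n = fcoef (a m) n" for m n
 define E where "E p x k = ee (of_int (fst p) * x + of_int (snd p) * k)" for p :: "int \<times> int" and x k
 define s where "s p = \<bar>real_of_int (fst p)\<bar> + \<bar>real_of_int (snd p)\<bar>" for p :: "int \<times> int"
 have s0: "s p \<ge> 0" for p by (simp add: s_def)
 have M0: "M \<ge> 0" using M[of 0 0] dlt norm_ge_zero[of "f 0 0"] by (simp add: strip_def del: norm_ge_zero)
 \<comment> \<open>The budget of decay rates in units of \<open>2 * pi * dlt\<close>: the
   coefficients give 3/4, the divisors cost 1/8, the exponentials on the half strip cost 1/2, and
   the remaining 1/8 makes the series summable.\<close>
 have bM: "cmod (b (fst p) (snd p)) \<le> M * exp (- 2 * pi * (3 * dlt / 4) * s p)" for p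
 proof -
  have "cmod (b (fst p) (snd p)) \<le> M * exp (- 2 * pi * (3 * dlt / 4) * \<bar>of_int (fst p)\<bar>) * exp (- 2 * pi * (3 * dlt / 4) * \<bar>of_int (snd p)\<bar>)"
   unfolding b_def by (rule fcoef_bound[OF ah ap aM]) (use dlt in auto)
  then show ?thesis by (simp add: s_def mult.assoc exp_add[symmetric] distrib_left)
 qed
 have EM: "cmod (E p x k) \<le> exp (2 * pi * (dlt / 2) * s p)" if "x \<in> strip (dlt / 2)" "k \<in> strip (dlt / 2)" for p x k
 proof -
  have "- (of_int (fst p) * Im x) \<le> \<bar>of_int (fst p)\<bar> * (dlt / 2)" "- (of_int (snd p) * Im k) \<le> \<bar>of_int (snd p)\<bar> * (dlt / 2)"
  proof -
   have "- (i * y) \<le> \<bar>i\<bar> * (dlt / 2)" if "\<bar>y\<bar> < dlt / 2" for i y :: real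
    using mult_left_mono[of "\<bar>y\<bar>" "dlt / 2" "\<bar>i\<bar>"] abs_ge_minus_self[of "i * y"] that by (simp add: abs_mult)
   then show "- (of_int (fst p) * Im x) \<le> \<bar>of_int (fst p)\<bar> * (dlt / 2)" "- (of_int (snd p) * Im k) \<le> \<bar>of_int (snd p)\<bar> * (dlt / 2)"
    using that by (auto simp: strip_def)
  qed
  then have "- (of_int (fst p) * Im x + of_int (snd p) * Im k) \<le> dlt / 2 * s p" by (simp add: s_def algebra_simps)
  then have "2 * pi * - (of_int (fst p) * Im x + of_int (snd p) * Im k) \<le> 2 * pi * (dlt / 2 * s p)" by (intro mult_left_mono) auto
  then show ?thesis by (simp add: E_def norm_ee algebra_simps)
 qed
 have sub: "strip (dlt / 2) \<subseteq> strip dlt" using dlt by (auto simp: strip_def)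
 have sumE: "((\<lambda>p. b (fst p) (snd p) * E p x k) has_sum f x k) UNIV" if xk: "x \<in> strip (dlt / 2)" "k \<in> strip (dlt / 2)" for x k
 proof -
  have xk': "x \<in> strip dlt" "k \<in> strip dlt" using xk sub by auto
  have "((\<lambda>p. b (fst p) (snd p) * E p x k) has_sum f x k) (UNIV \<times> UNIV)"
  proof (rule has_sum_SigmaI)
   show "((\<lambda>n. b (fst (m, n)) (snd (m, n)) * E (m, n) x k) has_sum (a m k * ee (of_int m * x))) UNIV" for m
   proof -
    have "((\<lambda>n. b m n * ee (of_int n * k)) has_sum a m k) UNIV"
     unfolding b_def by (rule fourier_inversion[OF ah ap aM xk'(2)]) (use dlt in auto)
    from has_sum_cmult_right[OF this, of "ee (of_int m * x)"] show ?thesis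
     by (simp add: E_def ee_add mult_ac)
   qed
   show "((\<lambda>m. a m k * ee (of_int m * x)) has_sum f x k) UNIV"
    unfolding a_def by (rule fourier_inversion[OF fx px M]) (use xk' in auto)
   have "(\<lambda>p. norm (b (fst p) (snd p) * E p x k)) summable_on UNIV"
   proof (rule Infinite_Sum.abs_summable_on_comparison_test)
    show "(\<lambda>p::int \<times> int. norm (M * exp (- (2 * pi * (dlt / 4)) * s p))) summable_on UNIV"
     unfolding s_def
     by (rule summable_on_iff_abs_summable_on_real[THEN iffD1, OF summable_on_cmult_right[OF summable_on_exp_int_prod]]) (use dlt in simp)
    fix p
    have "cmod (b (fst p) (snd p) * E p x k) \<le> M * exp (- 2 * pi * (3 * dlt / 4) * s p) * exp (2 * pi * (dlt / 2) * s p)"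
     unfolding norm_mult by (intro mult_mono bM EM xk) (use M0 in auto)
    also have "... = M * exp (- (2 * pi * (dlt / 4)) * s p)" by (simp add: mult.assoc exp_add[symmetric] algebra_simps)
    finally show "norm (b (fst p) (snd p) * E p x k) \<le> norm (M * exp (- (2 * pi * (dlt / 4)) * s p))" using M0 by simp
   qed
   then show "(\<lambda>p. b (fst p) (snd p) * E p x k) summable_on (UNIV \<times> UNIV)" using Infinite_Sum.abs_summable_summable by simp
  qed
  then show ?thesis by simp
 qed
 define w where "w p = 1 - ee (- (of_int (fst p) * of_real alp + of_int (snd p) * of_real \<beta>))" for p :: "int \<times> int"
 \<comment> \<open>The value 0 at \<open>(0, 0)\<close> is a choice: the constant mode of a solution
   is free.\<close>
 define D where "D p = (if p = (0, 0) then 0 else b (fst p) (snd p) / w p)" for p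
 obtain K where K: "K > 0" "\<And>s. s \<ge> 0 ==> (1 + s) ^ 3 \<le> K * exp (2 * pi * (dlt / 8) * s)"
  using cube_le_exp[of "2 * pi * (dlt / 8)"] dlt by auto
 have DM: "cmod (D p) \<le> M / c * K * exp (- 2 * pi * (5 * dlt / 8) * s p)" for p
 proof (cases "p = (0, 0)")
  case True
  then show ?thesis using M0 c K by (simp add: D_def)
 next
  case False
  define t where "t = (1 + s p) ^ 3"
  have t: "t > 0" using s0[of p] by (simp add: t_def)
  have w: "cmod (w p) \<ge> c / t" using sd[of "fst p" "snd p"] False by (simp add: w_def t_def s_def add.assoc prod_eq_iff)
  have ct: "c / t > 0" using c t by simp
  have "cmod (D p) = cmod (b (fst p) (snd p)) / cmod (w p)" using False by (simp add: D_def norm_divide)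
  also have "... \<le> (M * exp (- 2 * pi * (3 * dlt / 4) * s p)) / (c / t)"
   using w ct M0 by (intro frac_le bM) auto
  also have "... = M / c * exp (- 2 * pi * (3 * dlt / 4) * s p) * t" using c t by (simp add: field_simps)
  also have "... \<le> M / c * exp (- 2 * pi * (3 * dlt / 4) * s p) * (K * exp (2 * pi * (dlt / 8) * s p))"
   unfolding t_def using M0 c by (intro mult_left_mono K s0) auto
  also have "... = M / c * K * (exp (- 2 * pi * (3 * dlt / 4) * s p) * exp (2 * pi * (dlt / 8) * s p))" by simp
  also have "exp (- 2 * pi * (3 * dlt / 4) * s p) * exp (2 * pi * (dlt / 8) * s p) = exp (- 2 * pi * (5 * dlt / 8) * s p)"
   by (simp add: exp_add[symmetric] algebra_simps)
  finally show ?thesis .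
 qed
 define Bd where "Bd p = M / c * K * exp (- (2 * pi * (dlt / 8)) * s p)" for p
 have Bd: "Bd summable_on UNIV" unfolding Bd_def s_def
  by (rule summable_on_cmult_right[OF summable_on_exp_int_prod]) (use dlt in simp)
 have DB: "cmod (D p * E p x k) \<le> Bd p" if "x \<in> strip (dlt / 2)" "k \<in> strip (dlt / 2)" for p x k
 proof -
  have "cmod (D p * E p x k) \<le> M / c * K * exp (- 2 * pi * (5 * dlt / 8) * s p) * exp (2 * pi * (dlt / 2) * s p)"
   unfolding norm_mult by (intro mult_mono DM EM that) (use M0 c K in auto)
  also have "... = Bd p" unfolding Bd_def by (simp add: mult.assoc exp_add[symmetric] algebra_simps)
  finally show ?thesis .
 qed
 define h where "h x k = (\<Sum>\<^sub>\<infinity>p. D p * E p x k)" for x k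
 have hs: "((\<lambda>p. D p * E p x k) has_sum h x k) UNIV" if "x \<in> strip (dlt / 2)" "k \<in> strip (dlt / 2)" for x k
 proof -
  have "(\<lambda>p. norm (D p * E p x k)) summable_on UNIV"
  proof (rule Infinite_Sum.abs_summable_on_comparison_test)
   show "(\<lambda>p. norm (Bd p)) summable_on UNIV" using Bd by (rule summable_on_iff_abs_summable_on_real[THEN iffD1])
   show "norm (D p * E p x k) \<le> norm (Bd p)" for p using DB[OF that, of p] by simp
  qed
  then show ?thesis unfolding h_def by (rule has_sum_infsum[OF Infinite_Sum.abs_summable_summable])
 qed
 have "hol2 (dlt / 2) h" unfolding h_def
 proof (rule hol2_infsum)
  show "infinite (UNIV :: (int \<times> int) set)" by (simp add: finite_prod infinite_UNIV_int)
  show "hol2 (dlt / 2) (\<lambda>x k. D p * E p x k)" for p unfolding E_def by (intro hol2_mult hol2_const hol2_const_x)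
  show "\<exists>B. B summable_on UNIV \<and> (\<forall>p. \<forall>x\<in>strip (dlt / 2). \<forall>k\<in>strip (dlt / 2). cmod x \<le> M \<longrightarrow> cmod k \<le> M \<longrightarrow> cmod (D p * E p x k) \<le> B p)" for M
   using Bd DB by blast
 qed
 \<comment> \<open>The terms are periodic one by one, so the sum is periodic at all arguments, even
   where convergence is not known.\<close>
 moreover have "E p (x + 1) k = E p x k" "E p x (k + 1) = E p x k" for p x k
  by (simp_all add: E_def ee_add distrib_left)
 then have "h (x + 1) k = h x k" "h x (k + 1) = h x k" for x k by (simp_all add: h_def)
 moreover have "h x k - h (x - of_real alp) (k - of_real \<beta>) = f x k - b 0 0" if xk: "x \<in> strip (dlt / 2)" "k \<in> strip (dlt / 2)" for x k
 proof -
  have h1: "((\<lambda>p. D p * E p x k + - (D p * E p (x - of_real alp) (k - of_real \<beta>))) has_sum (h x k + - h (x - of_real alp) (k - of_real \<beta>))) UNIV"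
   by (intro has_sum_add hs has_sum_uminus[THEN iffD2]) (use xk in \<open>simp_all add: hs\<close>)
  have h2: "((\<lambda>p. b (fst p) (snd p) * E p x k + - (if p = (0, 0) then b 0 0 else 0)) has_sum (f x k + - b 0 0)) UNIV"
  proof (intro has_sum_add sumE xk has_sum_uminus[THEN iffD2])
   show "((\<lambda>p. if p = (0, 0) then b 0 0 else 0) has_sum (- (- b 0 0))) UNIV"
    by (rule has_sum_finite_neutralI[of "{(0, 0)}"]) auto
  qed
  have eq: "D p * E p x k + - (D p * E p (x - of_real alp) (k - of_real \<beta>)) = b (fst p) (snd p) * E p x k + - (if p = (0, 0) then b 0 0 else 0)" for p
  proof (cases "p = (0, 0)")
   case True
   then show ?thesis by (simp add: D_def E_def)
  next
   case False
   have "0 < c / (1 + \<bar>real_of_int (fst p)\<bar> + \<bar>real_of_int (snd p)\<bar>) ^ 3" using c by (intro divide_pos_pos zero_less_power) linarith+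
   also have "... \<le> cmod (w p)" using sd[of "fst p" "snd p"] False unfolding w_def by (simp add: prod_eq_iff)
   finally have w0: "w p \<noteq> 0" by auto
   have "E p (x - of_real alp) (k - of_real \<beta>) = E p x k * (1 - w p)"
   proof -
    have "E p (x - of_real alp) (k - of_real \<beta>) = E p x k * ee (- (of_int (fst p) * of_real alp + of_int (snd p) * of_real \<beta>))"
     unfolding E_def ee_add[symmetric] by (simp add: algebra_simps)
    then show ?thesis by (simp add: w_def)
   qed
   moreover have "D p * w p = b (fst p) (snd p)" using False w0 by (simp add: D_def)
   moreover have "D p * E p x k + - (D p * (E p x k * (1 - w p))) = (D p * w p) * E p x k" by (simp add: algebra_simps)
   ultimately show ?thesis using False by simp
  qed
  have "h x k + - h (x - of_real alp) (k - of_real \<beta>) = f x k + - b 0 0"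
   by (rule has_sum_unique[OF h1[unfolded eq] h2])
  then show ?thesis by simp
 qed
 ultimately show ?thesis using that by blast
qed

section \<open>The eigenvector section\<close>

text \<open>The Zak transform of the Gaussian \<open>exp(- 8 pi x\<^sup>2)\<close>; on real arguments it is dominated by its
 largest Gaussian.\<close>

definition chi_term :: "complex \<Rightarrow> complex \<Rightarrow> int \<Rightarrow> complex" where
 "chi_term x k n = exp (- 8 * complex_of_real pi * (x + of_int n)\<^sup>2) * ee (- of_int n * k)"

definition chi :: "complex \<Rightarrow> complex \<Rightarrow> complex" where
 "chi x k = (\<Sum>\<^sub>\<infinity>n. chi_term x k n)"

lemma norm_chi_term:
 "cmod (chi_term x k n) = exp (- 8 * pi * ((Re x + of_int n)\<^sup>2 - (Im x)\<^sup>2) + 2 * pi * of_int n * Im k)"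
 by (simp add: chi_term_def norm_mult norm_ee power2_eq_square exp_add[symmetric] algebra_simps)

lemma norm_chi_term_le:
 assumes "cmod x \<le> M" "cmod k \<le> M"
 shows "cmod (chi_term x k n) \<le> exp (16 * pi * M\<^sup>2 + 2 * pi * (M + 1)\<^sup>2) * exp (- (2 * pi) * \<bar>of_int n\<bar>)"
proof -
 define N where "N = \<bar>real_of_int n\<bar>"
 have b: "\<bar>Re x\<bar> \<le> M" "\<bar>Im x\<bar> \<le> M" "\<bar>Im k\<bar> \<le> M"
  using assms abs_Re_le_cmod[of x] abs_Im_le_cmod[of x] abs_Im_le_cmod[of k] by linarith+
 have M: "M \<ge> 0" using b(1) by linarith
 have sq: "(Re x)\<^sup>2 \<le> M\<^sup>2" "(Im x)\<^sup>2 \<le> M\<^sup>2" using b M by (auto simp: abs_le_square_iff[symmetric])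
 have "(of_int n)\<^sup>2 \<le> 2 * (Re x + of_int n)\<^sup>2 + 2 * (Re x)\<^sup>2"
  using zero_le_power2[of "2 * Re x + of_int n"] by (simp add: power2_eq_square algebra_simps)
 then have 1: "N\<^sup>2 \<le> 2 * (Re x + of_int n)\<^sup>2 + 2 * M\<^sup>2" using sq unfolding N_def power2_abs by linarith
 have 2: "of_int n * Im k \<le> N * M"
  using abs_ge_self[of "of_int n * Im k"] mult_left_mono[OF b(3), of N] by (simp add: N_def abs_mult)
 have 3: "N * (M + 1) \<le> N\<^sup>2 + (M + 1)\<^sup>2"
 proof -
  have "N * (M + 1) \<le> N\<^sup>2 + (M + 1)\<^sup>2 / 4"
   using zero_le_power2[of "N - (M + 1) / 2"] by (simp add: power2_diff power_divide)
  then show ?thesis using zero_le_power2[of "M + 1"] by linarith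
 qed
 have "- 8 * ((Re x + of_int n)\<^sup>2 - (Im x)\<^sup>2) + 2 * (of_int n * Im k) \<le> 16 * M\<^sup>2 + 2 * (M + 1)\<^sup>2 - 2 * N"
 proof -
  have "N * M + N \<le> N\<^sup>2 + (M + 1)\<^sup>2" using 3 by (simp add: distrib_left)
  have arith: "- 8 * (s - i) + 2 * t \<le> 16 * m + 2 * p - 2 * n"
   if "z + n \<le> l + p" "l \<le> 2 * s + 2 * m" "t \<le> z" "i \<le> m" "0 \<le> s" "0 \<le> m" for s i t m p n z l :: real
   using that by (simp only: right_diff_distrib)
  show ?thesis by (rule arith[OF \<open>N * M + N \<le> N\<^sup>2 + (M + 1)\<^sup>2\<close> 1 2 sq(2)]) auto
 qed
 then have "pi * (- 8 * ((Re x + of_int n)\<^sup>2 - (Im x)\<^sup>2) + 2 * (of_int n * Im k)) \<le> pi * (16 * M\<^sup>2 + 2 * (M + 1)\<^sup>2 - 2 * N)"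
  by (intro mult_left_mono) auto
 then have "- 8 * pi * ((Re x + of_int n)\<^sup>2 - (Im x)\<^sup>2) + 2 * pi * of_int n * Im k \<le> (16 * pi * M\<^sup>2 + 2 * pi * (M + 1)\<^sup>2) + - (2 * pi) * \<bar>of_int n\<bar>"
  by (simp add: N_def algebra_simps)
 then show ?thesis unfolding norm_chi_term exp_add[symmetric] by (simp only: exp_le_cancel_iff)
qed

lemma summable_chi_bound:
 "(\<lambda>n::int. exp (16 * pi * M\<^sup>2 + 2 * pi * (M + 1)\<^sup>2) * exp (- (2 * pi) * \<bar>of_int n\<bar>)) summable_on UNIV"
 by (rule summable_on_cmult_right[OF summable_on_exp_int]) simp

lemma has_sum_chi: "(chi_term x k has_sum chi x k) UNIV"
proof -
 define M where "M = max (cmod x) (cmod k)"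
 have "(\<lambda>n. norm (chi_term x k n)) summable_on UNIV"
 proof (rule Infinite_Sum.abs_summable_on_comparison_test)
  show "(\<lambda>n::int. norm (exp (16 * pi * M\<^sup>2 + 2 * pi * (M + 1)\<^sup>2) * exp (- (2 * pi) * \<bar>of_int n\<bar>))) summable_on UNIV"
   by (rule summable_on_iff_abs_summable_on_real[THEN iffD1, OF summable_chi_bound])
  show "norm (chi_term x k n) \<le> norm (exp (16 * pi * M\<^sup>2 + 2 * pi * (M + 1)\<^sup>2) * exp (- (2 * pi) * \<bar>of_int n\<bar>))" for n
   using norm_chi_term_le[of x M k n] by (simp add: M_def)
 qed
 then show ?thesis unfolding chi_def by (rule has_sum_infsum[OF Infinite_Sum.abs_summable_summable])
qed

lemma hol2_chi: "hol2 dlt chi"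
 unfolding chi_def
proof (rule hol2_infsum)
 show "infinite (UNIV :: int set)" by (rule infinite_UNIV_int)
 show "hol2 dlt (\<lambda>x k. chi_term x k n)" for n
  unfolding chi_term_def by (intro hol2_mult hol2_fst hol2_snd holomorphic_intros)
 show "\<exists>B. B summable_on UNIV \<and> (\<forall>n. \<forall>x\<in>strip dlt. \<forall>k\<in>strip dlt. cmod x \<le> M \<longrightarrow> cmod k \<le> M \<longrightarrow> cmod (chi_term x k n) \<le> B n)" for M
  using summable_chi_bound[of M] norm_chi_term_le[of _ M] by blast
qed

lemma chi_period_x: "chi (x + 1) k = ee k * chi x k"
proof -
 have "bij_betw (\<lambda>n::int. n + 1) UNIV UNIV" by (rule bij_betwI[of _ _ _ "\<lambda>n. n - 1"]) auto
 moreover have "chi_term (x + 1) k n = ee k * chi_term x k (n + 1)" for n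
 proof -
  have "ee (- of_int n * k) = ee k * ee (- of_int (n + 1) * k)" unfolding ee_add[symmetric] by (simp add: algebra_simps)
  moreover have "x + 1 + of_int n = x + of_int (n + 1)" by simp
  ultimately show ?thesis unfolding chi_term_def by (simp only: mult.left_commute)
 qed
 then have "chi (x + 1) k = ee k * (\<Sum>\<^sub>\<infinity>n. chi_term x k (n + 1))" by (simp only: chi_def infsum_cmult_right')
 ultimately show ?thesis using infsum_reindex_bij_betw[of "\<lambda>n. n + 1" UNIV UNIV "chi_term x k"] by (simp add: chi_def)
qed

lemma chi_period_k: "chi x (k + 1) = chi x k"
proof -
 have "ee (- of_int n * (k + 1)) = ee (- of_int n * k) * ee (of_int (- n))" for n
  by (simp only: ee_add[symmetric] distrib_left mult_1_right of_int_minus)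
 then show ?thesis by (simp only: chi_def chi_term_def ee_of_int mult_1_right)
qed

text \<open>After \<open>\<bar>a + n\<bar> \<ge> \<bar>n\<bar> - \<bar>a\<bar>\<close>, the
  difference of squares \<open>(N - 1/2) * (N + 1/2 - 2 * \<bar>a\<bar>)\<close> accounts for the
  linear gain in \<open>n\<close>.\<close>

lemma gauss_tail:
 fixes a D :: real and n :: int
 assumes "\<bar>a\<bar> \<le> 1 / 2" "0 \<le> D" "D \<le> \<bar>a\<bar>" "D \<le> 1 / 2 - \<bar>a\<bar>" "n \<noteq> 0"
 shows "D\<^sup>2 + \<bar>of_int n\<bar> / 4 \<le> (a + of_int n)\<^sup>2"
proof -
 define N where "N = \<bar>real_of_int n\<bar>"
 have N: "N \<ge> 1" using assms(5) by (simp add: N_def)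
 have "N - \<bar>a\<bar> \<le> \<bar>a + of_int n\<bar>" unfolding N_def by linarith
 moreover have "0 \<le> N - \<bar>a\<bar>" using N assms(1) by linarith
 ultimately have 1: "(N - \<bar>a\<bar>)\<^sup>2 \<le> (a + of_int n)\<^sup>2" by (metis abs_of_nonneg abs_le_square_iff)
 have "D\<^sup>2 \<le> (1 / 2 - \<bar>a\<bar>)\<^sup>2" using assms by (intro power_mono) auto
 moreover have "(N - \<bar>a\<bar>)\<^sup>2 - (1 / 2 - \<bar>a\<bar>)\<^sup>2 = (N - 1 / 2) * (N + 1 / 2 - 2 * \<bar>a\<bar>)" by (simp add: power2_eq_square algebra_simps)
 moreover have "(N - 1 / 2) * (N + 1 / 2 - 2 * \<bar>a\<bar>) \<ge> (N / 2) * (1 / 2)"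
  using N assms(1) by (intro mult_mono) auto
 ultimately show ?thesis using 1 unfolding N_def by linarith
qed

lemma exp_minus_2pi_le: "exp (- 2 * pi) \<le> 1 / 244"
proof -
 have "1 + 1 + 1\<^sup>2 / 2 \<le> exp (1::real)" by (rule exp_lower_Taylor_quadratic) simp
 then have "(5 / 2) ^ 6 \<le> exp (1::real) ^ 6" by (intro power_mono) auto
 also have "exp (1::real) ^ 6 = exp 6" by (simp add: exp_of_nat_mult[symmetric])
 also have "... \<le> exp (2 * pi)" using pi_gt3 by simp
 finally have "(244::real) \<le> exp (2 * pi)" by (simp add: power_divide)
 then have "inverse (exp (2 * pi)) \<le> inverse 244" by (intro le_imp_inverse_le) auto
 moreover have "exp (- 2 * pi) = inverse (exp (2 * pi))" using exp_minus[of "2 * pi"] by simp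
 ultimately show ?thesis by (simp only: inverse_eq_divide)
qed

text \<open>The error is measured against the larger of the two Gaussians that enter the vector at
  \<open>x\<close> and \<open>x - 1/2\<close>. The leading term itself would be no yardstick, since
  near \<open>\<bar>a\<bar> = 1/2\<close> a neighbouring term is as large.\<close>

lemma chi_approx:
 fixes a k D :: real
 assumes a: "\<bar>a\<bar> \<le> 1 / 2" "0 \<le> D" "D \<le> \<bar>a\<bar>" "D \<le> 1 / 2 - \<bar>a\<bar>"
 shows "cmod (chi (of_real a) (of_real k) - exp (- 8 * pi * a\<^sup>2)) \<le> exp (- 8 * pi * D\<^sup>2) / 100"
proof -
 define q where "q = exp (- 2 * pi)"
 define m where "m = exp (- 8 * pi * D\<^sup>2)"
 have q: "0 < q" "q \<le> 1 / 244" using exp_minus_2pi_le by (auto simp: q_def)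
 let ?x = "complex_of_real a" and ?k = "complex_of_real k"
 define t where "t n = (if n = 0 then 0 else chi_term ?x ?k n)" for n :: int
 define B where "B n = (if n = 0 then 0 else m * q ^ nat \<bar>n\<bar>)" for n :: int
 have z: "chi_term ?x ?k 0 = exp (- 8 * pi * a\<^sup>2)"
  by (simp add: chi_term_def flip: exp_of_real)
 have "((\<lambda>n. if n = 0 then - complex_of_real (exp (- 8 * pi * a\<^sup>2)) else 0) has_sum - complex_of_real (exp (- 8 * pi * a\<^sup>2))) UNIV"
  by (rule has_sum_finite_neutralI[of "{0}"]) auto
 from has_sum_add[OF has_sum_chi[of ?x ?k] this]
 have "((\<lambda>n. chi_term ?x ?k n + (if n = 0 then - complex_of_real (exp (- 8 * pi * a\<^sup>2)) else 0)) has_sum (chi ?x ?k - exp (- 8 * pi * a\<^sup>2))) UNIV" by simp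
 moreover have "chi_term ?x ?k n + (if n = 0 then - complex_of_real (exp (- 8 * pi * a\<^sup>2)) else 0) = t n" for n
  using z by (simp add: t_def)
 ultimately have T: "(t has_sum (chi ?x ?k - exp (- 8 * pi * a\<^sup>2))) UNIV" by (simp only:)
 have geo: "(\<lambda>n. m * q * q ^ n) sums (m * q * (1 / (1 - q)))" by (intro sums_mult geometric_sums) (use q in auto)
 have geo': "((\<lambda>n. m * q * q ^ n) has_sum (m * q * (1 / (1 - q)))) UNIV"
  by (rule norm_summable_imp_has_sum[OF _ geo]) (use sums_summable[OF geo] q in \<open>simp add: m_def\<close>)
 have "((\<lambda>n. B (int n)) has_sum (m * q * (1 / (1 - q)))) UNIV"
 proof -
  have "((\<lambda>n. B (int n)) has_sum (m * q * (1 / (1 - q)))) {1..}"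
  proof -
   have "bij_betw Suc UNIV {1..}" by (rule bij_betwI[of _ _ _ "\<lambda>n. n - 1"]) auto
   moreover have "B (int (Suc n)) = m * q * q ^ n" for n
   proof -
    have "nat \<bar>int (Suc n)\<bar> = Suc n" by simp
    then show ?thesis unfolding B_def by (simp only: power_Suc of_nat_eq_0_iff) simp
   qed
   ultimately show ?thesis using geo' has_sum_reindex_bij_betw[of Suc UNIV "{1..}" "\<lambda>n. B (int n)"] by simp
  qed
  moreover have "((\<lambda>n. B (int n)) has_sum (m * q * (1 / (1 - q)))) {1..} \<longleftrightarrow> ((\<lambda>n. B (int n)) has_sum (m * q * (1 / (1 - q)))) UNIV"
   by (rule has_sum_cong_neutral) (auto simp: B_def)
  ultimately show ?thesis by blast
 qed
 moreover have "((\<lambda>n. B (- int n - 1)) has_sum (m * q * (1 / (1 - q)))) UNIV"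
 proof -
  have "B (- int n - 1) = m * q * q ^ n" for n
  proof -
   have "nat \<bar>- int n - 1\<bar> = Suc n" "- int n - 1 \<noteq> 0" by simp_all
   then show ?thesis unfolding B_def by (simp only: power_Suc if_False mult.assoc)
  qed
  then show ?thesis using geo' by simp
 qed
 ultimately have BS: "(B has_sum (m * q * (1 / (1 - q)) + m * q * (1 / (1 - q)))) UNIV"
  by (rule has_sum_int_split)
 have tB: "norm (t n) \<le> B n" for n
 proof (cases "n = 0")
  case False
  have "cmod (chi_term ?x ?k n) = exp (- 8 * pi * (a + of_int n)\<^sup>2)" unfolding norm_chi_term by simp
  also have "... \<le> exp (- 8 * pi * (D\<^sup>2 + \<bar>of_int n\<bar> / 4))"
   using mult_left_mono[OF gauss_tail[OF a False], of "8 * pi"] by simp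
  also have "... = m * exp (real (nat \<bar>n\<bar>) * (- 2 * pi))" by (simp add: m_def exp_add[symmetric] algebra_simps)
  also have "... = m * q ^ nat \<bar>n\<bar>" unfolding q_def by (simp only: exp_of_nat_mult)
  finally show ?thesis using False by (simp add: t_def B_def)
 qed (simp add: t_def B_def)
 have "cmod (chi ?x ?k - exp (- 8 * pi * a\<^sup>2)) \<le> m * q * (1 / (1 - q)) + m * q * (1 / (1 - q))"
  by (rule norm_infsum_le[OF T BS tB])
 also have "... = m * (2 * q / (1 - q))" by simp
 \<comment> \<open>With \<open>q \<le> 1 / 244\<close> the two geometric tails amount to at most
   \<open>2 / 243\<close> of \<open>m\<close>.\<close>
 also have "... \<le> m * (1 / 100)"
  using q by (intro mult_left_mono) (auto simp: m_def field_simps)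
 finally show ?thesis by (simp add: m_def)
qed

section \<open>The matrix of the squared operator at parameter zero\<close>

definition qq :: "complex \<Rightarrow> complex" where "qq x = 9 / 10 * ee x"
definition Cc :: "complex \<Rightarrow> complex" where "Cc x = ee (- x) + 81 / 100 * ee x"
text \<open>On the thin strip, \<open>jm x\<close> and \<open>jp x\<close> are the products
  \<open>wgt 0 x * wgt 0 (x - 1/4)\<close> and \<open>wgt 0 x * wgt 0 (x + 1/4)\<close> after
  multiplication by the common denominator \<open>1 - qq x ^ 4\<close>.\<close>

definition jm :: "complex \<Rightarrow> complex" where "jm x = ee (- x) * (1 + qq x) * (ee (1 / 8) * (1 - \<i> * qq x))"
definition jp :: "complex \<Rightarrow> complex" where "jp x = ee (- x) * (1 + qq x) * (ee (- 1 / 8) * (1 + \<i> * qq x))"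
definition b1 :: "complex \<Rightarrow> complex \<Rightarrow> complex" where "b1 x k = jm x + ee k * jp x"
definition b2 :: "complex \<Rightarrow> complex \<Rightarrow> complex" where "b2 x k = jp (x - 1 / 2) + ee (- k) * jm (x - 1 / 2)"
definition s2 :: complex where "s2 = complex_of_real (sqrt 2)"
text \<open>The numbers are \<open>8 * (9/10)\<^sup>2\<close> and \<open>(9/10) ^ 4\<close>.\<close>

definition Rsq :: "complex \<Rightarrow> complex \<Rightarrow> complex" where
 "Rsq x k = 648 / 100 + \<i> * (ee k - ee (- k)) * (ee (- 2 * x) - 6561 / 10000 * ee (2 * x))"
definition RR :: "complex \<Rightarrow> complex \<Rightarrow> complex" where "RR x k = csqrt (Rsq x k)"
text \<open>The first component of \<open>R + J\<close> applied to the vector of \<open>chi\<close>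
  at \<open>x\<close> and \<open>x - 1/2\<close>, that is, up to a factor the spectral projection of
  the Gaussian onto the eigenvalue \<open>R\<close>. The second component is the same function at
  \<open>x - 1/2\<close>.\<close>

definition Phi :: "complex \<Rightarrow> complex \<Rightarrow> complex" where
 "Phi x k = (RR x k + s2 * Cc x) * chi x k + b1 x k * chi (x - 1 / 2) k"
text \<open>At real arguments \<open>chi x (- k)\<close> is the conjugate of \<open>chi x k\<close>,
  so this extends holomorphically the inner product of \<open>(R + J) chi\<close> with
  \<open>chi\<close>. Where it is nonzero, the eigenvector does not vanish.\<close>

definition Lam :: "complex \<Rightarrow> complex \<Rightarrow> complex" where
 "Lam x k = chi x (- k) * Phi x k + chi (x - 1 / 2) (- k) * Phi (x - 1 / 2) k"

lemma ee_half: "ee (1 / 2) = - 1"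
 using ee_of_real[of "1 / 2"] by simp
lemma ee_add_1: "ee (x + 1) = ee x" by (simp add: ee_add)
lemma ee_diff_1: "ee (x - 1) = ee x" by (simp add: ee_diff)
lemma ee_diff_half: "ee (x - 1 / 2) = - ee x" by (simp add: ee_diff ee_half)
lemma ee_add_half: "ee (x + 1 / 2) = - ee x" by (simp add: ee_add ee_half)
lemma ee_double: "ee (2 * x) = ee x * ee x" by (simp add: ee_add[symmetric])
lemma ee_eighth: "ee (1 / 8) = (1 + \<i>) / s2"
proof -
 have "ee (1 / 8) = cis (pi / 4)" using ee_of_real[of "1 / 8"] by simp
 also have "... = (1 + \<i>) / s2" unfolding s2_def
  by (simp add: complex_eq_iff cos_45 sin_45 Re_divide Im_divide field_simps)
 finally show ?thesis .
qed
lemma s2_square: "s2 * s2 = 2" by (simp add: s2_def flip: of_real_mult)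
lemma s2_nonzero: "s2 \<noteq> 0" by (simp add: s2_def)
lemma ee_minus_eighth: "ee (- 1 / 8) = (1 - \<i>) / s2"
proof -
 have "ee (- 1 / 8) = inverse (ee (1 / 8))" using ee_minus[of "1 / 8"] by simp
 also have "... = (1 - \<i>) / s2" unfolding ee_eighth
 proof (rule inverse_unique)
  have "(1 + \<i>) * (1 - \<i>) = 2" by (simp add: algebra_simps)
  then show "(1 + \<i>) / s2 * ((1 - \<i>) / s2) = 1" by (simp add: s2_square)
 qed
 finally show ?thesis .
qed

lemma qq_add_1: "qq (x + 1) = qq x" by (simp add: qq_def ee_add_1)
lemma qq_diff_half: "qq (x - 1 / 2) = - qq x" by (simp add: qq_def ee_diff_half)
lemma ee_minus_half: "ee (- (x - 1 / 2)) = - ee (- x)"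
proof -
 have "- (x - 1 / 2) = - x + 1 / 2" by simp
 then show ?thesis by (simp only: ee_add_half)
qed
lemma ee_minus_1: "ee (- (x + 1)) = ee (- x)"
proof -
 have "- (x + 1) = - x - 1" by simp
 then show ?thesis by (simp only: ee_diff_1)
qed
lemma Cc_add_1: "Cc (x + 1) = Cc x" unfolding Cc_def ee_minus_1 ee_add_1 ..
lemma Cc_diff_half: "Cc (x - 1 / 2) = - Cc x" unfolding Cc_def ee_minus_half ee_diff_half by simp
lemma jm_add_1: "jm (x + 1) = jm x" unfolding jm_def ee_minus_1 qq_add_1 ..
lemma jp_add_1: "jp (x + 1) = jp x" unfolding jp_def ee_minus_1 qq_add_1 ..
lemma b1_add_1: "b1 (x + 1) k = b1 x k" unfolding b1_def jm_add_1 jp_add_1 ..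
lemma b1_k: "b1 x (k + 1) = b1 x k" unfolding b1_def ee_add_1 ..
lemma Rsq_half: "Rsq (x - 1 / 2) k = Rsq x k"
proof -
 have "ee (- 2 * (x - 1 / 2)) = ee (- 2 * x + 1)" "ee (2 * (x - 1 / 2)) = ee (2 * x - 1)" by (simp_all add: right_diff_distrib)
 then show ?thesis unfolding Rsq_def by (simp only: ee_add_1 ee_diff_1)
qed
lemma Rsq_k: "Rsq x (k + 1) = Rsq x k" unfolding Rsq_def ee_minus_1 ee_add_1 ..
lemma RR_half: "RR (x - 1 / 2) k = RR x k" unfolding RR_def Rsq_half ..
lemma RR_k: "RR x (k + 1) = RR x k" unfolding RR_def Rsq_k ..
lemma RR_add_1: "RR (x + 1) k = RR x k"
proof -
 have "RR (x + 1) k = RR (x + 1 - 1 / 2) k" by (simp only: RR_half)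
 also have "x + 1 - 1 / 2 = x + 1 / 2" by simp
 also have "RR (x + 1 / 2) k = RR (x + 1 / 2 - 1 / 2) k" by (simp only: RR_half)
 finally show ?thesis by simp
qed

lemma chi_diff_1: "chi (x - 1) k = ee (- k) * chi x k"
 using chi_period_x[of "x - 1" k] by (simp add: ee_minus)
lemma chi_minus_k: "chi x (- (k + 1)) = chi x (- k)"
 using chi_period_k[of x "- k - 1"] by simp

lemma Phi_add_1: "Phi (x + 1) k = ee k * Phi x k"
proof -
 have "chi (x + 1 - 1 / 2) k = ee k * chi (x - 1 / 2) k" using chi_period_x[of "x - 1 / 2" k] by (simp add: algebra_simps)
 then show ?thesis unfolding Phi_def chi_period_x RR_add_1 Cc_add_1 b1_add_1 by (simp add: algebra_simps)
qed
lemma Phi_k: "Phi x (k + 1) = Phi x k" unfolding Phi_def chi_period_k RR_k b1_k ..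

lemma Phi_half: "Phi (x - 1 / 2) k = (RR x k - s2 * Cc x) * chi (x - 1 / 2) k + b2 x k * chi x k"
proof -
 have "x - 1 / 2 - 1 / 2 = x - 1" by simp
 then have "Phi (x - 1 / 2) k = (RR x k - s2 * Cc x) * chi (x - 1 / 2) k + b1 (x - 1 / 2) k * (ee (- k) * chi x k)"
  unfolding Phi_def by (simp add: RR_half Cc_diff_half chi_diff_1)
 also have "b1 (x - 1 / 2) k * (ee (- k) * chi x k) = b2 x k * chi x k"
 proof -
  have "ee k * ee (- k) = 1" by (simp add: ee_minus)
  then have "(A + ee k * B) * (ee (- k) * c) = (B + ee (- k) * A) * c" for A B c by algebra
  then show ?thesis unfolding b1_def b2_def .
 qed
 finally show ?thesis .
qed

text \<open>\<open>J = [[s2 C, b1], [b2, - s2 C]]\<close> satisfies \<open>J\<^sup>2 = R\<^sup>2\<close>.\<close>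

lemma Rsq_eq: "2 * Cc x * Cc x + b1 x k * b2 x k = Rsq x k"
proof -
 define X where "X = ee x"
 define Y where "Y = ee (- x)"
 define K where "K = ee k"
 define L where "L = ee (- k)"
 define p where "p = ee (1 / 8)"
 define m where "m = ee (- 1 / 8)"
 have XY: "X * Y = 1" by (simp add: X_def Y_def ee_minus)
 have KL: "K * L = 1" by (simp add: K_def L_def ee_minus)
 have pm: "p * m = 1" "p * p = \<i>" "m * m = - \<i>"
 proof -
  have s: "s2 * s2 = 2" by (rule s2_square)
  show "p * m = 1" "p * p = \<i>" "m * m = - \<i>" unfolding p_def m_def ee_eighth ee_minus_eighth
   by (simp_all add: s algebra_simps)
 qed
 have i: "\<i> * \<i> = - 1" by simp
 have q: "qq x = 9 / 10 * X" by (simp add: qq_def X_def)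
 have e2: "ee (- 2 * x) = Y * Y" "ee (2 * x) = X * X" using ee_double[of "- x"] ee_double[of x] by (simp_all add: X_def Y_def)
 define Q where "Q = 9 / 10 * X"
 have B1: "b1 x k = Y * (1 + Q) * (p * (1 - \<i> * Q) + K * (m * (1 + \<i> * Q)))"
  unfolding b1_def jm_def jp_def q Y_def[symmetric] K_def[symmetric] p_def[symmetric] m_def[symmetric] Q_def[symmetric] by (simp add: algebra_simps)
 have B2: "b2 x k = - (Y * (1 - Q) * (m * (1 - \<i> * Q) + L * (p * (1 + \<i> * Q))))"
  unfolding b2_def jm_def jp_def qq_diff_half q ee_minus_half Y_def[symmetric] L_def[symmetric] p_def[symmetric] m_def[symmetric] Q_def[symmetric] by (simp add: algebra_simps)
 have "(p * (1 - \<i> * Q) + K * (m * (1 + \<i> * Q))) * (m * (1 - \<i> * Q) + L * (p * (1 + \<i> * Q)))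
   = (1 - \<i> * Q) * (1 - \<i> * Q) * (p * m) + (1 + \<i> * Q) * (1 + \<i> * Q) * (K * L) * (p * m)
    + (1 - \<i> * Q) * (1 + \<i> * Q) * (L * (p * p) + K * (m * m))"
  by (simp add: algebra_simps)
 also have "... = 2 - 2 * Q * Q + (1 + Q * Q) * (\<i> * (L - K))"
  unfolding pm KL by (simp add: algebra_simps)
 finally have prod: "(p * (1 - \<i> * Q) + K * (m * (1 + \<i> * Q))) * (m * (1 - \<i> * Q) + L * (p * (1 + \<i> * Q))) = 2 - 2 * Q * Q + (1 + Q * Q) * (\<i> * (L - K))" .
 have "b1 x k * b2 x k = - (Y * Y * ((1 + Q) * (1 - Q)) * (2 - 2 * Q * Q + (1 + Q * Q) * (\<i> * (L - K))))"
  unfolding B1 B2 prod[symmetric] by (simp add: algebra_simps)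
 moreover have "Cc x = Y * (1 + Q * Q)"
 proof -
  have "Y * (Q * Q) = 81 / 100 * X * (X * Y)" by (simp add: Q_def algebra_simps)
  then show ?thesis unfolding Cc_def Y_def[symmetric] X_def[symmetric] XY by (simp add: distrib_left)
 qed
 ultimately have "2 * Cc x * Cc x + b1 x k * b2 x k
   = 8 * ((Y * Q) * (Y * Q)) + \<i> * (K - L) * (Y * Y - (Y * Q) * (Y * Q) * (Q * Q))"
  by (simp add: algebra_simps)
 also have "Y * Q = 9 / 10" using XY by (simp add: Q_def mult.commute)
 finally show ?thesis unfolding Rsq_def e2 K_def[symmetric] L_def[symmetric] by (simp add: Q_def algebra_simps)
qed

lemma RR_square: "RR x k * RR x k = Rsq x k"
 unfolding RR_def by (metis power2_csqrt power2_eq_square)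

text \<open>\<open>Phi\<close> lies in the range of \<open>J + R\<close>, and
  \<open>(J - R) * (J + R) = 0\<close>.\<close>

lemma Phi_eigen:
 shows "s2 * Cc x * Phi x k + b1 x k * Phi (x - 1 / 2) k = RR x k * Phi x k"
  and "b2 x k * Phi x k - s2 * Cc x * Phi (x - 1 / 2) k = RR x k * Phi (x - 1 / 2) k"
proof -
 define C where "C = s2 * Cc x"
 define R where "R = RR x k"
 define u where "u = chi x k"
 define v where "v = chi (x - 1 / 2) k"
 have P: "Phi x k = (R + C) * u + b1 x k * v" "Phi (x - 1 / 2) k = (R - C) * v + b2 x k * u"
  unfolding Phi_half by (simp_all add: Phi_def R_def C_def u_def v_def)
 have "C * C = 2 * Cc x * Cc x"
 proof -
  have "C * C = (s2 * s2) * Cc x * Cc x" by (simp add: C_def mult_ac)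
  then show ?thesis unfolding s2_square .
 qed
 then have J: "C * C + b1 x k * b2 x k = R * R" using Rsq_eq[of x k] RR_square[of x k] by (simp add: R_def)
 show "s2 * Cc x * Phi x k + b1 x k * Phi (x - 1 / 2) k = RR x k * Phi x k"
  unfolding P C_def[symmetric] R_def[symmetric] using J by algebra
 show "b2 x k * Phi x k - s2 * Cc x * Phi (x - 1 / 2) k = RR x k * Phi (x - 1 / 2) k"
  unfolding P C_def[symmetric] R_def[symmetric] using J by algebra
qed

section \<open>Estimates on a thin strip\<close>

lemma norm_ee_strip:
 assumes "\<bar>Im z\<bar> \<le> d"
 shows "cmod (ee z) \<le> exp (2 * pi * d)"
 using assms mult_left_mono[of "- Im z" d "2 * pi"] by (simp add: norm_ee)

lemma exp_6pi_le: "exp (6 * pi / 100) \<le> 5 / 4"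
proof -
 have "6 * pi / 100 \<le> (1/5::real)" using pi_approx by simp
 then have "exp (- (6 * pi / 100)) \<ge> 1 - 1 / 5" using exp_ge_add_one_self[of "- (6 * pi / 100)"] by linarith
 then have "inverse (exp (6 * pi / 100)) \<ge> 4 / 5" by (simp add: exp_minus)
 then show ?thesis by (simp add: inverse_eq_divide field_simps)
qed

text \<open>The number 3.3122 is \<open>2 * (1 + (9/10) ^ 4)\<close>; the exponent adds
  \<open>2 * pi * d\<close> from the factor in \<open>k\<close> and \<open>4 * pi * d\<close> from
  the factor in \<open>2 * x\<close>.\<close>

lemma Rsq_near:
 assumes "\<bar>Im x\<bar> \<le> d" "\<bar>Im k\<bar> \<le> d"
 shows "cmod (Rsq x k - 648 / 100) \<le> 33122 / 10000 * exp (6 * pi * d)"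
proof -
 have e: "cmod (ee k) \<le> exp (2 * pi * d)" "cmod (ee (- k)) \<le> exp (2 * pi * d)"
  "cmod (ee (- 2 * x)) \<le> exp (2 * pi * (2 * d))" "cmod (ee (2 * x)) \<le> exp (2 * pi * (2 * d))"
  using assms norm_ee_strip[of k d] norm_ee_strip[of "- k" d] norm_ee_strip[of "- 2 * x" "2 * d"] norm_ee_strip[of "2 * x" "2 * d"]
  by (simp_all add: abs_mult)
 have "cmod (Rsq x k - 648 / 100) = cmod (ee k - ee (- k)) * cmod (ee (- 2 * x) - 6561 / 10000 * ee (2 * x))"
  by (simp add: Rsq_def norm_mult)
 also have "... \<le> (exp (2 * pi * d) + exp (2 * pi * d)) * (exp (2 * pi * (2 * d)) + 6561 / 10000 * exp (2 * pi * (2 * d)))"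
 proof (intro mult_mono)
  show "cmod (ee k - ee (- k)) \<le> exp (2 * pi * d) + exp (2 * pi * d)"
   using norm_triangle_ineq4[of "ee k" "ee (- k)"] e by linarith
  have "cmod (6561 / 10000 * ee (2 * x)) = 6561 / 10000 * cmod (ee (2 * x))" by (simp add: norm_mult)
  then show "cmod (ee (- 2 * x) - 6561 / 10000 * ee (2 * x)) \<le> exp (2 * pi * (2 * d)) + 6561 / 10000 * exp (2 * pi * (2 * d))"
   using norm_triangle_ineq4[of "ee (- 2 * x)" "6561 / 10000 * ee (2 * x)"] e by linarith
 qed auto
 also have "... = 33122 / 10000 * (exp (2 * pi * d) * exp (2 * pi * (2 * d)))" by simp
 also have "exp (2 * pi * d) * exp (2 * pi * (2 * d)) = exp (6 * pi * d)" by (simp add: exp_add[symmetric] algebra_simps)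
 finally show ?thesis .
qed

text \<open>Thin enough for \<open>exp (6 * pi * d0) \<le> 5 / 4\<close>, which keeps the real part
  of \<open>Rsq\<close> above 2 and hence \<open>csqrt\<close> away from its cut.\<close>

abbreviation d0 :: real where "d0 \<equiv> 1 / 100"

lemma Rsq_Re_pos:
 assumes "x \<in> strip d0" "k \<in> strip d0"
 shows "Re (Rsq x k) > 2"
proof -
 have "cmod (Rsq x k - 648 / 100) \<le> 33122 / 10000 * exp (6 * pi * d0)"
  by (rule Rsq_near) (use assms in \<open>auto simp: strip_def\<close>)
 also have "... \<le> 33122 / 10000 * (5 / 4)" using exp_6pi_le by simp
 finally have "\<bar>Re (Rsq x k - 648 / 100)\<bar> \<le> 33122 / 10000 * (5 / 4)" using abs_Re_le_cmod order.trans by blast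
 moreover have "Re (Rsq x k - 648 / 100) = Re (Rsq x k) - 648 / 100" by simp
 ultimately show ?thesis by linarith
qed

lemma Re_csqrt_ge:
 assumes "0 \<le> a" "a\<^sup>2 \<le> Re z"
 shows "a \<le> Re (csqrt z)"
proof -
 have "csqrt z * csqrt z = z" by (metis power2_csqrt power2_eq_square)
 then have "Re z = (Re (csqrt z))\<^sup>2 - (Im (csqrt z))\<^sup>2" by (metis Re_complex_of_real complex.sel(1) times_complex.sel(1) power2_eq_square)
 then have "a\<^sup>2 \<le> (Re (csqrt z))\<^sup>2" using assms(2) zero_le_power2[of "Im (csqrt z)"] by linarith
 moreover have "0 \<le> Re (csqrt z)" by (rule Re_csqrt)
 ultimately show ?thesis using power2_le_imp_le by blast
qed

lemma RR_Re_pos: "x \<in> strip d0 ==> k \<in> strip d0 ==> Re (RR x k) \<ge> 1"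
 unfolding RR_def using Rsq_Re_pos[of x k] by (intro Re_csqrt_ge) auto

lemma hol_qq: "qq holomorphic_on S" unfolding qq_def[abs_def] by (intro holomorphic_intros)
lemma hol_Cc: "Cc holomorphic_on S" unfolding Cc_def[abs_def] by (intro holomorphic_intros)
lemma hol_jm: "jm holomorphic_on S" unfolding jm_def[abs_def] by (intro holomorphic_intros hol_qq)
lemma hol_jp: "jp holomorphic_on S" unfolding jp_def[abs_def] by (intro holomorphic_intros hol_qq)

lemma hol2_RR: "hol2 d0 RR"
 unfolding RR_def[abs_def]
proof (rule hol2_compose[where f = Rsq and g = csqrt and S = "- \<real>\<^sub>\<le>\<^sub>0"])
 show "hol2 d0 Rsq" unfolding Rsq_def[abs_def]
  by (intro hol2_add hol2_const hol2_mult hol2_diff hol2_fst hol2_snd holomorphic_intros)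
 show "csqrt holomorphic_on - \<real>\<^sub>\<le>\<^sub>0" by (rule holomorphic_on_csqrt)
 show "Rsq x k \<in> - \<real>\<^sub>\<le>\<^sub>0" if "x \<in> strip d0" "k \<in> strip d0" for x k
  using Rsq_Re_pos[OF that] by (auto simp: complex_nonpos_Reals_iff)
qed

lemma hol2_half: "hol2 dlt f ==> hol2 dlt (\<lambda>x k. f (x - 1 / 2) k)"
 using hol2_shift[of dlt f "1 / 2" 0] by simp

lemma hol2_b1: "hol2 dlt b1" unfolding b1_def[abs_def] by (intro hol2_add hol2_mult hol2_fst hol2_snd hol_jm hol_jp holomorphic_intros)

lemma hol2_Phi: "hol2 d0 Phi"
 unfolding Phi_def[abs_def] by (intro hol2_add hol2_mult hol2_RR hol2_const hol2_fst hol_Cc hol2_chi hol2_b1 hol2_half[of _ chi])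

lemma hol2_flip:
 assumes "hol2 dlt f"
 shows "hol2 dlt (\<lambda>x k. f x (- k))"
proof -
 have n: "- k \<in> strip dlt \<longleftrightarrow> k \<in> strip dlt" for k by (simp add: strip_def)
 have "continuous_on (strip dlt \<times> strip dlt) (\<lambda>p. f (fst (fst p, - snd p)) (snd (fst p, - snd p)))"
  by (rule continuous_on_compose2[of "strip dlt \<times> strip dlt" "\<lambda>p. f (fst p) (snd p)"])
   (use assms n in \<open>auto simp: hol2_def intro!: continuous_intros\<close>)
 moreover have "(\<lambda>k. f x (- k)) holomorphic_on strip dlt" if "x \<in> strip dlt" for x
  by (rule holomorphic_on_compose_gen[of "\<lambda>k. - k" _ "f x" "strip dlt", unfolded o_def])
   (use assms that n in \<open>auto simp: hol2_def intro!: holomorphic_intros\<close>)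
 ultimately show ?thesis using assms n by (auto simp: hol2_def)
qed

lemma hol2_chi_half: "hol2 dlt (\<lambda>x k. chi (x - 1 / 2) k)" by (rule hol2_half[OF hol2_chi])
lemma hol2_Lam: "hol2 d0 Lam"
 unfolding Lam_def[abs_def]
 by (intro hol2_add hol2_mult hol2_Phi hol2_half[OF hol2_Phi] hol2_flip[OF hol2_chi] hol2_flip[OF hol2_chi_half])

lemma Lam_k: "Lam x (k + 1) = Lam x k"
 unfolding Lam_def chi_minus_k Phi_k ..

text \<open>The half step exchanges the two summands of the pairing; the quasi-periodicity factors
  \<open>ee k\<close> and \<open>ee (- k)\<close> that arise cancel.\<close>

lemma Lam_half: "Lam (x - 1 / 2) k = Lam x k"
proof -
 have e: "ee k * ee (- k) = 1" by (simp add: ee_minus)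
 have h: "x - 1 / 2 - 1 / 2 = x - 1" by simp
 have "chi (x - 1) (- k) = ee k * chi x (- k)" using chi_diff_1[of x "- k"] by simp
 moreover have "Phi (x - 1) k = ee (- k) * Phi x k" using Phi_add_1[of "x - 1" k] by (simp add: ee_minus)
 ultimately show ?thesis unfolding Lam_def h using e by algebra
qed

section \<open>Positivity of the pairing on real arguments\<close>

lemma mult_near:
 fixes u v :: complex and g h m :: real
 assumes "cmod (u - g) \<le> m / 100" "cmod (v - h) \<le> m / 100" "0 \<le> g" "g \<le> m" "0 \<le> h" "h \<le> m"
 shows "cmod (u * v - of_real (g * h)) \<le> 201 / 10000 * m\<^sup>2"
proof -
 have "cmod v \<le> cmod (v - h) + cmod (complex_of_real h)" using norm_triangle_ineq[of "v - h" "complex_of_real h"] by simp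
 then have v: "cmod v \<le> 101 / 100 * m" using assms by simp
 have "u * v - of_real (g * h) = (u - g) * v + g * (v - h)" by (simp add: algebra_simps)
 then have "cmod (u * v - of_real (g * h)) \<le> cmod ((u - g) * v) + cmod (g * (v - h))" by (simp only: norm_triangle_ineq)
 also have "... = cmod (u - g) * cmod v + g * cmod (v - h)" using assms by (simp add: norm_mult)
 also have "... \<le> m / 100 * (101 / 100 * m) + m * (m / 100)"
  using assms v by (intro add_mono mult_mono) auto
 also have "... = 201 / 10000 * m\<^sup>2" by (simp add: power2_eq_square)
 finally show ?thesis .
qed

lemma jm_expand: "jm x = ((1 + \<i>) * ee (- x) + 9 / 5 + (1 - \<i>) * (81 / 100) * ee x) / s2"
proof -
 have XY: "ee x * ee (- x) = 1" by (simp add: ee_minus)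
 have "ee (- x) * (1 + qq x) * ((1 + \<i>) * (1 - \<i> * qq x)) = (1 + \<i>) * ee (- x) + 9 / 5 + (1 - \<i>) * (81 / 100) * ee x"
  unfolding qq_def using XY i_squared by algebra
 then show ?thesis unfolding jm_def ee_eighth by (simp add: mult_ac)
qed

lemma jp_expand: "jp x = ((1 - \<i>) * ee (- x) + 9 / 5 + (1 + \<i>) * (81 / 100) * ee x) / s2"
proof -
 have XY: "ee x * ee (- x) = 1" by (simp add: ee_minus)
 have "ee (- x) * (1 + qq x) * ((1 - \<i>) * (1 + \<i> * qq x)) = (1 - \<i>) * ee (- x) + 9 / 5 + (1 + \<i>) * (81 / 100) * ee x"
  unfolding qq_def using XY i_squared by algebra
 then show ?thesis unfolding jp_def ee_minus_eighth by (simp add: mult_ac)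
qed

lemma Re_divide_s2: "Re (z / s2) = Re z / sqrt 2" unfolding s2_def by (simp add: Re_divide_of_real)

lemma norm_qq_real: "cmod (qq (of_real x)) = 9 / 10" by (simp add: qq_def norm_mult norm_ee)

lemma norm_jm_real: "cmod (jm (of_real x)) \<le> 361 / 100" and norm_jp_real: "cmod (jp (of_real x)) \<le> 361 / 100"
proof -
 have q: "cmod (1 + qq (of_real x)) \<le> 19 / 10" "cmod (1 - \<i> * qq (of_real x)) \<le> 19 / 10" "cmod (1 + \<i> * qq (of_real x)) \<le> 19 / 10"
  using norm_triangle_ineq[of 1 "qq (of_real x)"] norm_triangle_ineq4[of 1 "\<i> * qq (of_real x)"] norm_triangle_ineq[of 1 "\<i> * qq (of_real x)"]
  by (simp_all add: norm_mult norm_qq_real)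
 have e: "cmod (ee (1 / 8)) = 1" "cmod (ee (- (1 / 8))) = 1" "cmod (ee (- of_real x)) = 1" by (simp_all add: norm_ee)
 have "cmod (jm (of_real x)) = cmod (1 + qq (of_real x)) * cmod (1 - \<i> * qq (of_real x))" by (simp add: jm_def norm_mult e)
 also have "... \<le> 19 / 10 * (19 / 10)" by (intro mult_mono q) auto
 finally show "cmod (jm (of_real x)) \<le> 361 / 100" by simp
 have "cmod (jp (of_real x)) = cmod (1 + qq (of_real x)) * cmod (1 + \<i> * qq (of_real x))" by (simp add: jp_def norm_mult e)
 also have "... \<le> 19 / 10 * (19 / 10)" by (intro mult_mono q) auto
 finally show "cmod (jp (of_real x)) \<le> 361 / 100" by simp
qed

text \<open>The sum is estimated jointly, through the parallelogram identity
  \<open>a\<^sup>2 + b\<^sup>2 = 2 + 2 * (81/100)\<close>. Separate bounds of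
  \<open>361 / 100\<close> for the two terms would be too weak for
  \<open>Lam_real_pos\<close>.\<close>

lemma norm_jp_jm_real:
 assumes s: "sin (2 * pi * x) \<ge> 0"
 shows "cmod (jp (of_real x)) + cmod (jm (of_real x - 1 / 2)) \<le> 362 / 100"
proof -
 define Q where "Q = qq (of_real x)"
 define a where "a = cmod (1 + Q)"
 define b where "b = cmod (1 - Q)"
 define t where "t = cmod (1 + \<i> * Q)"
 have Q: "Re Q = 9 / 10 * cos (2 * pi * x)" "Im Q = 9 / 10 * sin (2 * pi * x)"
  by (simp_all add: Q_def qq_def ee_of_real)
 have sc: "(Re Q)\<^sup>2 + (Im Q)\<^sup>2 = 81 / 100"
  unfolding Q by (simp add: power_mult_distrib power_divide) (simp flip: distrib_left)
 have e: "cmod (ee (1 / 8)) = 1" "cmod (ee (- (1 / 8))) = 1" "cmod (ee (- of_real x)) = 1" by (simp_all add: norm_ee)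
 have "cmod (jp (of_real x)) = a * t" by (simp add: jp_def norm_mult e a_def t_def Q_def)
 moreover have "cmod (jm (of_real x - 1 / 2)) = b * t"
  unfolding jm_def ee_minus_half qq_diff_half by (simp add: norm_mult e b_def t_def Q_def)
 moreover have "(a + b) * t \<le> 362 / 100"
 proof -
  have "a\<^sup>2 + b\<^sup>2 = 2 + 2 * ((Re Q)\<^sup>2 + (Im Q)\<^sup>2)"
   unfolding a_def b_def cmod_power2 by (simp add: power2_eq_square algebra_simps)
  then have ab: "a\<^sup>2 + b\<^sup>2 = 362 / 100" unfolding sc by simp
  have "(a + b)\<^sup>2 \<le> 2 * (a\<^sup>2 + b\<^sup>2)" using zero_le_power2[of "a - b"] by (simp add: power2_eq_square algebra_simps)
  then have 1: "(a + b)\<^sup>2 \<le> 724 / 100" unfolding ab by simp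
  have "t\<^sup>2 = 1 + ((Re Q)\<^sup>2 + (Im Q)\<^sup>2) - 2 * Im Q"
   unfolding t_def cmod_power2 by (simp add: power2_eq_square algebra_simps)
  then have 2: "t\<^sup>2 \<le> 181 / 100" unfolding sc using s Q by simp
  have "((a + b) * t)\<^sup>2 \<le> 724 / 100 * (181 / 100)"
   unfolding power_mult_distrib by (intro mult_mono 1 2) auto
  also have "... = (362 / 100)\<^sup>2" by (simp add: power2_eq_square)
  finally show ?thesis by (rule power2_le_imp_le) simp
 qed
 ultimately show ?thesis by (simp add: distrib_right)
qed

text \<open>The part free of \<open>k\<close> has real part at least \<open>254 / 100\<close>,
  thanks to the sign of the sine; the part with \<open>ee k\<close> and \<open>ee (- k)\<close> has
  modulus at most \<open>362 / 100\<close>.\<close>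

lemma Re_b1_b2:
 assumes s: "sin (2 * pi * x) \<ge> 0"
 shows "Re (b1 (of_real x) (of_real k) + b2 (of_real x) (of_real k)) \<ge> - 108 / 100"
proof -
 define c where "c = cos (2 * pi * x)"
 define s where "s = sin (2 * pi * x)"
 let ?x = "complex_of_real x" and ?k = "complex_of_real k"
 have X: "ee ?x = Complex c s" "ee (- ?x) = Complex c (- s)"
  using ee_of_real[of x] ee_of_real[of "- x"] by (simp_all add: complex_eq_iff c_def s_def)
 have h: "?x - 1 / 2 = of_real (x - 1 / 2)" by simp
 have "Re (jm ?x) = (181 / 100 * (c + s) + 9 / 5) / sqrt 2"
  unfolding jm_expand Re_divide_s2 X by (simp add: algebra_simps)
 moreover have "Re (jp (?x - 1 / 2)) = (181 / 100 * (s - c) + 9 / 5) / sqrt 2"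
  unfolding jp_expand Re_divide_s2 ee_minus_half ee_diff_half X by (simp add: algebra_simps) (simp add: field_simps)
 ultimately have main: "Re (jm ?x) + Re (jp (?x - 1 / 2)) = (362 / 100 * s + 18 / 5) / sqrt 2"
  by (simp add: add_divide_distrib[symmetric] algebra_simps)
 have "sqrt 2 \<le> 1415 / 1000" by (rule real_le_lsqrt) (auto simp: power2_eq_square)
 then have "254 / 100 * sqrt 2 \<le> 362 / 100 * s + 18 / 5" using assms unfolding s_def[symmetric] by linarith
 then have "254 / 100 \<le> (362 / 100 * s + 18 / 5) / sqrt 2" by (simp add: pos_le_divide_eq)
 then have 1: "254 / 100 \<le> Re (jm ?x) + Re (jp (?x - 1 / 2))" using main by simp
 have "cmod (ee ?k * jp ?x) + cmod (ee (- ?k) * jm (?x - 1 / 2)) \<le> 362 / 100"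
  using norm_jp_jm_real[OF assms] by (simp add: norm_mult norm_ee)
 moreover have "\<bar>Re (ee ?k * jp ?x)\<bar> \<le> cmod (ee ?k * jp ?x)" "\<bar>Re (ee (- ?k) * jm (?x - 1 / 2))\<bar> \<le> cmod (ee (- ?k) * jm (?x - 1 / 2))"
  by (rule abs_Re_le_cmod)+
 moreover have "Re (b1 ?x ?k + b2 ?x ?k) = Re (jm ?x) + Re (jp (?x - 1 / 2)) + Re (ee ?k * jp ?x) + Re (ee (- ?k) * jm (?x - 1 / 2))"
  unfolding b1_def b2_def by (simp only: plus_complex.sel)
 ultimately show ?thesis using 1 by linarith
qed

text \<open>With \<open>chi\<close> replaced by the Gaussians \<open>g\<close> and \<open>h\<close>,
  the real part is at least \<open>(177 - 54) / 100\<close> times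
  \<open>g\<^sup>2 + h\<^sup>2\<close>: the first number bounds \<open>Re R\<close>, the second is
  half of \<open>108 / 100\<close>. The replacement costs at most \<open>27 * E\<close>, about
  \<open>54 / 100\<close> of \<open>m\<^sup>2\<close>.\<close>

theorem Lam_real_pos:
 fixes x k :: real
 assumes x: "0 \<le> x" "x \<le> 1 / 2"
 shows "Re (Lam (of_real x) (of_real k)) > 0"
proof -
 define g where "g = exp (- 8 * pi * x\<^sup>2)"
 define h where "h = exp (- 8 * pi * (x - 1 / 2)\<^sup>2)"
 define D where "D = min x (1 / 2 - x)"
 define m where "m = exp (- 8 * pi * D\<^sup>2)"
 have D: "0 \<le> D" "D \<le> x" "D \<le> 1 / 2 - x" using x by (auto simp: D_def)
 have gm: "0 \<le> g" "g \<le> m" "0 \<le> h" "h \<le> m"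
 proof -
  have "D\<^sup>2 \<le> x\<^sup>2" "D\<^sup>2 \<le> (1 / 2 - x)\<^sup>2" using D by (auto intro: power_mono)
  then show "0 \<le> g" "g \<le> m" "0 \<le> h" "h \<le> m" by (auto simp: g_def h_def m_def power2_commute[of x])
 qed
 have "m = g \<or> m = h" by (auto simp: m_def g_def h_def D_def min_def power2_commute[of x])
 then have mS: "m\<^sup>2 \<le> g\<^sup>2 + h\<^sup>2" by auto
 have m0: "m\<^sup>2 > 0" by (simp add: m_def)
 define X where "X = complex_of_real x"
 define K where "K = complex_of_real k"
 define u1 where "u1 = chi X K"
 define u2 where "u2 = chi (X - 1 / 2) K"
 define v1 where "v1 = chi X (- K)"
 define v2 where "v2 = chi (X - 1 / 2) (- K)"
 have Xh: "X - 1 / 2 = of_real (x - 1 / 2)" by (simp add: X_def)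
 have near: "cmod (u1 - g) \<le> m / 100" "cmod (v1 - g) \<le> m / 100" "cmod (u2 - h) \<le> m / 100" "cmod (v2 - h) \<le> m / 100"
  using chi_approx[of x D k] chi_approx[of x D "- k"] chi_approx[of "x - 1 / 2" D k] chi_approx[of "x - 1 / 2" D "- k"] x D
  unfolding u1_def u2_def v1_def v2_def Xh unfolding X_def K_def g_def h_def m_def by simp_all
 define E where "E = 201 / 10000 * m\<^sup>2"
 define e11 where "e11 = v1 * u1 - of_real (g * g)"
 define e22 where "e22 = v2 * u2 - of_real (h * h)"
 define e12 where "e12 = v1 * u2 - of_real (g * h)"
 define e21 where "e21 = v2 * u1 - of_real (h * g)"
 have e: "cmod e11 \<le> E" "cmod e22 \<le> E" "cmod e12 \<le> E" "cmod e21 \<le> E"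
  unfolding e11_def e22_def e12_def e21_def E_def by (intro mult_near near gm)+
 have E0: "E \<ge> 0" by (simp add: E_def)
 define R where "R = RR X K"
 define C where "C = s2 * Cc X"
 define B1 where "B1 = b1 X K"
 define B2 where "B2 = b2 X K"
 have LamE: "Lam X K = (R * of_real (g\<^sup>2 + h\<^sup>2) + C * of_real (g\<^sup>2 - h\<^sup>2) + (B1 + B2) * of_real (g * h))
   + (R * (e11 + e22) + C * (e11 - e22) + B1 * e12 + B2 * e21)"
 proof -
  have "Lam X K = v1 * ((R + C) * u1 + B1 * u2) + v2 * ((R - C) * u2 + B2 * u1)"
   unfolding Lam_def Phi_half unfolding Phi_def R_def C_def B1_def B2_def u1_def u2_def v1_def v2_def ..
  then show ?thesis unfolding e11_def e22_def e12_def e21_def by (simp add: algebra_simps power2_eq_square)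
 qed
 have nR: "cmod R \<le> 32 / 10"
 proof -
  have near6: "cmod (Rsq X K - 648 / 100) \<le> 33122 / 10000 * exp (6 * pi * 0)"
   by (rule Rsq_near) (simp_all add: X_def K_def)
  have "cmod (Rsq X K) \<le> cmod (Rsq X K - 648 / 100) + cmod (648 / 100 :: complex)"
   using norm_triangle_ineq[of "Rsq X K - 648 / 100" "648 / 100"] by simp
  then have "cmod (Rsq X K) \<le> (32 / 10)\<^sup>2" using near6 by (simp add: power2_eq_square)
  moreover have "cmod (Rsq X K) = (cmod R)\<^sup>2" unfolding R_def by (simp only: RR_square[symmetric] norm_mult power2_eq_square)
  ultimately show ?thesis by (metis power2_le_imp_le divide_nonneg_nonneg zero_le_numeral)
 qed
 have ReR: "Re R \<ge> 177 / 100"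
 proof -
  have "cmod (Rsq X K - 648 / 100) \<le> 33122 / 10000 * exp (6 * pi * 0)"
   by (rule Rsq_near) (simp_all add: X_def K_def)
  then have "\<bar>Re (Rsq X K - 648 / 100)\<bar> \<le> 33122 / 10000" using abs_Re_le_cmod[of "Rsq X K - 648 / 100"] by simp
  moreover have "Re (Rsq X K - 648 / 100) = Re (Rsq X K) - 648 / 100" by simp
  moreover have "(177 / 100)\<^sup>2 = (31329 / 10000 :: real)" by (simp add: power2_eq_square)
  ultimately have "(177 / 100)\<^sup>2 \<le> Re (Rsq X K)" by linarith
  then show ?thesis unfolding R_def RR_def by (intro Re_csqrt_ge) auto
 qed
 have CX: "Cc X = Complex (181 / 100 * cos (2 * pi * x)) (- 19 / 100 * sin (2 * pi * x))"
  using ee_of_real[of x] ee_of_real[of "- x"] by (simp add: Cc_def X_def complex_eq_iff)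
 have s2': "sqrt 2 \<le> 3 / 2" by (rule real_le_lsqrt) (auto simp: power2_eq_square)
 have nC: "cmod C \<le> 272 / 100"
 proof -
  have "cmod (Cc X) \<le> cmod (ee (- X)) + cmod (81 / 100 * ee X)" unfolding Cc_def by (rule norm_triangle_ineq)
  also have "... = 181 / 100" by (simp add: norm_mult norm_ee X_def)
  finally have "cmod C \<le> 3 / 2 * (181 / 100)"
   unfolding C_def norm_mult using s2' by (intro mult_mono) (auto simp: s2_def)
  then show ?thesis by simp
 qed
 \<comment> \<open>The cosine in \<open>Re C\<close> and the difference
   \<open>g\<^sup>2 - h\<^sup>2\<close> change sign together at \<open>x = 1/4\<close>.\<close>
 have ReC: "Re C * (g\<^sup>2 - h\<^sup>2) \<ge> 0"
 proof -
  have ReC: "Re C = sqrt 2 * (181 / 100) * cos (2 * pi * x)" unfolding C_def CX s2_def by simp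
  show ?thesis
  proof (cases "x \<le> 1 / 4")
   case True
   have "2 * pi * x \<le> pi / 2" using True mult_left_mono[of x "1/4" "2 * pi"] by simp
   then have "cos (2 * pi * x) \<ge> 0" using x by (intro cos_ge_zero) (auto intro: order.trans[of _ 0])
   moreover have "x\<^sup>2 \<le> (1 / 2 - x)\<^sup>2" using x True by (intro power_mono) auto
   then have "h \<le> g" unfolding g_def h_def by (simp add: power2_commute[of x])
   then have "h\<^sup>2 \<le> g\<^sup>2" using gm by (intro power_mono) auto
   ultimately show ?thesis unfolding ReC by simp
  next
   case False
   have a1: "pi / 2 \<le> 2 * pi * x" using False mult_left_mono[of "1/4" x "2 * pi"] by simp
   have a2: "2 * pi * x \<le> pi" using x mult_left_mono[of x "1/2" "2 * pi"] by simp
   have "cos (2 * pi * x) \<le> 0"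
   proof -
    have "cos (2 * pi * x) = - cos (pi - 2 * pi * x)" by simp
    moreover have "cos (pi - 2 * pi * x) \<ge> 0" by (intro cos_ge_zero; use a1 a2 pi_gt_zero in linarith)
    ultimately show ?thesis by simp
   qed
   moreover have "(1 / 2 - x)\<^sup>2 \<le> x\<^sup>2" using x False by (intro power_mono) auto
   then have "g \<le> h" unfolding g_def h_def by (simp add: power2_commute[of x])
   then have "g\<^sup>2 \<le> h\<^sup>2" using gm by (intro power_mono) auto
   ultimately show ?thesis unfolding ReC by (simp add: mult_nonneg_nonpos mult_nonpos_nonpos)
  qed
 qed
 have sn: "sin (2 * pi * x) \<ge> 0" using x mult_left_mono[of x "1/2" "2 * pi"] by (intro sin_ge_zero) auto
 have ReB: "Re (B1 + B2) \<ge> - 108 / 100" unfolding B1_def B2_def X_def K_def by (rule Re_b1_b2[OF sn])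
 have nB: "cmod B1 \<le> 722 / 100" "cmod B2 \<le> 722 / 100"
 proof -
  have "cmod B1 \<le> cmod (jm X) + cmod (ee K * jp X)" unfolding B1_def b1_def by (rule norm_triangle_ineq)
  then show "cmod B1 \<le> 722 / 100" using norm_jm_real[of x] norm_jp_real[of x] by (simp add: norm_mult norm_ee X_def K_def)
  have "cmod B2 \<le> cmod (jp (X - 1 / 2)) + cmod (ee (- K) * jm (X - 1 / 2))" unfolding B2_def b2_def by (rule norm_triangle_ineq)
  then show "cmod B2 \<le> 722 / 100" using norm_jm_real[of "x - 1 / 2"] norm_jp_real[of "x - 1 / 2"] unfolding Xh by (simp add: norm_mult norm_ee K_def)
 qed
 \<comment> \<open>The factor 27 rounds up \<open>2 * (32/10 + 272/100 + 722/100)\<close>.\<close>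
 have err: "cmod (R * (e11 + e22) + C * (e11 - e22) + B1 * e12 + B2 * e21) \<le> 27 * E"
 proof -
  have "cmod (R * (e11 + e22)) \<le> 32 / 10 * (2 * E)" unfolding norm_mult
   using norm_triangle_ineq[of e11 e22] e nR by (intro mult_mono) auto
  moreover have "cmod (C * (e11 - e22)) \<le> 272 / 100 * (2 * E)" unfolding norm_mult
   using norm_triangle_ineq4[of e11 e22] e nC by (intro mult_mono) auto
  moreover have "cmod (B1 * e12) \<le> 722 / 100 * E" "cmod (B2 * e21) \<le> 722 / 100 * E" unfolding norm_mult
   by (rule mult_mono[OF nB(1) e(3)] mult_mono[OF nB(2) e(4)]; simp)+
  moreover have "cmod (R * (e11 + e22) + C * (e11 - e22) + B1 * e12 + B2 * e21)
    \<le> cmod (R * (e11 + e22)) + cmod (C * (e11 - e22)) + cmod (B1 * e12) + cmod (B2 * e21)"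
   by (intro order.trans[OF norm_triangle_ineq] add_mono order.refl)
  ultimately show ?thesis using E0 by linarith
 qed
 have gh: "g * h \<le> (g\<^sup>2 + h\<^sup>2) / 2" using zero_le_power2[of "g - h"] by (simp add: power2_eq_square algebra_simps)
 have gh0: "0 \<le> g * h" using gm by simp
 have "Re (R * of_real (g\<^sup>2 + h\<^sup>2) + C * of_real (g\<^sup>2 - h\<^sup>2) + (B1 + B2) * of_real (g * h))
   = Re R * (g\<^sup>2 + h\<^sup>2) + Re C * (g\<^sup>2 - h\<^sup>2) + Re (B1 + B2) * (g * h)"
  by (simp only: plus_complex.sel times_complex.sel Re_complex_of_real Im_complex_of_real mult_zero_right diff_zero)
 moreover have "Re R * (g\<^sup>2 + h\<^sup>2) \<ge> 177 / 100 * (g\<^sup>2 + h\<^sup>2)" using ReR by (intro mult_right_mono) auto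
 moreover have "Re (B1 + B2) * (g * h) \<ge> - 108 / 100 * (g * h)" using ReB gh0 by (rule mult_right_mono)
 ultimately have main: "Re (R * of_real (g\<^sup>2 + h\<^sup>2) + C * of_real (g\<^sup>2 - h\<^sup>2) + (B1 + B2) * of_real (g * h)) \<ge> 123 / 100 * (g\<^sup>2 + h\<^sup>2)"
  using ReC gh by linarith
 have "\<bar>Re (R * (e11 + e22) + C * (e11 - e22) + B1 * e12 + B2 * e21)\<bar> \<le> 27 * E" using abs_Re_le_cmod err order.trans by blast
 then have "Re (Lam X K) \<ge> 123 / 100 * (g\<^sup>2 + h\<^sup>2) - 27 * E" using main unfolding LamE plus_complex.sel by linarith
 moreover have "123 / 100 * m\<^sup>2 \<le> 123 / 100 * (g\<^sup>2 + h\<^sup>2)" using mS by (intro mult_left_mono) auto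
 moreover have "27 * E < 123 / 100 * m\<^sup>2" using m0 unfolding E_def by simp
 ultimately have "Re (Lam X K) > 0" by linarith
 then show ?thesis by (simp add: X_def K_def)
qed

section \<open>The graph transform\<close>

lemma periodic_shift_nat:
 assumes px: "\<And>x k. x \<in> strip dlt ==> k \<in> strip dlt ==> f (x + 1 / 2) k = f x k"
  and pk: "\<And>x k. x \<in> strip dlt ==> k \<in> strip dlt ==> f x (k + 1) = f x k"
  and xk: "x \<in> strip dlt" "k \<in> strip dlt"
 shows "f (x + of_nat m / 2) (k + of_nat n) = f x k"
proof -
 have sx: "x + of_nat m / 2 \<in> strip dlt" for m using xk by (simp add: strip_def)
 have sk: "k + of_nat n \<in> strip dlt" for n using xk by (simp add: strip_def)
 have "f (x + of_nat m / 2) (k + of_nat n) = f x (k + of_nat n)"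
 proof (induction m)
  case (Suc m)
  have "x + of_nat (Suc m) / 2 = x + of_nat m / 2 + 1 / 2" by (simp add: field_simps)
  then show ?case using px[OF sx sk] Suc by (simp only:)
 qed simp
 also have "... = f x k"
 proof (induction n)
  case (Suc n)
  have "k + of_nat (Suc n) = k + of_nat n + 1" by simp
  then show ?case using pk[OF xk(1) sk] Suc by (simp only:)
 qed simp
 finally show ?thesis .
qed

lemma periodic_reduce:
 assumes px: "\<And>x k. x \<in> strip dlt ==> k \<in> strip dlt ==> f (x + 1 / 2) k = f x k"
  and pk: "\<And>x k. x \<in> strip dlt ==> k \<in> strip dlt ==> f x (k + 1) = f x k"
  and xk: "x \<in> strip dlt" "k \<in> strip dlt"
 obtains x' k' where "0 \<le> Re x'" "Re x' \<le> 1 / 2" "Im x' = Im x" "0 \<le> Re k'" "Re k' \<le> 1" "Im k' = Im k" "f x' k' = f x k"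
proof -
 define j where "j = \<lfloor>2 * Re x\<rfloor>"
 define l where "l = \<lfloor>Re k\<rfloor>"
 define x' where "x' = x - of_int j / 2"
 define k' where "k' = k - of_int l"
 have r: "0 \<le> Re x'" "Re x' \<le> 1 / 2" "Im x' = Im x" "0 \<le> Re k'" "Re k' \<le> 1" "Im k' = Im k"
  unfolding x'_def k'_def j_def l_def by (simp_all, linarith+)
 have s': "x' \<in> strip dlt" "k' \<in> strip dlt" using xk r by (auto simp: strip_def)
 \<comment> \<open>The hypotheses only allow forward steps, so \<open>x\<close> and
   \<open>x'\<close> are both reached from a common base point behind them, and likewise
   \<open>k\<close> and \<open>k'\<close>.\<close>
 define x0 where "x0 = x' - of_nat (nat (- j)) / 2"
 define k0 where "k0 = k' - of_nat (nat (- l))"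
 have s0: "x0 \<in> strip dlt" "k0 \<in> strip dlt" using s' by (auto simp: x0_def k0_def strip_def)
 have e1: "x' = x0 + of_nat (nat (- j)) / 2" "k' = k0 + of_nat (nat (- l))" by (simp_all add: x0_def k0_def)
 have int_nat: "(of_int i :: complex) = of_nat (nat i) - of_nat (nat (- i))" for i
  by (cases "i \<ge> 0") (simp_all add: of_nat_nat)
 have e2: "x = x0 + of_nat (nat j) / 2" "k = k0 + of_nat (nat l)"
  unfolding x0_def k0_def x'_def k'_def int_nat[of j] int_nat[of l] by (simp_all add: diff_divide_distrib)
 have "f x' k' = f x0 k0" unfolding e1 by (rule periodic_shift_nat[where f = f and dlt = dlt, OF px pk s0])
 also have "... = f x k" unfolding e2 by (rule periodic_shift_nat[where f = f and dlt = dlt, OF px pk s0, symmetric])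
 finally show ?thesis using that r by blast
qed

definition cell :: "real \<Rightarrow> (complex \<times> complex) set" where
 "cell eta = cbox (Complex 0 (- eta)) (Complex (1 / 2) eta) \<times> cbox (Complex 0 (- eta)) (Complex 1 eta)"

lemma mem_cell: "(x, k) \<in> cell eta \<longleftrightarrow> 0 \<le> Re x \<and> Re x \<le> 1 / 2 \<and> \<bar>Im x\<bar> \<le> eta \<and> 0 \<le> Re k \<and> Re k \<le> 1 \<and> \<bar>Im k\<bar> \<le> eta"
 by (auto simp: cell_def in_cbox_complex_iff)

lemma compact_cell: "compact (cell eta)" unfolding cell_def by (intro compact_Times compact_cbox)

lemma cell_subset: "eta < dlt ==> cell eta \<subseteq> strip dlt \<times> strip dlt"
 by (auto simp: mem_cell strip_def)

lemma periodic_le: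
 fixes F :: "complex \<Rightarrow> complex \<Rightarrow> real"
 assumes px: "\<And>x k. x \<in> strip dlt ==> k \<in> strip dlt ==> F (x + 1 / 2) k = F x k"
  and pk: "\<And>x k. x \<in> strip dlt ==> k \<in> strip dlt ==> F x (k + 1) = F x k"
  and B: "\<And>x k. (x, k) \<in> cell dlt ==> x \<in> strip dlt ==> k \<in> strip dlt ==> F x k \<le> B"
  and xk: "x \<in> strip dlt" "k \<in> strip dlt"
 shows "F x k \<le> B"
proof -
 obtain x' k' where x': "0 \<le> Re x'" "Re x' \<le> 1 / 2" "Im x' = Im x" "0 \<le> Re k'" "Re k' \<le> 1" "Im k' = Im k" "F x' k' = F x k"
  using periodic_reduce[of dlt F, OF px pk xk] by blast
 have "F x' k' \<le> B" using x' xk by (intro B) (auto simp: mem_cell strip_def)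
 then show ?thesis using x'(7) by simp
qed

lemma periodic_bounded:
 fixes F :: "complex \<Rightarrow> complex \<Rightarrow> real"
 assumes px: "\<And>x k. x \<in> strip dlt ==> k \<in> strip dlt ==> F (x + 1 / 2) k = F x k"
  and pk: "\<And>x k. x \<in> strip dlt ==> k \<in> strip dlt ==> F x (k + 1) = F x k"
  and cont: "continuous_on (strip dlt \<times> strip dlt) (\<lambda>p. F (fst p) (snd p))" and eta: "eta < dlt"
 obtains B where "B > 0" "\<And>x k. x \<in> strip eta ==> k \<in> strip eta ==> F x k \<le> B"
proof -
 have "compact ((\<lambda>p. F (fst p) (snd p)) ` cell eta)"
  by (intro compact_continuous_image compact_cell continuous_on_subset[OF cont] cell_subset eta)
 then have "bounded ((\<lambda>p. F (fst p) (snd p)) ` cell eta)" by (rule compact_imp_bounded)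
 then obtain B where B: "B > 0" "\<forall>y\<in>(\<lambda>p. F (fst p) (snd p)) ` cell eta. norm y \<le> B" unfolding bounded_pos by blast
 have sub: "x \<in> strip dlt" if "x \<in> strip eta" for x using that eta by (auto simp: strip_def)
 have "F x k \<le> B" if "x \<in> strip eta" "k \<in> strip eta" for x k
 proof (rule periodic_le[where F = F and dlt = eta])
  show "F x k \<le> B" if "(x, k) \<in> cell eta" for x k using B(2) that by fastforce
 qed (use px pk sub that in auto)
 then show ?thesis using that B(1) by blast
qed

lemma hol2_compose_continuous:
 assumes "hol2 dlt f" "continuous_on S X" "continuous_on S Y" "\<And>s. s \<in> S ==> X s \<in> strip dlt" "\<And>s. s \<in> S ==> Y s \<in> strip dlt"
 shows "continuous_on S (\<lambda>s. f (X s) (Y s))"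
proof -
 have "continuous_on S (\<lambda>s. (\<lambda>p. f (fst p) (snd p)) (X s, Y s))"
  by (rule continuous_on_compose2[of "strip dlt \<times> strip dlt" "\<lambda>p. f (fst p) (snd p)"])
   (use assms in \<open>auto simp: hol2_def intro!: continuous_intros\<close>)
 then show ?thesis by simp
qed

lemma uniform_at_0:
 fixes A :: "real \<Rightarrow> complex \<Rightarrow> complex \<Rightarrow> complex"
 assumes cont: "continuous_on ({0..1} \<times> cell eta) (\<lambda>s. A (fst s) (fst (snd s)) (snd (snd s)))" and e: "e > 0"
 obtains t0 where "t0 > 0" "t0 \<le> 1" "\<And>t x k. 0 \<le> t ==> t \<le> t0 ==> (x, k) \<in> cell eta ==> cmod (A t x k - A 0 x k) < e"
proof -
 have "uniformly_continuous_on ({0..1} \<times> cell eta) (\<lambda>s. A (fst s) (fst (snd s)) (snd (snd s)))"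
  by (intro compact_uniformly_continuous cont compact_Times compact_cell compact_Icc)
 then obtain r where r: "r > 0" "\<And>s s'. s \<in> {0..1} \<times> cell eta ==> s' \<in> {0..1} \<times> cell eta ==> dist s' s < r ==>
   dist (A (fst s') (fst (snd s')) (snd (snd s'))) (A (fst s) (fst (snd s)) (snd (snd s))) < e"
  using e unfolding uniformly_continuous_on_def by meson
 show ?thesis
 proof
  show "min 1 (r / 2) > 0" "min 1 (r / 2) \<le> 1" using r by auto
  fix t x k assume t: "0 \<le> t" "t \<le> min 1 (r / 2)" "(x, k) \<in> cell eta"
  have "dist (A (fst (t, x, k)) (fst (snd (t, x, k))) (snd (snd (t, x, k)))) (A (fst (0::real, x, k)) (fst (snd (0::real, x, k))) (snd (snd (0::real, x, k)))) < e"
   by (rule r(2)) (use t r in \<open>auto simp: dist_Pair_Pair\<close>)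
  then show "cmod (A t x k - A 0 x k) < e" by (simp add: dist_norm)
 qed
qed

lemma continuous_bounded_family:
 fixes A :: "real \<Rightarrow> complex \<Rightarrow> complex \<Rightarrow> complex"
 assumes cont: "continuous_on ({0..1} \<times> cell eta) (\<lambda>s. A (fst s) (fst (snd s)) (snd (snd s)))"
 obtains B where "B > 0" "\<And>t x k. 0 \<le> t ==> t \<le> 1 ==> (x, k) \<in> cell eta ==> cmod (A t x k) \<le> B"
proof -
 have "compact ((\<lambda>s. A (fst s) (fst (snd s)) (snd (snd s))) ` ({0..1} \<times> cell eta))"
  by (intro compact_continuous_image cont compact_Times compact_cell compact_Icc)
 then have "bounded ((\<lambda>s. A (fst s) (fst (snd s)) (snd (snd s))) ` ({0..1} \<times> cell eta))" by (rule compact_imp_bounded)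
 then obtain B where B: "B > 0" "\<forall>y\<in>(\<lambda>s. A (fst s) (fst (snd s)) (snd (snd s))) ` ({0..1} \<times> cell eta). norm y \<le> B" unfolding bounded_pos by blast
 have "cmod (A t x k) \<le> B" if "0 \<le> t" "t \<le> 1" "(x, k) \<in> cell eta" for t x k
 proof -
  have "(t, x, k) \<in> {0..1} \<times> cell eta" using that by simp
  then show ?thesis using B(2) by fastforce
 qed
 then show ?thesis using B(1) that by blast
qed

text \<open>A Moebius map close to \<open>y \<mapsto> (\<lambda>2 / \<lambda>1) y\<close> contracts a small disc.\<close>

lemma moebius_contraction:
 fixes A00 A01 A10 A11 L :: complex and tht rho x0 :: real
 assumes L: "l > 0" "l \<le> cmod L" and tht: "0 < tht" "x0 + 20 * tht \<le> 1" "0 \<le> x0" and rho: "rho > 0"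
  and A00: "cmod (A00 - L) \<le> tht * l" and A11: "cmod A11 \<le> (x0 + tht) * cmod L" and A10: "cmod A10 \<le> tht * rho * l"
  and A01: "cmod A01 * (2 * rho) \<le> tht * l" and E: "1 \<le> E" "E \<le> 2" "(x0 + tht) * E \<le> x0 + 3 * tht"
 shows "\<And>y. cmod y \<le> E * rho ==> cmod (A00 + A01 * y) \<ge> (1 - 2 * tht) * cmod L"
  and "\<And>y. cmod y \<le> E * rho ==> cmod (A00 + A01 * y - L) \<le> 2 * tht * cmod L"
  and "\<And>y. cmod y \<le> E * rho ==> cmod ((A10 + A11 * y) / (A00 + A01 * y)) \<le> (1 - 10 * tht) * rho"
  and "\<And>y z r. cmod y \<le> E * rho ==> cmod z \<le> E * rho ==> cmod (y - z) \<le> E * r ==>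
   cmod ((A10 + A11 * y) / (A00 + A01 * y) - (A10 + A11 * z) / (A00 + A01 * z)) \<le> (1 - 4 * tht) * r"
proof -
 define N where "N = cmod L"
 have N: "N > 0" "l \<le> N" using L by (auto simp: N_def)
 have tht1: "tht \<le> 1 / 20" using tht by linarith
 have tl: "tht * l \<le> tht * N" using N tht by simp
 have A01': "cmod (A01 * y) \<le> tht * N" if "cmod y \<le> E * rho" for y
 proof -
  have "cmod (A01 * y) \<le> cmod A01 * (2 * rho)"
   unfolding norm_mult using that E rho by (intro mult_left_mono) (auto intro: order.trans[OF _ mult_right_mono])
  then show ?thesis using A01 tl by linarith
 qed
 have near: "cmod (A00 + A01 * y - L) \<le> 2 * tht * N" if "cmod y \<le> E * rho" for y
 proof -
  have "A00 + A01 * y - L = (A00 - L) + A01 * y" by simp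
  then have "cmod (A00 + A01 * y - L) \<le> cmod (A00 - L) + cmod (A01 * y)" by (simp only: norm_triangle_ineq)
  then show ?thesis using A01'[OF that] A00 tl by linarith
 qed
 have low: "cmod (A00 + A01 * y) \<ge> (1 - 2 * tht) * N" if "cmod y \<le> E * rho" for y
 proof -
  have "N \<le> cmod (L - (A00 + A01 * y)) + cmod (A00 + A01 * y)"
   unfolding N_def using norm_triangle_ineq[of "L - (A00 + A01 * y)" "A00 + A01 * y"] by simp
  then show ?thesis using near[OF that] by (simp add: norm_minus_commute algebra_simps)
 qed
 show "\<And>y. cmod y \<le> E * rho ==> cmod (A00 + A01 * y) \<ge> (1 - 2 * tht) * cmod L"
  "\<And>y. cmod y \<le> E * rho ==> cmod (A00 + A01 * y - L) \<le> 2 * tht * cmod L"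
  using low near unfolding N_def by blast+
 have d0: "(1 - 2 * tht) * N > 0" using N tht1 by simp
 show "cmod ((A10 + A11 * y) / (A00 + A01 * y)) \<le> (1 - 10 * tht) * rho" if y: "cmod y \<le> E * rho" for y
 proof -
  have "cmod (A10 + A11 * y) \<le> cmod A10 + cmod A11 * cmod y" by (metis norm_triangle_ineq norm_mult)
  also have "... \<le> tht * rho * l + (x0 + tht) * N * (E * rho)"
   using A10 A11 y tht N unfolding N_def by (intro add_mono mult_mono) auto
  also have "... \<le> tht * rho * N + (x0 + 3 * tht) * N * rho"
  proof (intro add_mono)
   show "tht * rho * l \<le> tht * rho * N" using N tht rho by (intro mult_left_mono) auto
   have "(x0 + tht) * E * (N * rho) \<le> (x0 + 3 * tht) * (N * rho)" using N rho E by (intro mult_right_mono) auto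
   then show "(x0 + tht) * N * (E * rho) \<le> (x0 + 3 * tht) * N * rho" by (simp add: mult_ac)
  qed
  also have "... = (x0 + 4 * tht) * (N * rho)" by (simp add: algebra_simps)
  \<comment> \<open>The room left by \<open>x0 + 20 * tht \<le> 1\<close> also pays for the factor
    \<open>1 - 2 * tht\<close> of the denominator.\<close>
  also have "... \<le> (1 - 16 * tht) * (N * rho)" using tht N rho by (intro mult_right_mono) auto
  also have "... \<le> ((1 - 10 * tht) * (1 - 2 * tht)) * (N * rho)"
  proof (intro mult_right_mono)
   have "0 \<le> tht * tht" using tht by simp
   then show "1 - 16 * tht \<le> (1 - 10 * tht) * (1 - 2 * tht)" using tht by (simp add: algebra_simps)
  qed (use N rho in auto)
  finally have num: "cmod (A10 + A11 * y) \<le> (1 - 10 * tht) * rho * ((1 - 2 * tht) * N)" by (simp add: mult_ac)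
  have "cmod ((A10 + A11 * y) / (A00 + A01 * y)) \<le> (1 - 10 * tht) * rho * ((1 - 2 * tht) * N) / ((1 - 2 * tht) * N)"
   unfolding norm_divide using num low[OF y] d0 tht1 rho by (intro frac_le) auto
  also have "... = (1 - 10 * tht) * rho" by (rule nonzero_mult_div_cancel_right) (rule d0[THEN less_imp_neq, THEN not_sym])
  finally show ?thesis .
 qed
 show "cmod ((A10 + A11 * y) / (A00 + A01 * y) - (A10 + A11 * z) / (A00 + A01 * z)) \<le> (1 - 4 * tht) * r"
  if y: "cmod y \<le> E * rho" and z: "cmod z \<le> E * rho" and yz: "cmod (y - z) \<le> E * r" for y z r
 proof -
  have r: "r \<ge> 0" using order.trans[OF norm_ge_zero yz] E by (simp add: zero_le_mult_iff)
  have ny: "A00 + A01 * y \<noteq> 0" and nz: "A00 + A01 * z \<noteq> 0" using low[OF y] low[OF z] d0 by auto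
  \<comment> \<open>A difference of two values of a Moebius map is governed by its determinant. Here
    \<open>A11 * A00\<close> dominates, and \<open>A01 * A10\<close> is of second order in
    \<open>tht\<close>.\<close>
  have eq: "(A10 + A11 * y) / (A00 + A01 * y) - (A10 + A11 * z) / (A00 + A01 * z)
    = (A11 * A00 - A01 * A10) * (y - z) / ((A00 + A01 * y) * (A00 + A01 * z))"
   using ny nz by (simp add: diff_frac_eq) (simp add: algebra_simps)
  have a00: "cmod A00 \<le> (1 + tht) * N"
  proof -
   have "cmod A00 \<le> cmod (A00 - L) + cmod L" using norm_triangle_ineq[of "A00 - L" L] by simp
   then show ?thesis using A00 tl by (simp add: N_def algebra_simps)
  qed
  have a: "cmod A11 * cmod A00 \<le> (x0 + tht) * N * ((1 + tht) * N)"
   using A11 a00 tht N unfolding N_def by (intro mult_mono) auto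
  have "cmod A01 * cmod A10 \<le> cmod A01 * (tht * rho * l)" using A10 by (intro mult_left_mono) auto
  also have "... = (cmod A01 * (2 * rho)) * (tht * l / 2)" by simp
  also have "... \<le> (tht * l) * (tht * l / 2)" using A01 tht L by (intro mult_right_mono) auto
  also have "... \<le> (tht * N) * (tht * N / 2)" using tl tht L N by (intro mult_mono) auto
  finally have b: "cmod A01 * cmod A10 \<le> tht * tht * N * N / 2" by (simp add: mult_ac)
  have "cmod (A11 * A00 - A01 * A10) \<le> cmod A11 * cmod A00 + cmod A01 * cmod A10"
   using norm_triangle_ineq4[of "A11 * A00" "A01 * A10"] by (simp add: norm_mult)
  also have "... \<le> ((x0 + tht) * (1 + tht) + tht * tht / 2) * (N * N)" using a b by (simp add: algebra_simps)
  finally have num: "cmod (A11 * A00 - A01 * A10) \<le> ((x0 + tht) * (1 + tht) + tht * tht / 2) * (N * N)" .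
  have numE: "((x0 + tht) * (1 + tht) + tht * tht / 2) * E \<le> 1 - 12 * tht"
  proof -
   have "((x0 + tht) * (1 + tht) + tht * tht / 2) * E = ((x0 + tht) * E) * (1 + tht) + tht * tht / 2 * E" by (simp add: algebra_simps)
   also have "... \<le> (x0 + 3 * tht) * (1 + tht) + tht * tht / 2 * 2" using E tht by (intro add_mono mult_right_mono mult_left_mono) auto
   also have "... \<le> (1 - 17 * tht) * (1 + tht) + tht * tht" using tht by (intro add_mono mult_right_mono) auto
   also have "... \<le> 1 - 12 * tht"
   proof -
    have "0 \<le> tht * tht" using tht by simp
    then show ?thesis using tht by (simp add: algebra_simps)
   qed
   finally show ?thesis .
  qed
  have den: "((1 - 2 * tht) * N) * ((1 - 2 * tht) * N) \<le> cmod (A00 + A01 * y) * cmod (A00 + A01 * z)"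
   using low[OF y] low[OF z] d0 by (intro mult_mono) auto
  have "cmod (A11 * A00 - A01 * A10) * cmod (y - z) \<le> ((x0 + tht) * (1 + tht) + tht * tht / 2) * (N * N) * (E * r)"
   using num yz tht by (intro mult_mono) auto
  also have "... = ((x0 + tht) * (1 + tht) + tht * tht / 2) * E * (N * N * r)" by (simp add: mult_ac)
  also have "... \<le> (1 - 12 * tht) * (N * N * r)" using numE r N by (intro mult_right_mono) auto
  also have "... \<le> ((1 - 4 * tht) * ((1 - 2 * tht) * (1 - 2 * tht))) * (N * N * r)"
  proof (intro mult_right_mono)
   have "0 \<le> tht * tht" using tht by simp
   moreover from this have "tht * (tht * tht) \<le> 1 / 20 * (tht * tht)" by (rule mult_right_mono[OF tht1])
   moreover have "(1 - 4 * tht) * ((1 - 2 * tht) * (1 - 2 * tht)) = 1 - 8 * tht + 20 * (tht * tht) - 16 * (tht * (tht * tht))" by algebra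
   ultimately show "1 - 12 * tht \<le> (1 - 4 * tht) * ((1 - 2 * tht) * (1 - 2 * tht))"
    using tht by linarith
  qed (use r N in auto)
  finally have num2: "cmod (A11 * A00 - A01 * A10) * cmod (y - z) \<le> (1 - 4 * tht) * r * (((1 - 2 * tht) * N) * ((1 - 2 * tht) * N))"
   by (simp add: mult_ac)
  have "cmod ((A10 + A11 * y) / (A00 + A01 * y) - (A10 + A11 * z) / (A00 + A01 * z))
    \<le> (1 - 4 * tht) * r * (((1 - 2 * tht) * N) * ((1 - 2 * tht) * N)) / (((1 - 2 * tht) * N) * ((1 - 2 * tht) * N))"
   unfolding eq norm_divide norm_mult using num2 den d0 tht1 r by (intro frac_le) auto
  also have "... = (1 - 4 * tht) * r" by (rule nonzero_mult_div_cancel_right) (rule mult_pos_pos[OF d0 d0, THEN less_imp_neq, THEN not_sym])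
  finally show ?thesis .
 qed
qed

section \<open>The operator on Zak transforms and its square\<close>

definition sg :: "real \<Rightarrow> real" where "sg t = sqrt 2 * t / 4"
definition om :: "real \<Rightarrow> real" where "om t = sqrt 3 * t / 2"

definition wgt :: "real \<Rightarrow> complex \<Rightarrow> complex" where
 "wgt t x = ee ((of_real (om t) - 1 / 2) * x) / (1 - qq x)"

text \<open>This is what \<open>f \<mapsto> ee ((om t - 1/2) * x) / (1 - qq x) * (f (x - (sg t +
  1/4)) + f (x - (sg t - 1/4)))\<close> becomes on Zak transforms: the modulation shifts
  \<open>k\<close>, and \<open>qq\<close>, of period 1 in \<open>x\<close>, acts as a
  scalar.\<close>

definition WW :: "real \<Rightarrow> (complex \<Rightarrow> complex \<Rightarrow> complex) \<Rightarrow> complex \<Rightarrow> complex \<Rightarrow> complex" where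
 "WW t G x k = wgt t x * (G (x - of_real (sg t + 1 / 4)) (k - of_real (om t - 1 / 2)) + G (x - of_real (sg t - 1 / 4)) (k - of_real (om t - 1 / 2)))"

text \<open>The quasi-periodicity of the Zak transform with terms
  \<open>f (x + n) * ee (- n * k)\<close>.\<close>

definition aut :: "real \<Rightarrow> (complex \<Rightarrow> complex \<Rightarrow> complex) \<Rightarrow> bool" where
 "aut dlt G \<longleftrightarrow> (\<forall>x\<in>strip dlt. \<forall>k\<in>strip dlt. G (x + 1) k = ee k * G x k \<and> G x (k + 1) = G x k)"

lemma autD: "aut dlt G ==> x \<in> strip dlt ==> k \<in> strip dlt ==> G (x + 1) k = ee k * G x k"
 "aut dlt G ==> x \<in> strip dlt ==> k \<in> strip dlt ==> G x (k + 1) = G x k"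
 by (auto simp: aut_def)

lemma strip_simps [simp]:
 "x + 1 \<in> strip dlt \<longleftrightarrow> x \<in> strip dlt" "x - 1 \<in> strip dlt \<longleftrightarrow> x \<in> strip dlt"
 "x + 1 / 2 \<in> strip dlt \<longleftrightarrow> x \<in> strip dlt" "x - 1 / 2 \<in> strip dlt \<longleftrightarrow> x \<in> strip dlt"
 "x - 2 * of_real a \<in> strip dlt \<longleftrightarrow> x \<in> strip dlt" "x - (of_real a - 1 / 2) \<in> strip dlt \<longleftrightarrow> x \<in> strip dlt"
 "x - (of_real a + 1 / 4) \<in> strip dlt \<longleftrightarrow> x \<in> strip dlt" "x - (of_real a - 1 / 4) \<in> strip dlt \<longleftrightarrow> x \<in> strip dlt"
 by (auto simp: strip_def)

lemma strip_mono: "dlt \<le> dlt' ==> x \<in> strip dlt ==> x \<in> strip dlt'" by (auto simp: strip_def)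

lemma norm_qq_less_1:
 assumes "x \<in> strip d0"
 shows "cmod (qq x) < 1"
proof -
 have "cmod (ee x) \<le> exp (2 * pi * d0)" by (rule norm_ee_strip) (use assms in \<open>simp add: strip_def\<close>)
 moreover have "exp (2 * pi * d0) ^ 3 \<le> 5 / 4" using exp_6pi_le by (simp add: exp_of_nat_mult[symmetric] mult.commute)
 have "exp (2 * pi * d0) < 10 / 9"
 proof (rule ccontr)
  assume "\<not> exp (2 * pi * d0) < 10 / 9"
  then have "(10 / 9) ^ 3 \<le> exp (2 * pi * d0) ^ 3" by (intro power_mono) auto
  with \<open>exp (2 * pi * d0) ^ 3 \<le> 5 / 4\<close> have "(10 / 9 :: real) ^ 3 \<le> 5 / 4" by linarith
  then show False by (simp add: power_divide)
 qed
 ultimately show ?thesis by (simp add: qq_def norm_mult)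
qed

lemma one_minus_qq: "x \<in> strip d0 ==> 1 - qq x \<noteq> 0"
 using norm_qq_less_1[of x] by auto

lemma norm_qq4_less_1: "x \<in> strip d0 ==> cmod (qq x ^ 4) < 1"
 using norm_qq_less_1[of x] by (simp add: norm_power power_less_one_iff)

lemma one_minus_qq4: "x \<in> strip d0 ==> 1 - qq x ^ 4 \<noteq> 0"
 using norm_qq4_less_1[of x] by auto

lemma hol_wgt: "wgt t holomorphic_on strip d0"
 unfolding wgt_def by (intro holomorphic_intros hol_qq one_minus_qq)

lemma hol2_WW:
 assumes G: "hol2 dlt G" and d: "dlt \<le> d0"
 shows "hol2 dlt (WW t G)"
 unfolding WW_def[abs_def]
 by (intro hol2_mult hol2_fst hol2_add hol2_shift G holomorphic_on_subset[OF hol_wgt]) (use d in \<open>auto intro: strip_mono\<close>)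

lemma wgt_add_1: "wgt t (x + 1) = ee (of_real (om t) - 1 / 2) * wgt t x"
 unfolding wgt_def qq_add_1 distrib_left ee_add by simp

lemma aut_WW:
 assumes G: "aut dlt G"
 shows "aut dlt (WW t G)"
 unfolding aut_def
proof (intro ballI conjI)
 fix x k assume xk: "x \<in> strip dlt" "k \<in> strip dlt"
 let ?k = "k - of_real (om t - 1 / 2)"
 have s: "x - of_real a \<in> strip dlt" "?k \<in> strip dlt" for a using xk by auto
 have sh: "x + 1 - of_real a = (x - of_real a) + 1" for a by simp
 have "WW t G (x + 1) k = ee (of_real (om t) - 1 / 2) * ee ?k * WW t G x k"
  unfolding WW_def wgt_add_1 sh autD(1)[OF G s] by (simp add: algebra_simps)
 moreover have "ee (of_real (om t) - 1 / 2) * ee ?k = ee k" unfolding ee_add[symmetric] by simp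
 ultimately show "WW t G (x + 1) k = ee k * WW t G x k" by simp
 have sk: "k + 1 - of_real b = (k - of_real b) + 1" for b by simp
 show "WW t G x (k + 1) = WW t G x k" unfolding WW_def sk autD(2)[OF G s] ..
qed

definition T11 :: "real \<Rightarrow> complex \<Rightarrow> complex" where
 "T11 t x = wgt t x * (wgt t (x - of_real (sg t + 1 / 4)) + wgt t (x - of_real (sg t - 1 / 4)))"
definition T12 :: "real \<Rightarrow> complex \<Rightarrow> complex \<Rightarrow> complex" where
 "T12 t x k = wgt t x * (wgt t (x - of_real (sg t + 1 / 4)) + ee (k - of_real (2 * om t)) * wgt t (x - of_real (sg t - 1 / 4)))"
definition T21 :: "real \<Rightarrow> complex \<Rightarrow> complex \<Rightarrow> complex" where
 "T21 t x k = wgt t (x - 1 / 2) * (ee (- (k - of_real (2 * om t))) * wgt t (x - 1 / 2 - of_real (sg t + 1 / 4)) + wgt t (x - 1 / 2 - of_real (sg t - 1 / 4)))"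

text \<open>Two quarter steps add up to 0 or to a half step in either direction, and the two half
  steps differ by a period. Hence the square couples only the values at \<open>x\<close> and
  \<open>x - 1/2\<close>, by a 2 x 2 matrix. The shift of \<open>k\<close> by
  \<open>2 * om t - 1\<close> is one by \<open>2 * om t\<close>, by periodicity.\<close>

lemma WW_WW:
 assumes G: "aut dlt G" and xk: "x \<in> strip dlt" "k \<in> strip dlt"
 shows "WW t (WW t G) x k = T11 t x * G (x - of_real (2 * sg t)) (k - of_real (2 * om t))
   + T12 t x k * G (x - of_real (2 * sg t) - 1 / 2) (k - of_real (2 * om t))"
  and "WW t (WW t G) (x - 1 / 2) k = T21 t x k * G (x - of_real (2 * sg t)) (k - of_real (2 * om t))
   + T11 t (x - 1 / 2) * G (x - of_real (2 * sg t) - 1 / 2) (k - of_real (2 * om t))"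
proof -
 define X where "X = x - of_real (2 * sg t)"
 define K where "K = k - of_real (2 * om t)"
 have X: "X \<in> strip dlt" "X - 1 / 2 \<in> strip dlt" "X - 1 / 2 - 1 / 2 \<in> strip dlt" and K: "K \<in> strip dlt"
  unfolding X_def K_def using xk by simp_all
 have k2: "k - of_real (om t - 1 / 2) - of_real (om t - 1 / 2) = K + 1" by (simp add: K_def)
 have e1: "x - of_real (sg t + 1 / 4) - of_real (sg t + 1 / 4) = X - 1 / 2" "x - of_real (sg t + 1 / 4) - of_real (sg t - 1 / 4) = X"
  "x - of_real (sg t - 1 / 4) - of_real (sg t + 1 / 4) = X" "x - of_real (sg t - 1 / 4) - of_real (sg t - 1 / 4) = X + 1 / 2"
  by (simp_all add: X_def)
 have e2: "x - 1 / 2 - of_real (sg t + 1 / 4) - of_real (sg t + 1 / 4) = X - 1" "x - 1 / 2 - of_real (sg t + 1 / 4) - of_real (sg t - 1 / 4) = X - 1 / 2"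
  "x - 1 / 2 - of_real (sg t - 1 / 4) - of_real (sg t + 1 / 4) = X - 1 / 2" "x - 1 / 2 - of_real (sg t - 1 / 4) - of_real (sg t - 1 / 4) = X"
  by (simp_all add: X_def)
 have Kp: "G (X - 1 / 2) (K + 1) = G (X - 1 / 2) K" "G X (K + 1) = G X K" "G (X + 1 / 2) (K + 1) = G (X + 1 / 2) K" "G (X - 1) (K + 1) = G (X - 1) K"
  using autD(2)[OF G _ K] X by simp_all
 have Xp: "G (X + 1 / 2) K = ee K * G (X - 1 / 2) K" "G X K = ee K * G (X - 1) K"
 proof -
  have h: "X - 1 / 2 + 1 = X + 1 / 2" "X - 1 + 1 = X" by simp_all
  show "G (X + 1 / 2) K = ee K * G (X - 1 / 2) K" "G X K = ee K * G (X - 1) K"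
   using autD(1)[OF G X(2) K] autD(1)[OF G _ K, of "X - 1"] X(1) unfolding h by simp_all
 qed
 then have Xm: "G (X - 1) K = ee (- K) * G X K" by (simp add: ee_minus)
 show "WW t (WW t G) x k = T11 t x * G (x - of_real (2 * sg t)) (k - of_real (2 * om t))
   + T12 t x k * G (x - of_real (2 * sg t) - 1 / 2) (k - of_real (2 * om t))"
  unfolding WW_def T11_def T12_def k2 e1 Kp Xp(1) X_def[symmetric] K_def[symmetric] by (simp add: algebra_simps)
 show "WW t (WW t G) (x - 1 / 2) k = T21 t x k * G (x - of_real (2 * sg t)) (k - of_real (2 * om t))
   + T11 t (x - 1 / 2) * G (x - of_real (2 * sg t) - 1 / 2) (k - of_real (2 * om t))"
  unfolding WW_def T11_def T21_def k2 e2 Kp Xm X_def[symmetric] K_def[symmetric] by (simp add: algebra_simps)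
qed

text \<open>\<open>1 - q ^ 4\<close> is the product of the four denominators \<open>1 - q\<close>,
  \<open>1 + q\<close>, \<open>1 + \<i> * q\<close>, \<open>1 - \<i> * q\<close> met after quarter
  and half steps. Cleared of it, the matrix is \<open>9/5 * s2\<close> times the identity plus
  \<open>J\<close>.\<close>

lemma T_at_0:
 assumes x: "x \<in> strip d0"
 shows "T11 0 x * (1 - qq x ^ 4) = 9 / 5 * s2 + s2 * Cc x" "T12 0 x k * (1 - qq x ^ 4) = b1 x k"
  "T21 0 x k * (1 - qq x ^ 4) = b2 x k"
proof -
 have t0: "sg 0 = 0" "om 0 = 0" by (simp_all add: sg_def om_def)
 define q where "q = qq x"
 define Y where "Y = ee (- x / 2)"
 define p where "p = ee (1 / 8)"
 define m where "m = ee (- 1 / 8)"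
 have YY: "Y * Y = ee (- x)" unfolding Y_def ee_add[symmetric] by simp
 have quarter: "ee (1 / 4) = \<i>" using ee_of_real[of "1 / 4"] by simp
 have q1: "qq (x - 1 / 4) = - \<i> * q" "qq (x + 1 / 4) = \<i> * q"
  unfolding qq_def q_def ee_diff ee_add quarter by (simp_all add: field_simps)
 have w: "wgt 0 x = Y / (1 - q)" by (simp add: wgt_def t0 Y_def q_def)
 have em: "ee (- (1 / 2) * (x - 1 / 4)) = Y * p" "ee (- (1 / 2) * (x + 1 / 4)) = Y * m"
  unfolding Y_def p_def m_def ee_add[symmetric] by (simp_all add: algebra_simps)
 have wm: "wgt 0 (x - 1 / 4) = Y * p / (1 + \<i> * q)" and wp: "wgt 0 (x + 1 / 4) = Y * m / (1 - \<i> * q)"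
  unfolding wgt_def t0 q1 using em by simp_all
 have quarter': "x - 1 / 2 - 1 / 4 = (x - 1 / 4) - 1 / 2" "x - 1 / 2 + 1 / 4 = (x + 1 / 4) - 1 / 2" by simp_all
 have wh: "wgt 0 (z - 1 / 2) = ee (1 / 4) * (ee (- z / 2) / (1 + qq z))" for z
 proof -
  have "ee (- (1 / 2) * (z - 1 / 2)) = ee (1 / 4) * ee (- z / 2)" unfolding ee_add[symmetric] by (simp add: algebra_simps)
  then show ?thesis unfolding wgt_def t0 qq_diff_half by simp
 qed
 have em': "ee (- (x - 1 / 4) / 2) = Y * p" "ee (- (x + 1 / 4) / 2) = Y * m"
 proof -
  have r: "- z / 2 = - (1 / 2) * z" for z :: complex by simp
  show "ee (- (x - 1 / 4) / 2) = Y * p" "ee (- (x + 1 / 4) / 2) = Y * m" unfolding r by (rule em)+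
 qed
 have w': "wgt 0 (x - 1 / 2) = \<i> * Y / (1 + q)" using wh[of x] by (simp add: quarter Y_def q_def)
 have wm': "wgt 0 (x - 1 / 2 - 1 / 4) = \<i> * (Y * p) / (1 - \<i> * q)" unfolding quarter' wh em' q1 quarter by simp
 have wp': "wgt 0 (x - 1 / 2 + 1 / 4) = \<i> * (Y * m) / (1 + \<i> * q)" unfolding quarter' wh em' q1 quarter by simp
 have nz: "1 - q \<noteq> 0" "1 + q \<noteq> 0" "1 + \<i> * q \<noteq> 0" "1 - \<i> * q \<noteq> 0"
 proof -
  have q: "cmod q < 1" unfolding q_def by (rule norm_qq_less_1[OF x])
  have n: "1 + z \<noteq> 0" if "cmod z < 1" for z using that by (metis add_eq_0_iff norm_minus_cancel norm_one less_irrefl)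
  show "1 - q \<noteq> 0" "1 + q \<noteq> 0" "1 + \<i> * q \<noteq> 0" "1 - \<i> * q \<noteq> 0"
   using n[of "- q"] n[of q] n[of "\<i> * q"] n[of "- (\<i> * q)"] q by (simp_all add: norm_mult)
 qed
 have fac: "1 - q ^ 4 = (1 - q) * (1 + q) * (1 + \<i> * q) * (1 - \<i> * q)" by (simp add: algebra_simps power4_eq_xxxx)
 have h: "x - of_real (0 + 1 / 4) = x - 1 / 4" "x - of_real (0 - 1 / 4) = x + 1 / 4"
  "x - 1 / 2 - of_real (0 + 1 / 4) = x - 1 / 2 - 1 / 4" "x - 1 / 2 - of_real (0 - 1 / 4) = x - 1 / 2 + 1 / 4" by simp_all
 have B1: "b1 x k = Y * Y * (1 + q) * (p * (1 - \<i> * q) + ee k * (m * (1 + \<i> * q)))"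
  unfolding b1_def jm_def jp_def YY q_def p_def m_def by (simp add: algebra_simps)
 have B2: "b2 x k = - (Y * Y * (1 - q) * (m * (1 - \<i> * q) + ee (- k) * (p * (1 + \<i> * q))))"
  unfolding b2_def jm_def jp_def qq_diff_half ee_minus_half YY q_def p_def m_def by (simp add: algebra_simps)
 have T12: "T12 0 x k = (Y / (1 - q)) * (Y * p / (1 + \<i> * q) + ee k * (Y * m / (1 - \<i> * q)))"
  unfolding T12_def t0 h w wm wp by simp
 have c: "(Y / a) * (Y * p / d + f * (Y * m / e)) * (a * b * d * e) = Y * Y * b * (p * e + f * (m * d))" if "a \<noteq> 0" "d \<noteq> 0" "e \<noteq> 0" for a b d e f
  using that by (simp add: field_simps)
 show "T12 0 x k * (1 - qq x ^ 4) = b1 x k"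
  unfolding T12 B1 q_def[symmetric] fac by (rule c) (use nz in auto)
 have T21: "T21 0 x k = (\<i> * Y / (1 + q)) * (ee (- k) * (\<i> * (Y * p) / (1 - \<i> * q)) + \<i> * (Y * m) / (1 + \<i> * q))"
  unfolding T21_def t0 h w' wm' wp' by simp
 have c2: "(\<i> * Y / b) * (f * (\<i> * (Y * p) / e) + \<i> * (Y * m) / d) * (a * b * d * e) = - (Y * Y * a * (m * e + f * (p * d)))" if "b \<noteq> 0" "d \<noteq> 0" "e \<noteq> 0" for a b d e f
 proof -
  have "(\<i> * Y / b) * (f * (\<i> * (Y * p) / e) + \<i> * (Y * m) / d) * (a * b * d * e) = (\<i> * \<i>) * (Y * Y * a * (m * e + f * (p * d)))"
   using that by (simp add: field_simps)
  then show ?thesis by simp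
 qed
 show "T21 0 x k * (1 - qq x ^ 4) = b2 x k"
  unfolding T21 B2 q_def[symmetric] fac by (rule c2) (use nz in auto)
 have "T11 0 x = (Y / (1 - q)) * (Y * p / (1 + \<i> * q) + 1 * (Y * m / (1 - \<i> * q)))"
  unfolding T11_def t0 h w wm wp by simp
 then have "T11 0 x * (1 - qq x ^ 4) = Y * Y * (1 + q) * (p * (1 - \<i> * q) + 1 * (m * (1 + \<i> * q)))"
  unfolding q_def[symmetric] fac by (simp only: c[OF nz(1) nz(3) nz(4)])
 also have "... = ((1 - \<i> * q) * (1 + \<i>) + (1 + \<i> * q) * (1 - \<i>)) / s2 * (ee (- x) * (1 + q))"
 proof -
  have "A * b * (u / s * e + 1 * (v / s * f)) = (e * u + f * v) / s * (A * b)" if "s \<noteq> 0" for A b u v s e f :: complex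
   using that by (simp add: field_simps)
  then show ?thesis unfolding YY p_def m_def ee_eighth ee_minus_eighth using s2_nonzero by blast
 qed
 also have "(1 - \<i> * q) * (1 + \<i>) + (1 + \<i> * q) * (1 - \<i>) = (s2 * s2) * (1 + q)" unfolding s2_square by (simp add: algebra_simps)
 also have "(s2 * s2) * (1 + q) / s2 * (ee (- x) * (1 + q)) = s2 * (ee (- x) * (1 + q) * (1 + q))" using s2_nonzero by simp
 also have "ee (- x) * (1 + q) * (1 + q) = 9 / 5 + Cc x"
 proof -
  have XY: "ee x * ee (- x) = 1" by (simp add: ee_minus)
  show ?thesis unfolding Cc_def q_def qq_def using XY by algebra
 qed
 finally show "T11 0 x * (1 - qq x ^ 4) = 9 / 5 * s2 + s2 * Cc x" by (simp add: algebra_simps)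
qed

section \<open>Eigenvalues and coordinates in the frame\<close>

definition lam1 :: "complex \<Rightarrow> complex \<Rightarrow> complex" where "lam1 x k = (9 / 5 * s2 + RR x k) / (1 - qq x ^ 4)"
definition lam2 :: "complex \<Rightarrow> complex \<Rightarrow> complex" where "lam2 x k = (9 / 5 * s2 - RR x k) / (1 - qq x ^ 4)"

text \<open>For \<open>a = 9/5 * s2\<close>, passing from \<open>a + R\<close> to
  \<open>a - R\<close> lowers the squared modulus by \<open>4 * a * Re R \<ge> 10\<close>, out of at
  most 49. The remaining proportion is below \<open>(9/10)\<^sup>2\<close>.\<close>

lemma lam_bounds:
 assumes xk: "x \<in> strip d0" "k \<in> strip d0"
 shows "1 \<le> cmod (lam1 x k)" "cmod (lam2 x k) \<le> 9 / 10 * cmod (lam1 x k)"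
proof -
 define a where "a = 9 / 5 * sqrt 2"
 define R where "R = RR x k"
 have as: "9 / 5 * s2 = complex_of_real a" by (simp add: a_def s2_def)
 have s1: "14 / 10 \<le> sqrt 2" by (rule real_le_rsqrt) (simp add: power2_eq_square)
 have s2: "sqrt 2 \<le> 3 / 2" by (rule real_le_lsqrt) (simp_all add: power2_eq_square)
 then have a: "5 / 2 \<le> a" "a \<le> 3" using s1 by (auto simp: a_def)
 have ReR: "Re R \<ge> 1" unfolding R_def by (rule RR_Re_pos[OF xk])
 have nR: "cmod R \<le> 4"
 proof -
  have near: "cmod (Rsq x k - 648 / 100) \<le> 33122 / 10000 * exp (6 * pi * d0)"
   by (rule Rsq_near) (use xk in \<open>auto simp: strip_def\<close>)
  have "cmod (Rsq x k) \<le> cmod (Rsq x k - 648 / 100) + cmod (648 / 100 :: complex)"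
   using norm_triangle_ineq[of "Rsq x k - 648 / 100" "648 / 100"] by simp
  then have "cmod (Rsq x k) \<le> 4\<^sup>2" using near exp_6pi_le by simp
  moreover have "cmod (Rsq x k) = (cmod R)\<^sup>2" unfolding R_def by (simp only: RR_square[symmetric] norm_mult power2_eq_square)
  ultimately have "(cmod R)\<^sup>2 \<le> 4\<^sup>2" by linarith
  then show ?thesis by (rule power2_le_imp_le) simp
 qed
 define N where "N = cmod (1 - qq x ^ 4)"
 have N: "N > 0" "N \<le> 2"
 proof -
  show "N > 0" unfolding N_def using one_minus_qq4[OF xk(1)] by simp
  show "N \<le> 2" unfolding N_def using norm_triangle_ineq4[of 1 "qq x ^ 4"] norm_qq4_less_1[OF xk(1)] by simp
 qed
 have l1: "cmod (lam1 x k) = cmod (of_real a + R) / N" and l2: "cmod (lam2 x k) = cmod (of_real a - R) / N"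
  unfolding lam1_def lam2_def as R_def N_def norm_divide by simp_all
 have "5 / 2 \<le> Re (of_real a + R)" using a ReR by simp
 also have "... \<le> cmod (of_real a + R)" by (rule complex_Re_le_cmod)
 finally have "N \<le> cmod (of_real a + R)" using N by linarith
 then show "1 \<le> cmod (lam1 x k)" unfolding l1 using N by simp
 have up: "cmod (of_real a + R) \<le> 7" using norm_triangle_ineq[of "of_real a" R] a nR by simp
 have "(cmod (of_real a - R))\<^sup>2 = (cmod (of_real a + R))\<^sup>2 - 4 * a * Re R"
  unfolding cmod_power2 by (simp add: power2_eq_square algebra_simps)
 moreover have "4 * a * Re R \<ge> 10"
 proof -
  have "5 / 2 * 1 \<le> a * Re R" using a ReR by (intro mult_mono) auto
  then show ?thesis by simp
 qed
 moreover have "(cmod (of_real a + R))\<^sup>2 \<le> 7\<^sup>2" using up by (intro power_mono) auto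
 ultimately have "(cmod (of_real a - R))\<^sup>2 \<le> (9 / 10 * cmod (of_real a + R))\<^sup>2"
  unfolding power_mult_distrib by (simp add: power2_eq_square)
 then have "cmod (of_real a - R) \<le> 9 / 10 * cmod (of_real a + R)" by (rule power2_le_imp_le) simp
 then show "cmod (lam2 x k) \<le> 9 / 10 * cmod (lam1 x k)" unfolding l1 l2
  using N divide_right_mono[of "cmod (of_real a - R)" "9 / 10 * cmod (of_real a + R)" N] by (simp only: times_divide_eq_right less_imp_le)
qed

text \<open>Coordinates with respect to the frame \<open>Phi\<close>, \<open>chi (x - 1/2) (- k)\<close>.\<close>

definition uu :: "complex \<Rightarrow> complex \<Rightarrow> complex \<Rightarrow> complex \<Rightarrow> complex" where
 "uu x k p q = (chi x (- k) * p + chi (x - 1 / 2) (- k) * q) / Lam x k"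
definition vv :: "complex \<Rightarrow> complex \<Rightarrow> complex \<Rightarrow> complex \<Rightarrow> complex" where
 "vv x k p q = (Phi (x - 1 / 2) k * p - Phi x k * q) / Lam x k"

text \<open>Cramer's rule: up to sign, \<open>Lam\<close> is the determinant of the frame vectors
  \<open>(Phi x, Phi (x - 1/2))\<close> and
  \<open>(chi (x - 1/2) (- k), - chi x (- k))\<close>.\<close>

lemma frame:
 assumes "Lam x k \<noteq> 0"
 shows "p = uu x k p q * Phi x k + vv x k p q * chi (x - 1 / 2) (- k)"
proof -
 have "(chi x (- k) * p + chi (x - 1 / 2) (- k) * q) * Phi x k + (Phi (x - 1 / 2) k * p - Phi x k * q) * chi (x - 1 / 2) (- k) = Lam x k * p"
  unfolding Lam_def by (simp add: algebra_simps)
 moreover have "uu x k p q * Phi x k + vv x k p q * chi (x - 1 / 2) (- k)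
   = ((chi x (- k) * p + chi (x - 1 / 2) (- k) * q) * Phi x k + (Phi (x - 1 / 2) k * p - Phi x k * q) * chi (x - 1 / 2) (- k)) / Lam x k"
  unfolding uu_def vv_def by (simp add: add_divide_distrib distrib_right)
 ultimately show ?thesis using assms by simp
qed

definition UU :: "real \<Rightarrow> complex \<Rightarrow> complex \<Rightarrow> complex \<Rightarrow> complex \<Rightarrow> complex" where
 "UU t x k p q = uu x k (T11 t x * p + T12 t x k * q) (T21 t x k * p + T11 t (x - 1 / 2) * q)"
definition VV :: "real \<Rightarrow> complex \<Rightarrow> complex \<Rightarrow> complex \<Rightarrow> complex \<Rightarrow> complex" where
 "VV t x k p q = vv x k (T11 t x * p + T12 t x k * q) (T21 t x k * p + T11 t (x - 1 / 2) * q)"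

text \<open>The four functions are the matrix of the squared operator between frames at two
  different points: the frame vectors are taken at the shifted point, the coordinates of their
  images at \<open>(x, k)\<close>.\<close>

definition A00 where "A00 t x k = UU t x k (Phi (x - of_real (2 * sg t)) (k - of_real (2 * om t))) (Phi (x - of_real (2 * sg t) - 1 / 2) (k - of_real (2 * om t)))"
definition A10 where "A10 t x k = VV t x k (Phi (x - of_real (2 * sg t)) (k - of_real (2 * om t))) (Phi (x - of_real (2 * sg t) - 1 / 2) (k - of_real (2 * om t)))"
definition A01 where "A01 t x k = UU t x k (chi (x - of_real (2 * sg t) - 1 / 2) (- (k - of_real (2 * om t)))) (- chi (x - of_real (2 * sg t)) (- (k - of_real (2 * om t))))"
definition A11 where "A11 t x k = VV t x k (chi (x - of_real (2 * sg t) - 1 / 2) (- (k - of_real (2 * om t)))) (- chi (x - of_real (2 * sg t)) (- (k - of_real (2 * om t))))"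

lemma UU_linear: "UU t x k (p + c * p') (q + c * q') = UU t x k p q + UU t x k p' q' * c"
 and VV_linear: "VV t x k (p + c * p') (q + c * q') = VV t x k p q + VV t x k p' q' * c"
 unfolding UU_def VV_def uu_def vv_def by (simp_all add: add_divide_distrib diff_divide_distrib algebra_simps)

text \<open>At \<open>t = 0\<close> the two frames coincide, and the first vector is an eigenvector,
  so the matrix is triangular. The second vector is no eigenvector in general, and
  \<open>A01\<close> remains.\<close>

lemma A_at_0:
 assumes xk: "x \<in> strip d0" "k \<in> strip d0" and Lam: "Lam x k \<noteq> 0"
 shows "A00 0 x k = lam1 x k" "A10 0 x k = 0" "A11 0 x k = lam2 x k"
proof -
 have t0: "sg 0 = 0" "om 0 = 0" by (simp_all add: sg_def om_def)
 define N where "N = 1 - qq x ^ 4"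
 have N: "N \<noteq> 0" unfolding N_def by (rule one_minus_qq4[OF xk(1)])
 have qh: "qq (x - 1 / 2) ^ 4 = qq x ^ 4" unfolding qq_diff_half by simp
 define a where "a = 9 / 5 * s2"
 define c where "c = s2 * Cc x"
 have T: "T11 0 x = (a + c) / N" "T12 0 x k = b1 x k / N" "T21 0 x k = b2 x k / N" "T11 0 (x - 1 / 2) = (a - c) / N"
 proof -
  show "T11 0 x = (a + c) / N" "T12 0 x k = b1 x k / N" "T21 0 x k = b2 x k / N"
   using T_at_0(1)[OF xk(1)] T_at_0(2,3)[OF xk(1), of k] N unfolding N_def a_def c_def by (simp_all add: eq_divide_eq)
  have "T11 0 (x - 1 / 2) * N = 9 / 5 * s2 + s2 * Cc (x - 1 / 2)"
   using T_at_0(1)[of "x - 1 / 2"] xk(1) unfolding qh N_def by simp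
  then show "T11 0 (x - 1 / 2) = (a - c) / N" using N unfolding a_def c_def Cc_diff_half by (simp add: eq_divide_eq)
 qed
 define P where "P = Phi x k"
 define Q where "Q = Phi (x - 1 / 2) k"
 define R where "R = RR x k"
 have e: "c * P + b1 x k * Q = R * P" "b2 x k * P - c * Q = R * Q"
  using Phi_eigen[of x k] unfolding P_def Q_def R_def c_def by simp_all
 define l where "l = (a + R) / N"
 have TP: "T11 0 x * P + T12 0 x k * Q = l * P" "T21 0 x k * P + T11 0 (x - 1 / 2) * Q = l * Q"
 proof -
  have "T11 0 x * P + T12 0 x k * Q = (a * P + (c * P + b1 x k * Q)) / N" unfolding T by (simp add: add_divide_distrib algebra_simps)
  then show "T11 0 x * P + T12 0 x k * Q = l * P" unfolding e l_def by (simp add: add_divide_distrib algebra_simps)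
  have "T21 0 x k * P + T11 0 (x - 1 / 2) * Q = (a * Q + (b2 x k * P - c * Q)) / N" unfolding T by (simp add: add_divide_distrib diff_divide_distrib algebra_simps)
  then show "T21 0 x k * P + T11 0 (x - 1 / 2) * Q = l * Q" unfolding e l_def by (simp add: add_divide_distrib algebra_simps)
 qed
 define B where "B = chi x (- k)"
 define D where "D = chi (x - 1 / 2) (- k)"
 have L: "Lam x k = B * P + D * Q" by (simp add: Lam_def B_def D_def P_def Q_def)
 have "UU 0 x k P Q = l" unfolding UU_def uu_def TP B_def[symmetric] D_def[symmetric]
  using Lam unfolding L by (simp add: divide_eq_eq algebra_simps)
 then show "A00 0 x k = lam1 x k" unfolding A00_def t0 by (simp add: P_def Q_def l_def lam1_def N_def a_def R_def)
 have "VV 0 x k P Q = 0" unfolding VV_def vv_def TP P_def[symmetric] Q_def[symmetric] by (simp add: algebra_simps)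
 then show "A10 0 x k = 0" unfolding A10_def t0 by (simp add: P_def Q_def)
 \<comment> \<open>The remaining diagonal entry is found as the trace minus the known eigenvalue
   \<open>l\<close>.\<close>
 have "Q * (T11 0 x * D + T12 0 x k * (- B)) - P * (T21 0 x k * D + T11 0 (x - 1 / 2) * (- B))
   = (T11 0 x + T11 0 (x - 1 / 2)) * (B * P + D * Q) - B * (T11 0 x * P + T12 0 x k * Q) - D * (T21 0 x k * P + T11 0 (x - 1 / 2) * Q)"
  by (simp add: algebra_simps)
 also have "... = (T11 0 x + T11 0 (x - 1 / 2) - l) * (B * P + D * Q)" unfolding TP by (simp add: algebra_simps)
 also have "T11 0 x + T11 0 (x - 1 / 2) - l = (a - R) / N" unfolding T l_def by (simp add: add_divide_distrib diff_divide_distrib)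
 finally have "VV 0 x k D (- B) = (a - R) / N" unfolding VV_def vv_def P_def[symmetric] Q_def[symmetric]
  using Lam unfolding L by (simp add: divide_eq_eq)
 then show "A11 0 x k = lam2 x k" unfolding A11_def t0 by (simp add: B_def D_def lam2_def N_def a_def R_def)
qed

text \<open>\<open>F t\<close> evaluates \<open>Lam\<close> after scaling the imaginary parts by
  \<open>t\<close>, so that \<open>t = 0\<close> sees real arguments only, where the real part has a
  positive minimum on the compact cell. Uniform continuity in \<open>t\<close> carries this over to
  a strip, and periodicity to all real parts.\<close>

lemma Lam_nonzero_strip:
 obtains d where "0 < d" "d \<le> d0" "\<And>x k. x \<in> strip d ==> k \<in> strip d ==> Lam x k \<noteq> 0"
proof -
 define F where "F t x k = Lam (of_real (Re x) + of_real t * (\<i> * of_real (Im x))) (of_real (Re k) + of_real t * (\<i> * of_real (Im k)))" for t x k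
 have in_strip: "of_real (Re x) + of_real t * (\<i> * of_real (Im x)) \<in> strip d0" if "0 \<le> t" "t \<le> 1" "\<bar>Im x\<bar> \<le> d0 / 2" for t x
  using that mult_mono[of "\<bar>t\<bar>" 1 "\<bar>Im x\<bar>" "d0 / 2"] by (simp add: strip_def abs_mult)
 have cF: "continuous_on ({0..1} \<times> cell (d0 / 2)) (\<lambda>s. F (fst s) (fst (snd s)) (snd (snd s)))"
  unfolding F_def
  by (rule hol2_compose_continuous[OF hol2_Lam]) (auto intro!: continuous_intros in_strip simp: mem_cell)
 have c0: "continuous_on (cell (d0 / 2)) (\<lambda>s. Re (F 0 (fst s) (snd s)))"
 proof -
  have "continuous_on (cell (d0 / 2)) (\<lambda>s. (\<lambda>s. F (fst s) (fst (snd s)) (snd (snd s))) (0, s))"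
   by (rule continuous_on_compose2[OF cF]) (auto intro!: continuous_intros)
  then show ?thesis by (intro continuous_intros) simp
 qed
 have ne: "cell (d0 / 2) \<noteq> {}" using mem_cell[of 0 0 "d0 / 2"] by auto
 obtain p where p: "p \<in> cell (d0 / 2)" "\<And>s. s \<in> cell (d0 / 2) ==> Re (F 0 (fst p) (snd p)) \<le> Re (F 0 (fst s) (snd s))"
  using continuous_attains_inf[OF compact_cell ne c0] by blast
 define e where "e = Re (F 0 (fst p) (snd p))"
 have e: "e > 0"
 proof -
  obtain x k where "p = (x, k)" by fastforce
  then show ?thesis using Lam_real_pos[of "Re x" "Re k"] p(1) unfolding e_def F_def by (simp add: mem_cell)
 qed
 obtain t0 where t0: "t0 > 0" "t0 \<le> 1" "\<And>t x k. 0 \<le> t ==> t \<le> t0 ==> (x, k) \<in> cell (d0 / 2) ==> cmod (F t x k - F 0 x k) < e"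
  using uniform_at_0[OF cF e] by blast
 define d where "d = t0 * (d0 / 2)"
 have d: "0 < d" "d \<le> d0" using t0 by (auto simp: d_def)
 have main: "Lam x k \<noteq> 0" if xk: "0 \<le> Re x" "Re x \<le> 1 / 2" "0 \<le> Re k" "Re k \<le> 1" "\<bar>Im x\<bar> < d" "\<bar>Im k\<bar> < d" for x k
 proof -
  define x' where "x' = Complex (Re x) (Im x / t0)"
  define k' where "k' = Complex (Re k) (Im k / t0)"
  have c: "(x', k') \<in> cell (d0 / 2)" using xk t0 unfolding mem_cell x'_def k'_def d_def by (simp add: divide_le_eq abs_mult mult.commute)
  have "F t0 x' k' = Lam x k"
  proof -
   have "of_real (Re x') + of_real t0 * (\<i> * of_real (Im x')) = x" "of_real (Re k') + of_real t0 * (\<i> * of_real (Im k')) = k"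
    using t0 by (simp_all add: complex_eq_iff x'_def k'_def)
   then show ?thesis unfolding F_def by simp
  qed
  moreover have "cmod (F t0 x' k' - F 0 x' k') < e" using t0 c by simp
  moreover have "e \<le> Re (F 0 x' k')" using p(2)[OF c] by (simp add: e_def)
  moreover have "Re (F 0 x' k') \<le> cmod (F 0 x' k')" by (rule complex_Re_le_cmod)
  ultimately show ?thesis by (auto simp: norm_minus_commute)
 qed
 have "Lam x k \<noteq> 0" if xk: "x \<in> strip d" "k \<in> strip d" for x k
 proof -
  obtain x' k' where "0 \<le> Re x'" "Re x' \<le> 1 / 2" "Im x' = Im x" "0 \<le> Re k'" "Re k' \<le> 1" "Im k' = Im k" "Lam x' k' = Lam x k"
  proof (rule periodic_reduce[where f = Lam and dlt = d and x = x and k = k])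
   show "Lam (x + 1 / 2) k = Lam x k" for x k using Lam_half[of "x + 1 / 2" k] by simp
   show "Lam x (k + 1) = Lam x k" for x k by (rule Lam_k)
  qed (use xk in auto)
  then show ?thesis using main[of x' k'] xk by (auto simp: strip_def)
 qed
 then show ?thesis using that d by blast
qed

lemma continuous_wgt:
 assumes "continuous_on S X" "continuous_on S T" "\<And>s. s \<in> S ==> X s \<in> strip d0"
 shows "continuous_on S (\<lambda>s. wgt (T s) (X s))"
 unfolding wgt_def qq_def om_def
proof (intro continuous_intros assms)
 show "\<forall>s\<in>S. 1 - 9 / 10 * ee (X s) \<noteq> 0" using one_minus_qq[OF assms(3)] unfolding qq_def by blast
qed auto

lemma continuous_A:
 assumes d: "0 \<le> eta" "eta < d" "d \<le> d0" and Lam: "\<And>x k. x \<in> strip d ==> k \<in> strip d ==> Lam x k \<noteq> 0"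
 shows "continuous_on ({0..1} \<times> cell eta) (\<lambda>s. A00 (fst s) (fst (snd s)) (snd (snd s)))"
  "continuous_on ({0..1} \<times> cell eta) (\<lambda>s. A10 (fst s) (fst (snd s)) (snd (snd s)))"
  "continuous_on ({0..1} \<times> cell eta) (\<lambda>s. A01 (fst s) (fst (snd s)) (snd (snd s)))"
  "continuous_on ({0..1} \<times> cell eta) (\<lambda>s. A11 (fst s) (fst (snd s)) (snd (snd s)))"
proof -
 let ?S = "{0..1} \<times> cell eta"
 let ?t = "fst :: real \<times> complex \<times> complex \<Rightarrow> real"
 let ?x = "\<lambda>s :: real \<times> complex \<times> complex. fst (snd s)"
 let ?k = "\<lambda>s :: real \<times> complex \<times> complex. snd (snd s)"
 have xs: "?x s \<in> strip d" "?k s \<in> strip d" if "s \<in> ?S" for s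
  using that d by (auto simp: mem_cell strip_def)
 have xs0: "?x s \<in> strip d0" "?k s \<in> strip d0" if "s \<in> ?S" for s
  using xs[OF that] strip_mono[OF d(3)] by blast+
 have csg: "continuous_on ?S (\<lambda>s. sg (?t s))" and com: "continuous_on ?S (\<lambda>s. om (?t s))"
  unfolding sg_def om_def by (intro continuous_intros; simp)+
 have ct: "continuous_on ?S ?t" and cx: "continuous_on ?S ?x" and ck: "continuous_on ?S ?k" by (intro continuous_intros)+
 have w: "continuous_on ?S (\<lambda>s. wgt (?t s) (?x s))" "continuous_on ?S (\<lambda>s. wgt (?t s) (?x s - 1 / 2))"
  by (rule continuous_wgt[OF _ ct]; use xs0 in \<open>auto intro!: continuous_on_diff cx continuous_on_const\<close>)+
 have csp: "continuous_on ?S (\<lambda>s. complex_of_real (sg (?t s) + 1 / 4))" "continuous_on ?S (\<lambda>s. complex_of_real (sg (?t s) - 1 / 4))"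
  by (intro continuous_on_of_real continuous_on_add continuous_on_diff csg continuous_on_const)+
 have w': "continuous_on ?S (\<lambda>s. wgt (?t s) (?x s - of_real (sg (?t s) + 1 / 4)))" "continuous_on ?S (\<lambda>s. wgt (?t s) (?x s - of_real (sg (?t s) - 1 / 4)))"
  "continuous_on ?S (\<lambda>s. wgt (?t s) (?x s - 1 / 2 - of_real (sg (?t s) + 1 / 4)))" "continuous_on ?S (\<lambda>s. wgt (?t s) (?x s - 1 / 2 - of_real (sg (?t s) - 1 / 4)))"
  by (rule continuous_wgt[OF _ ct], intro continuous_on_diff cx continuous_on_const csp, use xs0 in \<open>simp add: strip_def\<close>)+
 have ek: "continuous_on ?S (\<lambda>s. ee (?k s - of_real (2 * om (?t s))))" "continuous_on ?S (\<lambda>s. ee (- (?k s - of_real (2 * om (?t s)))))"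
  by (rule continuous_on_ee, intro continuous_on_minus continuous_on_diff ck continuous_on_of_real continuous_on_mult continuous_on_const com)+
 have T11: "continuous_on ?S (\<lambda>s. T11 (?t s) (?x s))" "continuous_on ?S (\<lambda>s. T11 (?t s) (?x s - 1 / 2))"
  "continuous_on ?S (\<lambda>s. T12 (?t s) (?x s) (?k s))" "continuous_on ?S (\<lambda>s. T21 (?t s) (?x s) (?k s))"
  unfolding T11_def T12_def T21_def
  by (intro continuous_on_mult continuous_on_add w w' ek)+
 have cc: "continuous_on ?S (\<lambda>s. f (X s) (Y s))" if "hol2 d0 f" "continuous_on ?S X" "continuous_on ?S Y" "\<And>s. s \<in> ?S ==> X s \<in> strip d0" "\<And>s. s \<in> ?S ==> Y s \<in> strip d0" for f X Y
  by (rule hol2_compose_continuous[OF that])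
 have sm: "- k \<in> strip dlt \<longleftrightarrow> k \<in> strip dlt" for k dlt by (simp add: strip_def)
 have P: "continuous_on ?S (\<lambda>s. Phi (?x s) (?k s))" "continuous_on ?S (\<lambda>s. Phi (?x s - 1 / 2) (?k s))"
  "continuous_on ?S (\<lambda>s. Phi (?x s - of_real (2 * sg (?t s))) (?k s - of_real (2 * om (?t s))))"
  "continuous_on ?S (\<lambda>s. Phi (?x s - of_real (2 * sg (?t s)) - 1 / 2) (?k s - of_real (2 * om (?t s))))"
  by (intro cc[OF hol2_Phi] continuous_intros csg com cx ck; use xs0 in simp)+
 have B: "continuous_on ?S (\<lambda>s. chi (?x s) (- ?k s))" "continuous_on ?S (\<lambda>s. chi (?x s - 1 / 2) (- ?k s))"
  "continuous_on ?S (\<lambda>s. chi (?x s - of_real (2 * sg (?t s))) (- (?k s - of_real (2 * om (?t s)))))"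
  "continuous_on ?S (\<lambda>s. chi (?x s - of_real (2 * sg (?t s)) - 1 / 2) (- (?k s - of_real (2 * om (?t s)))))"
  by (intro cc[OF hol2_chi] continuous_intros csg com cx ck; use xs0 in \<open>simp only: sm strip_simps strip_add_real\<close>)+
 have L: "continuous_on ?S (\<lambda>s. Lam (?x s) (?k s))" by (intro cc[OF hol2_Lam] cx ck xs0)
 have L0: "\<forall>s\<in>?S. Lam (?x s) (?k s) \<noteq> 0" using Lam xs by blast
 show "continuous_on ?S (\<lambda>s. A00 (?t s) (?x s) (?k s))" "continuous_on ?S (\<lambda>s. A10 (?t s) (?x s) (?k s))"
  "continuous_on ?S (\<lambda>s. A01 (?t s) (?x s) (?k s))" "continuous_on ?S (\<lambda>s. A11 (?t s) (?x s) (?k s))"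
  unfolding A00_def A10_def A01_def A11_def UU_def VV_def uu_def vv_def
  by (intro continuous_on_divide continuous_on_add continuous_on_diff continuous_on_mult continuous_on_minus T11 P B L L0)+
qed

text \<open>A half step in \<open>x\<close> multiplies a slope by a factor of modulus
  \<open>exp (- 2 * pi * Im k)\<close>. Multiplied by this weight, its modulus becomes periodic and
  can be estimated on the compact cell.\<close>

definition wt :: "complex \<Rightarrow> complex \<Rightarrow> real" where "wt x k = exp (4 * pi * Re x * Im k)"

lemma wt_pos: "wt x k > 0" by (simp add: wt_def)
lemma wt_k: "wt x (k + 1) = wt x k" by (simp add: wt_def)
lemma wt_half: "wt (x + 1 / 2) k = exp (2 * pi * Im k) * wt x k"
 by (simp add: wt_def exp_add[symmetric] algebra_simps)

text \<open>Precisely the factor for which the value at \<open>x - 1/2\<close> of the function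
  \<open>Phi + y * chi\<close> is the second component of the vector with slope \<open>y x k\<close>
  in the frame.\<close>

definition aut2 :: "real \<Rightarrow> (complex \<Rightarrow> complex \<Rightarrow> complex) \<Rightarrow> bool" where
 "aut2 dlt y \<longleftrightarrow> (\<forall>x\<in>strip dlt. \<forall>k\<in>strip dlt. y (x + 1 / 2) k = - ee k * y x k \<and> y x (k + 1) = y x k)"

definition phi_of :: "(complex \<Rightarrow> complex \<Rightarrow> complex) \<Rightarrow> complex \<Rightarrow> complex \<Rightarrow> complex" where
 "phi_of y x k = Phi x k + y x k * chi (x - 1 / 2) (- k)"

text \<open>The graph transform: the slope at \<open>(x, k)\<close> of the image of the line with
  slope \<open>y\<close> at the shifted point.\<close>

definition SS :: "real \<Rightarrow> (complex \<Rightarrow> complex \<Rightarrow> complex) \<Rightarrow> complex \<Rightarrow> complex \<Rightarrow> complex" where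
 "SS t y x k = (A10 t x k + A11 t x k * y (x - of_real (2 * sg t)) (k - of_real (2 * om t)))
   / (A00 t x k + A01 t x k * y (x - of_real (2 * sg t)) (k - of_real (2 * om t)))"

lemma phi_of_half:
 assumes y: "aut2 dlt y" and xk: "x \<in> strip dlt" "k \<in> strip dlt"
 shows "phi_of y (x - 1 / 2) k = Phi (x - 1 / 2) k + y x k * (- chi x (- k))"
proof -
 have e: "ee k * ee (- k) = 1" by (simp add: ee_minus)
 have "y (x - 1 / 2 + 1 / 2) k = - ee k * y (x - 1 / 2) k" using y xk unfolding aut2_def by (metis strip_simps(4))
 then have y1: "y x k = - ee k * y (x - 1 / 2) k" by simp
 have "x - 1 / 2 - 1 / 2 = x - 1" by simp
 then have "phi_of y (x - 1 / 2) k = Phi (x - 1 / 2) k + y (x - 1 / 2) k * (ee k * chi x (- k))"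
  unfolding phi_of_def using chi_diff_1[of x "- k"] by simp
 then show ?thesis unfolding y1 by simp
qed

lemma aut_phi_of:
 assumes y: "aut2 dlt y"
 shows "aut dlt (phi_of y)"
 unfolding aut_def
proof (intro ballI conjI)
 fix x k assume xk: "x \<in> strip dlt" "k \<in> strip dlt"
 have x1: "x + 1 / 2 \<in> strip dlt" using xk by simp
 have "y (x + 1 / 2 + 1 / 2) k = - ee k * (- ee k * y x k)" using y xk x1 unfolding aut2_def by metis
 moreover have "x + 1 / 2 + 1 / 2 = x + 1" by simp
 ultimately have yy: "y (x + 1) k = ee k * ee k * y x k" by simp
 have e: "ee k * ee (- k) = 1" by (simp add: ee_minus)
 have "chi (x - 1 / 2 + 1) (- k) = ee (- k) * chi (x - 1 / 2) (- k)" by (rule chi_period_x)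
 moreover have "x - 1 / 2 + 1 = x + 1 - 1 / 2" by simp
 ultimately have c: "chi (x + 1 - 1 / 2) (- k) = ee (- k) * chi (x - 1 / 2) (- k)" by simp
 show "phi_of y (x + 1) k = ee k * phi_of y x k"
  unfolding phi_of_def Phi_add_1 yy c using e by algebra
 show "phi_of y x (k + 1) = phi_of y x k"
  using y xk unfolding phi_of_def Phi_k chi_minus_k aut2_def by simp
qed

lemma hol2_phi_of: "hol2 d y ==> d \<le> d0 ==> hol2 d (phi_of y)"
 unfolding phi_of_def[abs_def]
 by (intro hol2_add hol2_mult hol2_mono[OF hol2_Phi] hol2_mono[OF hol2_flip[OF hol2_chi_half]]) auto

lemma uu_vv_WW:
 assumes y: "aut2 dlt y" and xk: "x \<in> strip dlt" "k \<in> strip dlt"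
 shows "uu x k (WW t (WW t (phi_of y)) x k) (WW t (WW t (phi_of y)) (x - 1 / 2) k)
   = A00 t x k + A01 t x k * y (x - of_real (2 * sg t)) (k - of_real (2 * om t))"
  and "vv x k (WW t (WW t (phi_of y)) x k) (WW t (WW t (phi_of y)) (x - 1 / 2) k)
   = A10 t x k + A11 t x k * y (x - of_real (2 * sg t)) (k - of_real (2 * om t))"
proof -
 define X where "X = x - of_real (2 * sg t)"
 define K where "K = k - of_real (2 * om t)"
 have XK: "X \<in> strip dlt" "K \<in> strip dlt" using xk by (simp_all add: X_def K_def)
 have p: "phi_of y X K = Phi X K + y X K * chi (X - 1 / 2) (- K)" by (simp add: phi_of_def)
 note q = phi_of_half[OF y XK]
 note w = WW_WW[OF aut_phi_of[OF y] xk, of t, folded X_def K_def]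
 show "uu x k (WW t (WW t (phi_of y)) x k) (WW t (WW t (phi_of y)) (x - 1 / 2) k)
   = A00 t x k + A01 t x k * y (x - of_real (2 * sg t)) (k - of_real (2 * om t))"
  unfolding w UU_def[symmetric] p q UU_linear A00_def A01_def X_def[symmetric] K_def[symmetric] ..
 show "vv x k (WW t (WW t (phi_of y)) x k) (WW t (WW t (phi_of y)) (x - 1 / 2) k)
   = A10 t x k + A11 t x k * y (x - of_real (2 * sg t)) (k - of_real (2 * om t))"
  unfolding w VV_def[symmetric] p q VV_linear A10_def A11_def X_def[symmetric] K_def[symmetric] ..
qed

lemma uu_vv_aut:
 assumes G: "aut dlt G" and xk: "x \<in> strip dlt" "k \<in> strip dlt"
 shows "uu (x + 1 / 2) k (G (x + 1 / 2) k) (G (x + 1 / 2 - 1 / 2) k) = uu x k (G x k) (G (x - 1 / 2) k)"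
  "vv (x + 1 / 2) k (G (x + 1 / 2) k) (G (x + 1 / 2 - 1 / 2) k) = - ee k * vv x k (G x k) (G (x - 1 / 2) k)"
  "uu x (k + 1) (G x (k + 1)) (G (x - 1 / 2) (k + 1)) = uu x k (G x k) (G (x - 1 / 2) k)"
  "vv x (k + 1) (G x (k + 1)) (G (x - 1 / 2) (k + 1)) = vv x k (G x k) (G (x - 1 / 2) k)"
proof -
 have e: "ee k * ee (- k) = 1" by (simp add: ee_minus)
 have h: "x - 1 / 2 + 1 = x + 1 / 2" "x + 1 / 2 - 1 / 2 = x" by simp_all
 have g: "G (x + 1 / 2) k = ee k * G (x - 1 / 2) k" using autD(1)[OF G _ xk(2), of "x - 1 / 2"] xk(1) unfolding h by simp
 have p: "Phi (x + 1 / 2) k = ee k * Phi (x - 1 / 2) k" using Phi_add_1[of "x - 1 / 2" k] unfolding h .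
 have c: "chi (x + 1 / 2) (- k) = ee (- k) * chi (x - 1 / 2) (- k)" using chi_period_x[of "x - 1 / 2" "- k"] unfolding h .
 have L: "Lam (x + 1 / 2) k = Lam x k" using Lam_half[of "x + 1 / 2" k] unfolding h by simp
 have "ee (- k) * C * (ee k * A) + D * B = D * B + C * A" for A B C D using e by algebra
 then show "uu (x + 1 / 2) k (G (x + 1 / 2) k) (G (x + 1 / 2 - 1 / 2) k) = uu x k (G x k) (G (x - 1 / 2) k)"
  unfolding uu_def h L g c by simp
 have "(P * (ee k * A) - ee k * Q * B) / l = - ee k * ((Q * B - P * A) / l)" for A B P Q l
  by (simp add: diff_divide_distrib algebra_simps)
 then show "vv (x + 1 / 2) k (G (x + 1 / 2) k) (G (x + 1 / 2 - 1 / 2) k) = - ee k * vv x k (G x k) (G (x - 1 / 2) k)"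
  unfolding vv_def h L g p .
 have gk: "G x (k + 1) = G x k" "G (x - 1 / 2) (k + 1) = G (x - 1 / 2) k" using autD(2)[OF G _ xk(2)] xk(1) by simp_all
 show "uu x (k + 1) (G x (k + 1)) (G (x - 1 / 2) (k + 1)) = uu x k (G x k) (G (x - 1 / 2) k)"
  "vv x (k + 1) (G x (k + 1)) (G (x - 1 / 2) (k + 1)) = vv x k (G x k) (G (x - 1 / 2) k)"
  unfolding uu_def vv_def gk chi_minus_k Lam_k Phi_k by simp_all
qed

lemma SS_eq:
 assumes y: "aut2 dlt y" and xk: "x \<in> strip dlt" "k \<in> strip dlt"
 shows "SS t y x k = vv x k (WW t (WW t (phi_of y)) x k) (WW t (WW t (phi_of y)) (x - 1 / 2) k)
   / uu x k (WW t (WW t (phi_of y)) x k) (WW t (WW t (phi_of y)) (x - 1 / 2) k)"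
 unfolding uu_vv_WW[OF assms] SS_def ..

lemma aut2_SS:
 assumes y: "aut2 dlt y"
 shows "aut2 dlt (SS t y)"
 unfolding aut2_def
proof (intro ballI conjI)
 fix x k assume xk: "x \<in> strip dlt" "k \<in> strip dlt"
 have x1: "x + 1 / 2 \<in> strip dlt" and k1: "k + 1 \<in> strip dlt" using xk by simp_all
 have G: "aut dlt (WW t (WW t (phi_of y)))" by (intro aut_WW aut_phi_of y)
 show "SS t y (x + 1 / 2) k = - ee k * SS t y x k"
  unfolding SS_eq[OF y x1 xk(2)] SS_eq[OF y xk] uu_vv_aut(1,2)[OF G xk] by simp
 show "SS t y x (k + 1) = SS t y x k"
  unfolding SS_eq[OF y xk(1) k1] SS_eq[OF y xk] uu_vv_aut(3,4)[OF G xk] ..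
qed

lemma hol2_uu_vv:
 assumes d: "d \<le> d0" and Lam: "\<And>x k. x \<in> strip d ==> k \<in> strip d ==> Lam x k \<noteq> 0" and G: "hol2 d G"
 shows "hol2 d (\<lambda>x k. uu x k (G x k) (G (x - 1 / 2) k))" "hol2 d (\<lambda>x k. vv x k (G x k) (G (x - 1 / 2) k))"
 unfolding uu_def vv_def
 by (intro hol2_divide hol2_add hol2_diff hol2_mult G hol2_half[OF G] hol2_mono[OF hol2_Phi] hol2_mono[OF hol2_half[OF hol2_Phi]]
   hol2_flip[OF hol2_chi] hol2_flip[OF hol2_chi_half] hol2_mono[OF hol2_Lam] d Lam; assumption)+

text \<open>An invariant line field is a fixed point of \<open>SS\<close>, found by iteration from 0
  in the weighted supremum norm. The shift changes the weight by a factor \<open>E\<close> close to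
  1, which the gap between \<open>lam1\<close> and \<open>lam2\<close> absorbs. The iterates are
  holomorphic, and so is their limit.\<close>

theorem eigen_section:
 obtains eta t0 where "0 < eta" "eta \<le> d0" "0 < t0" "t0 \<le> 1" "\<And>t. 0 < t ==> t \<le> t0 ==>
  \<exists>phi a. hol2 eta phi \<and> aut eta phi \<and> (\<exists>x. phi (of_real x) 0 \<noteq> 0) \<and> hol2 eta a \<and>
   (\<forall>x\<in>strip eta. \<forall>k\<in>strip eta. a (x + 1 / 2) k = a x k \<and> a x (k + 1) = a x k \<and>
    WW t (WW t phi) x k = a x k * phi x k \<and> cmod (a x k - lam1 x k) \<le> 1 / 2 * cmod (lam1 x k))"
proof -
 obtain d where d: "0 < d" "d \<le> d0" and Lam: "\<And>x k. x \<in> strip d ==> k \<in> strip d ==> Lam x k \<noteq> 0"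
  by (rule Lam_nonzero_strip) blast
 define eta where "eta = d / 2"
 have eta: "0 < eta" "eta < d" "eta \<le> d0" using d by (auto simp: eta_def)
 have sub: "x \<in> strip d" "x \<in> strip d0" if "x \<in> strip eta" for x using that eta d by (auto simp: strip_def)
 have subc: "x \<in> strip d" "k \<in> strip d" "x \<in> strip d0" "k \<in> strip d0" if "(x, k) \<in> cell eta" for x k
  using that eta d by (auto simp: strip_def mem_cell)
 have Lam': "Lam x k \<noteq> 0" if "x \<in> strip eta" "k \<in> strip eta" for x k using Lam sub that by blast
 note cont = continuous_A[OF less_imp_le[OF eta(1)] eta(2) d(2) Lam]
 \<comment> \<open>The largest value with \<open>9/10 + 20 * tht \<le> 1\<close>, where
   \<open>9/10\<close> bounds the ratio of the two eigenvalues.\<close>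
 define tht :: real where "tht = 1 / 200"
 obtain B where B: "B > 0" "\<And>t x k. 0 \<le> t ==> t \<le> 1 ==> (x, k) \<in> cell eta ==> cmod (A01 t x k) \<le> B"
  using continuous_bounded_family[OF cont(3)] by blast
 \<comment> \<open>Since the weight is at least 1/2 on the cell,
   \<open>cmod (A01 t x k / w x k) * (2 * rho)\<close> is at most
   \<open>4 * B * rho = tht\<close>.\<close>
 define rho where "rho = tht / (4 * B)"
 have rho: "rho > 0" using B by (simp add: rho_def tht_def)
 obtain ta where ta: "ta > 0" "ta \<le> 1" "\<And>t x k. 0 \<le> t ==> t \<le> ta ==> (x, k) \<in> cell eta ==> cmod (A00 t x k - A00 0 x k) < tht"
  using uniform_at_0[OF cont(1), of tht] by (auto simp: tht_def)
 obtain tb where tb: "tb > 0" "tb \<le> 1" "\<And>t x k. 0 \<le> t ==> t \<le> tb ==> (x, k) \<in> cell eta ==> cmod (A11 t x k - A11 0 x k) < tht"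
  using uniform_at_0[OF cont(4), of tht] by (auto simp: tht_def)
 have "tht * rho / 2 > 0" using rho by (simp add: tht_def)
 from uniform_at_0[OF cont(2) this]
 obtain tc where tc: "tc > 0" "tc \<le> 1" "\<And>t x k. 0 \<le> t ==> t \<le> tc ==> (x, k) \<in> cell eta ==> cmod (A10 t x k - A10 0 x k) < tht * rho / 2"
  by blast
 define t0 where "t0 = min (min ta tb) (min tc (tht / 2))"
 have t0: "0 < t0" "t0 \<le> 1" "t0 \<le> ta" "t0 \<le> tb" "t0 \<le> tc" "t0 \<le> tht / 2" using ta tb tc by (auto simp: t0_def tht_def)
 have "\<exists>phi a. hol2 eta phi \<and> aut eta phi \<and> (\<exists>x. phi (of_real x) 0 \<noteq> 0) \<and> hol2 eta a \<and>
   (\<forall>x\<in>strip eta. \<forall>k\<in>strip eta. a (x + 1 / 2) k = a x k \<and> a x (k + 1) = a x k \<and>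
    WW t (WW t phi) x k = a x k * phi x k \<and> cmod (a x k - lam1 x k) \<le> 1 / 2 * cmod (lam1 x k))"
  if t: "0 < t" "t \<le> t0" for t
 proof -
  \<comment> \<open>The shift moves \<open>Re x\<close> by \<open>2 * sg t\<close>, and
    \<open>Im k\<close> is below \<open>1/100\<close>; so the weight changes by a factor of at most
    \<open>exp t\<close>. The bound \<open>t \<le> tht / 2\<close> makes this at most
    \<open>1 + tht\<close>.\<close>
  define E where "E = exp t"
  have E: "1 \<le> E" "E \<le> 2" "(9 / 10 + tht) * E \<le> 9 / 10 + 3 * tht"
  proof -
   have t1: "t \<le> tht / 2" using t t0 by linarith
   show "1 \<le> E" using t by (simp add: E_def)
   have "t \<le> 1" using t t0 by linarith
   then have "E \<le> 1 + t + t\<^sup>2" using exp_bound[of t] t by (simp add: E_def)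
   moreover have "t\<^sup>2 \<le> 1 * t" using t \<open>t \<le> 1\<close> unfolding power2_eq_square by (intro mult_right_mono) auto
   ultimately have E: "E \<le> 1 + tht" using t1 by linarith
   then show "E \<le> 2" by (simp add: tht_def)
   have "(9 / 10 + tht) * E \<le> (9 / 10 + tht) * (1 + tht)" using E by (intro mult_left_mono) (auto simp: tht_def)
   then show "(9 / 10 + tht) * E \<le> 9 / 10 + 3 * tht" by (simp add: tht_def)
  qed
  define tau where "tau x = x - complex_of_real (2 * sg t)" for x
  define kap where "kap k = k - complex_of_real (2 * om t)" for k
  have tk: "tau x \<in> strip eta \<longleftrightarrow> x \<in> strip eta" "kap x \<in> strip eta \<longleftrightarrow> x \<in> strip eta" for x by (simp_all add: tau_def kap_def)
  have SS: "SS t y x k = (A10 t x k + A11 t x k * y (tau x) (kap k)) / (A00 t x k + A01 t x k * y (tau x) (kap k))" for y x k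
   by (simp add: SS_def tau_def kap_def)
  have sg_le: "0 \<le> sg t" "sg t \<le> t"
  proof -
   have "sqrt 2 \<le> 4" by (rule real_le_lsqrt) auto
   then have "sqrt 2 * t \<le> 4 * t" using t by (intro mult_right_mono) auto
   then show "0 \<le> sg t" "sg t \<le> t" using t by (auto simp: sg_def)
  qed
  have wtau: "wt x k \<le> E * wt (tau x) (kap k)" if "k \<in> strip eta" for x k
  proof -
   have "8 * pi * sg t * Im k \<le> 8 * pi * sg t * (1 / 100)"
    using that eta sg_le by (intro mult_left_mono) (auto simp: strip_def)
   also have "... = (8 * pi / 100) * sg t" by simp
   also have "... \<le> 1 * sg t" by (rule mult_right_mono) (use pi_less_4 sg_le in auto)
   finally have "8 * pi * sg t * Im k \<le> t" using sg_le by linarith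
   then have "4 * pi * Re x * Im k \<le> t + 4 * pi * Re (tau x) * Im (kap k)" by (simp add: tau_def kap_def algebra_simps)
   then show ?thesis unfolding wt_def E_def exp_add[symmetric] by simp
  qed
  define bd where "bd r y \<longleftrightarrow> (\<forall>x\<in>strip eta. \<forall>k\<in>strip eta. cmod (y x k) * wt x k \<le> r)" for r :: real and y :: "complex \<Rightarrow> complex \<Rightarrow> complex"
  have bdD: "cmod (y (tau x) (kap k) * of_real (wt x k)) \<le> E * r" if "bd r y" "x \<in> strip eta" "k \<in> strip eta" for r y x k
  proof -
   have "cmod (y (tau x) (kap k)) * wt x k \<le> cmod (y (tau x) (kap k)) * (E * wt (tau x) (kap k))"
    using wtau that by (intro mult_left_mono) auto
   also have "... = E * (cmod (y (tau x) (kap k)) * wt (tau x) (kap k))" by simp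
   also have "... \<le> E * r" using that E tk unfolding bd_def by (intro mult_left_mono) auto
   finally show ?thesis using wt_pos[of x k] by (simp add: norm_mult)
  qed
  have per: "cmod (y (x + 1 / 2) k) * wt (x + 1 / 2) k = cmod (y x k) * wt x k" "cmod (y x (k + 1)) * wt x (k + 1) = cmod (y x k) * wt x k"
   if "aut2 eta y" "x \<in> strip eta" "k \<in> strip eta" for y x k
  proof -
   have "exp (- (2 * pi * Im k)) * exp (2 * pi * Im k) = 1" by (simp flip: exp_add)
   then have "exp (- (2 * pi * Im k)) * cmod (y x k) * (exp (2 * pi * Im k) * wt x k) = cmod (y x k) * wt x k"
    by (metis mult.assoc mult.left_commute mult_1)
   then show "cmod (y (x + 1 / 2) k) * wt (x + 1 / 2) k = cmod (y x k) * wt x k"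
    using that unfolding aut2_def wt_half by (simp add: norm_mult norm_ee)
   show "cmod (y x (k + 1)) * wt x (k + 1) = cmod (y x k) * wt x k" using that unfolding aut2_def wt_k by simp
  qed
  have bdI: "bd r y" if y: "aut2 eta y" and c: "\<And>x k. (x, k) \<in> cell eta ==> x \<in> strip eta ==> k \<in> strip eta ==> cmod (y x k) * wt x k \<le> r" for r y
   unfolding bd_def
  proof (intro ballI)
   fix x k assume xk: "x \<in> strip eta" "k \<in> strip eta"
   show "cmod (y x k) * wt x k \<le> r"
    by (rule periodic_le[where F = "\<lambda>x k. cmod (y x k) * wt x k" and dlt = eta and x = x and k = k, OF per(1)[OF y] per(2)[OF y] c xk])
  qed
  have wcell: "wt x k \<le> 2" "1 / wt x k \<le> 2" if "(x, k) \<in> cell eta" for x k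
  proof -
   have "\<bar>Re x * Im k\<bar> \<le> 1 / 2 * (1 / 100)" unfolding abs_mult using that eta by (intro mult_mono) (auto simp: mem_cell)
   then have "pi * \<bar>Re x * Im k\<bar> \<le> 4 * (1 / 2 * (1 / 100))" using pi_less_4 by (intro mult_mono) auto
   then have "\<bar>4 * pi * Re x * Im k\<bar> \<le> 1 / 2" by (simp add: abs_mult)
   moreover have "exp z \<le> 2" if "\<bar>z\<bar> \<le> 1 / 2" for z :: real
   proof -
    have "exp z \<le> exp (1 / 2)" using that by simp
    also have "... \<le> 1 + 1 / 2 + (1 / 2)\<^sup>2" by (rule exp_bound) auto
    finally show ?thesis by (simp add: power2_eq_square)
   qed
   ultimately have "exp (4 * pi * Re x * Im k) \<le> 2" "exp (- (4 * pi * Re x * Im k)) \<le> 2" by simp_all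
   then show "wt x k \<le> 2" "1 / wt x k \<le> 2" by (simp_all add: wt_def exp_minus inverse_eq_divide)
  qed
  \<comment> \<open>In the variable \<open>y * w\<close> the Moebius map has the entries
    \<open>A10 * w\<close> and \<open>A01 / w\<close> off the diagonal, and the weighted bounds
    become bounds on moduli.\<close>
  define w where "w x k = complex_of_real (wt x k)" for x k
  have w0: "w x k \<noteq> 0" for x k using wt_pos[of x k] by (simp add: w_def)
  have moeb: "0 < (1::real)" "1 \<le> cmod (lam1 x k)" "0 < tht" "9 / 10 + 20 * tht \<le> 1" "0 \<le> (9 / 10::real)"  "rho > 0"
    "cmod (A00 t x k - lam1 x k) \<le> tht * 1" "cmod (A11 t x k) \<le> (9 / 10 + tht) * cmod (lam1 x k)" "cmod (A10 t x k * w x k) \<le> tht * rho * 1"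
    "cmod (A01 t x k / w x k) * (2 * rho) \<le> tht * 1" "1 \<le> E" "E \<le> 2" "(9 / 10 + tht) * E \<le> 9 / 10 + 3 * tht"
   if c: "(x, k) \<in> cell eta" for x k
  proof -
   note s = subc[OF c]
   note A0 = A_at_0[OF s(3,4) Lam[OF s(1,2)]]
   show "1 \<le> cmod (lam1 x k)" by (rule lam_bounds(1)[OF s(3,4)])
   show "cmod (A00 t x k - lam1 x k) \<le> tht * 1" using ta(3)[of t x k] t t0 c unfolding A0 by simp
   have "cmod (A11 t x k - lam2 x k) \<le> tht" using tb(3)[of t x k] t t0 c unfolding A0 by simp
   then have "cmod (A11 t x k) \<le> tht * 1 + cmod (lam2 x k)" using norm_triangle_ineq[of "A11 t x k - lam2 x k" "lam2 x k"] by simp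
   also have "... \<le> tht * cmod (lam1 x k) + 9 / 10 * cmod (lam1 x k)"
    using lam_bounds[OF s(3,4)] by (intro add_mono mult_left_mono) (auto simp: tht_def)
   finally show "cmod (A11 t x k) \<le> (9 / 10 + tht) * cmod (lam1 x k)" by (simp add: distrib_right)
   have wp: "cmod (w x k) = wt x k" using wt_pos[of x k] by (simp add: w_def)
   have "cmod (A10 t x k) \<le> tht * rho / 2" using tc(3)[of t x k] t t0 c unfolding A0 by simp
   then have "cmod (A10 t x k) * wt x k \<le> tht * rho / 2 * 2" using wcell[OF c] wt_pos[of x k] rho by (intro mult_mono) (auto simp: tht_def)
   then show "cmod (A10 t x k * w x k) \<le> tht * rho * 1" by (simp add: norm_mult wp)
   have "cmod (A01 t x k) * (1 / wt x k) \<le> B * 2"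
    using B(2)[of t x k] t t0 c wcell[OF c] wt_pos[of x k] B(1) by (intro mult_mono) auto
   then have "cmod (A01 t x k) * (1 / wt x k) * (2 * rho) \<le> B * 2 * (2 * rho)" using rho by (intro mult_right_mono) auto
   also have "... = tht" using B(1) by (simp add: rho_def)
   finally show "cmod (A01 t x k / w x k) * (2 * rho) \<le> tht * 1" by (simp add: norm_divide wp)
  qed (use E rho in \<open>auto simp: tht_def\<close>)
  have mc1: "(1 - 2 * tht) * cmod (lam1 x k) \<le> cmod (A00 t x k + A01 t x k / w x k * y)"
   "cmod (A00 t x k + A01 t x k / w x k * y - lam1 x k) \<le> 2 * tht * cmod (lam1 x k)"
   "cmod ((A10 t x k * w x k + A11 t x k * y) / (A00 t x k + A01 t x k / w x k * y)) \<le> (1 - 10 * tht) * rho"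
   if c: "(x, k) \<in> cell eta" and y: "cmod y \<le> E * rho" for x k y
   by (rule moebius_contraction(1)[OF moeb[OF c] y] moebius_contraction(2)[OF moeb[OF c] y] moebius_contraction(3)[OF moeb[OF c] y])+
  have mc4: "cmod ((A10 t x k * w x k + A11 t x k * y) / (A00 t x k + A01 t x k / w x k * y) - (A10 t x k * w x k + A11 t x k * z) / (A00 t x k + A01 t x k / w x k * z)) \<le> (1 - 4 * tht) * r"
   if c: "(x, k) \<in> cell eta" and y: "cmod y \<le> E * rho" "cmod z \<le> E * rho" "cmod (y - z) \<le> E * r" for x k y z r
   by (rule moebius_contraction(4)[OF moeb[OF c] y])
  note mc = mc1 mc4
  have den: "A00 t x k + A01 t x k * y = A00 t x k + A01 t x k / w x k * (y * w x k)" for x k y using w0[of x k] by simp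
  have num: "(A10 t x k + A11 t x k * y) / D * w x k = (A10 t x k * w x k + A11 t x k * (y * w x k)) / D" for x k y D
   by (simp add: algebra_simps)
  have wn: "cmod z * wt x k = cmod (z * w x k)" for z x k using wt_pos[of x k] by (simp add: w_def norm_mult)
  have yw: "cmod (y (tau x) (kap k) * w x k) \<le> E * r" if "bd r y" "x \<in> strip eta" "k \<in> strip eta" for r y x k
   using bdD[OF that] by (simp add: w_def)
  have S_bd: "bd rho (SS t y)" if y: "aut2 eta y" "bd rho y" for y
  proof (rule bdI[OF aut2_SS[OF y(1)]])
   fix x k assume c: "(x, k) \<in> cell eta" "x \<in> strip eta" "k \<in> strip eta"
   have "cmod (SS t y x k) * wt x k \<le> (1 - 10 * tht) * rho"
    unfolding wn SS den num by (rule mc(3)[OF c(1) yw[OF y(2) c(2,3)]])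
   then show "cmod (SS t y x k) * wt x k \<le> rho" using rho by (simp add: tht_def)
  qed
  have S_contr: "bd ((1 - 4 * tht) * r) (\<lambda>x k. SS t y x k - SS t z x k)"
   if y: "aut2 eta y" "bd rho y" and z: "aut2 eta z" "bd rho z" and yz: "bd r (\<lambda>x k. y x k - z x k)" for y z r
  proof (rule bdI)
   show "aut2 eta (\<lambda>x k. SS t y x k - SS t z x k)"
    using aut2_SS[OF y(1), of t] aut2_SS[OF z(1), of t] unfolding aut2_def by (simp add: algebra_simps)
   fix x k assume c: "(x, k) \<in> cell eta" "x \<in> strip eta" "k \<in> strip eta"
   have d: "cmod (y (tau x) (kap k) * w x k - z (tau x) (kap k) * w x k) \<le> E * r"
    using yw[OF yz c(2,3)] by (simp add: left_diff_distrib)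
   show "cmod (SS t y x k - SS t z x k) * wt x k \<le> (1 - 4 * tht) * r"
    unfolding wn left_diff_distrib[of _ _ "w x k"] SS den num by (rule mc(4)[OF c(1) yw[OF y(2) c(2,3)] yw[OF z(2) c(2,3)] d])
  qed
  define Y where "Y n = (SS t ^^ n) (\<lambda>x k. 0)" for n
  have Y0: "Y 0 = (\<lambda>x k. 0)" and YS: "Y (Suc n) = SS t (Y n)" for n by (simp_all add: Y_def)
  have Ya: "aut2 eta (Y n)" for n
  proof (induction n)
   case 0
   show ?case by (simp add: Y0 aut2_def)
  next
   case (Suc n)
   then show ?case unfolding YS by (rule aut2_SS)
  qed
  have Yb: "bd rho (Y n)" for n
  proof (induction n)
   case 0
   show ?case using rho by (simp add: Y0 bd_def)
  next
   case (Suc n)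
   then show ?case unfolding YS by (rule S_bd[OF Ya])
  qed
  have den0: "A00 t x k + A01 t x k * y (tau x) (kap k) \<noteq> 0 \<and> cmod (A00 t x k + A01 t x k * y (tau x) (kap k) - lam1 x k) \<le> 2 * tht * cmod (lam1 x k)"
   if y: "bd rho y" and c: "(x, k) \<in> cell eta" "x \<in> strip eta" "k \<in> strip eta" for y x k
  proof -
   have "0 < (1 - 2 * tht) * cmod (lam1 x k)" using moeb(2)[OF c(1)] by (intro mult_pos_pos) (auto simp: tht_def)
   also have "... \<le> cmod (A00 t x k + A01 t x k / w x k * (y (tau x) (kap k) * w x k))" by (rule mc(1)[OF c(1) yw[OF y c(2,3)]])
   finally have "A00 t x k + A01 t x k * y (tau x) (kap k) \<noteq> 0" unfolding den[symmetric] by auto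
   then show ?thesis using mc(2)[OF c(1) yw[OF y c(2,3)]] unfolding den[symmetric] by blast
  qed
  define a where "a y x k = A00 t x k + A01 t x k * y (tau x) (kap k)" for y x k
  have a_eq: "a y x k = uu x k (WW t (WW t (phi_of y)) x k) (WW t (WW t (phi_of y)) (x - 1 / 2) k)"
   if "aut2 eta y" "x \<in> strip eta" "k \<in> strip eta" for y x k
   unfolding a_def tau_def kap_def using uu_vv_WW(1)[OF that, of t] by simp
  have a_per: "a y (x + 1 / 2) k = a y x k" "a y x (k + 1) = a y x k" if y: "aut2 eta y" and xk: "x \<in> strip eta" "k \<in> strip eta" for y x k
  proof -
   have x1: "x + 1 / 2 \<in> strip eta" "k + 1 \<in> strip eta" using xk by simp_all
   have G: "aut eta (WW t (WW t (phi_of y)))" by (intro aut_WW aut_phi_of y)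
   show "a y (x + 1 / 2) k = a y x k" "a y x (k + 1) = a y x k"
    unfolding a_eq[OF y x1(1) xk(2)] a_eq[OF y xk(1) x1(2)] a_eq[OF y xk] uu_vv_aut(1,3)[OF G xk] by simp_all
  qed
  have qq4h: "qq (x + 1 / 2) ^ 4 = qq x ^ 4" for x using qq_diff_half[of "x + 1 / 2"] by simp
  have l_per: "lam1 (x + 1 / 2) k = lam1 x k" "lam1 x (k + 1) = lam1 x k" for x k
   using RR_half[of "x + 1 / 2" k] unfolding lam1_def RR_k qq4h by simp_all
  have a_near: "a y x k \<noteq> 0" "cmod (a y x k - lam1 x k) \<le> 1 / 2 * cmod (lam1 x k)"
   if y: "aut2 eta y" "bd rho y" and xk: "x \<in> strip eta" "k \<in> strip eta" for y x k
  proof -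
   \<comment> \<open>Both functions are paired so that one and the same reduction brings their
     arguments into the cell.\<close>
   define F where "F x k = (a y x k, lam1 x k)" for x k
   obtain x' k' where x': "0 \<le> Re x'" "Re x' \<le> 1 / 2" "Im x' = Im x" "0 \<le> Re k'" "Re k' \<le> 1" "Im k' = Im k" "F x' k' = F x k"
   proof (rule periodic_reduce[where f = F and dlt = eta and x = x and k = k])
    show "F (x + 1 / 2) k = F x k" if "x \<in> strip eta" "k \<in> strip eta" for x k
     unfolding F_def a_per(1)[OF y(1) that] l_per ..
    show "F x (k + 1) = F x k" if "x \<in> strip eta" "k \<in> strip eta" for x k
     unfolding F_def a_per(2)[OF y(1) that] l_per ..
   qed (use xk in auto)
   have c: "(x', k') \<in> cell eta" "x' \<in> strip eta" "k' \<in> strip eta" using x' xk by (auto simp: mem_cell strip_def)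
   have "a y x' k' \<noteq> 0" "cmod (a y x' k' - lam1 x' k') \<le> 2 * tht * cmod (lam1 x' k')" using den0[OF y(2) c] unfolding a_def by blast+
   moreover have "2 * tht * cmod (lam1 x' k') \<le> 1 / 2 * cmod (lam1 x' k')" by (intro mult_right_mono) (auto simp: tht_def)
   ultimately have "a y x' k' \<noteq> 0" "cmod (a y x' k' - lam1 x' k') \<le> 1 / 2 * cmod (lam1 x' k')" by linarith+
   then show "a y x k \<noteq> 0" "cmod (a y x k - lam1 x k) \<le> 1 / 2 * cmod (lam1 x k)" using x'(7) by (auto simp: F_def)
  qed
  have WWh: "hol2 eta (WW t (WW t (phi_of y)))" if "hol2 eta y" for y using that eta by (intro hol2_WW hol2_phi_of)
  have a_hol: "hol2 eta (a y)" if y: "aut2 eta y" "hol2 eta y" for y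
   by (rule hol2_cong[OF hol2_uu_vv(1)[OF eta(3) Lam' WWh[OF y(2)]]]) (use a_eq[OF y(1)] in auto)
  have S_hol: "hol2 eta (SS t y)" if y: "aut2 eta y" "bd rho y" "hol2 eta y" for y
  proof -
   have "hol2 eta (\<lambda>x k. vv x k (WW t (WW t (phi_of y)) x k) (WW t (WW t (phi_of y)) (x - 1 / 2) k)
     / uu x k (WW t (WW t (phi_of y)) x k) (WW t (WW t (phi_of y)) (x - 1 / 2) k))"
    using a_near(1)[OF y(1,2)] a_eq[OF y(1)]
    by (intro hol2_divide hol2_uu_vv[OF eta(3) Lam' WWh[OF y(3)]]) auto
   then show ?thesis by (rule hol2_cong) (rule SS_eq[OF y(1)])
  qed
  have Yh: "hol2 eta (Y n)" for n
  proof (induction n)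
   case 0
   show ?case unfolding Y0 by (rule hol2_const)
  next
   case (Suc n)
   then show ?case unfolding YS by (rule S_hol[OF Ya Yb])
  qed
  define q where "q = 1 - 4 * tht"
  have q: "0 \<le> q" "q < 1" by (auto simp: q_def tht_def)
  have diff: "bd (q ^ n * rho) (\<lambda>x k. Y (Suc n) x k - Y n x k)" for n
  proof (induction n)
   case 0
   then show ?case using Yb[of 1] by (simp add: Y0)
  next
   case (Suc n)
   have "bd (q * (q ^ n * rho)) (\<lambda>x k. SS t (Y (Suc n)) x k - SS t (Y n) x k)"
    unfolding q_def by (rule S_contr[OF Ya Yb Ya Yb Suc.IH[unfolded q_def]])
   then show ?case unfolding YS[symmetric] by (simp add: mult.assoc)
  qed
  \<comment> \<open>The limit is written as a telescoping series, so that the geometric bounds on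
    the increments give convergence by the Weierstrass test.\<close>
  define y where "y x k = (\<Sum>n. Y (Suc n) x k - Y n x k)" for x k
  have tele: "(\<Sum>i<n. Y (Suc i) x k - Y i x k) = Y n x k" for n x k
   using sum_lessThan_telescope[of "\<lambda>i. Y i x k" n] by (simp add: Y0)
  have lim: "uniform_limit {p \<in> strip eta \<times> strip eta. norm p \<le> M} (\<lambda>n p. Y n (fst p) (snd p)) (\<lambda>p. y (fst p) (snd p)) sequentially" for M
  proof -
   define C where "C = exp (4 * pi * (M * eta))"
   have "uniform_limit {p \<in> strip eta \<times> strip eta. norm p \<le> M} (\<lambda>n p. \<Sum>i<n. Y (Suc i) (fst p) (snd p) - Y i (fst p) (snd p))
     (\<lambda>p. \<Sum>i. Y (Suc i) (fst p) (snd p) - Y i (fst p) (snd p)) sequentially"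
   proof (rule Weierstrass_m_test)
    show "summable (\<lambda>n. q ^ n * rho * C)" using q by (intro summable_mult2 summable_geometric) auto
    fix n p assume p: "p \<in> {p \<in> strip eta \<times> strip eta. norm p \<le> M}"
    define x k where "x = fst p" and "k = snd p"
    have xk: "x \<in> strip eta" "k \<in> strip eta" using p by (auto simp: x_def k_def)
    have "cmod x \<le> M" using p norm_fst_le[of x k] by (simp add: x_def k_def)
    then have "\<bar>Re x * Im k\<bar> \<le> M * eta" unfolding abs_mult using xk abs_Re_le_cmod[of x] by (intro mult_mono) (auto simp: strip_def)
    then have "- (Re x * Im k) \<le> M * eta" by linarith
    then have "4 * pi * (- (Re x * Im k)) \<le> 4 * pi * (M * eta)" by (intro mult_left_mono) auto
    then have wC: "1 \<le> wt x k * C" unfolding wt_def C_def exp_add[symmetric] by (simp add: algebra_simps)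
    have "cmod (Y (Suc n) x k - Y n x k) * 1 \<le> cmod (Y (Suc n) x k - Y n x k) * (wt x k * C)"
     using wC by (rule mult_left_mono) simp
    then have "cmod (Y (Suc n) x k - Y n x k) \<le> cmod (Y (Suc n) x k - Y n x k) * (wt x k * C)" by simp
    also have "... \<le> q ^ n * rho * C"
     using diff[of n] xk unfolding bd_def by (simp only: mult.assoc[symmetric]) (intro mult_right_mono, auto simp: C_def)
    finally show "cmod (Y (Suc n) (fst p) (snd p) - Y n (fst p) (snd p)) \<le> q ^ n * rho * C" by (simp add: x_def k_def)
   qed
   then show ?thesis unfolding tele y_def .
  qed
  have ptw: "(\<lambda>n. Y n x k) \<longlonglongrightarrow> y x k" if "x \<in> strip eta" "k \<in> strip eta" for x k
   using tendsto_uniform_limitI[OF lim[of "norm (x, k)"], of "(x, k)"] that by simp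
  have yh: "hol2 eta y" by (rule hol2_uniform_limit[OF Yh lim])
  have ya: "aut2 eta y" unfolding aut2_def
  proof (intro ballI conjI)
   fix x k assume xk: "x \<in> strip eta" "k \<in> strip eta"
   have "(\<lambda>n. Y n (x + 1 / 2) k) \<longlonglongrightarrow> y (x + 1 / 2) k" "(\<lambda>n. Y n x (k + 1)) \<longlonglongrightarrow> y x (k + 1)" using xk by (auto intro!: ptw)
   moreover have "(\<lambda>n. Y n (x + 1 / 2) k) = (\<lambda>n. - ee k * Y n x k)" "(\<lambda>n. Y n x (k + 1)) = (\<lambda>n. Y n x k)"
    using Ya xk unfolding aut2_def by auto
   moreover have "(\<lambda>n. - ee k * Y n x k) \<longlonglongrightarrow> - ee k * y x k" by (intro tendsto_intros ptw xk)
   ultimately show "y (x + 1 / 2) k = - ee k * y x k" "y x (k + 1) = y x k"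
    using LIMSEQ_unique ptw[OF xk] by metis+
  qed
  have yb: "bd rho y" unfolding bd_def
  proof (intro ballI)
   fix x k assume xk: "x \<in> strip eta" "k \<in> strip eta"
   have "(\<lambda>n. cmod (Y n x k) * wt x k) \<longlonglongrightarrow> cmod (y x k) * wt x k" by (intro tendsto_intros ptw xk)
   moreover have "cmod (Y n x k) * wt x k \<le> rho" for n using Yb[of n] xk unfolding bd_def by blast
   ultimately show "cmod (y x k) * wt x k \<le> rho" by (intro LIMSEQ_le_const2) auto
  qed
  have fixp: "SS t y x k = y x k" if xk: "x \<in> strip eta" "k \<in> strip eta" for x k
  proof -
   have Yt: "(\<lambda>n. Y n (tau x) (kap k)) \<longlonglongrightarrow> y (tau x) (kap k)" using xk by (intro ptw) (simp_all add: tk)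
   have "(\<lambda>n. SS t (Y n) x k) \<longlonglongrightarrow> SS t y x k" unfolding SS
    using a_near(1)[OF ya yb xk] unfolding a_def by (intro tendsto_intros Yt)
   moreover have "(\<lambda>n. SS t (Y n) x k) \<longlonglongrightarrow> y x k" using LIMSEQ_Suc[OF ptw[OF xk]] by (simp add: YS)
   ultimately show ?thesis using LIMSEQ_unique by blast
  qed
  have eig: "WW t (WW t (phi_of y)) x k = a y x k * phi_of y x k" if xk: "x \<in> strip eta" "k \<in> strip eta" for x k
  proof -
   define p where "p = WW t (WW t (phi_of y)) x k"
   define p' where "p' = WW t (WW t (phi_of y)) (x - 1 / 2) k"
   have u: "uu x k p p' = a y x k" using a_eq[OF ya xk] by (simp add: p_def p'_def)
   have "vv x k p p' / uu x k p p' = y x k" using SS_eq[OF ya xk, of t] fixp[OF xk] by (simp add: p_def p'_def)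
   then have v: "vv x k p p' = a y x k * y x k" unfolding u using a_near(1)[OF ya yb xk] by (simp add: field_simps)
   have "p = uu x k p p' * Phi x k + vv x k p p' * chi (x - 1 / 2) (- k)" by (rule frame[OF Lam'[OF xk]])
   then show ?thesis unfolding u v p_def[symmetric] phi_of_def by (simp add: algebra_simps)
  qed
  \<comment> \<open>If \<open>phi_of y\<close> vanished at the real points \<open>0\<close> and
    \<open>- 1/2\<close> with \<open>k = 0\<close>, both components of a vector with first
    coordinate 1 would vanish, which forces \<open>Lam 0 0 = 0\<close>.\<close>
  have nz: "\<exists>x. phi_of y (of_real x) 0 \<noteq> 0"
  proof (rule ccontr)
   assume "\<not> ?thesis"
   then have z: "phi_of y (of_real x) 0 = 0" for x by blast
   have s0: "(0::complex) \<in> strip eta" using eta by (simp add: strip_def)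
   have "phi_of y 0 0 = 0" using z[of 0] by simp
   then have "Phi 0 0 + y 0 0 * chi (0 - 1 / 2) (- 0) = 0" by (simp only: phi_of_def)
   moreover have "phi_of y (0 - 1 / 2) 0 = 0" using z[of "- 1 / 2"] by simp
   then have "Phi (0 - 1 / 2) 0 + y 0 0 * (- chi 0 (- 0)) = 0" unfolding phi_of_half[OF ya s0 s0] .
   ultimately have "Lam 0 0 = 0" unfolding Lam_def by algebra
   then show False using Lam'[OF s0 s0] by simp
  qed
  show ?thesis
   using hol2_phi_of[OF yh eta(3)] aut_phi_of[OF ya] nz a_hol[OF ya yh] a_per[OF ya] eig a_near(2)[OF ya yb] by blast
 qed
 then show ?thesis using that[OF eta(1,3) t0(1,2)] by blast
qed

section \<open>The window\<close>

lemma hol2_scale: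
 assumes f: "hol2 dlt f" and c: "\<bar>c\<bar> * dlt' \<le> dlt" "dlt' \<le> dlt" "c \<noteq> 0"
 shows "hol2 dlt' (\<lambda>x k. f (of_real c * x) k)"
proof -
 have x: "of_real c * x \<in> strip dlt" if "x \<in> strip dlt'" for x
 proof -
  have "\<bar>c\<bar> * \<bar>Im x\<bar> < \<bar>c\<bar> * dlt'" using that c(3) by (simp add: strip_def)
  then show ?thesis using c(1) by (simp add: strip_def abs_mult)
 qed
 have k: "k \<in> strip dlt" if "k \<in> strip dlt'" for k using that c(2) by (rule strip_mono[rotated])
 have "continuous_on (strip dlt' \<times> strip dlt') (\<lambda>p. f (of_real c * fst p) (snd p))"
 proof (rule hol2_compose_continuous[OF f])
  show "of_real c * fst p \<in> strip dlt" "snd p \<in> strip dlt" if "p \<in> strip dlt' \<times> strip dlt'" for p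
   using that x k by auto
 qed (intro continuous_intros)+
 moreover have "(\<lambda>x. f (of_real c * x) k) holomorphic_on strip dlt'" if "k \<in> strip dlt'" for k
  by (rule holomorphic_on_compose_gen[of "\<lambda>x. of_real c * x" _ "\<lambda>x. f x k" "strip dlt", unfolded o_def])
   (use f x k[OF that] in \<open>auto simp: hol2_def intro!: holomorphic_intros\<close>)
 moreover have "f (of_real c * x) holomorphic_on strip dlt'" if "x \<in> strip dlt'" for x
 proof (rule holomorphic_on_subset)
  show "f (of_real c * x) holomorphic_on strip dlt" using f x[OF that] unfolding hol2_def by blast
 qed (use k in auto)
 ultimately show ?thesis unfolding hol2_def by blast
qed

lemma Re_pos_not_nonpos: "Re z > 0 ==> z \<notin> \<real>\<^sub>\<le>\<^sub>0"
 by (auto simp: complex_nonpos_Reals_iff)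

lemma hol2_lam1: "hol2 d0 lam1"
 unfolding lam1_def[abs_def]
 by (intro hol2_divide hol2_add hol2_const hol2_RR hol2_fst holomorphic_intros hol_qq one_minus_qq4)

text \<open>A logarithm of the multiplier \<open>a\<close>, assembled from principal logarithms of quantities with
 positive real part.\<close>

lemma log_multiplier:
 assumes eta: "eta \<le> d0" and a: "hol2 eta a"
  and near: "\<And>x k. x \<in> strip eta ==> k \<in> strip eta ==> cmod (a x k - lam1 x k) \<le> 1 / 2 * cmod (lam1 x k)"
  and per: "\<And>x k. x \<in> strip eta ==> k \<in> strip eta ==> a (x + 1 / 2) k = a x k"
   "\<And>x k. x \<in> strip eta ==> k \<in> strip eta ==> a x (k + 1) = a x k"
 obtains l where "hol2 eta l" "\<And>x k. x \<in> strip eta ==> k \<in> strip eta ==> exp (l x k) = a x k"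
  "\<And>x k. x \<in> strip eta ==> k \<in> strip eta ==> l (x + 1 / 2) k = l x k"
  "\<And>x k. x \<in> strip eta ==> k \<in> strip eta ==> l x (k + 1) = l x k"
proof -
 define l where "l x k = Ln (9 / 5 * s2 + RR x k) - Ln (1 - qq x ^ 4) + Ln (a x k / lam1 x k)" for x k
 have s: "x \<in> strip d0" if "x \<in> strip eta" for x using that eta by (rule strip_mono[rotated])
 have p1: "Re (9 / 5 * s2 + RR x k) > 0" if "x \<in> strip eta" "k \<in> strip eta" for x k
 proof -
  have "Re (9 / 5 * s2 + RR x k) = 9 / 5 * sqrt 2 + Re (RR x k)" by (simp add: s2_def)
  moreover have "0 < sqrt 2" by simp
  ultimately show ?thesis using RR_Re_pos[OF s s, OF that] by linarith
 qed
 have p2: "Re (1 - qq x ^ 4) > 0" if "x \<in> strip eta" for x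
  using norm_qq4_less_1[OF s[OF that]] complex_Re_le_cmod[of "qq x ^ 4"] by (simp del: Re_power2)
 have l0: "lam1 x k \<noteq> 0" if "x \<in> strip eta" "k \<in> strip eta" for x k
  using lam_bounds(1)[OF s s, OF that] by auto
 have p3: "Re (a x k / lam1 x k) > 0" if xk: "x \<in> strip eta" "k \<in> strip eta" for x k
 proof -
  have "a x k / lam1 x k - 1 = (a x k - lam1 x k) / lam1 x k" using l0[OF xk] by (simp add: diff_divide_distrib)
  then have "cmod (a x k / lam1 x k - 1) \<le> 1 / 2" using near[OF xk] l0[OF xk] by (simp add: norm_divide divide_le_eq)
  then show ?thesis using abs_Re_le_cmod[of "a x k / lam1 x k - 1"] by simp
 qed
 have LnS: "Ln holomorphic_on - \<real>\<^sub>\<le>\<^sub>0" by (rule holomorphic_on_Ln) auto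
 have h1: "hol2 eta (\<lambda>x k. Ln (9 / 5 * s2 + RR x k))"
  by (rule hol2_compose[where f = "\<lambda>x k. 9 / 5 * s2 + RR x k" and g = Ln, OF _ LnS])
   (use p1 Re_pos_not_nonpos eta in \<open>auto intro!: hol2_add hol2_const hol2_mono[OF hol2_RR]\<close>)
 have h2: "hol2 eta (\<lambda>x k. Ln (1 - qq x ^ 4))"
  by (rule hol2_compose[where f = "\<lambda>x k. 1 - qq x ^ 4" and g = Ln, OF _ LnS])
   (use p2 Re_pos_not_nonpos in \<open>auto intro!: hol2_fst holomorphic_intros hol_qq\<close>)
 have h3: "hol2 eta (\<lambda>x k. Ln (a x k / lam1 x k))"
  by (rule hol2_compose[where f = "\<lambda>x k. a x k / lam1 x k" and g = Ln, OF _ LnS])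
   (use p3 l0 Re_pos_not_nonpos eta in \<open>auto intro!: hol2_divide a hol2_mono[OF hol2_lam1]\<close>)
 have 1: "hol2 eta l" unfolding l_def[abs_def] by (intro hol2_add hol2_diff h1 h2 h3)
 have 2: "exp (l x k) = a x k" if xk: "x \<in> strip eta" "k \<in> strip eta" for x k
 proof -
  have n: "9 / 5 * s2 + RR x k \<noteq> 0" "1 - qq x ^ 4 \<noteq> 0" "a x k / lam1 x k \<noteq> 0"
   using p1[OF xk] p2[OF xk(1)] p3[OF xk] by (metis less_irrefl zero_complex.sel(1))+
  have "exp (l x k) = (9 / 5 * s2 + RR x k) / (1 - qq x ^ 4) * (a x k / lam1 x k)"
   unfolding l_def exp_add exp_diff exp_Ln[OF n(1)] exp_Ln[OF n(2)] exp_Ln[OF n(3)] ..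
  also have "(9 / 5 * s2 + RR x k) / (1 - qq x ^ 4) = lam1 x k" by (simp add: lam1_def)
  finally show ?thesis using l0[OF xk] by simp
 qed
 have qh: "qq (x + 1 / 2) ^ 4 = qq x ^ 4" for x using qq_diff_half[of "x + 1 / 2"] by simp
 have Rh: "RR (x + 1 / 2) k = RR x k" for x k using RR_half[of "x + 1 / 2" k] by simp
 have lh: "lam1 (x + 1 / 2) k = lam1 x k" "lam1 x (k + 1) = lam1 x k" for x k unfolding lam1_def qh Rh RR_k by simp_all
 have 3: "l (x + 1 / 2) k = l x k" "l x (k + 1) = l x k" if "x \<in> strip eta" "k \<in> strip eta" for x k
  unfolding l_def qh Rh RR_k lh per[OF that] by simp_all
 show ?thesis using that[OF 1 2 3] by blast
qed

text \<open>Rescaling by a function \<open>psi\<close> replaces the multiplier \<open>a\<close> by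
  \<open>a\<close> times a translate of \<open>psi\<close> over \<open>psi\<close>. In logarithms
  this is the cohomological equation, whose constant \<open>C\<close> gives the eigenvalue
  \<open>exp C\<close> of the square; a square root \<open>mu\<close> of it leads back to the
  operator itself.\<close>

lemma WW_eigenfunction:
 obtains eps t nu G where "0 < eps" "eps \<le> d0" "0 < t" "t \<le> 1 / 2" "nu \<noteq> 0" "hol2 eps G" "aut eps G"
  "\<And>x k. x \<in> strip eps ==> k \<in> strip eps ==> WW t G x k = nu * G x k"
  "\<exists>x\<in>strip (eps / 4). \<exists>k\<in>strip (eps / 4). G x k \<noteq> 0"
proof -
 obtain eta t0 where eta: "0 < eta" "eta \<le> d0" and t0: "0 < t0" "t0 \<le> 1" and es: "\<And>t. 0 < t ==> t \<le> t0 ==>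
  \<exists>phi a. hol2 eta phi \<and> aut eta phi \<and> (\<exists>x. phi (of_real x) 0 \<noteq> 0) \<and> hol2 eta a \<and>
   (\<forall>x\<in>strip eta. \<forall>k\<in>strip eta. a (x + 1 / 2) k = a x k \<and> a x (k + 1) = a x k \<and>
    WW t (WW t phi) x k = a x k * phi x k \<and> cmod (a x k - lam1 x k) \<le> 1 / 2 * cmod (lam1 x k))"
  by (rule eigen_section) blast
 define N where "N = nat \<lceil>1 / t0\<rceil> + 2"
 define t where "t = 1 / real N"
 have N: "N > 0" "2 \<le> real N" "1 / t0 \<le> real N" by (auto simp: N_def) linarith
 have t: "0 < t" "t \<le> t0" "t \<le> 1 / 2"
  using N t0 by (auto simp: t_def field_simps)
 obtain phi a where es': "hol2 eta phi \<and> aut eta phi \<and> (\<exists>x. phi (of_real x) 0 \<noteq> 0) \<and> hol2 eta a \<and>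
   (\<forall>x\<in>strip eta. \<forall>k\<in>strip eta. a (x + 1 / 2) k = a x k \<and> a x (k + 1) = a x k \<and>
    WW t (WW t phi) x k = a x k * phi x k \<and> cmod (a x k - lam1 x k) \<le> 1 / 2 * cmod (lam1 x k))"
  using es[OF t(1,2)] by blast
 then have phih: "hol2 eta phi" "aut eta phi" and a: "hol2 eta a" by blast+
 from es' obtain x0 where x0: "phi (of_real x0) 0 \<noteq> 0" by blast
 note phi = phih x0
 have ap: "a (x + 1 / 2) k = a x k" "a x (k + 1) = a x k" and ae: "WW t (WW t phi) x k = a x k * phi x k"
  and an: "cmod (a x k - lam1 x k) \<le> 1 / 2 * cmod (lam1 x k)" if "x \<in> strip eta" "k \<in> strip eta" for x k
  using es' that by blast+
 obtain l where l: "hol2 eta l" and le: "\<And>x k. x \<in> strip eta ==> k \<in> strip eta ==> exp (l x k) = a x k"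
  and lp: "\<And>x k. x \<in> strip eta ==> k \<in> strip eta ==> l (x + 1 / 2) k = l x k" "\<And>x k. x \<in> strip eta ==> k \<in> strip eta ==> l x (k + 1) = l x k"
  using log_multiplier[OF eta(2) a an ap] by blast
 have lc: "continuous_on (strip eta \<times> strip eta) (\<lambda>p. cmod (l (fst p) (snd p)))"
  using l unfolding hol2_def by (intro continuous_on_norm) blast
 have lcp: "cmod (l (x + 1 / 2) k) = cmod (l x k)" "cmod (l x (k + 1)) = cmod (l x k)" if "x \<in> strip eta" "k \<in> strip eta" for x k
  using lp[OF that] by simp_all
 have h2: "eta / 2 < eta" using eta by simp
 obtain B where B: "B > 0" "\<And>x k. x \<in> strip (eta / 2) ==> k \<in> strip (eta / 2) ==> cmod (l x k) \<le> B"
  using periodic_bounded[where F = "\<lambda>x k. cmod (l x k)" and dlt = eta, OF lcp lc h2] by blast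
 \<comment> \<open>Halving the argument turns the period 1/2 in \<open>x\<close> into the period 1
   that the Fourier series expect; \<open>psi\<close> undoes this by doubling.\<close>
 define f where "f x k = l (of_real (1 / 2) * x) k" for x k
 have fs: "hol2 (eta / 2) f" unfolding f_def[abs_def] by (rule hol2_scale[OF l]) (use eta in auto)
 have half: "of_real (1 / 2) * x \<in> strip (eta / 2)" "of_real (1 / 2) * x \<in> strip eta" if "x \<in> strip (eta / 2)" for x :: complex
  using that eta by (auto simp: strip_def)
 have sub: "k \<in> strip eta" if "k \<in> strip (eta / 2)" for k using that eta by (auto simp: strip_def)
 have fpx: "f (x + 1) k = f x k" if "x \<in> strip (eta / 2)" "k \<in> strip (eta / 2)" for x k
 proof -
  have e: "of_real (1 / 2) * (x + 1) = of_real (1 / 2) * x + 1 / 2" by (simp add: field_simps)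
  show ?thesis unfolding f_def e by (rule lp(1)[OF half(2) sub, OF that])
 qed
 have fpk: "f x (k + 1) = f x k" if "x \<in> strip (eta / 2)" "k \<in> strip (eta / 2)" for x k
  unfolding f_def by (rule lp(2)[OF half(2) sub, OF that])
 have fB: "cmod (f x k) \<le> B" if "x \<in> strip (eta / 2)" "k \<in> strip (eta / 2)" for x k
  unfolding f_def by (rule B(2)[OF half(1) that(2), OF that(1)])
 obtain c where c: "c > 0" "\<And>m n::int. (m, n) \<noteq> (0, 0) ==>
  cmod (1 - ee (- (of_int m * of_real (sqrt 2 / N) + of_int n * of_real (sqrt 3 / N)))) \<ge> c / (1 + \<bar>of_int m\<bar> + \<bar>of_int n\<bar>) ^ 3"
  using small_divisors_sqrt2_sqrt3[OF N(1)] by blast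
 have e2: "eta / 2 > 0" using eta by simp
 obtain h C where h: "hol2 (eta / 2 / 2) h" and hp: "\<And>x k. h (x + 1) k = h x k" "\<And>x k. h x (k + 1) = h x k"
  and hc: "\<And>x k. x \<in> strip (eta / 2 / 2) ==> k \<in> strip (eta / 2 / 2) ==> h x k - h (x - of_real (sqrt 2 / N)) (k - of_real (sqrt 3 / N)) = f x k - C"
  using cohomological_equation[OF fs e2 fpx fpk fB c] by blast
 define eps where "eps = eta / 8"
 have eps: "0 < eps" "eps \<le> d0" using eta by (auto simp: eps_def)
 have se: "x \<in> strip eta" "x \<in> strip (eta / 2 / 2)" "of_real 2 * x \<in> strip (eta / 2 / 2)" if "x \<in> strip eps" for x :: complex
  using that eta by (auto simp: strip_def eps_def)
 define psi where "psi x k = exp (h (of_real 2 * x) k)" for x k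
 have psih: "hol2 eps psi" unfolding psi_def[abs_def]
 proof (rule hol2_compose[where f = "\<lambda>x k. h (of_real 2 * x) k" and g = exp and S = UNIV])
  show "hol2 eps (\<lambda>x k. h (of_real 2 * x) k)" by (rule hol2_scale[OF h]) (use eta in \<open>auto simp: eps_def\<close>)
 qed (auto intro: holomorphic_intros)
 have psip: "psi (x + 1 / 2) k = psi x k" "psi (x - 1 / 2) k = psi x k" "psi (x + 1) k = psi x k" "psi x (k + 1) = psi x k" for x k
 proof -
  have "of_real 2 * (x + 1 / 2) = of_real 2 * x + 1" by simp
  then show 1: "psi (x + 1 / 2) k = psi x k" for x unfolding psi_def by (simp add: hp distrib_left)
  show 2: "psi (x - 1 / 2) k = psi x k" using 1[of "x - 1 / 2"] by simp
  show "psi (x + 1) k = psi x k" using 1[of "x + 1 / 2"] 1[of x] by (simp add: add.assoc)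
  show "psi x (k + 1) = psi x k" unfolding psi_def hp ..
 qed
 have psie: "psi (x - of_real (2 * sg t)) (k - of_real (2 * om t)) * a x k = exp C * psi x k" if xk: "x \<in> strip eps" "k \<in> strip eps" for x k
 proof -
  \<comment> \<open>The normalisations of \<open>sg\<close> and \<open>om\<close> are chosen for
    this: with \<open>t = 1 / N\<close>, and \<open>x\<close> doubled, the two shifts of the square
    are \<open>sqrt 2 / N\<close> and \<open>sqrt 3 / N\<close>, as in the small divisor
    bound.\<close>
  have e1: "of_real 2 * (x - of_real (2 * sg t)) = of_real 2 * x - of_real (sqrt 2 / N)" for x :: complex
   by (simp add: sg_def t_def right_diff_distrib)
  have e2: "of_real (2 * om t) = (of_real (sqrt 3 / N) :: complex)" by (simp add: om_def t_def)
  have "h (of_real 2 * x) k - h (of_real 2 * x - of_real (sqrt 2 / N)) (k - of_real (sqrt 3 / N)) = l x k - C"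
   using hc[OF se(3) se(2), OF xk] by (simp add: f_def)
  then have "h (of_real 2 * x - of_real (sqrt 2 / N)) (k - of_real (sqrt 3 / N)) + l x k = C + h (of_real 2 * x) k"
   by (simp add: algebra_simps)
  then show ?thesis unfolding psi_def e1 e2 le[OF se(1) se(1), OF xk, symmetric] exp_add[symmetric] by simp
 qed
 define G where "G x k = psi x k * phi x k" for x k
 have Gh: "hol2 eps G" unfolding G_def[abs_def] by (rule hol2_mult[OF psih hol2_mono[OF phi(1)]]) (use eta in \<open>simp add: eps_def\<close>)
 have phia: "aut eps phi" using phi(2) se unfolding aut_def by blast
 have Ga: "aut eps G" unfolding aut_def G_def psip using phia unfolding aut_def by simp
 have GG: "WW t (WW t G) x k = exp C * G x k" if xk: "x \<in> strip eps" "k \<in> strip eps" for x k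
 proof -
  have "WW t (WW t G) x k = psi (x - of_real (2 * sg t)) (k - of_real (2 * om t)) * WW t (WW t phi) x k"
   unfolding WW_WW(1)[OF Ga xk] WW_WW(1)[OF phia xk] G_def psip by (simp add: algebra_simps)
  also have "... = (psi (x - of_real (2 * sg t)) (k - of_real (2 * om t)) * a x k) * phi x k"
   unfolding ae[OF se(1) se(1), OF xk] by simp
  finally show ?thesis unfolding psie[OF xk] G_def by simp
 qed
 have Gnz: "G (of_real x0) 0 \<noteq> 0" using phi(3) by (simp add: G_def psi_def)
 define mu where "mu = exp (C / 2)"
 have mu: "mu \<noteq> 0" "mu * mu = exp C" by (simp_all add: mu_def flip: exp_add)
 show ?thesis
 \<comment> \<open>The square of the operator minus \<open>mu * mu\<close> annihilates
   \<open>G\<close>: either the operator plus \<open>mu\<close> produces an eigenfunction for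
   \<open>mu\<close>, or \<open>G\<close> is one for \<open>- mu\<close>. The test is made on the
   quarter strip, where the claim requires a nonzero value; in the second case the eigenvalue
   equation is known only there, and the quarter strip becomes the new strip.\<close>
 proof (cases "\<exists>x\<in>strip (eps / 4). \<exists>k\<in>strip (eps / 4). WW t G x k + mu * G x k \<noteq> 0")
  case True
  define G' where "G' x k = WW t G x k + mu * G x k" for x k
  have "hol2 eps G'" unfolding G'_def[abs_def] by (intro hol2_add hol2_mult hol2_const hol2_WW Gh eps)
  moreover have "aut eps G'" using Ga aut_WW[OF Ga, of t] unfolding aut_def G'_def by (simp add: algebra_simps)
  moreover have "WW t G' x k = mu * G' x k" if xk: "x \<in> strip eps" "k \<in> strip eps" for x k
  proof -
   have "WW t G' x k = WW t (WW t G) x k + mu * WW t G x k"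
    unfolding WW_def[of t G'] WW_def[of t "WW t G"] WW_def[of t G x k] G'_def by (simp add: algebra_simps)
   then show ?thesis unfolding GG[OF xk] mu(2)[symmetric] G'_def by (simp add: algebra_simps)
  qed
  ultimately show ?thesis using that[OF eps t(1,3) mu(1)] True unfolding G'_def by blast
 next
  case False
  have e4: "eps / 4 \<le> eps" "0 < eps / 4" "eps / 4 \<le> d0" using eps by auto
  have "WW t G x k = - mu * G x k" if "x \<in> strip (eps / 4)" "k \<in> strip (eps / 4)" for x k
  proof -
   have "WW t G x k + mu * G x k = 0" using False that by blast
   then show ?thesis by (simp add: eq_neg_iff_add_eq_0)
  qed
  moreover have "aut (eps / 4) G" using Ga strip_mono[OF e4(1)] unfolding aut_def by blast
  moreover have "of_real x0 \<in> strip (eps / 4 / 4)" "0 \<in> strip (eps / 4 / 4)" using eps by (simp_all add: strip_def)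
  ultimately show ?thesis using that[OF e4(2,3) t(1,3) _ hol2_mono[OF Gh e4(1)]] mu(1) Gnz by (metis neg_equal_0_iff_equal)
 qed
qed

section \<open>The window as an integral over the dual variable\<close>

lemma aut_int:
 assumes G: "aut dlt G" and xk: "x \<in> strip dlt" "k \<in> strip dlt"
 shows "G (x + of_int j) k = ee (of_int j * k) * G x k"
proof -
 have s: "x + of_int j \<in> strip dlt" for j using xk by (simp add: strip_def)
 show ?thesis
 proof (induction j rule: int_induct[of _ 0])
  case (step1 i)
  have h: "x + of_int (i + 1) = x + of_int i + 1" by simp
  have e: "ee (of_int (i + 1) * k) = ee k * ee (of_int i * k)" unfolding ee_add[symmetric] by (simp add: algebra_simps)
  show ?case unfolding h e autD(1)[OF G s[of i] xk(2)] step1(2) by (simp only: mult.assoc)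
 next
  case (step2 i)
  have "x + of_int i = x + of_int (i - 1) + 1" by simp
  then have "ee (of_int i * k) * G x k = ee k * G (x + of_int (i - 1)) k" using autD(1)[OF G s[of "i - 1"] xk(2)] step2 by simp
  moreover have "ee (of_int i * k) = ee k * ee (of_int (i - 1) * k)" unfolding ee_add[symmetric] by (simp add: algebra_simps)
  ultimately show ?case by simp
 qed simp
qed

text \<open>Integration over a period in \<open>k\<close> inverts the Zak transform, and the
  eigenvalue equation becomes a relation between translates. By periodicity and holomorphy the line
  of integration may be moved up or down, to the side on which \<open>G\<close> is exponentially
  small.\<close>

theorem holomorphic_window:
 obtains dlt M c s w nu f where "0 < dlt" "0 < M" "0 < c" "0 < s" "s < 1 / 4" "nu \<noteq> 0"
  "f holomorphic_on strip dlt" "\<And>x. x \<in> strip dlt ==> cmod (f x) \<le> M * exp (- c * \<bar>Re x\<bar>)"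
  "\<exists>t::real. f (of_real t) \<noteq> 0"
  "\<And>t::real. nu * (1 - 9 / 10 * ee (of_real t)) * f (of_real t)
    = ee (of_real (w * t)) * (f (of_real (t - (s + 1 / 4))) + f (of_real (t - (s - 1 / 4))))"
proof -
 obtain eps t nu G where eps: "0 < eps" "eps \<le> d0" and t: "0 < t" "t \<le> 1 / 2" and nu: "nu \<noteq> 0" and G: "hol2 eps G" "aut eps G"
  and eig: "\<And>x k. x \<in> strip eps ==> k \<in> strip eps ==> WW t G x k = nu * G x k"
  and nz: "\<exists>x\<in>strip (eps / 4). \<exists>k\<in>strip (eps / 4). G x k \<noteq> 0"
  using WW_eigenfunction by blast
 define f where "f x = fcoef (G x) 0" for x
 have Gk: "G x holomorphic_on strip eps" if "x \<in> strip eps" for x using G(1) that by (auto simp: hol2_def)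
 have Gp: "G x (k + 1) = G x k" if "x \<in> strip eps" "k \<in> strip eps" for x k using autD(2)[OF G(2) that] .
 have fh: "f holomorphic_on strip eps"
  using uniform_limit_riemann[OF G(1) eps(1) Gp] unfolding f_def[abs_def] fcoef_def by simp
 have fi: "((\<lambda>u. G x (z + of_real u)) has_integral f x) {0..1}" if "x \<in> strip eps" "z \<in> strip eps" for x z
  using fcoef_shift[OF Gk[OF that(1)] Gp[OF that(1)] that(2), of 0] unfolding f_def by simp
 have s0: "0 < sg t" "sg t < 1 / 4"
 proof -
  have "sqrt 2 < 2" by (rule real_sqrt_less_mono[of 2 4, simplified])
  then have "sqrt 2 * t < 1" using mult_strict_right_mono[of "sqrt 2" 2 t] t by linarith
  then show "0 < sg t" "sg t < 1 / 4" using t by (auto simp: sg_def)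
 qed
 have eqn: "nu * (1 - 9 / 10 * ee (of_real u)) * f (of_real u) = ee (of_real ((om t - 1 / 2) * u)) * (f (of_real (u - (sg t + 1 / 4))) + f (of_real (u - (sg t - 1 / 4))))" for u :: real
 proof -
  let ?x = "complex_of_real u"
  have x: "?x \<in> strip eps" "?x - of_real b \<in> strip eps" "- of_real b \<in> strip eps" "0 \<in> strip eps" for b using eps by (simp_all add: strip_def)
  have sh: "((\<lambda>v. G (?x - of_real b) (of_real v - of_real (om t - 1 / 2))) has_integral f (?x - of_real b)) {0..1}" for b
   using fi[OF x(2)[of b] x(3)[of "om t - 1 / 2"]] by (simp only: add.commute[of "- _"] add_uminus_conv_diff)
  have "((\<lambda>v. wgt t ?x * (G (?x - of_real (sg t + 1 / 4)) (of_real v - of_real (om t - 1 / 2)) + G (?x - of_real (sg t - 1 / 4)) (of_real v - of_real (om t - 1 / 2))))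
    has_integral (wgt t ?x * (f (?x - of_real (sg t + 1 / 4)) + f (?x - of_real (sg t - 1 / 4))))) {0..1}"
   by (intro has_integral_mult_right has_integral_add sh)
  then have "((\<lambda>v. WW t G ?x (of_real v)) has_integral (wgt t ?x * (f (?x - of_real (sg t + 1 / 4)) + f (?x - of_real (sg t - 1 / 4))))) {0..1}"
   by (simp only: WW_def)
  moreover have "WW t G ?x (of_real v) = nu * G ?x (0 + of_real v)" for v using eig[OF x(1) of_real_strip[OF eps(1)]] by simp
  ultimately have "((\<lambda>v. nu * G ?x (0 + of_real v)) has_integral (wgt t ?x * (f (?x - of_real (sg t + 1 / 4)) + f (?x - of_real (sg t - 1 / 4))))) {0..1}" by (simp only:)
  then have e: "nu * f ?x = wgt t ?x * (f (?x - of_real (sg t + 1 / 4)) + f (?x - of_real (sg t - 1 / 4)))"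
   using has_integral_mult_right[OF fi[OF x(1) x(4)], of nu] has_integral_unique by blast
  have n: "1 - qq ?x \<noteq> 0" by (rule one_minus_qq) simp
  have wfe: "wgt t ?x * (1 - qq ?x) = ee (of_real ((om t - 1 / 2) * u))" using n by (simp add: wgt_def)
  have "nu * (1 - qq ?x) * f ?x = (1 - qq ?x) * (nu * f ?x)" by simp
  also have "... = (wgt t ?x * (1 - qq ?x)) * (f (?x - of_real (sg t + 1 / 4)) + f (?x - of_real (sg t - 1 / 4)))"
   unfolding e by (simp only: mult.assoc mult.left_commute)
  finally have h: "nu * (1 - qq ?x) * f ?x = ee (of_real ((om t - 1 / 2) * u)) * (f (?x - of_real (sg t + 1 / 4)) + f (?x - of_real (sg t - 1 / 4)))"
   unfolding wfe .
  have r: "of_real (u - b) = ?x - of_real b" for b by simp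
  show ?thesis using h unfolding r qq_def .
 qed
 \<comment> \<open>Doubling \<open>x\<close> creates the period 1/2 that the boundedness lemma
   expects; the exponential compensates the modulus of \<open>ee k\<close> picked up in each
   step.\<close>
 define W where "W x k = cmod (G (of_real 2 * x) k) * exp (4 * pi * Re x * Im k)" for x k
 have e2: "eps / 4 < eps / 2" using eps by simp
 have two: "of_real 2 * x \<in> strip eps" if "x \<in> strip (eps / 2)" for x :: complex using that by (auto simp: strip_def)
 have sub: "x \<in> strip eps" if "x \<in> strip (eps / 2)" for x using that eps by (auto simp: strip_def)
 have Wp: "W (x + 1 / 2) k = W x k" if xk: "x \<in> strip (eps / 2)" "k \<in> strip (eps / 2)" for x k
 proof -
  have "of_real 2 * (x + 1 / 2) = of_real 2 * x + 1" by simp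
  then have e1: "cmod (G (of_real 2 * (x + 1 / 2)) k) = exp (- (2 * pi * Im k)) * cmod (G (of_real 2 * x) k)"
   using autD(1)[OF G(2) two[OF xk(1)] sub[OF xk(2)]] by (simp add: norm_mult norm_ee)
  have e2: "exp (4 * pi * Re (x + 1 / 2) * Im k) = exp (2 * pi * Im k) * exp (4 * pi * Re x * Im k)"
   by (simp add: exp_add[symmetric] algebra_simps)
  have e3: "exp (- (2 * pi * Im k)) * exp (2 * pi * Im k) = 1" by (simp flip: exp_add)
  have ab: "p * v * (q * w) = v * w" if "p * q = 1" for p q v w :: real
  proof -
   have "p * v * (q * w) = (p * q) * (v * w)" by (simp only: mult_ac)
   then show ?thesis using that by simp
  qed
  show ?thesis unfolding W_def e1 e2 by (rule ab[OF e3])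
 qed
 have Wk: "W x (k + 1) = W x k" if xk: "x \<in> strip (eps / 2)" "k \<in> strip (eps / 2)" for x k
  unfolding W_def using autD(2)[OF G(2) two[OF xk(1)] sub[OF xk(2)]] by simp
 have "hol2 (eps / 2) (\<lambda>x k. G (of_real 2 * x) k)" by (rule hol2_scale[OF G(1)]) (use eps in auto)
 then have "continuous_on (strip (eps / 2) \<times> strip (eps / 2)) (\<lambda>p. G (of_real 2 * fst p) (snd p))" unfolding hol2_def by blast
 then have Wc: "continuous_on (strip (eps / 2) \<times> strip (eps / 2)) (\<lambda>p. W (fst p) (snd p))"
  unfolding W_def by (intro continuous_intros)
 obtain M where M: "M > 0" "\<And>x k. x \<in> strip (eps / 4) ==> k \<in> strip (eps / 4) ==> W x k \<le> M"
  using periodic_bounded[where F = W and dlt = "eps / 2", OF Wp Wk Wc e2] by blast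
 have GM: "cmod (G x k) \<le> M * exp (- (2 * pi * Re x * Im k))" if xk: "x \<in> strip (eps / 2)" "k \<in> strip (eps / 4)" for x k
 proof -
  have "of_real (1 / 2) * x \<in> strip (eps / 4)" using xk by (simp add: strip_def)
  from M(2)[OF this xk(2)] have le: "cmod (G x k) * exp (2 * pi * Re x * Im k) \<le> M" by (simp add: W_def mult.assoc)
  have "cmod (G x k) = (cmod (G x k) * exp (2 * pi * Re x * Im k)) * exp (- (2 * pi * Re x * Im k))" by (simp add: mult.assoc flip: exp_add)
  also have "... \<le> M * exp (- (2 * pi * Re x * Im k))" using le by (intro mult_right_mono) auto
  finally show ?thesis .
 qed
 define c where "c = 2 * pi * (eps / 8)"
 have c: "c > 0" using eps by (simp add: c_def)
 have decay: "cmod (f x) \<le> M * exp (- c * \<bar>Re x\<bar>)" if x: "x \<in> strip (eps / 2)" for x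
 proof -
  \<comment> \<open>The line lies above the real axis for positive \<open>Re x\<close> and below it
    for negative \<open>Re x\<close>, so that the bound on \<open>G\<close> becomes
    \<open>M * exp (- c * \<bar>Re x\<bar>)\<close>.\<close>
  define z where "z = Complex 0 (sgn (Re x) * (eps / 8))"
  have "\<bar>Im z\<bar> \<le> eps / 8" using eps by (simp add: z_def abs_mult sgn_if)
  then have z: "z \<in> strip eps" "z \<in> strip (eps / 4)" using eps by (auto simp: strip_def)
  have "cmod (f x) \<le> (M * exp (- c * \<bar>Re x\<bar>)) * measure lborel (cbox 0 (1::real))"
  proof (rule has_integral_bound)
   show "((\<lambda>u. G x (z + of_real u)) has_integral f x) (cbox 0 1)" using fi[OF sub[OF x] z(1)] by simp
   fix u :: real
   have "cmod (G x (z + of_real u)) \<le> M * exp (- (2 * pi * Re x * Im (z + of_real u)))" by (rule GM[OF x]) (use z in simp)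
   also have "- (2 * pi * Re x * Im (z + of_real u)) = - c * \<bar>Re x\<bar>"
    by (simp add: z_def c_def sgn_if abs_if)
   finally show "cmod (G x (z + of_real u)) \<le> M * exp (- c * \<bar>Re x\<bar>)" .
  qed (use M in simp)
  then show ?thesis by simp
 qed
 have fnz: "\<exists>u::real. f (of_real u) \<noteq> 0"
 proof (rule ccontr)
  assume "\<not> ?thesis"
  then have z: "f (of_real u) = 0" for u :: real by blast
  \<comment> \<open>The real line accumulates at 0, so the identity theorem extends the vanishing to
    the strip.\<close>
  have f0: "f x = 0" if x: "x \<in> strip eps" for x
  proof (rule analytic_continuation[OF fh open_strip, where U = "range complex_of_real" and \<xi> = 0])
   show "connected (strip eps)" by (intro convex_connected convex_strip)
   show "range complex_of_real \<subseteq> strip eps" using eps by auto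
   show "(0::complex) \<in> strip eps" using eps by (simp add: strip_def)
   show "(0::complex) islimpt range complex_of_real" unfolding islimpt_approachable
   proof (intro allI impI)
    fix e :: real assume "e > 0"
    then show "\<exists>x'\<in>range complex_of_real. x' \<noteq> 0 \<and> dist x' 0 < e"
     by (intro bexI[of _ "of_real (e / 2)"] rangeI conjI) (simp_all add: dist_norm)
   qed
  qed (use z x in auto)
  obtain x k where xk: "x \<in> strip (eps / 4)" "k \<in> strip (eps / 4)" "G x k \<noteq> 0" using nz by blast
  have x2: "x \<in> strip (eps / 2)" and x1: "x \<in> strip eps" using xk eps by (auto simp: strip_def)
  \<comment> \<open>By quasi-periodicity the coefficient of index \<open>n\<close> of
    \<open>G x\<close> is \<open>f (x - n)\<close>; if \<open>f\<close> vanishes, so does the whole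
    Fourier series of \<open>G x\<close>, which contradicts the nonzero value of
    \<open>G\<close>.\<close>
  have co: "fcoef (G x) n = 0" for n
  proof -
   have xn: "x + of_int (- n) \<in> strip eps" using x1 by (simp add: strip_def)
   have "G (x + of_int (- n)) (of_real u) = G x (of_real u) * ee (- of_int n * of_real u)" for u
    using aut_int[OF G(2) x1 of_real_strip[OF eps(1)], of "- n" u] by (simp add: mult.commute)
   then have "fcoef (G x) n = f (x + of_int (- n))" unfolding f_def fcoef_def by simp
   then show ?thesis using f0[OF xn] by simp
  qed
  have s4: "eps / 4 \<le> eps" using eps by simp
  have "((\<lambda>n. fcoef (G x) n * ee (of_int n * k)) has_sum G x k) UNIV"
  proof (rule fourier_inversion)
   show "G x holomorphic_on strip (eps / 4)" by (rule holomorphic_on_subset[OF Gk[OF x1]]) (use strip_mono[OF s4] in blast)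
   show "G x (v + 1) = G x v" if "v \<in> strip (eps / 4)" for v by (rule Gp[OF x1 strip_mono[OF s4 that]])
   show "cmod (G x v) \<le> M * exp (2 * pi * \<bar>Re x\<bar>)" if v: "v \<in> strip (eps / 4)" for v
   proof -
    have "\<bar>Re x * Im v\<bar> \<le> \<bar>Re x\<bar> * 1" unfolding abs_mult using v eps by (intro mult_left_mono) (auto simp: strip_def)
    then have "- (Re x * Im v) \<le> \<bar>Re x\<bar>" by linarith
    then have "2 * pi * (- (Re x * Im v)) \<le> 2 * pi * \<bar>Re x\<bar>" by (intro mult_left_mono) auto
    then have "M * exp (- (2 * pi * Re x * Im v)) \<le> M * exp (2 * pi * \<bar>Re x\<bar>)" using M(1) by simp
    then show ?thesis using GM[OF x2 v] by linarith
   qed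
  qed (rule xk(2))
  then have "((\<lambda>n::int. 0) has_sum G x k) UNIV" unfolding co by simp
  then show False using xk(3) has_sum_unique[OF _ has_sum_0] by (metis (no_types))
 qed
 have e2': "eps / 2 > 0" using eps by simp
 have fh2: "f holomorphic_on strip (eps / 2)" by (rule holomorphic_on_subset[OF fh]) (use sub in blast)
 show ?thesis using that[OF e2' M(1) c s0 nu fh2 decay fnz eqn] .
qed

section \<open>From holomorphy on a strip to Gelfand--Shilov estimates\<close>

lemma nth_derivative_of_real:
 assumes f: "f holomorphic_on strip dlt" and dlt: "dlt > 0"
 shows "nth_derivative n (\<lambda>t. f (of_real t)) = (\<lambda>t. (deriv ^^ n) f (of_real t))"
proof (induction n)
 case (Suc n)
 have "vector_derivative (\<lambda>t. (deriv ^^ n) f (of_real t)) (at t) = (deriv ^^ Suc n) f (of_real t)" for t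
 proof (rule vector_derivative_at, rule has_vector_derivative_real_field)
  have "(deriv ^^ n) f holomorphic_on strip dlt" by (rule holomorphic_higher_deriv[OF f open_strip])
  then show "((deriv ^^ n) f has_field_derivative (deriv ^^ Suc n) f (of_real t)) (at (of_real t))"
   using holomorphic_derivI[OF _ open_strip of_real_strip[OF dlt]] by simp
 qed
 then show ?case using Suc by (simp add: nth_derivative_def)
qed (simp add: nth_derivative_def)

lemma power_le_fact_exp:
 fixes x :: real
 assumes "x \<ge> 0"
 shows "x ^ m \<le> fact m * exp x"
proof -
 have "(\<Sum>n\<in>{m}. inverse (fact n) * x ^ n) \<le> (\<Sum>n. inverse (fact n) * x ^ n)"
  by (rule sum_le_suminf[OF summable_exp]) (use assms in auto)
 then have "inverse (fact m) * x ^ m \<le> exp x" by (simp add: exp_def scaleR_conv_of_real)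
 then show ?thesis by (simp add: field_simps)
qed

text \<open>Cauchy's inequality on discs of fixed radius yields \<open>fact n\<close>, the
  exponential decay yields \<open>fact m\<close>; both are dominated by their powers with exponents
  at least 1.\<close>

theorem gelfand_shilov_of_strip:
 assumes f: "f holomorphic_on strip dlt" and dlt: "dlt > 0" and M: "M > 0" and c: "c > 0"
  and decay: "\<And>x. x \<in> strip dlt ==> cmod (f x) \<le> M * exp (- c * \<bar>Re x\<bar>)"
  and s: "s \<ge> 1" "\<sigma> \<ge> 1"
 shows "(\<lambda>t. f (of_real t)) \<in> gelfand_shilov s \<sigma>"
proof -
 define r where "r = dlt / 2"
 have r: "r > 0" using dlt by (simp add: r_def)
 have sub: "cball (of_real t) r \<subseteq> strip dlt" for t
 proof
  fix z assume "z \<in> cball (complex_of_real t) r"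
  then have "cmod (z - of_real t) \<le> r" by (simp add: dist_norm norm_minus_commute)
  then have "\<bar>Im z\<bar> \<le> r" using abs_Im_le_cmod[of "z - of_real t"] by simp
  then show "z \<in> strip dlt" using dlt by (simp add: strip_def r_def)
 qed
 have bound: "cmod ((deriv ^^ n) f (of_real t)) \<le> fact n * (M * exp (c * r) * exp (- c * \<bar>t\<bar>)) / r ^ n" for n t
 proof (rule Cauchy_inequality[OF _ _ r])
  show "f holomorphic_on ball (of_real t) r" by (rule holomorphic_on_subset[OF f]) (use sub[of t] ball_subset_cball in blast)
  show "continuous_on (cball (of_real t) r) f" by (rule continuous_on_subset[OF holomorphic_on_imp_continuous_on[OF f] sub])
  fix z assume z: "cmod (of_real t - z) = r"
  then have "\<bar>t - Re z\<bar> \<le> r" using abs_Re_le_cmod[of "of_real t - z"] by simp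
  then have "\<bar>t\<bar> - r \<le> \<bar>Re z\<bar>" by linarith
  then have "c * (\<bar>t\<bar> - r) \<le> c * \<bar>Re z\<bar>" using c by (intro mult_left_mono) auto
  then have "exp (- c * \<bar>Re z\<bar>) \<le> exp (c * r) * exp (- c * \<bar>t\<bar>)" by (simp add: exp_add[symmetric] algebra_simps)
  then have "M * exp (- c * \<bar>Re z\<bar>) \<le> M * (exp (c * r) * exp (- c * \<bar>t\<bar>))" using M by (intro mult_left_mono) auto
  moreover have "z \<in> strip dlt" using sub[of t] z by (auto simp: dist_norm)
  ultimately show "cmod (f z) \<le> M * exp (c * r) * exp (- c * \<bar>t\<bar>)" using decay[of z] by (simp add: mult.assoc)
 qed
 define h where "h = max (1 / c) (1 / r)"
 have h: "h > 0" "1 / c \<le> h" "1 / r \<le> h" using c r by (auto simp: h_def less_max_iff_disj)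
 define K where "K = M * exp (c * r)"
 have K: "K > 0" using M by (simp add: K_def)
 have main: "cmod (t ^ m * nth_derivative n (\<lambda>t. f (of_real t)) t) \<le> K * h ^ (m + n) * fact m powr s * fact n powr \<sigma>" for m n and t :: real
 proof -
  have "(c * \<bar>t\<bar>) ^ m \<le> fact m * exp (c * \<bar>t\<bar>)" by (rule power_le_fact_exp) (use c in simp)
  then have "c ^ m * \<bar>t\<bar> ^ m * exp (- c * \<bar>t\<bar>) \<le> fact m * exp (c * \<bar>t\<bar>) * exp (- c * \<bar>t\<bar>)"
   unfolding power_mult_distrib by (intro mult_right_mono) auto
  also have "... = fact m" by (simp add: mult.assoc flip: exp_add)
  finally have tm: "\<bar>t\<bar> ^ m * exp (- c * \<bar>t\<bar>) \<le> fact m * (1 / c) ^ m"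
   using c by (simp add: power_divide pos_le_divide_eq mult_ac)
  have p: "(fact j :: real) \<le> fact j powr q" if "q \<ge> 1" for j :: nat and q :: real
   using powr_mono[OF that fact_ge_1[of j]] by simp
  have "cmod (t ^ m * nth_derivative n (\<lambda>t. f (of_real t)) t) = \<bar>t\<bar> ^ m * cmod ((deriv ^^ n) f (of_real t))"
   unfolding nth_derivative_of_real[OF f dlt] by (simp add: norm_mult norm_power)
  also have "... \<le> \<bar>t\<bar> ^ m * (fact n * (M * exp (c * r) * exp (- c * \<bar>t\<bar>)) / r ^ n)"
   by (intro mult_left_mono bound) auto
  also have "... = K * (\<bar>t\<bar> ^ m * exp (- c * \<bar>t\<bar>)) * (fact n * (1 / r) ^ n)"
   by (simp add: K_def power_divide)
  also have "... \<le> K * (fact m * (1 / c) ^ m) * (fact n * (1 / r) ^ n)"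
   using tm K r by (intro mult_right_mono mult_left_mono) auto
  also have "... \<le> K * (fact m powr s * h ^ m) * (fact n powr \<sigma> * h ^ n)"
   using K c r h p[OF s(1), of m] p[OF s(2), of n]
   by (intro mult_mono mult_left_mono power_mono mult_nonneg_nonneg) auto
  also have "... = K * h ^ (m + n) * fact m powr s * fact n powr \<sigma>" by (simp add: power_add mult_ac)
  finally show ?thesis .
 qed
 have sm: "smooth (\<lambda>t. f (of_real t))" unfolding smooth_def nth_derivative_of_real[OF f dlt]
 proof (intro allI)
  fix n t
  have "(deriv ^^ n) f holomorphic_on strip dlt" by (rule holomorphic_higher_deriv[OF f open_strip])
  then have "((deriv ^^ n) f has_field_derivative deriv ((deriv ^^ n) f) (of_real t)) (at (of_real t))"
   by (rule holomorphic_derivI[OF _ open_strip of_real_strip[OF dlt]])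
  from has_vector_derivative_real_field[OF this] show "(\<lambda>t. (deriv ^^ n) f (of_real t)) differentiable at t"
   by (rule differentiableI_vector)
 qed
 have "cmod (of_real t ^ m * nth_derivative n (\<lambda>t. f (of_real t)) t) \<le> K * h ^ (m + n) * fact m powr s * fact n powr \<sigma>"
  for m n and t :: real using main[where m = m and n = n and t = t] by simp
 then have "\<forall>m n t. cmod (of_real t ^ m * nth_derivative n (\<lambda>t. f (of_real t)) t) \<le> K * h ^ (m + n) * fact m powr s * fact n powr \<sigma>"
  by (intro allI)
 with h(1) have "\<exists>h>0. \<forall>m n t. cmod (of_real t ^ m * nth_derivative n (\<lambda>t. f (of_real t)) t) \<le> K * h ^ (m + n) * fact m powr s * fact n powr \<sigma>"
  by (intro exI[of _ h] conjI)
 with K have "\<exists>C>0. \<exists>h>0. \<forall>m n t. cmod (of_real t ^ m * nth_derivative n (\<lambda>t. f (of_real t)) t) \<le> C * h ^ (m + n) * fact m powr s * fact n powr \<sigma>"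
  by (rule exI[of _ K, OF conjI])
 with sm show ?thesis unfolding gelfand_shilov_def mem_Collect_eq by (rule conjI)
qed

lemma gelfand_shilov_L2:
 assumes g: "g \<in> gelfand_shilov s \<sigma>" "s > 0" "\<sigma> > 0"
 shows "g \<in> L2"
proof -
 have gi: "integrable lborel g" using gelfand_shilov_integrable[OF g(1), of 0] by (simp add: nth_derivative_def)
 then have gm [measurable]: "g \<in> borel_measurable borel" by simp
 obtain C h where C: "C > 0" "\<And>m n t. cmod (t ^ m * nth_derivative n g t) \<le> C * h ^ (m + n) * fact m powr s * fact n powr \<sigma>"
  using g(1) unfolding gelfand_shilov_def by blast
 have b: "cmod (g t) \<le> C" for t using C(2)[of t 0 0] by (simp add: nth_derivative_def)
 have "integrable lborel (\<lambda>t. (cmod (g t))\<^sup>2)"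
 proof (rule Bochner_Integration.integrable_bound)
  show "integrable lborel (\<lambda>t. C * cmod (g t))" using gi by simp
  show "AE t in lborel. norm ((cmod (g t))\<^sup>2) \<le> norm (C * cmod (g t))"
   using b C(1) by (auto simp: power2_eq_square abs_mult intro!: mult_right_mono)
 qed measurable
 then have "integrable lebesgue (\<lambda>t. (cmod (g t))\<^sup>2)" by (subst integrable_completion) auto
 moreover have "g \<in> borel_measurable lebesgue" by (rule measurable_completion) simp
 ultimately show ?thesis by (simp add: L2_def)
qed

text \<open>The functional equation of \<open>holomorphic_window\<close> is a linear relation between four Weyl shifts.\<close>

theorem four_point_window:
 obtains g \<Lambda> where "\<And>s \<sigma>. s \<ge> 1 ==> \<sigma> \<ge> 1 ==> g \<in> gelfand_shilov s \<sigma>" "\<exists>t. g t \<noteq> 0"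
  "finite \<Lambda>" "card \<Lambda> = 4" "L2_lin_dependent (gabor_system g) \<Lambda>"
proof (rule holomorphic_window)
 fix dlt M c s w :: real and nu :: complex and f :: "complex \<Rightarrow> complex"
 assume dlt: "0 < dlt" and M: "0 < M" and c: "0 < c" and s: "0 < s" "s < 1 / 4" and nu: "nu \<noteq> 0"
  and f: "f holomorphic_on strip dlt" and decay: "\<And>x. x \<in> strip dlt ==> cmod (f x) \<le> M * exp (- c * \<bar>Re x\<bar>)"
  and nz: "\<exists>t::real. f (of_real t) \<noteq> 0"
  and eqn: "\<And>t::real. nu * (1 - 9 / 10 * ee (of_real t)) * f (of_real t)
    = ee (of_real (w * t)) * (f (of_real (t - (s + 1 / 4))) + f (of_real (t - (s - 1 / 4))))"
 define g where "g t = f (of_real t)" for t :: real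
 define z1 where "z1 = (0 :: real, 0 :: real)"
 define z2 where "z2 = (0 :: real, 1 :: real)"
 define z3 where "z3 = (s + 1 / 4, w)"
 define z4 where "z4 = (s - 1 / 4, w)"
 \<comment> \<open>Positivity of \<open>s\<close> and \<open>s < 1 / 4\<close> keep both
   translations away from 0, hence \<open>z3\<close> and \<open>z4\<close> away from
   \<open>z1\<close> and \<open>z2\<close>.\<close>
 have d: "z1 \<noteq> z2" "z1 \<noteq> z3" "z1 \<noteq> z4" "z2 \<noteq> z3" "z2 \<noteq> z4" "z3 \<noteq> z4"
  using s by (auto simp: z1_def z2_def z3_def z4_def)
 \<comment> \<open>The last case cancels the phase \<open>cis (- pi * fst z * snd z)\<close>
   contained in the symmetric form of the Weyl shift; for \<open>z1\<close> and \<open>z2\<close>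
   this phase is 1.\<close>
 define a where "a z = (if z = z1 then nu else if z = z2 then - nu * (9 / 10) else - cis (pi * fst z * snd z))" for z
 have cancel: "- A * (B * (X * Y)) = - (X * Y)" if "A * B = 1" for A B X Y :: complex
  using that by (simp flip: mult.assoc)
 have "(\<Sum>z\<in>{z1, z2, z3, z4}. a z * gabor_system g z t) = 0" for t
 proof -
  have "(\<Sum>z\<in>{z1, z2, z3, z4}. a z * gabor_system g z t) = a z1 * gabor_system g z1 t + a z2 * gabor_system g z2 t + a z3 * gabor_system g z3 t + a z4 * gabor_system g z4 t"
   using d by (simp add: add.assoc)
  also have "a z1 * gabor_system g z1 t = nu * g t" by (simp add: a_def gabor_system_def weyl_shift_cis z1_def)
  also have "a z2 * gabor_system g z2 t = - nu * (9 / 10) * ee (of_real t) * g t"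
   using d by (simp add: a_def gabor_system_def weyl_shift_cis ee_of_real) (simp add: z2_def)
  also have "a z3 * gabor_system g z3 t = - (ee (of_real (w * t)) * g (t - (s + 1 / 4)))"
  proof -
   have "cis (pi * (s + 1 / 4) * w) * cis (- pi * (s + 1 / 4) * w) = 1" by (simp add: cis_mult)
   then have "- cis (pi * (s + 1 / 4) * w) * (cis (- pi * (s + 1 / 4) * w) * (cis (2 * pi * w * t) * g (t - (s + 1 / 4)))) = - (cis (2 * pi * w * t) * g (t - (s + 1 / 4)))"
    by (rule cancel)
   moreover have "a z3 = - cis (pi * (s + 1 / 4) * w)" using d by (simp add: a_def) (simp add: z3_def)
   ultimately show ?thesis unfolding gabor_system_def weyl_shift_cis ee_of_real by (simp add: z3_def mult.assoc)
  qed
  also have "a z4 * gabor_system g z4 t = - (ee (of_real (w * t)) * g (t - (s - 1 / 4)))"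
  proof -
   have "cis (pi * (s - 1 / 4) * w) * cis (- pi * (s - 1 / 4) * w) = 1" by (simp add: cis_mult)
   then have "- cis (pi * (s - 1 / 4) * w) * (cis (- pi * (s - 1 / 4) * w) * (cis (2 * pi * w * t) * g (t - (s - 1 / 4)))) = - (cis (2 * pi * w * t) * g (t - (s - 1 / 4)))"
    by (rule cancel)
   moreover have "a z4 = - cis (pi * (s - 1 / 4) * w)" using d by (simp add: a_def) (simp add: z4_def)
   ultimately show ?thesis unfolding gabor_system_def weyl_shift_cis ee_of_real by (simp add: z4_def mult.assoc)
  qed
  finally show ?thesis using eqn[of t] unfolding g_def by (simp add: algebra_simps)
 qed
 moreover have "a z1 \<noteq> 0" using nu by (simp add: a_def)
 ultimately have "L2_lin_dependent (gabor_system g) {z1, z2, z3, z4}"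
  unfolding L2_lin_dependent_def L2_zero_def by (intro exI[of _ a]) auto
 moreover have "g \<in> gelfand_shilov s' \<sigma>" if "s' \<ge> 1" "\<sigma> \<ge> 1" for s' \<sigma>
  unfolding g_def[abs_def] by (rule gelfand_shilov_of_strip[OF f dlt M c decay that])
 moreover have "card {z1, z2, z3, z4} = 4" using d by simp
 moreover have "\<exists>t. g t \<noteq> 0" using nz by (simp add: g_def)
 ultimately show ?thesis using that[of g "{z1, z2, z3, z4}"] by blast
qed

theorem corollary1p2:
  fixes s \<sigma> :: real
  assumes "s > 0" and "\<sigma> > 0"
  shows "((\<exists>g \<in> gelfand_shilov s \<sigma>. g \<noteq> (\<lambda>t. 0) \<and>
             (\<exists>\<Lambda> :: (real \<times> real) set. finite \<Lambda> \<and> L2_lin_dependent (gabor_system g) \<Lambda>))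
           \<longleftrightarrow> s \<ge> 1 \<and> \<sigma> \<ge> 1)
    \<and> (\<exists>g \<in> L2. \<not> L2_zero g \<and>
         (\<exists>\<Lambda> :: (real \<times> real) set. finite \<Lambda> \<and> card \<Lambda> = 4 \<and> L2_lin_dependent (gabor_system g) \<Lambda>))
    \<and> (\<forall>g \<in> L2. \<not> L2_zero g \<longrightarrow>
         (\<forall>\<Lambda> :: (real \<times> real) set. finite \<Lambda> \<and> card \<Lambda> \<le> 3 \<longrightarrow>
            \<not> L2_lin_dependent (gabor_system g) \<Lambda>))"
proof (rule four_point_window)
 fix g and \<Lambda> :: "(real \<times> real) set"
 assume g: "\<And>s \<sigma>. s \<ge> 1 \<Longrightarrow> \<sigma> \<ge> 1 \<Longrightarrow> g \<in> gelfand_shilov s \<sigma>" "\<exists>t. g t \<noteq> 0"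
  and \<Lambda>: "finite \<Lambda>" "card \<Lambda> = 4" "L2_lin_dependent (gabor_system g) \<Lambda>"
 have g11: "g \<in> gelfand_shilov 1 1" by (rule g(1)) auto
 \<comment> \<open>A nonzero value at one point excludes vanishing almost everywhere because
   \<open>g\<close> is continuous.\<close>
 have gnz: "\<not> L2_zero g"
 proof
  assume "L2_zero g"
  then have ae: "AE t in lebesgue. g t = 0" by (simp add: L2_zero_def)
  have "smooth g" using g11 by (simp add: gelfand_shilov_def)
  then have "g differentiable at t" for t unfolding smooth_def nth_derivative_def by (metis funpow_0)
  then have "continuous_on UNIV g" by (simp add: continuous_at_imp_continuous_on differentiable_imp_continuous_within)
  from AE_lebesgue_continuous_eq_0[OF ae this] show False using g(2) by blast
 qed
 have gL2: "g \<in> L2" by (rule gelfand_shilov_L2[OF g11]) auto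
 have eq: "(\<exists>g \<in> gelfand_shilov s \<sigma>. g \<noteq> (\<lambda>t. 0) \<and>
       (\<exists>\<Lambda> :: (real \<times> real) set. finite \<Lambda> \<and> L2_lin_dependent (gabor_system g) \<Lambda>))
      \<longleftrightarrow> s \<ge> 1 \<and> \<sigma> \<ge> 1"
 proof
  assume "\<exists>g \<in> gelfand_shilov s \<sigma>. g \<noteq> (\<lambda>t. 0) \<and>
       (\<exists>\<Lambda> :: (real \<times> real) set. finite \<Lambda> \<and> L2_lin_dependent (gabor_system g) \<Lambda>)"
  then obtain f L where f: "f \<in> gelfand_shilov s \<sigma>" "f \<noteq> (\<lambda>t. 0)" and L: "finite L" "L2_lin_dependent (gabor_system f) L"
   by blast
  show "s \<ge> 1 \<and> \<sigma> \<ge> 1"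
  proof (rule ccontr)
   assume "\<not> (s \<ge> 1 \<and> \<sigma> \<ge> 1)"
   then have "s < 1 \<or> \<sigma> < 1" by linarith
   then show False using gelfand_shilov_independent[OF f(1) assms _ L] f(2) by blast
  qed
 next
  assume "s \<ge> 1 \<and> \<sigma> \<ge> 1"
  then have "g \<in> gelfand_shilov s \<sigma>" using g(1) by blast
  moreover have "g \<noteq> (\<lambda>t. 0)" using g(2) by auto
  ultimately show "\<exists>g \<in> gelfand_shilov s \<sigma>. g \<noteq> (\<lambda>t. 0) \<and>
       (\<exists>\<Lambda> :: (real \<times> real) set. finite \<Lambda> \<and> L2_lin_dependent (gabor_system g) \<Lambda>)"
   using \<Lambda>(1,3) by blast
 qed
 have four: "\<exists>g \<in> L2. \<not> L2_zero g \<and>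
     (\<exists>\<Lambda> :: (real \<times> real) set. finite \<Lambda> \<and> card \<Lambda> = 4 \<and> L2_lin_dependent (gabor_system g) \<Lambda>)"
  by (rule bexI[of _ g], rule conjI, rule gnz, rule exI[of _ \<Lambda>], intro conjI \<Lambda>, rule gL2)
 show ?thesis
  by (rule conjI[OF eq conjI[OF four]], intro ballI allI impI notI, elim conjE notE, rule gabor_three_points)
qed

end
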